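(* Any solvmanifold admitting either an invariant Vaisman structure or an invariant Sasakian structure carries a geodesically complete flat torsion-free (affine) connection.
   Context: A solvmanifold is a compact quotient $\Gamma\backslash G$, where $G$ is a simply connected solvable Lie group and $\Gamma$ is a lattice in $G$ (a discrete subgroup with $\Gamma\backslash G$ compact; then $G$ is unimodular). A structure on $\Gamma\backslash G$ is invariant if it is induced by a left invariant structure on $G$, equivalently by a corresponding structure on the Lie algebra $\mathfrak{g}$ of $G$, as follows; $d$ is the Chevalley–Eilenberg differential. Vaisman structure on $\mathfrak{g}$: an endomorphism $J$ with $J^2=-\mathrm{Id}$ and $[Jx,Jy]-[x,y]-J([Jx,y]+[x,Jy])=0$, and a Hermitian inner product $\langle\cdot,\cdot\rangle$, such that, with $\omega(x,y)=\langle Jx,y\rangle$, there is a (nonzero) $\theta\in\mathfrak{g}^*$ (the Lee form) with $d\theta=0$, $d\omega=\theta\wedge\omega$ and $\nabla\theta=0$, where $\nabla$ is the Levi-Civita connection. Sasakian structure on $\mathfrak{g}$: $(\langle\cdot,\cdot\rangle,\phi,\xi,\eta)$, with $\langle\cdot,\cdot\rangle$ an inner product, $\phi\in\operatorname{End}(\mathfrak{g})$, $\xi\in\mathfrak{g}$, $\eta\in\mathfrak{g}^*$, such that $\eta(\xi)=1$, $\phi^2=-\mathrm{Id}+\eta\otimes\xi$, $\langle\phi x,\phi y\rangle=\langle x,y\rangle-\eta(x)\eta(y)$, $N_\phi=-d\eta\otimes\xi$ where $N_\phi(x,y)=[\phi x,\phi y]+\phi^2[x,y]-\phi([\phi x,y]+[x,\phi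 y])$, and $d\eta(x,y)=-\langle\phi x,y\rangle$ for all $x,y$. (Up to rescaling the structure tensors this is the same as the convention $d\eta(x,y)=2\langle\phi x,y\rangle$.) *)

theory Defs
  imports
    "HOL-Analysis.Analysis"
    "HOL-Algebra.Solvable_Groups"
    "HOL-Library.Function_Algebras"
begin

section \<open>Linear structure on function spaces\<close>

text \<open>
  Addition and multiplication of functions are pointwise (\<^theory>\<open>HOL-Library.Function_Algebras\<close>);
  the instance below adds the pointwise real scaling. Smooth functions, derivations of them, and
  hence vector fields are then elements of a type of class \<^class>\<open>real_vector\<close>.
\<close>

instantiation "fun" :: (type, real_vector) real_vector
begin

definition scaleR_fun :: "real \<Rightarrow> ('a \<Rightarrow> 'b) \<Rightarrow> 'a \<Rightarrow> 'b" where
  "scaleR_fun c f = (\<lambda>x. c *\<^sub>R f x)"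

instance
  by standard (auto simp: scaleR_fun_def fun_eq_iff scaleR_add_right scaleR_add_left)

end

definition linear_on :: "'v::real_vector set \<Rightarrow> ('v \<Rightarrow> 'w::real_vector) \<Rightarrow> bool" where
  "linear_on L f \<longleftrightarrow>
     (\<forall>x\<in>L. \<forall>y\<in>L. f (x + y) = f x + f y) \<and> (\<forall>c. \<forall>x\<in>L. f (c *\<^sub>R x) = c *\<^sub>R f x)"

definition bilinear_on :: "'v::real_vector set \<Rightarrow> ('v \<Rightarrow> 'v \<Rightarrow> 'w::real_vector) \<Rightarrow> bool" where
  "bilinear_on L b \<longleftrightarrow> (\<forall>x\<in>L. linear_on L (b x)) \<and> (\<forall>y\<in>L. linear_on L (\<lambda>x. b x y))"


section \<open>Vaisman and Sasakian structures on a Lie algebra\<close>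

text \<open>
  A Lie algebra is given by its carrier \<open>L\<close>, a subspace of a real vector space, and its bracket \<open>br\<close>.
  All maps are only constrained on \<open>L\<close>.
\<close>

definition inner_product_on :: "'v::real_vector set \<Rightarrow> ('v \<Rightarrow> 'v \<Rightarrow> real) \<Rightarrow> bool" where
  "inner_product_on L ip \<longleftrightarrow> bilinear_on L ip \<and> (\<forall>x\<in>L. \<forall>y\<in>L. ip x y = ip y x) \<and>
     (\<forall>x\<in>L. x \<noteq> 0 \<longrightarrow> ip x x > 0)"

text \<open>The Chevalley--Eilenberg differential in degrees 1 and 2, and the wedge of a 1-form with a 2-form.\<close>

definition ce_d1 :: "('v \<Rightarrow> 'v \<Rightarrow> 'v) \<Rightarrow> ('v \<Rightarrow> real) \<Rightarrow> 'v \<Rightarrow> 'v \<Rightarrow> real" where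
  "ce_d1 br \<alpha> x y = - \<alpha> (br x y)"

definition ce_d2 :: "('v \<Rightarrow> 'v \<Rightarrow> 'v) \<Rightarrow> ('v \<Rightarrow> 'v \<Rightarrow> real) \<Rightarrow> 'v \<Rightarrow> 'v \<Rightarrow> 'v \<Rightarrow> real" where
  "ce_d2 br \<beta> x y z = - \<beta> (br x y) z + \<beta> (br x z) y - \<beta> (br y z) x"

definition wedge12 :: "('v \<Rightarrow> real) \<Rightarrow> ('v \<Rightarrow> 'v \<Rightarrow> real) \<Rightarrow> 'v \<Rightarrow> 'v \<Rightarrow> 'v \<Rightarrow> real" where
  "wedge12 \<alpha> \<beta> x y z = \<alpha> x * \<beta> y z + \<alpha> y * \<beta> z x + \<alpha> z * \<beta> x y"

text \<open>The Levi-Civita connection of an inner product, on left invariant fields.\<close>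

definition levi_civita_on ::
    "'v::real_vector set \<Rightarrow> ('v \<Rightarrow> 'v \<Rightarrow> 'v) \<Rightarrow> ('v \<Rightarrow> 'v \<Rightarrow> real) \<Rightarrow> ('v \<Rightarrow> 'v \<Rightarrow> 'v) \<Rightarrow> bool" where
  "levi_civita_on L br ip nab \<longleftrightarrow>
     (\<forall>x\<in>L. \<forall>y\<in>L. nab x y \<in> L) \<and> bilinear_on L nab \<and>
     (\<forall>x\<in>L. \<forall>y\<in>L. nab x y - nab y x = br x y) \<and>
     (\<forall>x\<in>L. \<forall>y\<in>L. \<forall>z\<in>L. ip (nab x y) z + ip y (nab x z) = 0)"

definition complex_structure_on ::
    "'v::real_vector set \<Rightarrow> ('v \<Rightarrow> 'v \<Rightarrow> 'v) \<Rightarrow> ('v \<Rightarrow> 'v) \<Rightarrow> bool" where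
  "complex_structure_on L br J \<longleftrightarrow>
     J \<in> L \<rightarrow> L \<and> linear_on L J \<and> (\<forall>x\<in>L. J (J x) = - x) \<and>
     (\<forall>x\<in>L. \<forall>y\<in>L. br (J x) (J y) - br x y - J (br (J x) y + br x (J y)) = 0)"

text \<open>
  As \<open>\<theta>\<close> is invariant, \<open>(\<nabla>\<^sub>x \<theta>) y = - \<theta> (\<nabla>\<^sub>x y)\<close>; the last conjunct is \<open>\<nabla>\<theta> = 0\<close>.
\<close>

definition vaisman_structure_on ::
    "'v::real_vector set \<Rightarrow> ('v \<Rightarrow> 'v \<Rightarrow> 'v) \<Rightarrow> ('v \<Rightarrow> 'v) \<Rightarrow> ('v \<Rightarrow> 'v \<Rightarrow> real) \<Rightarrow> ('v \<Rightarrow> real) \<Rightarrow> bool" where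
  "vaisman_structure_on L br J ip \<theta> \<longleftrightarrow>
     complex_structure_on L br J \<and>
     inner_product_on L ip \<and> (\<forall>x\<in>L. \<forall>y\<in>L. ip (J x) (J y) = ip x y) \<and>
     linear_on L \<theta> \<and> (\<exists>x\<in>L. \<theta> x \<noteq> 0) \<and>
     (\<forall>x\<in>L. \<forall>y\<in>L. ce_d1 br \<theta> x y = 0) \<and>
     (let \<omega> = (\<lambda>x y. ip (J x) y) in
        \<forall>x\<in>L. \<forall>y\<in>L. \<forall>z\<in>L. ce_d2 br \<omega> x y z = wedge12 \<theta> \<omega> x y z) \<and>
     (\<exists>nab. levi_civita_on L br ip nab \<and> (\<forall>x\<in>L. \<forall>y\<in>L. - \<theta> (nab x y) = 0))"

definition sasakian_structure_on ::
    "'v::real_vector set \<Rightarrow> ('v \<Rightarrow> 'v \<Rightarrow> 'v) \<Rightarrow> ('v \<Rightarrow> 'v \<Rightarrow> real) \<Rightarrow> ('v \<Rightarrow> 'v) \<Rightarrow> 'v \<Rightarrow> ('v \<Rightarrow> real) \<Rightarrow> bool" where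
  "sasakian_structure_on L br ip \<phi> \<xi> \<eta> \<longleftrightarrow>
     inner_product_on L ip \<and> \<phi> \<in> L \<rightarrow> L \<and> linear_on L \<phi> \<and> \<xi> \<in> L \<and> linear_on L \<eta> \<and>
     \<eta> \<xi> = 1 \<and>
     (\<forall>x\<in>L. \<phi> (\<phi> x) = - x + \<eta> x *\<^sub>R \<xi>) \<and>
     (\<forall>x\<in>L. \<forall>y\<in>L. ip (\<phi> x) (\<phi> y) = ip x y - \<eta> x * \<eta> y) \<and>
     (\<forall>x\<in>L. \<forall>y\<in>L. br (\<phi> x) (\<phi> y) + \<phi> (\<phi> (br x y)) - \<phi> (br (\<phi> x) y + br x (\<phi> y))
                     = - (ce_d1 br \<eta> x y *\<^sub>R \<xi>)) \<and>
     (\<forall>x\<in>L. \<forall>y\<in>L. ce_d1 br \<eta> x y = - ip (\<phi> x) y)"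


section \<open>Smooth manifolds\<close>

text \<open>\<open>C\<^sup>k\<close> and \<open>C\<^sup>\<infinity>\<close> functions; meant for open \<open>S\<close>.\<close>

primrec ck_on :: "nat \<Rightarrow> 'e::euclidean_space set \<Rightarrow> ('e \<Rightarrow> 'f::euclidean_space) \<Rightarrow> bool" where
  "ck_on 0 S f \<longleftrightarrow> continuous_on S f"
| "ck_on (Suc k) S f \<longleftrightarrow>
     (\<forall>x\<in>S. f differentiable (at x)) \<and> (\<forall>v. ck_on k S (\<lambda>x. frechet_derivative f (at x) v))"

definition smooth_on :: "'e::euclidean_space set \<Rightarrow> ('e \<Rightarrow> 'f::euclidean_space) \<Rightarrow> bool" where
  "smooth_on S f \<longleftrightarrow> (\<forall>k. ck_on k S f)"

text \<open>The atlas of a manifold is a set of charts \<open>(U, \<phi>)\<close>; it need not be maximal.\<close>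

record ('a, 'e) manifold =
  mtop :: "'a topology"
  atlas :: "('a set \<times> ('a \<Rightarrow> 'e)) set"

definition smooth_manifold :: "('a, 'e::euclidean_space) manifold \<Rightarrow> bool" where
  "smooth_manifold M \<longleftrightarrow>
     Hausdorff_space (mtop M) \<and>
     (\<exists>B. countable B \<and> (\<forall>V\<in>B. openin (mtop M) V) \<and>
          (\<forall>U x. openin (mtop M) U \<and> x \<in> U \<longrightarrow> (\<exists>V\<in>B. x \<in> V \<and> V \<subseteq> U))) \<and>
     \<Union> (fst ` atlas M) = topspace (mtop M) \<and>
     (\<forall>(U, \<phi>) \<in> atlas M. openin (mtop M) U \<and> open (\<phi> ` U) \<and>
        homeomorphic_map (subtopology (mtop M) U) (top_of_set (\<phi> ` U)) \<phi>) \<and>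
     (\<forall>(U, \<phi>) \<in> atlas M. \<forall>(V, \<psi>) \<in> atlas M. smooth_on (\<phi> ` (U \<inter> V)) (\<psi> \<circ> inv_into U \<phi>))"

definition smooth_map ::
    "('a, 'e::euclidean_space) manifold \<Rightarrow> ('b, 'f::euclidean_space) manifold \<Rightarrow> ('a \<Rightarrow> 'b) \<Rightarrow> bool" where
  "smooth_map M N f \<longleftrightarrow>
     continuous_map (mtop M) (mtop N) f \<and>
     (\<forall>(U, \<phi>) \<in> atlas M. \<forall>(V, \<psi>) \<in> atlas N.
        smooth_on (\<phi> ` (U \<inter> f -` V)) (\<psi> \<circ> f \<circ> inv_into U \<phi>))"

definition open_submanifold :: "'e::euclidean_space set \<Rightarrow> ('e, 'e) manifold" where
  "open_submanifold S = \<lparr> mtop = top_of_set S, atlas = {(S, id)} \<rparr>"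

definition prod_manifold ::
    "('a, 'e) manifold \<Rightarrow> ('b, 'f) manifold \<Rightarrow> ('a \<times> 'b, 'e \<times> 'f) manifold" where
  "prod_manifold M N =
     \<lparr> mtop = prod_topology (mtop M) (mtop N),
       atlas = {(U \<times> V, map_prod \<phi> \<psi>) | U \<phi> V \<psi>. (U, \<phi>) \<in> atlas M \<and> (V, \<psi>) \<in> atlas N} \<rparr>"

text \<open>
  \<open>C\<^sup>\<infinity>(M)\<close>. Functions are normalised to be \<open>0\<close> off the manifold, so that equality of functions is
  equality on the manifold.
\<close>

definition smooth_functions :: "('a, 'e::euclidean_space) manifold \<Rightarrow> ('a \<Rightarrow> real) set" where
  "smooth_functions M =
     {f. smooth_map M (open_submanifold UNIV) f \<and> (\<forall>x. x \<notin> topspace (mtop M) \<longrightarrow> f x = 0)}"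


section \<open>Vector fields and affine connections\<close>

text \<open>
  Vector fields are the derivations of \<open>C\<^sup>\<infinity>(M)\<close>, normalised to be \<open>0\<close> off \<open>C\<^sup>\<infinity>(M)\<close>. The value of \<open>X\<close>
  at \<open>p\<close> is the tangent vector \<open>f \<mapsto> X f p\<close>.
\<close>

type_synonym 'a vfield = "('a \<Rightarrow> real) \<Rightarrow> 'a \<Rightarrow> real"

definition vector_fields :: "('a, 'e::euclidean_space) manifold \<Rightarrow> 'a vfield set" where
  "vector_fields M =
     {X. X \<in> smooth_functions M \<rightarrow> smooth_functions M \<and> linear_on (smooth_functions M) X \<and>
         (\<forall>f\<in>smooth_functions M. \<forall>g\<in>smooth_functions M. X (f * g) = X f * g + f * X g) \<and>
         (\<forall>f. f \<notin> smooth_functions M \<longrightarrow> X f = 0)}"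

definition vf_bracket :: "'a vfield \<Rightarrow> 'a vfield \<Rightarrow> 'a vfield" where
  "vf_bracket X Y = (\<lambda>f. X (Y f) - Y (X f))"

definition vf_mult :: "('a \<Rightarrow> real) \<Rightarrow> 'a vfield \<Rightarrow> 'a vfield" where
  "vf_mult f X = (\<lambda>g. f * X g)"

definition affine_connection ::
    "('a, 'e::euclidean_space) manifold \<Rightarrow> ('a vfield \<Rightarrow> 'a vfield \<Rightarrow> 'a vfield) \<Rightarrow> bool" where
  "affine_connection M nab \<longleftrightarrow>
     (\<forall>X\<in>vector_fields M. \<forall>Y\<in>vector_fields M. nab X Y \<in> vector_fields M) \<and>
     bilinear_on (vector_fields M) nab \<and>
     (\<forall>f\<in>smooth_functions M. \<forall>X\<in>vector_fields M. \<forall>Y\<in>vector_fields M.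
        nab (vf_mult f X) Y = vf_mult f (nab X Y) \<and>
        nab X (vf_mult f Y) = vf_mult (X f) Y + vf_mult f (nab X Y))"

definition flat_connection ::
    "('a, 'e::euclidean_space) manifold \<Rightarrow> ('a vfield \<Rightarrow> 'a vfield \<Rightarrow> 'a vfield) \<Rightarrow> bool" where
  "flat_connection M nab \<longleftrightarrow>
     (\<forall>X\<in>vector_fields M. \<forall>Y\<in>vector_fields M. \<forall>Z\<in>vector_fields M.
        nab X (nab Y Z) - nab Y (nab X Z) - nab (vf_bracket X Y) Z = 0)"

definition torsion_free_connection ::
    "('a, 'e::euclidean_space) manifold \<Rightarrow> ('a vfield \<Rightarrow> 'a vfield \<Rightarrow> 'a vfield) \<Rightarrow> bool" where
  "torsion_free_connection M nab \<longleftrightarrow>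
     (\<forall>X\<in>vector_fields M. \<forall>Y\<in>vector_fields M. nab X Y - nab Y X - vf_bracket X Y = 0)"

text \<open>
  Vector fields along a curve \<open>c : I \<rightarrow> M\<close> (\<open>I\<close> an open interval) are the derivations
  \<open>C\<^sup>\<infinity>(M) \<rightarrow> C\<^sup>\<infinity>(I)\<close> over the homomorphism \<open>f \<mapsto> f \<circ> c\<close>, with the same normalisation as above.
\<close>

type_synonym 'a vfield_along = "('a \<Rightarrow> real) \<Rightarrow> real \<Rightarrow> real"

definition vector_fields_along ::
    "('a, 'e::euclidean_space) manifold \<Rightarrow> real set \<Rightarrow> (real \<Rightarrow> 'a) \<Rightarrow> 'a vfield_along set" where
  "vector_fields_along M I c =
     {V. V \<in> smooth_functions M \<rightarrow> smooth_functions (open_submanifold I) \<and>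
         linear_on (smooth_functions M) V \<and>
         (\<forall>f\<in>smooth_functions M. \<forall>g\<in>smooth_functions M. \<forall>t\<in>I.
            V (f * g) t = V f t * g (c t) + f (c t) * V g t) \<and>
         (\<forall>f. f \<notin> smooth_functions M \<longrightarrow> V f = 0)}"

definition velocity ::
    "('a, 'e::euclidean_space) manifold \<Rightarrow> real set \<Rightarrow> (real \<Rightarrow> 'a) \<Rightarrow> 'a vfield_along" where
  "velocity M I c =
     (\<lambda>f t. if f \<in> smooth_functions M \<and> t \<in> I then deriv (\<lambda>s. f (c s)) t else 0)"

definition vf_restrict :: "real set \<Rightarrow> (real \<Rightarrow> 'a) \<Rightarrow> 'a vfield \<Rightarrow> 'a vfield_along" where
  "vf_restrict I c Y = (\<lambda>f t. if t \<in> I then Y f (c t) else 0)"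

text \<open>
  The covariant derivative \<open>D\<close> along \<open>c\<close> induced by the connection, through its defining properties
  (which determine it uniquely): it is additive, \<open>D (h V) = h' V + h D V\<close>, and
  \<open>D (Y \<circ> c) = \<nabla>\<^sub>c\<^sub>' Y\<close>, where \<open>\<nabla>\<^sub>v Y\<close> for a tangent vector \<open>v\<close> at \<open>p\<close> is \<open>\<nabla>\<^sub>X Y\<close> at \<open>p\<close> for any
  field \<open>X\<close> with value \<open>v\<close> at \<open>p\<close>.
\<close>

definition covariant_derivative_along ::
    "('a, 'e::euclidean_space) manifold \<Rightarrow> ('a vfield \<Rightarrow> 'a vfield \<Rightarrow> 'a vfield) \<Rightarrow>
     real set \<Rightarrow> (real \<Rightarrow> 'a) \<Rightarrow> ('a vfield_along \<Rightarrow> 'a vfield_along) \<Rightarrow> bool" where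
  "covariant_derivative_along M nab I c D \<longleftrightarrow>
     D \<in> vector_fields_along M I c \<rightarrow> vector_fields_along M I c \<and>
     linear_on (vector_fields_along M I c) D \<and>
     (\<forall>h\<in>smooth_functions (open_submanifold I). \<forall>V\<in>vector_fields_along M I c.
        \<forall>f\<in>smooth_functions M. \<forall>t\<in>I.
          D (\<lambda>g. h * V g) f t = deriv h t * V f t + h t * D V f t) \<and>
     (\<forall>X\<in>vector_fields M. \<forall>Y\<in>vector_fields M. \<forall>t\<in>I.
        (\<forall>f\<in>smooth_functions M. X f (c t) = velocity M I c f t) \<longrightarrow>
        (\<forall>f\<in>smooth_functions M. D (vf_restrict I c Y) f t = nab X Y f (c t)))"

definition geodesic_on ::
    "('a, 'e::euclidean_space) manifold \<Rightarrow> ('a vfield \<Rightarrow> 'a vfield \<Rightarrow> 'a vfield) \<Rightarrow>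
     real set \<Rightarrow> (real \<Rightarrow> 'a) \<Rightarrow> bool" where
  "geodesic_on M nab I c \<longleftrightarrow>
     smooth_map (open_submanifold I) M c \<and>
     (\<exists>D. covariant_derivative_along M nab I c D \<and> D (velocity M I c) = 0)"

definition geodesically_complete ::
    "('a, 'e::euclidean_space) manifold \<Rightarrow> ('a vfield \<Rightarrow> 'a vfield \<Rightarrow> 'a vfield) \<Rightarrow> bool" where
  "geodesically_complete M nab \<longleftrightarrow>
     (\<forall>I c. open I \<and> is_interval I \<and> I \<noteq> {} \<and> geodesic_on M nab I c \<longrightarrow>
        (\<exists>c'. geodesic_on M nab UNIV c' \<and> (\<forall>t\<in>I. c' t = c t)))"


section \<open>Lie groups and solvmanifolds\<close>

definition lie_group :: "('g, 'm) monoid_scheme \<Rightarrow> ('g, 'e::euclidean_space) manifold \<Rightarrow> bool" where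
  "lie_group G M \<longleftrightarrow>
     group G \<and> smooth_manifold M \<and> topspace (mtop M) = carrier G \<and>
     smooth_map (prod_manifold M M) M (\<lambda>(x, y). x \<otimes>\<^bsub>G\<^esub> y) \<and>
     smooth_map M M (m_inv G)"

text \<open>
  The Lie algebra of \<open>G\<close>: the left invariant vector fields with the commutator bracket. Invariance
  of \<open>X\<close> is \<open>X (f \<circ> L\<^sub>a) = (X f) \<circ> L\<^sub>a\<close> for all left translations \<open>L\<^sub>a\<close>.
\<close>

definition left_translate :: "('g, 'm) monoid_scheme \<Rightarrow> 'g \<Rightarrow> ('g \<Rightarrow> real) \<Rightarrow> 'g \<Rightarrow> real" where
  "left_translate G a f = (\<lambda>x. if x \<in> carrier G then f (a \<otimes>\<^bsub>G\<^esub> x) else 0)"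

definition lie_algebra ::
    "('g, 'm) monoid_scheme \<Rightarrow> ('g, 'e::euclidean_space) manifold \<Rightarrow> 'g vfield set" where
  "lie_algebra G M =
     {X \<in> vector_fields M. \<forall>a\<in>carrier G. \<forall>f\<in>smooth_functions M.
        X (left_translate G a f) = left_translate G a (X f)}"

text \<open>
  As in \<^const>\<open>simply_connected\<close>: any two loops are homotopic through loops. In particular the space is
  path connected.
\<close>

definition simply_connected_space :: "'a topology \<Rightarrow> bool" where
  "simply_connected_space X \<longleftrightarrow>
     (\<forall>p q. pathin X p \<and> p 1 = p 0 \<and> pathin X q \<and> q 1 = q 0 \<longrightarrow>
        homotopic_with (\<lambda>r. r 1 = r 0) (top_of_set {0..1::real}) X p q)"

text \<open>
  \<open>\<Gamma>\G\<close> is the set of right cosets \<open>\<Gamma> g\<close>, with the quotient topology, and with the smooth structure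
  for which the projection is a local diffeomorphism (for discrete \<open>\<Gamma>\<close>): its charts are those of
  \<open>G\<close>, restricted to open sets on which the projection is injective, and pushed forward.
\<close>

definition coset_space ::
    "('g, 'm) monoid_scheme \<Rightarrow> ('g, 'e) manifold \<Rightarrow> 'g set \<Rightarrow> ('g set, 'e) manifold" where
  "coset_space G M \<Gamma> =
     \<lparr> mtop = topology (\<lambda>S. S \<subseteq> rcosets\<^bsub>G\<^esub> \<Gamma> \<and> openin (mtop M) {x \<in> carrier G. \<Gamma> #>\<^bsub>G\<^esub> x \<in> S}),
       atlas = {((\<lambda>x. \<Gamma> #>\<^bsub>G\<^esub> x) ` W, \<phi> \<circ> inv_into W (\<lambda>x. \<Gamma> #>\<^bsub>G\<^esub> x)) | U \<phi> W.
                  (U, \<phi>) \<in> atlas M \<and> openin (mtop M) W \<and> W \<subseteq> U \<and> inj_on (\<lambda>x. \<Gamma> #>\<^bsub>G\<^esub> x) W} \<rparr>"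

lemma openin_coset_space:
  "openin (mtop (coset_space G M \<Gamma>)) S \<longleftrightarrow>
     S \<subseteq> rcosets\<^bsub>G\<^esub> \<Gamma> \<and> openin (mtop M) {x \<in> carrier G. \<Gamma> #>\<^bsub>G\<^esub> x \<in> S}"
proof -
  let ?P = "\<lambda>S. S \<subseteq> rcosets\<^bsub>G\<^esub> \<Gamma> \<and> openin (mtop M) {x \<in> carrier G. \<Gamma> #>\<^bsub>G\<^esub> x \<in> S}"
  have "istopology ?P"
    unfolding istopology_def
  proof (intro conjI allI impI)
    fix S T assume "?P S" "?P T"
    then have "openin (mtop M) ({x \<in> carrier G. \<Gamma> #>\<^bsub>G\<^esub> x \<in> S} \<inter> {x \<in> carrier G. \<Gamma> #>\<^bsub>G\<^esub> x \<in> T})"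
      by blast
    moreover have "{x \<in> carrier G. \<Gamma> #>\<^bsub>G\<^esub> x \<in> S} \<inter> {x \<in> carrier G. \<Gamma> #>\<^bsub>G\<^esub> x \<in> T}
        = {x \<in> carrier G. \<Gamma> #>\<^bsub>G\<^esub> x \<in> S \<inter> T}"
      by blast
    ultimately show "openin (mtop M) {x \<in> carrier G. \<Gamma> #>\<^bsub>G\<^esub> x \<in> S \<inter> T}"
      by simp
    show "S \<inter> T \<subseteq> rcosets\<^bsub>G\<^esub> \<Gamma>" using \<open>?P S\<close> by blast
  next
    fix K assume K: "\<forall>S\<in>K. ?P S"
    then have "openin (mtop M) (\<Union>S\<in>K. {x \<in> carrier G. \<Gamma> #>\<^bsub>G\<^esub> x \<in> S})"
      by blast
    moreover have "(\<Union>S\<in>K. {x \<in> carrier G. \<Gamma> #>\<^bsub>G\<^esub> x \<in> S}) = {x \<in> carrier G. \<Gamma> #>\<^bsub>G\<^esub> x \<in> \<Union> K}"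
      by blast
    ultimately show "openin (mtop M) {x \<in> carrier G. \<Gamma> #>\<^bsub>G\<^esub> x \<in> \<Union> K}"
      by simp
    show "\<Union> K \<subseteq> rcosets\<^bsub>G\<^esub> \<Gamma>" using K by blast
  qed
  then show ?thesis
    by (simp add: coset_space_def)
qed

definition lattice_subgroup ::
    "('g, 'm) monoid_scheme \<Rightarrow> ('g, 'e) manifold \<Rightarrow> 'g set \<Rightarrow> bool" where
  "lattice_subgroup G M \<Gamma> \<longleftrightarrow>
     subgroup \<Gamma> G \<and> subtopology (mtop M) \<Gamma> = discrete_topology \<Gamma> \<and>
     compact_space (mtop (coset_space G M \<Gamma>))"

text \<open>\<^term>\<open>solvmanifold G M \<Gamma>\<close>: the data \<open>(G, M)\<close> and \<open>\<Gamma>\<close> present \<open>\<Gamma>\G\<close> as a solvmanifold.\<close>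

definition solvmanifold ::
    "('g, 'm) monoid_scheme \<Rightarrow> ('g, 'e::euclidean_space) manifold \<Rightarrow> 'g set \<Rightarrow> bool" where
  "solvmanifold G M \<Gamma> \<longleftrightarrow>
     lie_group G M \<and> simply_connected_space (mtop M) \<and> solvable G \<and> lattice_subgroup G M \<Gamma>"

text \<open>
  Invariant structures on \<open>\<Gamma>\G\<close> are those induced by left invariant structures on \<open>G\<close>, that is,
  by structures on the Lie algebra of \<open>G\<close>.
\<close>

definition admits_invariant_vaisman ::
    "('g, 'm) monoid_scheme \<Rightarrow> ('g, 'e::euclidean_space) manifold \<Rightarrow> bool" where
  "admits_invariant_vaisman G M \<longleftrightarrow>
     (\<exists>J ip \<theta>. vaisman_structure_on (lie_algebra G M) vf_bracket J ip \<theta>)"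

definition admits_invariant_sasakian ::
    "('g, 'm) monoid_scheme \<Rightarrow> ('g, 'e::euclidean_space) manifold \<Rightarrow> bool" where
  "admits_invariant_sasakian G M \<longleftrightarrow>
     (\<exists>ip \<phi> \<xi> \<eta>. sasakian_structure_on (lie_algebra G M) vf_bracket ip \<phi> \<xi> \<eta>)"

end

theory Submission
 imports Defs
begin

text \<open>A product \<open>x * y\<close> on the Lie algebra with \<open>x * y - y * x = [x, y]\<close> whose left multiplications form a
representation defines a left invariant flat torsion-free connection, which descends to the quotient. In the
left trivialization its geodesics satisfy \<open>v' = - v * v\<close>, so it is complete if all solutions of this
equation extend to bounded solutions on the line.

A lattice forces unimodularity. The space transverse to the Reeb and Lee directions is a Kaehler Lie algebra whose Ricci
form is exact, so that its scalar curvature vanishes, whereas for a unimodular solvable metric Lie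
algebra the scalar curvature is a sum of nonpositive terms. Hence the transverse algebra is flat; correcting
its Levi-Civita connection \<open>\<nabla>\<close> by the fundamental form, \<open>x * y = \<nabla>\<^sub>x y + (\<phi> x \<bullet> y) / 2 \<xi>\<close>, gives the product.\<close>

section \<open>Calculus of smooth functions\<close>

text \<open>The bracket modulo \<open>\<xi>\<close> can be handled because \<open>\<xi>\<close> is
  central: \<open>br \<xi>\<close> is skew, so its square has trace minus a sum of squares, while
  \<open>\<xi>\<close> is a combination of brackets in a solvable algebra (unless
  \<open>\<phi>\<close> vanishes), where this trace is 0. Since only real spaces occur, that
  vanishing is not read off triangular matrices; nilpotency comes from comparing factorial with
  geometric growth. The term added to \<open>\<nabla>\<close> is alternating, so it restores the
  \<open>\<xi>\<close>-component of the torsion without changing \<open>x * x\<close>; along a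
  geodesic the equation becomes linear with a skew operator, whence boundedness. Boundedness matters
  because the curve is reconstructed from its velocity with a time step that depends only on a bound
  for the velocity. On the analytic side, fields are derivations of functions on the quotient. A
  single chart at the identity, moved by left translations, together with
  \<open>\<Gamma>\<close>-periodic bump functions, turns them into \<open>\<Gamma>\<close>-periodic
  functions on \<open>G\<close> with values in the Lie algebra, where the connection has constant
  coefficients.\<close>

lemma ck_on_SucD:
 "ck_on (Suc k) S f ==> x \<in> S ==> (f has_derivative frechet_derivative f (at x)) (at x)"
 by (simp add: frechet_derivative_works)

lemma ck_on_cong:
 assumes "open S" and "\<And>x. x \<in> S ==> f x = g x"
 shows "ck_on k S f \<longleftrightarrow> ck_on k S g"
 using assms(2)
proof (induction k arbitrary: f g)
 case 0
 then show ?case by (auto cong: continuous_on_cong)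
next
 case (Suc k)
 have d: "(f has_derivative D) (at x) \<longleftrightarrow> (g has_derivative D) (at x)" if "x \<in> S" for x D
  using has_derivative_transform_within_open[OF _ assms(1) that] Suc.prems by metis
 then have "frechet_derivative f (at x) = frechet_derivative g (at x)" if "x \<in> S" for x
  using that by (simp add: frechet_derivative_def)
 then have "ck_on k S (\<lambda>x. frechet_derivative f (at x) v) \<longleftrightarrow>
       ck_on k S (\<lambda>x. frechet_derivative g (at x) v)" for v
  by (intro Suc.IH) auto
 with d show ?case by (auto simp: differentiable_def)
qed

lemma ck_on_SucI:
 assumes "open S" and "\<And>x. x \<in> S ==> (f has_derivative D x) (at x)"
  and "\<And>v. ck_on k S (\<lambda>x. D x v)"
 shows "ck_on (Suc k) S f"
proof -
 have "ck_on k S (\<lambda>x. frechet_derivative f (at x) v)" for v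
  by (subst ck_on_cong[OF assms(1), of _ "\<lambda>x. D x v"])
   (use assms frechet_derivative_at in \<open>metis\<close>, use assms in auto)
 then show ?thesis using assms(2) by (auto simp: differentiable_def)
qed

lemma ck_on_Suc_imp: "ck_on (Suc k) S f ==> ck_on k S f"
proof (induction k arbitrary: f)
 case 0
 then show ?case
  by (auto intro!: continuous_at_imp_continuous_on differentiable_imp_continuous_within)
next
 case (Suc k)
 then show ?case by (metis ck_on.simps(2))
qed

lemma ck_on_subset: "ck_on k S f ==> T \<subseteq> S ==> ck_on k T f"
 by (induction k arbitrary: f) (auto intro: continuous_on_subset)

text \<open>Continuity and differentiability at a point are local. Smoothness claims on manifolds
  are reduced by this to neighbourhoods on which a chart or a local lift is available.\<close>

lemma ck_on_local:
 assumes "\<And>x. x \<in> S ==> \<exists>T. open T \<and> x \<in> T \<and> ck_on k T f"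
 shows "ck_on k S f"
 using assms
proof (induction k arbitrary: f)
 case 0
 then show ?case
  by (metis ck_on.simps(1) continuous_on_eq_continuous_at continuous_at_imp_continuous_on)
next
 case (Suc k)
 show ?case
  unfolding ck_on.simps
 proof (intro conjI ballI allI)
  fix x assume "x \<in> S" then show "f differentiable at x" using Suc.prems by fastforce
 next
  fix v
  show "ck_on k S (\<lambda>x. frechet_derivative f (at x) v)"
   by (rule Suc.IH) (use Suc.prems in fastforce)
 qed
qed

lemma ck_on_const: "open S ==> ck_on k S (\<lambda>x. c)"
proof (induction k arbitrary: c)
 case (Suc k)
 then show ?case
  by (intro ck_on_SucI[where D="\<lambda>x v. 0"]) auto
qed auto

lemma ck_on_add:
 assumes "open S"
 shows "ck_on k S f ==> ck_on k S g ==> ck_on k S (\<lambda>x. f x + g x)"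
proof (induction k arbitrary: f g)
 case 0
 then show ?case by (auto intro: continuous_intros)
next
 case (Suc k)
 show ?case
  by (rule ck_on_SucI[OF assms, where D="\<lambda>x v. frechet_derivative f (at x) v + frechet_derivative g (at x) v"])
   (use Suc in \<open>auto intro!: has_derivative_add ck_on_SucD Suc.IH\<close>)
qed

lemma ck_on_sum:
 assumes "open S" and "\<And>i. i \<in> I ==> ck_on k S (f i)"
 shows "ck_on k S (\<lambda>x. \<Sum>i\<in>I. f i x)"
 using assms(2) by (induction I rule: infinite_finite_induct) (auto intro!: ck_on_const ck_on_add assms(1))

lemma ck_on_bilinear:
 assumes "open S" and "bounded_bilinear B"
 shows "ck_on k S f ==> ck_on k S g ==> ck_on k S (\<lambda>x. B (f x) (g x))"
proof (induction k arbitrary: f g)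
 case 0
 then show ?case by (auto intro: bounded_bilinear.continuous_on[OF assms(2)])
next
 case (Suc k)
 show ?case
 proof (rule ck_on_SucI[OF assms(1), where D="\<lambda>x v. B (f x) (frechet_derivative g (at x) v)
   + B (frechet_derivative f (at x) v) (g x)"])
  show "((\<lambda>x. B (f x) (g x)) has_derivative
     (\<lambda>v. B (f x) (frechet_derivative g (at x) v) + B (frechet_derivative f (at x) v) (g x))) (at x)"
   if "x \<in> S" for x
   using Suc.prems that by (intro bounded_bilinear.FDERIV[OF assms(2)] ck_on_SucD)
  show "ck_on k S (\<lambda>x. B (f x) (frechet_derivative g (at x) v) + B (frechet_derivative f (at x) v) (g x))" for v
   by (intro ck_on_add assms(1) Suc.IH) (use Suc.prems in \<open>auto dest: ck_on_Suc_imp simp del: ck_on.simps(2), auto\<close>)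
 qed
qed

lemma ck_on_linear:
 assumes "open S" and "bounded_linear h"
 shows "ck_on k S f ==> ck_on k S (\<lambda>x. h (f x))"
proof (induction k arbitrary: f)
 case 0
 then show ?case by (auto intro: bounded_linear.continuous_on[OF assms(2)])
next
 case (Suc k)
 show ?case
  by (rule ck_on_SucI[OF assms(1), where D="\<lambda>x v. h (frechet_derivative f (at x) v)"])
   (use Suc in \<open>auto intro!: bounded_linear.has_derivative[OF assms(2)] ck_on_SucD\<close>)
qed

lemma ck_on_ident: "open S ==> ck_on k S (\<lambda>x. x)"
proof (cases k)
 case (Suc j)
 assume "open S"
 then show ?thesis unfolding Suc
  by (intro ck_on_SucI[where D="\<lambda>x v. v"]) (auto intro: ck_on_const)
qed auto

lemma ck_on_Pair:
 assumes "open S"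
 shows "ck_on k S f ==> ck_on k S g ==> ck_on k S (\<lambda>x. (f x, g x))"
proof (induction k arbitrary: f g)
 case 0
 then show ?case by (auto intro: continuous_intros)
next
 case (Suc k)
 show ?case
  by (rule ck_on_SucI[OF assms, where D="\<lambda>x v. (frechet_derivative f (at x) v, frechet_derivative g (at x) v)"])
   (use Suc in \<open>auto intro!: has_derivative_Pair ck_on_SucD Suc.IH\<close>)
qed

lemma linear_eq_sum_Basis:
 fixes f :: "'a::euclidean_space => 'b::real_vector"
 assumes "linear f"
 shows "f x = (\<Sum>b\<in>Basis. (x \<bullet> b) *\<^sub>R f b)"
proof -
 have "f (\<Sum>b\<in>Basis. (x \<bullet> b) *\<^sub>R b) = (\<Sum>b\<in>Basis. (x \<bullet> b) *\<^sub>R f b)"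
  by (simp add: linear_sum[OF assms] linear_cmul[OF assms])
 then show ?thesis by (simp add: euclidean_representation)
qed

lemma ck_on_compose:
 assumes "open S" "open T"
 shows "ck_on k S f ==> f ` S \<subseteq> T ==> ck_on k T g ==> ck_on k S (\<lambda>x. g (f x))"
proof (induction k arbitrary: g)
 case 0
 then show ?case by (auto intro: continuous_on_compose2)
next
 case (Suc k)
 let ?D = "\<lambda>x v. frechet_derivative g (at (f x)) (frechet_derivative f (at x) v)"
 have dg: "(g has_derivative frechet_derivative g (at (f x))) (at (f x))" if "x \<in> S" for x
  using Suc.prems that by (intro ck_on_SucD) auto
 show ?case
 proof (rule ck_on_SucI[OF assms(1), where D="?D"])
  show "((\<lambda>x. g (f x)) has_derivative ?D x) (at x)" if "x \<in> S" for x
   using has_derivative_compose[OF ck_on_SucD[OF Suc.prems(1) that] dg[OF that]] .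
  show "ck_on k S (\<lambda>x. ?D x v)" for v
  proof -
   \<comment> \<open>The direction in which \<open>g\<close> is differentiated varies with
     \<open>x\<close>, which the induction hypothesis does not allow; in the expansion over
     \<open>Basis\<close> the directions are fixed and the variation sits in scalar
     coefficients.\<close>
   have "ck_on k S (\<lambda>x. \<Sum>b\<in>Basis. (frechet_derivative f (at x) v \<bullet> b) *\<^sub>R frechet_derivative g (at (f x)) b)"
    using Suc.prems
    by (intro ck_on_sum ck_on_bilinear[OF _ bounded_bilinear_scaleR] assms
      ck_on_linear[OF _ bounded_linear_inner_left] Suc.IH) (auto dest: ck_on_Suc_imp simp del: ck_on.simps(2), auto)
   then show ?thesis
    by (subst ck_on_cong[OF assms(1)])
     (auto intro: linear_eq_sum_Basis[OF has_derivative_linear[OF dg]])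
  qed
 qed
qed

lemma smooth_on_cong:
 assumes "open S" and "\<And>x. x \<in> S ==> f x = g x"
 shows "smooth_on S f \<longleftrightarrow> smooth_on S g"
 using ck_on_cong[OF assms] by (auto simp: smooth_on_def)

lemma smooth_on_subset: "smooth_on S f ==> T \<subseteq> S ==> smooth_on T f"
 by (auto simp: smooth_on_def intro: ck_on_subset)

lemma smooth_on_local:
 "(\<And>x. x \<in> S ==> \<exists>T. open T \<and> x \<in> T \<and> smooth_on T f) ==> smooth_on S f"
 unfolding smooth_on_def by (metis ck_on_local)

lemma smooth_on_const: "open S ==> smooth_on S (\<lambda>x. c)"
 by (auto simp: smooth_on_def intro: ck_on_const)

lemma smooth_on_ident: "open S ==> smooth_on S (\<lambda>x. x)"
 by (auto simp: smooth_on_def intro: ck_on_ident)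

lemma smooth_on_add:
 "open S ==> smooth_on S f ==> smooth_on S g ==> smooth_on S (\<lambda>x. f x + g x)"
 by (auto simp: smooth_on_def intro: ck_on_add)

lemma smooth_on_sum:
 "open S ==> (\<And>i. i \<in> I ==> smooth_on S (f i)) ==> smooth_on S (\<lambda>x. \<Sum>i\<in>I. f i x)"
 by (auto simp: smooth_on_def intro: ck_on_sum)

lemma smooth_on_bilinear:
 "open S ==> bounded_bilinear B ==> smooth_on S f ==> smooth_on S g ==> smooth_on S (\<lambda>x. B (f x) (g x))"
 by (auto simp: smooth_on_def intro: ck_on_bilinear)

lemma smooth_on_linear:
 "open S ==> bounded_linear h ==> smooth_on S f ==> smooth_on S (\<lambda>x. h (f x))"
 by (auto simp: smooth_on_def intro: ck_on_linear)

lemma smooth_on_Pair: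
 "open S ==> smooth_on S f ==> smooth_on S g ==> smooth_on S (\<lambda>x. (f x, g x))"
 by (auto simp: smooth_on_def intro: ck_on_Pair)

lemma smooth_on_compose:
 "open S ==> open T ==> smooth_on S f ==> f ` S \<subseteq> T ==> smooth_on T g ==> smooth_on S (\<lambda>x. g (f x))"
 by (auto simp: smooth_on_def intro: ck_on_compose)

lemma smooth_on_scaleR:
 "open S ==> smooth_on S f ==> smooth_on S g ==> smooth_on S (\<lambda>x. f x *\<^sub>R g x)"
 by (rule smooth_on_bilinear[OF _ bounded_bilinear_scaleR])

lemma smooth_on_mult:
 fixes f g :: "'a::euclidean_space => real"
 shows "open S ==> smooth_on S f ==> smooth_on S g ==> smooth_on S (\<lambda>x. f x * g x)"
 by (rule smooth_on_bilinear[OF _ bounded_bilinear_mult])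

lemma smooth_on_inner:
 "open S ==> smooth_on S f ==> smooth_on S g ==> smooth_on S (\<lambda>x. f x \<bullet> g x)"
 by (rule smooth_on_bilinear[OF _ bounded_bilinear_inner])

lemma smooth_on_minus: "open S ==> smooth_on S f ==> smooth_on S (\<lambda>x. - f x)"
 by (rule smooth_on_linear[OF _ bounded_linear_minus[OF bounded_linear_ident]])

lemma smooth_on_diff:
 "open S ==> smooth_on S f ==> smooth_on S g ==> smooth_on S (\<lambda>x. f x - g x)"
 using smooth_on_add[OF _ _ smooth_on_minus, of S f g] by simp

lemma smooth_on_componentwise:
 assumes "open S" and "\<And>b. b \<in> Basis ==> smooth_on S (\<lambda>x. f x \<bullet> b)"
 shows "smooth_on S f"
proof -
 have "smooth_on S (\<lambda>x. \<Sum>b\<in>Basis. (f x \<bullet> b) *\<^sub>R b)"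
  by (intro smooth_on_sum smooth_on_scaleR smooth_on_const assms)
 then show ?thesis by (simp add: euclidean_representation)
qed

lemma smooth_on_has_derivative:
 "smooth_on S f ==> x \<in> S ==> (f has_derivative frechet_derivative f (at x)) (at x)"
 by (metis smooth_on_def ck_on_SucD)

lemma smooth_on_imp_continuous_on: "smooth_on S f ==> continuous_on S f"
 unfolding smooth_on_def by (metis ck_on.simps(1))

lemma smooth_on_frechet_derivative:
 "smooth_on S f ==> smooth_on S (\<lambda>x. frechet_derivative f (at x) v)"
 unfolding smooth_on_def by (metis ck_on.simps(2))

lemma frechet_derivative_cong_on:
 assumes "open S" "x \<in> S" "\<And>y. y \<in> S ==> f y = g y"
 shows "frechet_derivative f (at x) = frechet_derivative g (at x)"
proof -
 have "(f has_derivative D) (at x) \<longleftrightarrow> (g has_derivative D) (at x)" for D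
  using has_derivative_transform_within_open[OF _ assms(1,2)] assms(3) by metis
 then show ?thesis by (simp add: frechet_derivative_def)
qed

lemma frechet_derivative_chain:
 assumes "(f has_derivative f') (at x)" "(g has_derivative g') (at (f x))"
 shows "frechet_derivative (\<lambda>x. g (f x)) (at x) v = g' (f' v)"
 using frechet_derivative_at[OF has_derivative_compose[OF assms]] by metis

lemma smooth_on_partial_fst:
 assumes "open S" "smooth_on S (\<lambda>(x, y). f x y)" and "(x, y) \<in> S"
 shows "frechet_derivative (\<lambda>x. f x y) (at x) v = frechet_derivative (\<lambda>(x, y). f x y) (at (x, y)) (v, 0)"
proof -
 have "((\<lambda>x. (x, y)) has_derivative (\<lambda>v. (v, 0))) (at x)"
  by (auto intro!: derivative_eq_intros)
 from frechet_derivative_chain[OF this smooth_on_has_derivative[OF assms(2,3)]]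
 show ?thesis by simp
qed

lemma smooth_on_partial_snd:
 assumes "open S" "smooth_on S (\<lambda>(x, y). f x y)" and "(x, y) \<in> S"
 shows "frechet_derivative (f x) (at y) v = frechet_derivative (\<lambda>(x, y). f x y) (at (x, y)) (0, v)"
proof -
 have "((\<lambda>y. (x, y)) has_derivative (\<lambda>v. (0, v))) (at y)"
  by (auto intro!: derivative_eq_intros)
 from frechet_derivative_chain[OF this smooth_on_has_derivative[OF assms(2,3)]]
 show ?thesis by simp
qed

subsection \<open>Bump functions\<close>

text \<open>The exponent \<open>n\<close> makes the family closed under differentiation up to linear
  combinations, as an induction on the order of differentiability requires; the bump function itself
  uses \<open>n = 0\<close>.\<close>

definition exp_inv :: "nat => real => real" where
 "exp_inv n x = (if x > 0 then (1 / x) ^ n * exp (- 1 / x) else 0)"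

lemma exp_inv_tendsto_0: "((exp_inv n) \<longlongrightarrow> 0) (at 0)"
proof (rule filterlim_split_at)
 have "((\<lambda>x. exp_inv n x) \<longlongrightarrow> 0) (at_left (0::real)) \<longleftrightarrow> ((\<lambda>x::real. 0::real) \<longlongrightarrow> 0) (at_left (0::real))"
  by (intro filterlim_cong refl) (auto simp: eventually_at_filter exp_inv_def)
 then show "((exp_inv n) \<longlongrightarrow> 0) (at_left 0)" by simp
 have "((\<lambda>x. (inverse x) ^ n / exp (inverse x)) \<longlongrightarrow> 0) (at_right (0::real))"
  by (rule filterlim_compose[OF tendsto_power_div_exp_0 filterlim_inverse_at_top_right])
 moreover have "((\<lambda>x. exp_inv n x) \<longlongrightarrow> 0) (at_right (0::real)) \<longleftrightarrow>
   ((\<lambda>x. (inverse x) ^ n / exp (inverse x)) \<longlongrightarrow> 0) (at_right (0::real))"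
  by (intro filterlim_cong refl)
   (auto simp: eventually_at_filter exp_inv_def exp_minus field_simps)
 ultimately show "((exp_inv n) \<longlongrightarrow> 0) (at_right 0)" by simp
qed

lemma exp_inv_deriv:
 "(exp_inv n has_real_derivative (exp_inv (n + 2) x - n * exp_inv (n + 1) x)) (at x)"
proof -
 consider "x > 0" | "x < 0" | "x = 0" by linarith
 then show ?thesis
 proof cases
  case 1
  have i: "((\<lambda>x. 1 / x) has_real_derivative - ((1 / x) ^ 2)) (at x)"
   using 1 by (auto intro!: derivative_eq_intros simp: field_simps power2_eq_square)
  have p: "((\<lambda>x. (1 / x) ^ n) has_real_derivative - (n * (1 / x) ^ (n + 1))) (at x)"
   using DERIV_power[OF i, of n] by (cases n) (auto simp: power2_eq_square algebra_simps)
  have e: "((\<lambda>x. exp (- (1 / x))) has_real_derivative exp (- (1 / x)) * (1 / x) ^ 2) (at x)"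
   using DERIV_chain2[OF DERIV_exp DERIV_minus[OF i]] by simp
  have "((\<lambda>x. (1 / x) ^ n * exp (- 1 / x)) has_real_derivative
    (exp_inv (n + 2) x - n * exp_inv (n + 1) x)) (at x)"
   using DERIV_mult[OF p e] 1 by (simp add: exp_inv_def power2_eq_square algebra_simps)
  then show ?thesis
   by (rule has_field_derivative_transform_within_open[where S="{0<..}"]) (use 1 in \<open>auto simp: exp_inv_def\<close>)
 next
  case 2
  have "((\<lambda>x. 0) has_real_derivative 0) (at x)" by simp
  then have "(exp_inv n has_real_derivative 0) (at x)"
   by (rule has_field_derivative_transform_within_open[where S="{..<0}"]) (use 2 in \<open>auto simp: exp_inv_def\<close>)
  then show ?thesis using 2 by (simp add: exp_inv_def)
 next
  case 3
  \<comment> \<open>At the origin the difference quotient is the next member of the family, so the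
    derivative is again the limit 0 already computed.\<close>
  have "exp_inv n h / h = exp_inv (n + 1) h" for h by (auto simp: exp_inv_def)
  then have "((\<lambda>h. (exp_inv n (0 + h) - exp_inv n 0) / h) \<longlongrightarrow> 0) (at 0)"
   using exp_inv_tendsto_0[of "n + 1"] by (simp add: exp_inv_def[of n 0])
  then have "(exp_inv n has_real_derivative 0) (at 0)" by (simp add: DERIV_def)
  then show ?thesis using 3 by (simp add: exp_inv_def)
 qed
qed

lemma smooth_on_exp_inv: "smooth_on UNIV (exp_inv n)"
proof -
 have "ck_on k UNIV (exp_inv n)" for k
 proof (induction k arbitrary: n)
  case 0
  show ?case
   by (auto intro!: continuous_at_imp_continuous_on DERIV_isCont[OF exp_inv_deriv])
 next
  case (Suc k)
  have scale: "ck_on k UNIV (\<lambda>x. c * exp_inv j x)" for c j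
   using ck_on_linear[OF _ bounded_linear_mult_right[of c] Suc.IH[of j]] by simp
  have "ck_on k UNIV (\<lambda>x. v * exp_inv (n + 2) x + (- real n * v) * exp_inv (n + 1) x)" for v
   by (intro ck_on_add scale) simp
  moreover have "v * exp_inv (n + 2) x + (- real n * v) * exp_inv (n + 1) x
    = (exp_inv (n + 2) x - n * exp_inv (n + 1) x) * v" for v x by (simp add: algebra_simps)
  ultimately show ?case
   by (intro ck_on_SucI[where D="\<lambda>x v. (exp_inv (n + 2) x - n * exp_inv (n + 1) x) * v"])
    (use exp_inv_deriv in \<open>auto simp: has_field_derivative_def\<close>)
 qed
 then show ?thesis by (simp add: smooth_on_def)
qed

lemma bump_function:
 assumes "0 < s" "s < r"
 obtains \<beta> :: "'a::euclidean_space => real"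
 where "smooth_on UNIV \<beta>" and "\<And>x. norm x \<le> s ==> \<beta> x = 1" and "\<And>x. r \<le> norm x ==> \<beta> x = 0"
proof
 let ?e = "exp_inv 0"
 define c where "c = ?e (r^2 - s^2)"
 \<comment> \<open>The inner \<open>?e\<close> vanishes for \<open>norm x \<le> s\<close> and is at
   least \<open>c\<close> for \<open>norm x \<ge> r\<close>; hence the argument of the outer one is
   \<open>c\<close> on the small ball and nonpositive outside the large one. Only
   \<open>x \<bullet> x\<close> enters, not the norm, so nothing is lost at 0.\<close>
 define \<beta> :: "'a => real" where "\<beta> = (\<lambda>x. (1 / ?e c) * ?e (c - ?e (x \<bullet> x - s^2)))"
 have "r^2 - s^2 > 0" using assms by (simp add: power_strict_mono)
 then have c: "c > 0" by (simp add: c_def exp_inv_def)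
 then have ec: "?e c > 0" by (simp add: exp_inv_def)
 have e: "smooth_on S f ==> open S ==> smooth_on S (\<lambda>x. ?e (f x))" for S :: "'a set" and f
  by (rule smooth_on_compose[where T=UNIV]) (auto intro: smooth_on_exp_inv)
 show "smooth_on UNIV \<beta>"
  unfolding \<beta>_def
  by (intro smooth_on_mult smooth_on_const e smooth_on_diff smooth_on_inner smooth_on_ident) auto
 show "\<beta> x = 1" if "norm x \<le> s" for x
 proof -
  have "x \<bullet> x \<le> s^2" using that assms by (simp add: dot_square_norm power_mono)
  then show ?thesis using ec by (simp add: \<beta>_def exp_inv_def[of 0 "x \<bullet> x - s^2"])
 qed
 show "\<beta> x = 0" if "r \<le> norm x" for x
 proof -
  have "r^2 \<le> x \<bullet> x" using that assms by (simp add: dot_square_norm power_mono)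
  then have "c \<le> ?e (x \<bullet> x - s^2)"
   using \<open>r^2 - s^2 > 0\<close> by (auto simp: c_def exp_inv_def intro!: frac_le)
  then show ?thesis by (simp add: \<beta>_def exp_inv_def[of 0 "c - _"])
 qed
qed

subsection \<open>Hadamard's lemma\<close>

lemma scaleR_in_ball_0: "x \<in> ball 0 r ==> 0 \<le> t ==> t \<le> 1 ==> t *\<^sub>R x \<in> ball (0::'a::real_normed_vector) r"
 using mult_left_le_one_le[of "norm x" t] by auto

text \<open>Differentiating under the integral produces a further factor \<open>t\<close>; the
  weight \<open>t ^ m\<close> with arbitrary \<open>m\<close> makes the claim stable under
  this.\<close>

lemma ck_on_ray_integral:
 fixes f :: "'a::euclidean_space => real"
 shows "ck_on k (ball 0 r) f ==> ck_on k (ball 0 r) (\<lambda>x. integral (cbox 0 1) (\<lambda>t. t ^ m * f (t *\<^sub>R x)))"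
proof (induction k arbitrary: m f)
 case 0
 then have f: "continuous_on (ball 0 r) f" by simp
 have "continuous_on (ball 0 r \<times> cbox (0::real) 1) (\<lambda>(x, t). t ^ m * f (t *\<^sub>R x))"
  unfolding case_prod_beta
  by (intro continuous_intros continuous_on_compose2[OF f]) (use scaleR_in_ball_0[of _ r] in auto)
 then show ?case
  using integral_continuous_on_param[of "ball 0 r" 0 1 "\<lambda>x t. t ^ m * f (t *\<^sub>R x)"]
  by (simp add: case_prod_beta)
next
 case (Suc k)
 let ?f' = "\<lambda>x. frechet_derivative f (at x)"
 have lin: "bounded_linear (?f' x)" if "x \<in> ball 0 r" for x
  using has_derivative_bounded_linear[OF ck_on_SucD[OF Suc.prems that]] .
 have cf: "continuous_on (ball 0 r) f"
  using Suc.prems by (metis smooth_on_def ck_on.simps(1) ck_on_Suc_imp ck_on_subset differentiable_imp_continuous_on differentiable_on_eq_differentiable_at open_ball ck_on.simps(2))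
 have cf': "continuous_on (ball 0 r) (\<lambda>x. ?f' x v)" for v
 proof -
  have "ck_on k (ball 0 r) (\<lambda>x. ?f' x v)" using Suc.prems by simp
  then show ?thesis by (induction k) (simp, metis ck_on_Suc_imp)
 qed
 \<comment> \<open>The Leibniz rule asks for a jointly continuous derivative with values in bounded
   linear maps; the value 0 off the domain is a dummy.\<close>
 define fx where "fx = (\<lambda>x t. if x \<in> ball 0 r \<and> t \<in> cbox (0::real) 1
   then Blinfun (\<lambda>v. t ^ Suc m * ?f' (t *\<^sub>R x) v) else 0)"
 have fx: "blinfun_apply (fx x t) = (\<lambda>v. t ^ Suc m * ?f' (t *\<^sub>R x) v)"
  if "x \<in> ball 0 r" "t \<in> cbox 0 1" for x t
  using that lin[of "t *\<^sub>R x"] scaleR_in_ball_0[of x r t]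
  by (simp add: fx_def bounded_linear_Blinfun_apply bounded_linear_const_mult)
 have cfx: "continuous_on (ball 0 r \<times> cbox 0 1) (\<lambda>(x, t). fx x t)"
 proof (rule continuous_on_blinfun_componentwise)
  fix i :: 'a
  have "continuous_on (ball 0 r \<times> cbox (0::real) 1) (\<lambda>(x, t). t ^ Suc m * ?f' (t *\<^sub>R x) i)"
   unfolding case_prod_beta
   by (intro continuous_intros continuous_on_compose2[OF cf'[of i]]) (use scaleR_in_ball_0[of _ r] in auto)
  then show "continuous_on (ball 0 r \<times> cbox 0 1) (\<lambda>x. blinfun_apply (case x of (x, t) => fx x t) i)"
   by (rule continuous_on_eq) (auto simp: fx)
 qed
 have cfx1: "continuous_on (cbox 0 1) (fx x)" if "x \<in> ball 0 r" for x
  using continuous_on_compose2[OF cfx, of "cbox 0 1" "\<lambda>t. (x, t)"] that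
  by (simp add: image_subset_iff continuous_on_Pair continuous_on_id)
 have intfx: "blinfun_apply (integral (cbox 0 1) (fx x)) v = integral (cbox 0 1) (\<lambda>t. t ^ Suc m * ?f' (t *\<^sub>R x) v)"
  if "x \<in> ball 0 r" for x v
  by (subst blinfun_apply_integral[OF integrable_continuous[OF cfx1[OF that]]])
   (use that fx in \<open>auto intro!: Henstock_Kurzweil_Integration.integral_cong\<close>)
 show ?case
 proof (rule ck_on_SucI[where D="\<lambda>x. blinfun_apply (integral (cbox 0 1) (fx x))"])
  fix x :: 'a assume x: "x \<in> ball 0 r"
  have "((\<lambda>x. integral (cbox 0 1) (\<lambda>t. t ^ m * f (t *\<^sub>R x))) has_derivative
    blinfun_apply (integral (cbox 0 1) (fx x))) (at x within ball 0 r)"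
  proof (rule leibniz_rule[OF _ _ cfx x])
   fix x :: 'a and t :: real assume xt: "x \<in> ball 0 r" "t \<in> cbox 0 1"
   then have in_b: "t *\<^sub>R x \<in> ball 0 r" using scaleR_in_ball_0[of x r t] by simp
   have "((\<lambda>x. t ^ m * f (t *\<^sub>R x)) has_derivative (\<lambda>v. t ^ m * ?f' (t *\<^sub>R x) (t *\<^sub>R v))) (at x)"
    by (intro has_derivative_mult_right
      has_derivative_compose[where f="\<lambda>x. t *\<^sub>R x", OF _ ck_on_SucD[OF Suc.prems in_b]])
     (auto intro!: derivative_eq_intros)
   then show "((\<lambda>x. t ^ m * f (t *\<^sub>R x)) has_derivative blinfun_apply (fx x t)) (at x within ball 0 r)"
    using xt by (simp add: fx linear_cmul[OF bounded_linear.linear[OF lin[OF in_b]]] has_derivative_at_withinI mult.assoc mult.left_commute)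
  next
   fix x :: 'a assume "x \<in> ball 0 r"
   then show "(\<lambda>t. t ^ m * f (t *\<^sub>R x)) integrable_on cbox 0 1"
    by (intro integrable_continuous continuous_intros continuous_on_compose2[OF cf])
     (use scaleR_in_ball_0[of _ r] in auto)
  qed auto
  then show "((\<lambda>x. integral (cbox 0 1) (\<lambda>t. t ^ m * f (t *\<^sub>R x))) has_derivative
    blinfun_apply (integral (cbox 0 1) (fx x))) (at x)"
   using at_within_open[OF x] by simp
 next
  fix v
  have "ck_on k (ball 0 r) (\<lambda>x. integral (cbox 0 1) (\<lambda>t. t ^ Suc m * ?f' (t *\<^sub>R x) v))"
   using Suc.prems by (intro Suc.IH) simp
  then show "ck_on k (ball 0 r) (\<lambda>x. blinfun_apply (integral (cbox 0 1) (fx x)) v)"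
   by (subst ck_on_cong[OF open_ball]) (rule intfx, assumption)
 qed auto
qed

text \<open>Integrate the derivative along the segment from 0 to \<open>y\<close> and expand the
  direction \<open>y\<close> in \<open>Basis\<close>. The smooth factors \<open>g b\<close> are what
  lets the product rule evaluate a derivation at a point.\<close>

lemma Hadamard_lemma:
 fixes f :: "'a::euclidean_space => real"
 assumes f: "smooth_on (ball 0 r) f" and "r > 0"
 obtains g where "\<And>b. smooth_on (ball 0 r) (g b)"
  and "\<And>y. y \<in> ball 0 r ==> f y = f 0 + (\<Sum>b\<in>Basis. (y \<bullet> b) * g b y)"
  and "\<And>b. g b 0 = frechet_derivative f (at 0) b"
proof
 let ?f' = "\<lambda>x. frechet_derivative f (at x)"
 \<comment> \<open>The factor \<open>t ^ 0\<close> is there to match the weighted integral of the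
   previous lemma.\<close>
 define g where "g = (\<lambda>b x. integral (cbox 0 1) (\<lambda>t. t ^ 0 * ?f' (t *\<^sub>R x) b))"
 show "smooth_on (ball 0 r) (g b)" for b
  unfolding g_def smooth_on_def
  by (intro allI ck_on_ray_integral) (use smooth_on_frechet_derivative[OF f] smooth_on_def in metis)
 show "g b 0 = ?f' 0 b" for b by (simp add: g_def)
 fix y :: 'a assume y: "y \<in> ball 0 r"
 have b: "t *\<^sub>R y \<in> ball 0 r" if "t \<in> {0..1}" for t using scaleR_in_ball_0[OF y] that by auto
 have "((\<lambda>t. ?f' (t *\<^sub>R y) y) has_integral (f (1 *\<^sub>R y) - f (0 *\<^sub>R y))) {0..1}"
 proof (rule fundamental_theorem_of_calculus)
  fix t :: real assume t: "t \<in> {0..1}"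
  have "((\<lambda>t. f (t *\<^sub>R y)) has_derivative (\<lambda>h. ?f' (t *\<^sub>R y) (h *\<^sub>R y))) (at t)"
   by (rule has_derivative_compose[where f="\<lambda>t. t *\<^sub>R y", OF _ smooth_on_has_derivative[OF f b[OF t]]])
    (auto intro!: derivative_eq_intros)
  moreover have "?f' (t *\<^sub>R y) (h *\<^sub>R y) = h *\<^sub>R ?f' (t *\<^sub>R y) y" for h
   using linear_cmul[OF has_derivative_linear[OF smooth_on_has_derivative[OF f b[OF t]]]] .
  ultimately show "((\<lambda>t. f (t *\<^sub>R y)) has_vector_derivative ?f' (t *\<^sub>R y) y) (at t within {0..1})"
   by (simp add: has_vector_derivative_def has_derivative_at_withinI)
 qed simp
 then have "f y - f 0 = integral {0..1} (\<lambda>t. ?f' (t *\<^sub>R y) y)" by (simp add: integral_unique)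
 also have "\<dots> = integral {0..1} (\<lambda>t. \<Sum>c\<in>Basis. (y \<bullet> c) *\<^sub>R ?f' (t *\<^sub>R y) c)"
  by (intro Henstock_Kurzweil_Integration.integral_cong
    linear_eq_sum_Basis[OF has_derivative_linear[OF smooth_on_has_derivative[OF f b]]])
 also have "\<dots> = (\<Sum>c\<in>Basis. integral {0..1} (\<lambda>t. (y \<bullet> c) *\<^sub>R ?f' (t *\<^sub>R y) c))"
  by (intro Henstock_Kurzweil_Integration.integral_sum integrable_cmul integrable_continuous_interval
    continuous_on_compose2[OF smooth_on_imp_continuous_on[OF smooth_on_frechet_derivative[OF f]]] continuous_intros)
   (use b in auto)
 finally show "f y = f 0 + (\<Sum>c\<in>Basis. (y \<bullet> c) * g c y)" by (simp add: g_def)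
qed

subsection \<open>Ordinary differential equations\<close>

text \<open>Both integrals start at the left end of the interval, so their difference is the
  oriented integral from \<open>t0\<close> to \<open>u\<close> for \<open>u\<close> on either side
  of \<open>t0\<close>.\<close>

lemma integral_diff_bound:
 fixes g :: "real => 'a::euclidean_space"
 assumes g: "continuous_on {t0-e..t0+e} g" and C: "\<And>s. s \<in> {t0-e..t0+e} ==> norm (g s) \<le> C"
  and u: "u \<in> {t0-e..t0+e}"
 shows "norm (integral {t0-e..u} g - integral {t0-e..t0} g) \<le> C * e"
proof -
 have e: "e \<ge> 0" and "C \<ge> 0" using u order_trans[OF norm_ge_zero C[of u]] by auto
 have int: "g integrable_on {t0-e..w}" if "w \<le> t0 + e" for w
  using g that by (intro integrable_continuous_interval) (auto intro: continuous_on_subset)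
 have bnd: "norm (integral {p..q} g) \<le> C * e" if "t0-e \<le> p" "p \<le> q" "q \<le> t0+e" "q - p \<le> e" for p q
 proof -
  have "norm (integral {p..q} g) \<le> C * (q - p)"
   using that C by (intro integral_bound continuous_on_subset[OF g]) auto
  also have "\<dots> \<le> C * e" using that \<open>C \<ge> 0\<close> by (intro mult_left_mono) auto
  finally show ?thesis .
 qed
 show ?thesis
 proof (cases "t0 \<le> u")
  case True
  have "integral {t0-e..t0} g + integral {t0..u} g = integral {t0-e..u} g"
   using True u e by (intro Henstock_Kurzweil_Integration.integral_combine int) auto
  then have "integral {t0-e..u} g - integral {t0-e..t0} g = integral {t0..u} g"
   by (simp add: algebra_simps)
  then show ?thesis using bnd[of t0 u] True u e by auto
 next
  case False
  have "integral {t0-e..u} g + integral {u..t0} g = integral {t0-e..t0} g"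
   using False u e by (intro Henstock_Kurzweil_Integration.integral_combine int) auto
  then have "integral {t0-e..u} g - integral {t0-e..t0} g = - integral {u..t0} g"
   by (simp add: algebra_simps)
  then show ?thesis using bnd[of u t0] False u e by auto
 qed
qed

text \<open>The Lipschitz constant and the bound on \<open>F\<close> are global, so the integral
  operator contracts the whole space of bounded continuous functions; the field to which this is
  applied is cut off beforehand.\<close>

lemma Picard_Lindelof:
 fixes F :: "real => 'a::euclidean_space => 'a"
 assumes cont: "continuous_on UNIV (\<lambda>(t, x). F t x)"
  and lip: "\<And>t x y. norm (F t x - F t y) \<le> K * norm (x - y)"
  and bd: "\<And>t x. norm (F t x) \<le> B"
  and e: "e > 0" "0 \<le> K" "K * e < 1"
 obtains x where "x t0 = x0"
  and "\<And>t. \<bar>t - t0\<bar> < e ==> (x has_vector_derivative F t (x t)) (at t)"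
  and "\<And>t. norm (x t - x0) \<le> B * e"
proof -
 \<comment> \<open>Clamping time to the interval around \<open>t0\<close> lets the iterates be
   bounded functions on the whole line; inside the interval \<open>c\<close> is the identity and the
   integral equation is the genuine one.\<close>
 define c where "c = (\<lambda>t. max (t0 - e) (min (t0 + e) t))"
 have c: "c t \<in> {t0-e..t0+e}" for t using e by (auto simp: c_def)
 have cont_c: "continuous_on UNIV c" unfolding c_def by (intro continuous_intros)
 define J where "J = (\<lambda>g t. integral {t0-e..c t} g - integral {t0-e..t0} g :: 'a)"
 define T where "T = (\<lambda>y :: real \<Rightarrow>\<^sub>C 'a. Bcontfun (\<lambda>t. x0 + J (\<lambda>s. F s (apply_bcontfun y s)) t))"
 have cF: "continuous_on S (\<lambda>s. F s (apply_bcontfun y s))" for y S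
  using continuous_on_compose2[OF cont, of S "\<lambda>s. (s, apply_bcontfun y s)"]
  by (simp add: continuous_on_Pair continuous_on_id)
 have cJ: "continuous_on UNIV (J g)" if "continuous_on {t0-e..t0+e} g" for g
  unfolding J_def
  by (intro continuous_intros continuous_on_compose2[OF indefinite_integral_continuous_1[of g "t0 - e" "t0 + e"] cont_c]
    integrable_continuous_interval that) (use c in auto)
 have bJ: "norm (J g t) \<le> C * e" if "continuous_on {t0-e..t0+e} g" "\<And>s. norm (g s) \<le> C" for g C t
  unfolding J_def by (rule integral_diff_bound[OF that(1) that(2) c])
 have T: "apply_bcontfun (T y) t = x0 + J (\<lambda>s. F s (apply_bcontfun y s)) t" for y t
 proof -
  have "(\<lambda>t. x0 + J (\<lambda>s. F s (apply_bcontfun y s)) t) \<in> bcontfun"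
  proof (rule bcontfun_normI)
   fix t show "norm (x0 + J (\<lambda>s. F s (apply_bcontfun y s)) t) \<le> norm x0 + B * e"
    using norm_triangle_ineq bJ[OF cF bd] by (meson add_left_mono order_trans)
  qed (intro continuous_intros cJ cF)
  then show ?thesis by (simp add: T_def Bcontfun_inverse)
 qed
 have "\<exists>!x. T x = x"
 proof (rule banach_fix_type)
  show "0 \<le> K * e" "K * e < 1" using e by auto
  show "\<forall>y z. dist (T y) (T z) \<le> K * e * dist y z"
  proof (intro allI, rule dist_bound)
   fix y z t
   let ?g = "\<lambda>y s. F s (apply_bcontfun y s)"
   have int: "?g y integrable_on {t0-e..u}" for y u
    by (intro integrable_continuous_interval cF)
   have "J (?g y) t - J (?g z) t = J (\<lambda>s. ?g y s - ?g z s) t"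
    unfolding J_def by (simp add: Henstock_Kurzweil_Integration.integral_diff[OF int int])
   moreover have "norm (J (\<lambda>s. ?g y s - ?g z s) t) \<le> K * dist y z * e"
   proof (rule bJ)
    show "norm (?g y s - ?g z s) \<le> K * dist y z" for s
     using lip[of s "apply_bcontfun y s" "apply_bcontfun z s"] dist_bounded[of y s z] e
     by (smt (verit) dist_norm mult_left_mono)
   qed (intro continuous_intros cF)
   ultimately show "dist (apply_bcontfun (T y) t) (apply_bcontfun (T z) t) \<le> K * e * dist y z"
    by (simp add: T dist_norm algebra_simps)
  qed
 qed
 then obtain y where "T y = y" by blast
 then have y: "apply_bcontfun y t = x0 + J (\<lambda>s. F s (apply_bcontfun y s)) t" for t using T by metis
 show ?thesis
 proof (rule that[of "apply_bcontfun y"])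
  show "apply_bcontfun y t0 = x0" using e by (subst y) (simp add: J_def c_def)
  show "norm (apply_bcontfun y t - x0) \<le> B * e" for t by (subst y) (simp add: bJ[OF cF bd])
  fix t assume t: "\<bar>t - t0\<bar> < e"
  then have "t \<in> {t0-e<..<t0+e}" by auto
  let ?h = "\<lambda>u. x0 + (integral {t0-e..u} (\<lambda>s. F s (apply_bcontfun y s)) - integral {t0-e..t0} (\<lambda>s. F s (apply_bcontfun y s)))"
  have "((\<lambda>u. integral {t0-e..u} (\<lambda>s. F s (apply_bcontfun y s))) has_vector_derivative F t (apply_bcontfun y t))
    (at t within {t0-e..t0+e})"
   using t by (intro integral_has_vector_derivative cF) auto
  then have "((\<lambda>u. integral {t0-e..u} (\<lambda>s. F s (apply_bcontfun y s))) has_vector_derivative F t (apply_bcontfun y t)) (at t)"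
   using \<open>t \<in> {t0-e<..<t0+e}\<close> at_within_interior[of t "{t0-e..t0+e}"] by simp
  then have "(?h has_vector_derivative F t (apply_bcontfun y t)) (at t)"
   by (auto intro!: derivative_eq_intros)
  then show "(apply_bcontfun y has_vector_derivative F t (apply_bcontfun y t)) (at t)"
  proof (rule has_vector_derivative_transform_within_open[OF _ open_greaterThanLessThan \<open>t \<in> {t0-e<..<t0+e}\<close>])
   fix u assume "u \<in> {t0-e<..<t0+e}"
   then show "?h u = apply_bcontfun y u" by (subst y) (auto simp: J_def c_def)
  qed
 qed
qed

text \<open>The solution is the exponential series of \<open>t\<close> times \<open>L\<close>
  applied to \<open>v0\<close>; its components are real power series that converge everywhere and
  are differentiated termwise.\<close>

lemma linear_ode_solution:
 fixes L :: "'a::euclidean_space => 'a"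
 assumes L: "linear L"
 obtains v where "v t0 = v0" and "\<And>t. (v has_vector_derivative L (v t)) (at t)"
proof -
 obtain K where K: "K > 0" "\<And>x. norm (L x) \<le> K * norm x"
  using linear_bounded_pos[OF L] by metis
 have pow: "norm ((L ^^ n) v0) \<le> K ^ n * norm v0" for n
 proof (induction n)
  case (Suc n)
  then show ?case using K(2)[of "(L ^^ n) v0"] K(1)
   by (auto intro: order_trans mult_left_mono simp: mult.assoc)
 qed simp
 have summ: "summable (\<lambda>n. (t ^ n / fact n) *\<^sub>R (L ^^ n) v0)" for t
 proof (rule summable_comparison_test)
  have "summable (\<lambda>n. inverse (fact n) * (\<bar>t\<bar> * K) ^ n)" by (rule summable_exp)
  then show "summable (\<lambda>n. (inverse (fact n) * (\<bar>t\<bar> * K) ^ n) * norm v0)" by (rule summable_mult2)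
  show "\<exists>N. \<forall>n\<ge>N. norm ((t ^ n / fact n) *\<^sub>R (L ^^ n) v0) \<le> (inverse (fact n) * (\<bar>t\<bar> * K) ^ n) * norm v0"
  proof (intro exI allI impI)
   fix n :: nat
   have "norm ((t ^ n / fact n) *\<^sub>R (L ^^ n) v0) = (\<bar>t\<bar> ^ n / fact n) * norm ((L ^^ n) v0)"
    by (simp add: power_abs)
   also have "\<dots> \<le> (\<bar>t\<bar> ^ n / fact n) * (K ^ n * norm v0)" by (intro mult_left_mono pow) auto
   finally show "norm ((t ^ n / fact n) *\<^sub>R (L ^^ n) v0) \<le> (inverse (fact n) * (\<bar>t\<bar> * K) ^ n) * norm v0"
    by (simp add: field_simps)
  qed
 qed
 define w where "w = (\<lambda>t. \<Sum>n. (t ^ n / fact n) *\<^sub>R (L ^^ n) v0)"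
 have w: "(w has_vector_derivative L (w t)) (at t)" for t
  unfolding has_vector_derivative_def
 proof (subst has_derivative_componentwise_within, intro ballI)
  fix b :: 'a assume b: "b \<in> Basis"
  define c where "c = (\<lambda>n. ((L ^^ n) v0 \<bullet> b) / fact n)"
  have cs: "summable (\<lambda>n. c n * x ^ n)" for x
   using bounded_linear.summable[OF bounded_linear_inner_left summ[of x], of b] by (simp add: c_def field_simps)
  have wb: "w x \<bullet> b = (\<Sum>n. c n * x ^ n)" for x
   using bounded_linear.suminf[OF bounded_linear_inner_left summ[of x], of b] by (simp add: w_def c_def field_simps)
  have "L (w t) \<bullet> b = (\<Sum>n. L ((t ^ n / fact n) *\<^sub>R (L ^^ n) v0) \<bullet> b)"
   unfolding w_def
   using bounded_linear.suminf[OF bounded_linear_compose[OF bounded_linear_inner_left linear_conv_bounded_linear[THEN iffD1, OF L]] summ[of t], of b]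
   by simp
  also have "\<dots> = (\<Sum>n. diffs c n * t ^ n)"
  proof (intro suminf_cong)
   fix n
   have "diffs c n = ((L ^^ Suc n) v0 \<bullet> b) / fact n"
    by (simp add: diffs_def c_def fact_Suc del: of_nat_Suc)
   then show "L ((t ^ n / fact n) *\<^sub>R (L ^^ n) v0) \<bullet> b = diffs c n * t ^ n"
    by (simp add: linear_cmul[OF L])
  qed
  finally have "((\<lambda>x. w x \<bullet> b) has_real_derivative L (w t) \<bullet> b) (at t)"
   unfolding wb using termdiffs_strong_converges_everywhere[OF cs] by simp
  then show "((\<lambda>x. w x \<bullet> b) has_derivative (\<lambda>x. x *\<^sub>R L (w t) \<bullet> b)) (at t)"
   by (simp add: has_field_derivative_def mult_commute_abs)
 qed
 show ?thesis
 proof (rule that[of "\<lambda>t. w (t - t0)"])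
  show "w (t0 - t0) = v0"
   by (subst w_def, subst suminf_finite[of "{0}"]) auto
  show "((\<lambda>t. w (t - t0)) has_vector_derivative L (w (t - t0))) (at t)" for t
   using vector_diff_chain_at[of "\<lambda>t. t - t0" 1 t w "L (w (t - t0))"] w[of "t - t0"]
    has_vector_derivative_diff[OF has_vector_derivative_id has_vector_derivative_const[of t0], of "at t"]
   by (simp add: o_def)
 qed
qed

text \<open>Bootstrapping: if the right-hand side is as regular as the solution, each pass gains one
  derivative.\<close>

lemma smooth_on_vector_derivI:
 fixes y :: "real => 'a::euclidean_space"
 assumes "open S" and d: "\<And>t. t \<in> S ==> (y has_vector_derivative D t) (at t)"
  and D: "\<And>k. ck_on k S y ==> ck_on k S D"
 shows "smooth_on S y"
proof -
 have "ck_on k S y" for k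
 proof (induction k)
  case 0
  show ?case using d
   by (auto intro!: continuous_at_imp_continuous_on has_vector_derivative_continuous)
 next
  case (Suc k)
  show ?case
   by (rule ck_on_SucI[where D="\<lambda>t h. h *\<^sub>R D t"])
    (use d[unfolded has_vector_derivative_def] assms(1) D[OF Suc.IH] in
     \<open>auto intro: ck_on_linear[OF _ bounded_linear_scaleR_right]\<close>)
 qed
 then show ?thesis by (simp add: smooth_on_def)
qed

section \<open>Solvable Lie algebras\<close>

subsection \<open>Traces and orthogonal projections\<close>

definition tr :: "('a::euclidean_space => 'a) => real" where
 "tr f = (\<Sum>b\<in>Basis. f b \<bullet> b)"

lemma inner_sum_Basis: "(x::'a::euclidean_space) \<bullet> y = (\<Sum>b\<in>Basis. (x \<bullet> b) * (y \<bullet> b))"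
 by (rule euclidean_inner)

lemma tr_commute:
 assumes "linear f" "linear g"
 shows "tr (\<lambda>x. f (g x)) = tr (\<lambda>x. g (f x))"
proof -
 have "tr (\<lambda>x. f (g x)) = (\<Sum>b\<in>Basis. \<Sum>c\<in>Basis. (g b \<bullet> c) * (f c \<bullet> b))" if "linear f" "linear g" for f g
  unfolding tr_def
  by (subst linear_eq_sum_Basis[OF that(1)]) (simp add: inner_sum_left)
 from this[OF assms] this[OF assms(2,1)] show ?thesis
  by (simp add: mult.commute) (rule sum.swap)
qed

text \<open>Such a sum is a trace and independent of the orthonormal basis, so a map in one slot can
  be moved to the other slot as its adjoint.\<close>

lemma sum_Basis_adjoint:
 fixes q :: "'a::euclidean_space => 'a => real"
 assumes q: "bilinear q" and f: "linear f" and adj: "\<And>x y. g x \<bullet> y = x \<bullet> g' y"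
 shows "(\<Sum>b\<in>Basis. q (f b) (g b)) = (\<Sum>b\<in>Basis. q (f (g' b)) b)"
proof -
 have l: "linear (q x)" "linear (\<lambda>x. q x y)" for x y using q by (auto simp: bilinear_def)
 have "(\<Sum>b\<in>Basis. q (f b) (g b)) = (\<Sum>b\<in>Basis. \<Sum>c\<in>Basis. (b \<bullet> g' c) * q (f b) c)"
  by (subst linear_eq_sum_Basis[OF l(1)]) (simp add: adj)
 also have "\<dots> = (\<Sum>c\<in>Basis. \<Sum>b\<in>Basis. (g' c \<bullet> b) * q (f b) c)"
  by (subst sum.swap) (simp add: inner_commute)
 also have "\<dots> = (\<Sum>c\<in>Basis. q (f (g' c)) c)"
  by (subst linear_eq_sum_Basis[OF linear_compose[OF f l(2), unfolded o_def]]) simp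
 finally show ?thesis .
qed

lemma sum_Basis_rank_one:
 fixes q :: "'a::euclidean_space => 'a => real"
 assumes "bilinear q"
 shows "(\<Sum>b\<in>Basis. (x \<bullet> b) * q x b) = q x x"
proof -
 have "linear (q x)" using assms by (simp add: bilinear_def)
 from linear_eq_sum_Basis[OF this, of x] show ?thesis by simp
qed

definition orth_proj :: "'a::euclidean_space set => ('a => 'a) => bool" where
 "orth_proj W p \<longleftrightarrow> linear p \<and> (\<forall>x. p x \<in> W) \<and> (\<forall>x\<in>W. p x = x) \<and> (\<forall>x y. p x \<bullet> y = x \<bullet> p y)"

lemma orth_proj_exists:
 fixes W :: "'a::euclidean_space set"
 assumes "subspace W"
 obtains p where "orth_proj W p"
proof -
 obtain B where B: "B \<subseteq> W" "pairwise orthogonal B" "\<And>x. x \<in> B ==> norm x = 1" "independent B" "span B = W"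
  using orthonormal_basis_subspace[OF assms] by metis
 have fin: "finite B" using B(4) independent_imp_finite by blast
 define p where "p = (\<lambda>x. \<Sum>b\<in>B. (x \<bullet> b) *\<^sub>R b)"
 have lin: "linear p"
  unfolding p_def by (intro linear_compose_sum ballI) (auto intro!: linearI simp: algebra_simps)
 have "p x \<in> W" for x
  unfolding p_def using B(1,5) by (metis (no_types, lifting) span_base span_scale span_sum subsetD)
 moreover have pb: "p b = b" if "b \<in> B" for b
 proof -
  have "p b = (\<Sum>c\<in>B. if c = b then b else 0)"
   unfolding p_def
  proof (rule sum.cong[OF refl])
   fix c assume "c \<in> B"
   then show "(b \<bullet> c) *\<^sub>R c = (if c = b then b else 0)"
    using B(2,3) that by (auto simp: pairwise_def orthogonal_def dot_square_norm)
  qed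
  then show ?thesis using fin that by simp
 qed
 have "p x = x" if "x \<in> W" for x
 proof -
  have "x \<in> span B" using that B(5) by simp
  then show ?thesis
   by (induction rule: span_induct_alt)
    (auto simp: linear_0[OF lin] linear_add[OF lin] linear_cmul[OF lin] pb)
 qed
 moreover have "p x \<bullet> y = x \<bullet> p y" for x y
  by (simp add: p_def inner_sum_left inner_sum_right inner_commute mult.commute)
 ultimately show ?thesis using that lin unfolding orth_proj_def by blast
qed

subsection \<open>Commutators that commute with an argument are nilpotent\<close>

text \<open>The Kleinecke-Shirokov argument: if \<open>D\<close> denotes the commutator with \<open>Y\<close>, then \<open>D\<^sup>n (X\<^sup>n) = n! Z\<^sup>n\<close>,
 so the powers of \<open>Z\<close> decrease too fast for \<open>Z\<close> to be onto a nonzero subspace.\<close>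

lemma commutator_nilpotent:
 fixes X Y Z :: "'a::euclidean_space => 'a"
 assumes lin: "linear X" "linear Y" "linear Z"
  and U: "\<And>u. u \<in> U ==> X u \<in> U" "\<And>u. u \<in> U ==> Y u \<in> U" "\<And>u. u \<in> U ==> Z u \<in> U" "subspace U"
  and Z: "\<And>u. u \<in> U ==> X (Y u) - Y (X u) = Z u" and ZY: "\<And>u. u \<in> U ==> Z (Y u) = Y (Z u)"
 shows "\<exists>n. \<forall>u\<in>U. (Z ^^ n) u = 0"
proof -
 \<comment> \<open>The commutation relations hold only on the invariant subspace \<open>U\<close>;
   so \<open>D\<close> acts on arbitrary functions, and membership in \<open>U\<close> is carried
   along instead of restricting the maps.\<close>
 define D where "D A u = A (Y u) - Y (A u)" for A u
 have Xn: "(X ^^ n) u \<in> U" if "u \<in> U" for n u using that U(1) by (induction n) auto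
 have DU: "(D ^^ n) A u \<in> U" if "\<And>u. u \<in> U ==> A u \<in> U" "u \<in> U" for n A u
  using that(2) by (induction n arbitrary: u) (auto simp: D_def that(1) U subspace_diff)
 \<comment> \<open>On \<open>U\<close>, \<open>D\<close> is a derivation with \<open>D X = Z\<close>
   and \<open>D Z = 0\<close>. For \<open>n = 0\<close> the truncated \<open>n - 1\<close> is
   harmless because its coefficient is 0.\<close>
 have Leibniz: "(D ^^ n) (\<lambda>u. X (A u)) u = X ((D ^^ n) A u) + real n *\<^sub>R Z ((D ^^ (n - 1)) A u)"
  if A: "\<And>u. u \<in> U ==> A u \<in> U" and "u \<in> U" for n A u
  using that(2)
 proof (induction n arbitrary: u)
  case (Suc n)
  let ?G = "(D ^^ n) A" and ?H = "(D ^^ (n - 1)) A"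
  have G: "?G u \<in> U" "?H u \<in> U" by (rule DU[OF A Suc.prems], assumption)+
  have "(D ^^ Suc n) (\<lambda>u. X (A u)) u
    = X (?G (Y u)) - Y (X (?G u)) + real n *\<^sub>R (Z (?H (Y u)) - Y (Z (?H u)))"
   using Suc.IH[OF Suc.prems] Suc.IH[OF U(2)[OF Suc.prems]]
   by (simp add: D_def[of "(D ^^ n) _"] linear_add[OF lin(2)] linear_cmul[OF lin(2)] algebra_simps)
  also have "Y (X (?G u)) = X (Y (?G u)) - Z (?G u)" using Z[OF G(1)] by (simp add: algebra_simps)
  also have "real n *\<^sub>R (Z (?H (Y u)) - Y (Z (?H u))) = real n *\<^sub>R Z (?G u)"
   using ZY[OF G(2)] by (cases n) (simp_all add: D_def linear_diff[OF lin(3)])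
  finally show ?case by (simp add: D_def[of "(D ^^ n) A"] linear_diff[OF lin(1)] algebra_simps)
 qed simp
 have DX: "(D ^^ n) (X ^^ n) u = fact n *\<^sub>R (Z ^^ n) u \<and> (D ^^ Suc n) (X ^^ n) u = 0" if "u \<in> U" for n u
  using that
 proof (induction n arbitrary: u)
  case (Suc n)
  have e: "X ^^ Suc n = (\<lambda>u. X ((X ^^ n) u))" by (simp add: o_def)
  have 1: "(D ^^ n) (X ^^ n) u = fact n *\<^sub>R (Z ^^ n) u" "(D ^^ Suc n) (X ^^ n) u = 0" using Suc by blast+
  have "(D ^^ Suc n) (X ^^ n) (Y u) = 0" using Suc U(2) by blast
  then have 2: "(D ^^ Suc (Suc n)) (X ^^ n) u = 0"
   using 1(2) linear_0[OF lin(2)] unfolding funpow.simps(2)[of "Suc n"] o_apply D_def[of "(D ^^ Suc n) _"] by simp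
  have "(D ^^ Suc n) (X ^^ Suc n) u = X 0 + real (Suc n) *\<^sub>R Z (fact n *\<^sub>R (Z ^^ n) u)"
   using Leibniz[where A="X ^^ n" and n="Suc n", OF Xn Suc.prems] unfolding e 1(2) by (simp only: diff_Suc_1 1(1))
  moreover have "(D ^^ Suc (Suc n)) (X ^^ Suc n) u = X 0 + real (Suc (Suc n)) *\<^sub>R Z 0"
   using Leibniz[where A="X ^^ n" and n="Suc (Suc n)", OF Xn Suc.prems] unfolding e 2 by (simp only: diff_Suc_1 1(2))
  ultimately show ?case
   by (simp add: linear_0[OF lin(1)] linear_0[OF lin(3)] linear_cmul[OF lin(3)] del: funpow.simps) (simp add: algebra_simps)
 qed (simp add: D_def)
 obtain K k where K: "K > 0" "\<And>u. norm (Y u) \<le> K * norm u" and k: "k > 0" "\<And>u. norm (X u) \<le> k * norm u"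
  using linear_bounded_pos[OF lin(2)] linear_bounded_pos[OF lin(1)] by metis
 have pow: "norm ((f ^^ n) u) \<le> B ^ n * norm u" if "B > 0" "\<And>u. norm (f u) \<le> B * norm u" for f :: "'a => 'a" and B n u
 proof (induction n)
  case (Suc n)
  have "norm (f ((f ^^ n) u)) \<le> B * norm ((f ^^ n) u)" by (rule that(2))
  also have "\<dots> \<le> B * (B ^ n * norm u)" using Suc that(1) by (intro mult_left_mono) auto
  finally show ?case by simp
 qed simp
 have Dn: "norm ((D ^^ n) A u) \<le> (2 * K) ^ n * a * norm u" if "a > 0" "\<And>u. norm (A u) \<le> a * norm u" for n a u and A :: "'a => 'a"
 proof (induction n arbitrary: u)
  case (Suc n)
  let ?b = "(2 * K) ^ n * a"
  have "norm ((D ^^ Suc n) A u) \<le> norm ((D ^^ n) A (Y u)) + norm (Y ((D ^^ n) A u))"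
   by (simp add: D_def norm_triangle_ineq4)
  also have "\<dots> \<le> ?b * norm (Y u) + K * norm ((D ^^ n) A u)" by (intro add_mono Suc K)
  also have "\<dots> \<le> ?b * (K * norm u) + K * (?b * norm u)"
   using K(1) that(1) by (intro add_mono mult_left_mono Suc K) auto
  finally show ?case by (simp add: algebra_simps)
 qed (simp add: that)
 \<comment> \<open>Each application of \<open>D\<close> multiplies a norm bound by at most
   \<open>2 * K\<close>, while \<open>D\<close> applied \<open>n\<close> times to the
   \<open>n\<close>-th power of \<open>X\<close> is \<open>fact n\<close> times the
   \<open>n\<close>-th power of \<open>Z\<close>.\<close>
 have Zn: "fact n * norm ((Z ^^ n) u) \<le> (2 * K * k) ^ n * norm u" if "u \<in> U" for n u
  using Dn[where a="k ^ n" and A="X ^^ n" and n=n and u=u] pow[OF k] k(1) DX[OF that, of n] by (simp add: power_mult_distrib)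
 define V where "V n = (Z ^^ n) ` U" for n
 have V0: "V 0 = U" and VS: "V (Suc n) = Z ` V n" "V (Suc n) = (Z ^^ n) ` Z ` U" for n
  by (simp_all add: V_def image_image funpow_swap1)
 have sV: "subspace (V n)" for n
  by (induction n) (simp_all add: V0 VS(1) U(4) linear_subspace_image[OF lin(3)])
 have VU: "V n \<subseteq> U" for n
 proof (induction n)
  case (Suc n)
  then show ?case unfolding VS(1) using U(3) by blast
 qed (simp add: V0)
 have VV: "V (Suc n) \<subseteq> V n" for n
  unfolding VS(2) unfolding V_def by (intro image_mono) (use U(3) in blast)
 \<comment> \<open>The images of the powers of \<open>Z\<close> decrease, so at the least dimension
   \<open>Z\<close> maps \<open>V n\<close> onto itself and has a linear right inverse
   \<open>g\<close> there. Iterating \<open>g\<close> gives preimages whose norms grow only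
   geometrically, against the factorial in \<open>Zn\<close>.\<close>
 obtain n where n: "\<And>m. dim (V n) \<le> dim (V m)" using ex_has_least_nat[of "\<lambda>_. True" 0 "\<lambda>n. dim (V n)"] by auto
 have ZV: "Z ` V n = V n" using subspace_dim_equal[OF sV sV VV n] by (simp only: VS(1))
 obtain g where g: "range g \<subseteq> V n" "linear g" "\<And>v. v \<in> V n ==> Z (g v) = v"
  using linear_exists_right_inverse_on[OF lin(3) sV, of n] unfolding ZV by blast
 obtain c where c: "c > 0" "\<And>v. norm (g v) \<le> c * norm v" using linear_bounded_pos[OF g(2)] by blast
 have "v = 0" if v: "v \<in> V n" for v
 proof (rule ccontr)
  assume "v \<noteq> 0"
  have gm: "(g ^^ m) v \<in> V n" for m using v g(1) by (cases m) auto
  have Zg: "(Z ^^ m) ((g ^^ m) v) = v" for m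
  proof (induction m)
   case (Suc m)
   then show ?case using funpow_swap1[of Z m "g ((g ^^ m) v)"] by (simp add: g(3)[OF gm])
  qed simp
  have le: "fact m \<le> (2 * K * k * c) ^ m" for m
  proof -
   have "fact m * norm v \<le> (2 * K * k) ^ m * norm ((g ^^ m) v)"
    using Zn[of "(g ^^ m) v" m] gm[of m] VU[of n] Zg[of m] by auto
   also have "\<dots> \<le> (2 * K * k) ^ m * (c ^ m * norm v)"
    using K(1) k(1) by (intro mult_left_mono pow[OF c]) auto
   finally show ?thesis using \<open>v \<noteq> 0\<close> by (simp add: power_mult_distrib)
  qed
  have "(\<lambda>m. inverse (fact m) * (2 * K * k * c) ^ m) \<longlonglongrightarrow> 0" by (rule summable_LIMSEQ_zero[OF summable_exp])
  moreover have "1 \<le> inverse (fact m) * (2 * K * k * c) ^ m" for m using le[of m] by (simp add: field_simps)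
  ultimately have "(1::real) \<le> 0" by (intro LIMSEQ_le_const) auto
  then show False by simp
 qed
 then show ?thesis by (auto simp: V_def)
qed

text \<open>In a nonzero invariant subspace of least dimension the kernel of each \<open>z\<close>
  is nonzero by nilpotency and invariant by commutativity, hence everything.\<close>

lemma common_kernel:
 fixes \<Z> :: "('a::euclidean_space => 'a) set"
 assumes lin: "\<And>z. z \<in> \<Z> ==> linear z"
  and U: "subspace U" "U \<noteq> {0}" "\<And>z u. z \<in> \<Z> ==> u \<in> U ==> z u \<in> U"
  and comm: "\<And>z z' u. z \<in> \<Z> ==> z' \<in> \<Z> ==> u \<in> U ==> z (z' u) = z' (z u)"
  and nil: "\<And>z. z \<in> \<Z> ==> \<exists>n. \<forall>u\<in>U. (z ^^ n) u = 0"
 shows "\<exists>u\<in>U. u \<noteq> 0 \<and> (\<forall>z\<in>\<Z>. z u = 0)"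
proof -
 define P where "P = (\<lambda>U'. subspace U' \<and> U' \<noteq> {0} \<and> U' \<subseteq> U \<and> (\<forall>z\<in>\<Z>. \<forall>u\<in>U'. z u \<in> U'))"
 have "P U" using U by (auto simp: P_def)
 then obtain U' where U': "P U'" and min: "\<And>V. P V ==> dim U' \<le> dim V"
  using ex_has_least_nat[of P U dim] by auto
 have "z u = 0" if z: "z \<in> \<Z>" and u: "u \<in> U'" for z u
 proof -
  define V where "V = {u \<in> U'. z u = 0}"
  have sV: "subspace V"
  proof -
   have "V = U' \<inter> {u. z u = 0}" by (auto simp: V_def)
   then show ?thesis using U' linear_subspace_kernel[OF lin[OF z]] by (auto simp: P_def intro: subspace_inter)
  qed
  obtain w where w: "w \<in> U'" "w \<noteq> 0" using U' subspace_0 by (auto simp: P_def)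
  obtain n where n: "(z ^^ n) w = 0" using nil[OF z] w U' by (auto simp: P_def)
  define m where "m = (LEAST n. (z ^^ n) w = 0)"
  have m: "(z ^^ m) w = 0" unfolding m_def by (rule LeastI[of "\<lambda>n. (z ^^ n) w = 0", OF n])
  have "m \<noteq> 0" using m w by (metis funpow_0)
  then obtain k where k: "m = Suc k" using not0_implies_Suc by blast
  have "(z ^^ k) w \<noteq> 0" using not_less_Least[of k "\<lambda>n. (z ^^ n) w = 0"] k m_def by auto
  moreover have "(z ^^ j) w \<in> U'" for j using U' z w by (induction j) (auto simp: P_def)
  ultimately have ne: "V \<noteq> {0}" using m k unfolding V_def by fastforce
  have "P V"
   unfolding P_def
  proof (intro conjI ballI)
   fix z' v assume "z' \<in> \<Z>" "v \<in> V"
   then show "z' v \<in> V" using U' comm[OF z \<open>z' \<in> \<Z>\<close>, of v] linear_0[OF lin[OF \<open>z' \<in> \<Z>\<close>]]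
    by (auto simp: V_def P_def)
  qed (use sV ne U' in \<open>auto simp: V_def P_def\<close>)
  then have "dim U' \<le> dim V" by (rule min)
  then have "V = U'"
   using sV U' by (intro subspace_dim_equal) (auto simp: V_def P_def)
  then show ?thesis using u by (auto simp: V_def)
 qed
 moreover obtain w where "w \<in> U'" "w \<noteq> 0" using U' subspace_0 by (auto simp: P_def)
 ultimately show ?thesis using U' by (auto simp: P_def)
qed

subsection \<open>Solvable Lie algebras and traces\<close>

locale lie_algebra_on =
 fixes br :: "'a::euclidean_space => 'a => 'a"
 assumes br_bilinear: "bilinear br"
  and br_antisym: "br x y = - br y x"
  and br_jacobi: "br x (br y z) = br (br x y) z + br y (br x z)"
begin

lemma linear_br: "linear (br x)" "linear (\<lambda>x. br x y)"
 using br_bilinear by (auto simp: bilinear_def)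

lemmas br_simps = linear_0[OF linear_br(1)] linear_0[OF linear_br(2)]
 linear_add[OF linear_br(1)] linear_add[OF linear_br(2)]
 linear_diff[OF linear_br(1)] linear_diff[OF linear_br(2)]
 linear_neg[OF linear_br(1)] linear_neg[OF linear_br(2)]
 linear_cmul[OF linear_br(1)] linear_cmul[OF linear_br(2)]

lemma br_self: "br x x = 0"
 using br_antisym[of x x] by (simp add: eq_neg_iff_add_eq_0 flip: scaleR_2)

primrec der :: "nat => 'a set" where
 "der 0 = UNIV"
| "der (Suc n) = span {br x y | x y. x \<in> der n \<and> y \<in> der n}"

lemma br_in_der: "x \<in> der n ==> y \<in> der n ==> br x y \<in> der (Suc n)"
 by (auto intro: span_base)

lemma der_ideal: "x \<in> der n ==> br g x \<in> der n"
proof (induction n arbitrary: g x)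
 case (Suc n)
 from Suc.prems have "x \<in> span {br x y | x y. x \<in> der n \<and> y \<in> der n}" by simp
 then show ?case
 proof (induction rule: span_induct_alt)
  case base
  then show ?case by (simp add: br_simps span_0)
 next
  case (step c x y)
  then obtain a b where ab: "x = br a b" "a \<in> der n" "b \<in> der n" by auto
  have "br g x \<in> der (Suc n)"
   unfolding ab(1) br_jacobi[of g] der.simps
   by (intro span_add span_base) (use ab Suc.IH in blast)+
  then show ?case using step by (simp add: br_simps span_add span_scale)
 qed
qed simp

lemma der_1: "der (Suc 0) = span {br x y | x y. True}"
 by simp

text \<open>This takes the place of Lie's theorem. \<open>Q k\<close> says that the
  \<open>k\<close>-th derived algebra kills some nonzero submodule; it is clear for
  \<open>k = N\<close> and is pushed down to \<open>k = 1\<close>, the submodule shrinking twice in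
  each step.\<close>

lemma solvable_module_null_submodule:
 fixes \<rho> :: "'a => 'b::euclidean_space => 'b"
 assumes lin: "\<And>x. linear (\<rho> x)" "\<And>v. linear (\<lambda>x. \<rho> x v)"
  and V: "subspace V" "V \<noteq> {0}" "\<And>x v. v \<in> V ==> \<rho> x v \<in> V"
  and rep: "\<And>x y v. v \<in> V ==> \<rho> (br x y) v = \<rho> x (\<rho> y v) - \<rho> y (\<rho> x v)"
  and solv: "der N = {0}"
 shows "\<exists>U. subspace U \<and> U \<noteq> {0} \<and> U \<subseteq> V \<and> (\<forall>x. \<forall>u\<in>U. \<rho> x u \<in> U) \<and>
   (\<forall>z\<in>der (Suc 0). \<forall>u\<in>U. \<rho> z u = 0)"
proof -
 define Q where "Q = (\<lambda>k. \<exists>U. subspace U \<and> U \<noteq> {0} \<and> U \<subseteq> V \<and> (\<forall>x. \<forall>u\<in>U. \<rho> x u \<in> U) \<and>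
   (\<forall>z\<in>der k. \<forall>u\<in>U. \<rho> z u = 0))"
 have span0: "\<rho> z u = 0" if "z \<in> span S" "\<And>s. s \<in> S ==> \<rho> s u = 0" for z S u
  using that(1)
  by (induction rule: span_induct_alt)
   (auto simp: linear_0[OF lin(2)] linear_add[OF lin(2)] linear_cmul[OF lin(2)] that(2))
 have nullspace: "\<exists>U'. subspace U' \<and> U' \<noteq> {0} \<and> U' \<subseteq> U \<and> (\<forall>x. \<forall>u\<in>U'. \<rho> x u \<in> U') \<and> (\<forall>z\<in>\<Z>. \<forall>u\<in>U'. \<rho> z u = 0)"
  if U: "subspace U" "U \<noteq> {0}" "U \<subseteq> V" "\<And>x u. u \<in> U ==> \<rho> x u \<in> U"
   and ideal: "\<And>x z. z \<in> \<Z> ==> br x z \<in> span \<Z>"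
   and comm: "\<And>z z' u. z \<in> \<Z> ==> z' \<in> \<Z> ==> u \<in> U ==> \<rho> z (\<rho> z' u) = \<rho> z' (\<rho> z u)"
   and nil: "\<And>z. z \<in> \<Z> ==> \<exists>n. \<forall>u\<in>U. (\<rho> z ^^ n) u = 0" for U \<Z>
 proof -
  let ?U' = "{u \<in> U. \<forall>z\<in>\<Z>. \<rho> z u = 0}"
  have "?U' = U \<inter> (\<Inter>z\<in>\<Z>. {u. \<rho> z u = 0})" by auto
  also have "subspace \<dots>" by (intro subspace_inter subspace_Inter U) (auto intro: linear_subspace_kernel lin)
  finally have "subspace ?U'" .
  moreover have "\<exists>u\<in>U. u \<noteq> 0 \<and> (\<forall>f\<in>\<rho> ` \<Z>. f u = 0)"
   by (rule common_kernel) (use lin U comm nil in auto)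
  then have "?U' \<noteq> {0}" by blast
  moreover have "\<rho> x u \<in> ?U'" if u: "u \<in> ?U'" for x u
  proof -
   have "\<rho> z (\<rho> x u) = 0" if z: "z \<in> \<Z>" for z
   proof -
    have "\<rho> (br x z) u = 0" by (rule span0[OF ideal[OF z]]) (use u in auto)
    then show ?thesis using rep[of u x z] u U z by (auto simp: linear_0[OF lin(1)])
   qed
   then show ?thesis using u U by auto
  qed
  ultimately show ?thesis by (intro exI[of _ ?U']) auto
 qed
 have "Q N" using V by (auto simp: Q_def solv linear_0[OF lin(2)] intro!: exI[of _ V])
 moreover have "Q (Suc k)" if Q2: "Q (Suc (Suc k))" for k
 proof -
  let ?b = "der (Suc k)"
  obtain U where U: "subspace U" "U \<noteq> {0}" "U \<subseteq> V" "\<And>x u. u \<in> U ==> \<rho> x u \<in> U"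
   and U0: "\<And>z u. z \<in> der (Suc (Suc k)) ==> u \<in> U ==> \<rho> z u = 0"
   using Q2 unfolding Q_def by blast
  \<comment> \<open>Brackets of elements of \<open>?b\<close> kill \<open>U\<close>, so
    \<open>?b\<close> acts by commuting maps. An element \<open>br x y\<close> with \<open>y\<close>
    in \<open>?b\<close> lies in \<open>?b\<close> again, thus commutes with \<open>y\<close>, and
    is therefore nilpotent.\<close>
  have comm: "\<rho> y (\<rho> y' u) = \<rho> y' (\<rho> y u)" if "y \<in> ?b" "y' \<in> ?b" "u \<in> U" for y y' u
   using rep[of u y y'] U0[OF br_in_der[OF that(1,2)] that(3)] that U by auto
  let ?Z = "{br x y | x y. y \<in> ?b}"
  have Zb: "z \<in> ?b" if "z \<in> ?Z" for z using that der_ideal[of _ "Suc k"] by blast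
  have "\<exists>n. \<forall>u\<in>U. (\<rho> z ^^ n) u = 0" if z: "z \<in> ?Z" for z
  proof -
   obtain x y where xy: "z = br x y" "y \<in> ?b" using z by auto
   show ?thesis
   proof (rule commutator_nilpotent[of "\<rho> x" "\<rho> y"])
    show "\<rho> x (\<rho> y u) - \<rho> y (\<rho> x u) = \<rho> z u" if "u \<in> U" for u using rep[of u x y] xy that U by auto
    show "\<rho> z (\<rho> y u) = \<rho> y (\<rho> z u)" if "u \<in> U" for u by (rule comm[OF Zb[OF z] xy(2) that])
   qed (use lin U in auto)
  qed
  note nilZ = this
  have "\<exists>U'. subspace U' \<and> U' \<noteq> {0} \<and> U' \<subseteq> U \<and> (\<forall>x. \<forall>u\<in>U'. \<rho> x u \<in> U') \<and> (\<forall>z\<in>?Z. \<forall>u\<in>U'. \<rho> z u = 0)"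
  proof (rule nullspace[OF U])
   show "br x z \<in> span ?Z" if "z \<in> ?Z" for x z
    using Zb[OF that] by (intro span_base) blast
   show "\<rho> z (\<rho> z' u) = \<rho> z' (\<rho> z u)" if "z \<in> ?Z" "z' \<in> ?Z" "u \<in> U" for z z' u
    by (rule comm[OF Zb[OF that(1)] Zb[OF that(2)] that(3)])
  qed (assumption, rule nilZ)
  then obtain K where K: "subspace K" "K \<noteq> {0}" "K \<subseteq> U" "\<And>x u. u \<in> K ==> \<rho> x u \<in> K"
   and K0: "\<And>z u. z \<in> ?Z ==> u \<in> K ==> \<rho> z u = 0"
   by blast
  \<comment> \<open>On \<open>K\<close> the brackets of anything with \<open>?b\<close> act as 0, so
    \<open>?b\<close> acts centrally. Each bracket in \<open>?Z2\<close> then acts as a central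
    commutator, hence nilpotently.\<close>
  let ?Z2 = "{br x y | x y. x \<in> der k \<and> y \<in> der k}"
  have central: "\<rho> g (\<rho> z u) = \<rho> z (\<rho> g u)" if "z \<in> ?Z2" "u \<in> K" for g z u
  proof -
   have "z \<in> ?b" using that(1) by (auto intro: span_base)
   then have "\<rho> (br g z) u = 0" using K0 that(2) by blast
   then show ?thesis using rep[of u g z] that(2) K U by auto
  qed
  have nil2: "\<exists>n. \<forall>u\<in>K. (\<rho> z ^^ n) u = 0" if z: "z \<in> ?Z2" for z
  proof -
   obtain x y where xy: "z = br x y" using z by auto
   note com = central[OF z]
   show ?thesis
   proof (rule commutator_nilpotent[of "\<rho> x" "\<rho> y"])
    show "\<rho> x (\<rho> y u) - \<rho> y (\<rho> x u) = \<rho> z u" if "u \<in> K" for u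
     using rep[of u x y] xy that K(3) U(3) by auto
    show "\<rho> z (\<rho> y u) = \<rho> y (\<rho> z u)" if "u \<in> K" for u by (rule com[OF that, symmetric])
   qed (fact lin K(1) K(4))+
  qed
  have "\<exists>U'. subspace U' \<and> U' \<noteq> {0} \<and> U' \<subseteq> K \<and> (\<forall>x. \<forall>u\<in>U'. \<rho> x u \<in> U') \<and> (\<forall>z\<in>?Z2. \<forall>u\<in>U'. \<rho> z u = 0)"
  proof (rule nullspace[OF K(1,2)])
   show "br x z \<in> span ?Z2" if "z \<in> ?Z2" for x z
    using der_ideal[of z "Suc k" x] that by (auto intro: span_base)
   show "K \<subseteq> V" using K(3) U(3) by blast
   show "\<rho> x u \<in> K" if "u \<in> K" for x u by (rule K(4)[OF that])
   show "\<rho> z (\<rho> z' u) = \<rho> z' (\<rho> z u)" if "z' \<in> ?Z2" "u \<in> K" for z z' u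
    by (rule central[OF that])
  qed (rule nil2)
  then obtain U' where U': "subspace U'" "U' \<noteq> {0}" "U' \<subseteq> K" "\<forall>x. \<forall>u\<in>U'. \<rho> x u \<in> U'" "\<forall>z\<in>?Z2. \<forall>u\<in>U'. \<rho> z u = 0"
   by blast
  then have "\<forall>z\<in>?b. \<forall>u\<in>U'. \<rho> z u = 0" using span0[of _ ?Z2] by auto
  with U' K U show ?thesis unfolding Q_def by blast
 qed
 then have "Q (Suc k) ==> Q (Suc 0)" for k by (induction k) auto
 \<comment> \<open>The descent starts at a successor; for \<open>N = 0\<close> the algebra itself is
   zero, and its derived algebra acts as 0 as well.\<close>
 moreover have "N \<noteq> 0 \<or> Q (Suc 0)"
 proof (cases "N = 0")
  case True
  then have "\<forall>z\<in>der (Suc 0). z = 0" using solv by (metis UNIV_I der.simps(1) singletonD)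
  then show ?thesis using \<open>Q N\<close> True solv by (auto simp: Q_def)
 qed simp
 ultimately have "Q (Suc 0)" by (metis not0_implies_Suc)
 then show ?thesis by (simp only: Q_def)
qed

text \<open>The trace is computed on the submodule of the previous lemma, where it vanishes, and by induction on its
 complement, where the module structure is that of the quotient.\<close>

lemma solvable_module_trace_zero:
 fixes \<rho> :: "'a => 'b::euclidean_space => 'b"
 assumes "linear p" "\<And>v. p (p v) = p v" "\<And>x. linear (\<rho> x)" "\<And>v. linear (\<lambda>x. \<rho> x v)"
  "\<And>x v. p (\<rho> x (p v)) = \<rho> x (p v)" "\<And>x y v. \<rho> (br x y) (p v) = \<rho> x (\<rho> y (p v)) - \<rho> y (\<rho> x (p v))"
  and solv: "der N = {0}" and z: "z \<in> der (Suc 0)"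
 shows "tr (\<lambda>u. \<rho> z (\<rho> z (p u))) = 0"
 using assms(1-6)
proof (induction "dim (range p)" arbitrary: p \<rho> rule: less_induct)
 case less
 note lp = less.prems(1) and pp = less.prems(2) and lr = less.prems(3,4) and pr = less.prems(5) and rep = less.prems(6)
 have mem: "p v = v" if "v \<in> range p" for v using that pp by auto
 have rp: "\<rho> x v \<in> range p" if "v \<in> range p" for x v using pr[of x v] mem[OF that] by (metis rangeI)
 have sp: "subspace (range p)" by (rule linear_subspace_image[OF lp subspace_UNIV])
 show ?case
 proof (cases "range p = {0}")
  case True
  then have "p u = 0" for u by blast
  then show ?thesis by (simp add: tr_def linear_0[OF lr(1)])
 next
  case False
  have "\<rho> (br x y) v = \<rho> x (\<rho> y v) - \<rho> y (\<rho> x v)" if "v \<in> range p" for x y v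
   using rep[of x y v] by (simp only: mem[OF that])
  from solvable_module_null_submodule[OF lr sp False rp this solv]
  obtain U where U: "subspace U" "U \<noteq> {0}" "U \<subseteq> range p" "\<And>x u. u \<in> U ==> \<rho> x u \<in> U"
   "\<And>z u. z \<in> der (Suc 0) ==> u \<in> U ==> \<rho> z u = 0" by blast
  obtain P where "orth_proj U P" using orth_proj_exists[OF U(1)] by metis
  then have lP: "linear P" and P: "P x \<in> U" "x \<in> U ==> P x = x" for x by (auto simp: orth_proj_def)
  define q where "q u = p u - P (p u)" for u
  have lq: "linear q" unfolding q_def using linear_compose_sub[OF lp linear_compose[OF lp lP]] by (simp add: o_def)
  have q: "q v = v - P v" if "v \<in> range p" for v using mem[OF that] by (simp add: q_def)
  have qU: "q u = 0" if "u \<in> U" for u using q[of u] P(2)[OF that] U(3) that by auto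
  have qp: "q u \<in> range p" for u
   unfolding q_def by (rule subspace_diff[OF sp rangeI]) (use U(3) P(1) in blast)
  have "q (p u) = q u" for u by (simp add: q_def pp)
  then have qq: "q (q u) = q u" for u
   using linear_diff[OF lq, of "p u" "P (p u)"] qU[OF P(1), of "p u"] by (simp flip: q_def)
  \<comment> \<open>\<open>q\<close> kills the invariant subspace \<open>U\<close>, so the
    compressed maps compose like maps on the quotient module.\<close>
  have qrq: "q (\<rho> x (q v)) = q (\<rho> x v)" if "v \<in> range p" for x v
   by (simp add: q[OF that] linear_diff[OF lr(1)] linear_diff[OF lq] qU[OF U(4)[OF P(1)]])
  have "tr (\<lambda>u. q (\<rho> z (q (\<rho> z (q u))))) = 0"
  proof (rule less.hyps[of q "\<lambda>x v. q (\<rho> x v)"])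
   obtain u where u: "u \<in> U" "u \<noteq> 0" using U(1,2) subspace_0 by blast
   have "u \<notin> range q" using qU[OF u(1)] u(2) qq by (metis rangeE)
   then have "range q \<subset> range p" using qp u(1) U(3) by blast
   moreover have "subspace (range q)" by (rule linear_subspace_image[OF lq subspace_UNIV])
   ultimately show "dim (range q) < dim (range p)" using sp by (intro dim_psubset) (simp add: span_eq_iff[THEN iffD2])
   show "linear (\<lambda>v. q (\<rho> x v))" for x using linear_compose[OF lr(1) lq] by (simp add: o_def)
   show "linear (\<lambda>x. q (\<rho> x v))" for v using linear_compose[OF lr(2) lq] by (simp add: o_def)
   show "q (\<rho> (br x y) (q v)) = q (\<rho> x (q (\<rho> y (q v)))) - q (\<rho> y (q (\<rho> x (q v))))" for x y v
    using rep[of x y "q v"] by (simp add: mem[OF qp] qrq[OF rp[OF qp]] linear_diff[OF lq])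
  qed (rule lq qq)+
  also have "(\<lambda>u. q (\<rho> z (q (\<rho> z (q u))))) = (\<lambda>u. q (\<rho> z (\<rho> z (q u))))" by (simp only: qrq[OF rp[OF qp]])
  also have "tr \<dots> = tr (\<lambda>u. \<rho> z (\<rho> z (q (q u))))"
   using tr_commute[OF lq linear_compose[OF lq linear_compose[OF lr(1)[of z] lr(1)[of z]]]] by (simp add: o_def)
  \<comment> \<open>\<open>q u\<close> and \<open>p u\<close> differ by an element of
    \<open>U\<close>, which \<open>\<rho> z\<close> kills because \<open>z\<close> is in the derived
    algebra; passing to the complement loses no trace.\<close>
  also have "(\<lambda>u. \<rho> z (\<rho> z (q (q u)))) = (\<lambda>u. \<rho> z (\<rho> z (p u)))"
   unfolding qq by (simp add: q_def linear_diff[OF lr(1)] U(5)[OF z P(1)])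
  finally show ?thesis .
 qed
qed

text \<open>One half of Cartan's criterion, on the diagonal of the trace form, from the adjoint
  representation.\<close>

lemma derived_trace_zero:
 assumes "der N = {0}" and "z \<in> der (Suc 0)"
 shows "tr (\<lambda>u. br z (br z u)) = 0"
proof (rule solvable_module_trace_zero[where p="\<lambda>u. u" and \<rho>=br, OF linear_ident refl linear_br refl _ assms])
 show "br (br x y) v = br x (br y v) - br y (br x v)" for x y v using br_jacobi[of x y v] by simp
qed

end

section \<open>Complete left-symmetric products from Sasakian and Vaisman structures\<close>

text \<open>A left-symmetric (pre-Lie) algebra: the second condition is vanishing torsion, the third
  vanishing curvature of the left invariant connection \<open>star\<close>. The last one extends
  every solution of the velocity equation to a bounded one; the bound later yields uniform time
  steps when the velocity is integrated to a curve.\<close>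

definition complete_lsa :: "('a::euclidean_space => 'a => 'a) => ('a => 'a => 'a) => bool" where
 "complete_lsa br star \<longleftrightarrow>
   bilinear star \<and> (\<forall>x y. star x y - star y x = br x y) \<and>
   (\<forall>x y z. star x (star y z) - star y (star x z) = star (br x y) z) \<and>
   (\<forall>I v t0. open I \<and> is_interval I \<and> t0 \<in> I \<and>
    (\<forall>t\<in>I. (v has_vector_derivative - star (v t) (v t)) (at t)) \<longrightarrow>
    (\<exists>w. (\<forall>t::real. (w has_vector_derivative - star (w t) (w t)) (at t)) \<and> bounded (range w) \<and>
       (\<forall>t\<in>I. w t = v t)))"

text \<open>
 The common axioms. A Sasakian structure has \<open>A = 0\<close>; for a Vaisman structure \<open>A\<close> is the unit Lee
 vector, \<open>\<xi> = J A\<close>, and \<open>\<phi>\<close> agrees with \<open>J\<close> on the complement of \<open>A\<close> and \<open>\<xi>\<close> and vanishes on them.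
 The transverse Kaehler Lie algebra is the image of \<open>\<phi>\<close>.
\<close>

locale transverse_kaehler = lie_algebra_on br for br :: "'a::euclidean_space => 'a => 'a" +
 fixes \<phi> :: "'a => 'a" and \<xi> A :: 'a
 assumes lin_phi: "linear \<phi>"
  and phi_skew: "\<phi> x \<bullet> y = - (x \<bullet> \<phi> y)"
  and phi_phi: "\<phi> (\<phi> x) = - x + (\<xi> \<bullet> x) *\<^sub>R \<xi> + (A \<bullet> x) *\<^sub>R A"
  and phi_xi: "\<phi> \<xi> = 0" and phi_A: "\<phi> A = 0"
  and xi_unit: "\<xi> \<bullet> \<xi> = 1" and xi_A: "\<xi> \<bullet> A = 0"
  and xi_br: "\<xi> \<bullet> br x y = \<phi> x \<bullet> y" and A_br: "A \<bullet> br x y = 0"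
  and integrable: "br (\<phi> x) (\<phi> y) = br x y + \<phi> (br (\<phi> x) y + br x (\<phi> y))"
  and A_phi: "br A (\<phi> x) = \<phi> (br A x)"
  and xi_skew: "br \<xi> x \<bullet> y = - (x \<bullet> br \<xi> y)"
  and unimodular: "tr (br x) = 0"
  and solv_trace: "z \<in> span {br x y | x y. True} ==> tr (\<lambda>u. br z (br z u)) = 0"
begin

section \<open>Trace identities and centrality of \<open>\<xi>\<close>\<close>

lemmas phi_simps = linear_0[OF lin_phi] linear_add[OF lin_phi] linear_diff[OF lin_phi]
 linear_neg[OF lin_phi] linear_cmul[OF lin_phi] linear_sum[OF lin_phi]

lemma phi_phi_inner: "\<phi> x \<bullet> \<phi> y = x \<bullet> y - (\<xi> \<bullet> x) * (\<xi> \<bullet> y) - (A \<bullet> x) * (A \<bullet> y)"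
 by (simp add: phi_skew phi_phi inner_diff_right inner_add_right inner_commute)

lemma xi_phi: "\<xi> \<bullet> \<phi> x = 0" and A_phi_0: "A \<bullet> \<phi> x = 0"
 using phi_skew[of \<xi> x] phi_skew[of A x] by (simp_all add: phi_xi phi_A)

lemma phi_self: "\<phi> x \<bullet> x = 0"
 using phi_skew[of x x] by (simp add: inner_commute)

lemma bilinearI:
 fixes q :: "'a => 'a => 'b::real_vector"
 shows "(\<And>x. linear (q x)) ==> (\<And>y. linear (\<lambda>x. q x y)) ==> bilinear q"
 by (simp add: bilinear_def)

lemmas lin_simps = br_simps phi_simps inner_add_left inner_add_right inner_diff_left inner_diff_right
 algebra_simps

text \<open>\<open>\<phi>\<close> is an isometry on the complement of \<open>\<xi>\<close> and
  \<open>A\<close> and kills both; moving one \<open>\<phi>\<close> to the other slot turns the sum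
  into a trace against \<open>- \<phi> (\<phi> b)\<close>.\<close>

lemma sum_phi_phi:
 fixes q :: "'a => 'a => real"
 assumes q: "bilinear q"
 shows "(\<Sum>b\<in>Basis. q (\<phi> b) (\<phi> b)) = (\<Sum>b\<in>Basis. q b b) - q \<xi> \<xi> - q A A"
proof -
 have l: "linear (q x)" "linear (\<lambda>x. q x y)" for x y using q by (auto simp: bilinear_def)
 have "(\<Sum>b\<in>Basis. q (\<phi> b) (\<phi> b)) = (\<Sum>b\<in>Basis. q (\<phi> (- \<phi> b)) b)"
  by (rule sum_Basis_adjoint[OF q lin_phi]) (simp add: phi_skew)
 also have "\<dots> = (\<Sum>b\<in>Basis. q b b - (\<xi> \<bullet> b) * q \<xi> b - (A \<bullet> b) * q A b)"
  by (simp add: phi_simps phi_phi linear_add[OF l(2)] linear_diff[OF l(2)] linear_cmul[OF l(2)] algebra_simps)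
 also have "\<dots> = (\<Sum>b\<in>Basis. q b b) - q \<xi> \<xi> - q A A"
  by (simp add: sum_subtractf sum_Basis_rank_one[OF q])
 finally show ?thesis .
qed

lemma sum_phi_skew:
 fixes q :: "'a => 'a => real"
 assumes q: "bilinear q"
 shows "(\<Sum>b\<in>Basis. q (\<phi> b) b) = - (\<Sum>b\<in>Basis. q b (\<phi> b))"
proof -
 have l: "linear (\<lambda>x. q x y)" for y using q by (auto simp: bilinear_def)
 have "(\<Sum>b\<in>Basis. q b (\<phi> b)) = (\<Sum>b\<in>Basis. q (- \<phi> b) b)"
  using sum_Basis_adjoint[OF q linear_ident, of \<phi> "\<lambda>x. - \<phi> x"] by (simp add: phi_skew)
 then show ?thesis by (simp add: linear_neg[OF l] sum_negf)
qed

text \<open>The fundamental form \<open>\<phi> x \<bullet> y\<close> is the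
  \<open>\<xi>\<close>-component of the bracket, so its closedness is the
  \<open>\<xi>\<close>-component of the Jacobi identity.\<close>

lemma beta_closed: "\<phi> (br x y) \<bullet> z + \<phi> (br y z) \<bullet> x + \<phi> (br z x) \<bullet> y = 0"
proof -
 have "br (br x y) z + br (br y z) x + br (br z x) y = 0"
  using br_jacobi[of x y z] br_antisym[of "br y z" x] br_antisym[of "br z x" y] br_antisym[of z x]
  by (simp add: br_simps)
 then have "\<xi> \<bullet> (br (br x y) z + br (br y z) x + br (br z x) y) = 0" by simp
 then show ?thesis by (simp add: inner_add_right xi_br)
qed

text \<open>Contract the closedness of the fundamental form with \<open>b\<close> and
  \<open>\<phi> b\<close>: two of the three terms become traces of \<open>br x\<close>, which vanish
  by unimodularity, so the sum has no transverse part. This places \<open>\<xi>\<close> in the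
  derived algebra when \<open>\<phi>\<close> is not 0, and later makes the trace of the Ricci form
  vanish.\<close>

lemma sum_br_phi: "(\<Sum>b\<in>Basis. br b (\<phi> b)) = (\<Sum>b\<in>Basis. \<phi> b \<bullet> \<phi> b) *\<^sub>R \<xi>" (is "?s = ?N *\<^sub>R \<xi>")
proof -
 have "\<phi> ?s \<bullet> x = 0" for x
 proof -
  have bil: "bilinear (\<lambda>u v. br x u \<bullet> v)"
   by (intro bilinearI linearI) (auto simp: lin_simps)
  have trx: "(\<Sum>b\<in>Basis. br x b \<bullet> b) = 0" using unimodular[of x] by (simp add: tr_def)
  have "(\<Sum>b\<in>Basis. \<phi> (br x b) \<bullet> \<phi> b) = (\<Sum>b\<in>Basis. br x b \<bullet> b - (\<xi> \<bullet> b) * (\<phi> x \<bullet> b))"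
   by (simp add: phi_phi_inner xi_br A_br mult.commute)
  also have "\<dots> = - (\<phi> x \<bullet> \<xi>)"
   by (subst inner_sum_Basis[of "\<phi> x" \<xi>]) (simp add: sum_subtractf trx mult.commute)
  finally have 1: "(\<Sum>b\<in>Basis. \<phi> (br x b) \<bullet> \<phi> b) = 0" by (simp add: xi_phi inner_commute)
  have "(\<Sum>b\<in>Basis. br x (\<phi> b) \<bullet> \<phi> b) = - (br x \<xi> \<bullet> \<xi>) - br x A \<bullet> A"
   by (subst sum_phi_phi[OF bil]) (simp add: trx)
  also have "\<dots> = 0" using xi_br[of x \<xi>] A_br[of x A] by (simp add: inner_commute[of _ \<xi>] inner_commute[of _ A] xi_phi)
  finally have 2: "(\<Sum>b\<in>Basis. br x (\<phi> b) \<bullet> \<phi> b) = 0" .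
  have "(\<Sum>b\<in>Basis. \<phi> (br x b) \<bullet> \<phi> b + \<phi> (br b (\<phi> b)) \<bullet> x + \<phi> (br (\<phi> b) x) \<bullet> b) = 0"
   by (simp add: beta_closed)
  moreover have "\<phi> (br (\<phi> b) x) \<bullet> b = br x (\<phi> b) \<bullet> \<phi> b" for b
   by (simp add: phi_skew br_antisym[of _ x])
  ultimately show ?thesis
   using 1 2 by (simp add: sum.distrib phi_simps inner_sum_left)
 qed
 then have "\<phi> ?s = 0" by (metis inner_eq_zero_iff)
 then have "\<phi> (\<phi> ?s) = 0" by (simp add: phi_simps)
 moreover have "\<xi> \<bullet> ?s = ?N" by (simp add: inner_sum_right xi_br)
 moreover have "A \<bullet> ?s = 0" by (simp add: inner_sum_right A_br)
 ultimately show ?thesis using phi_phi[of ?s] by simp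
qed

text \<open>If \<open>\<phi>\<close> vanishes, \<open>br \<xi> x\<close> has neither a transverse
  component nor one along \<open>\<xi>\<close> or \<open>A\<close>. Otherwise the square of the skew
  map \<open>br \<xi>\<close> has trace 0, and this trace is minus the sum of its squared
  entries.\<close>

lemma xi_central: "br \<xi> x = 0"
proof (cases "(\<Sum>b\<in>Basis. \<phi> b \<bullet> \<phi> b) = 0")
 case True
 then have "\<forall>b\<in>Basis. \<phi> b = 0" by (subst (asm) sum_nonneg_eq_0_iff) auto
 then have "\<phi> y = 0" for y by (subst linear_eq_sum_Basis[OF lin_phi]) simp
 then show ?thesis
  using phi_phi[of "br \<xi> x"] xi_br[of \<xi> x] A_br[of \<xi> x] by simp
next
 case False
 let ?N = "\<Sum>b\<in>Basis. \<phi> b \<bullet> \<phi> b"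
 have "\<xi> = (1 / ?N) *\<^sub>R (\<Sum>b\<in>Basis. br b (\<phi> b))" unfolding sum_br_phi using False by simp
 also have "\<dots> \<in> span {br x y | x y. True}" by (intro span_scale span_sum span_base) blast
 finally have "tr (\<lambda>u. br \<xi> (br \<xi> u)) = 0" by (rule solv_trace)
 then have "(\<Sum>b\<in>Basis. br \<xi> b \<bullet> br \<xi> b) = 0"
  unfolding tr_def by (simp only: xi_skew[of "br \<xi> _"] sum_negf neg_equal_0_iff_equal)
 then have "\<forall>b\<in>Basis. br \<xi> b = 0" by (subst (asm) sum_nonneg_eq_0_iff) auto
 then show ?thesis by (subst linear_eq_sum_Basis[OF linear_br(1)]) simp
qed

lemma central_xi: "br x \<xi> = 0"
 using br_antisym[of x \<xi>] xi_central by simp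

text \<open>The transverse scalar curvature vanishes: the Ricci form is the differential of
 \<open>x \<mapsto> tr (\<phi> ad x)\<close>, and its trace is the value of this form at a multiple of the central \<open>\<xi>\<close>.\<close>

lemma scalar_curvature:
 "(\<Sum>y\<in>Basis. \<Sum>z\<in>Basis. \<phi> (br y z) \<bullet> \<phi> (br y z)) + 2 * (\<Sum>x\<in>Basis. tr (\<lambda>u. br x (br x u))) = 0"
proof -
 \<comment> \<open>These are the structure constants of the transverse bracket with one index turned
   by \<open>\<phi>\<close>. In them closedness is a cyclic identity, and both traces of the claim
   become quadratic sums.\<close>
 define c where "c = (\<lambda>x y z. \<phi> x \<bullet> br y z)"
 have c_cyc: "c x y z + c y z x + c z x y = 0" for x y z
  using beta_closed[of x y z] phi_skew[of x "br y z"] phi_skew[of y "br z x"] phi_skew[of z "br x y"]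
  by (simp add: c_def inner_commute)
 have c_anti: "c x y z = - c x z y" for x y z by (simp add: c_def br_antisym[of y z])
 have bil_c: "bilinear (\<lambda>u v. c x y u * c z w v)" "bilinear (\<lambda>u v. (\<phi> x \<bullet> br y u) * (br z w \<bullet> v))" for x y z w
  unfolding c_def by (intro bilinearI linearI; simp add: lin_simps)+
 define Q where "Q = (\<Sum>x\<in>Basis. \<Sum>y\<in>Basis. \<Sum>z\<in>Basis. c x y z * c y z x)"
 define S where "S = (\<Sum>x\<in>Basis. \<Sum>y\<in>Basis. \<Sum>z\<in>Basis. c x y z * c x y z)"
 have cycle: "(\<Sum>x\<in>Basis. \<Sum>y\<in>Basis. \<Sum>z\<in>Basis. f y z x) = (\<Sum>x\<in>Basis. \<Sum>y\<in>Basis. \<Sum>z\<in>Basis. f x y z)"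
  for f :: "'a => 'a => 'a => real"
 proof -
  have "(\<Sum>x\<in>Basis. \<Sum>y\<in>Basis. \<Sum>z\<in>Basis. f y z x) = (\<Sum>y\<in>Basis. \<Sum>x\<in>Basis. \<Sum>z\<in>Basis. f y z x)"
   by (rule sum.swap)
  also have "\<dots> = (\<Sum>y\<in>Basis. \<Sum>z\<in>Basis. \<Sum>x\<in>Basis. f y z x)"
   by (intro sum.cong refl sum.swap)
  finally show ?thesis .
 qed
 have "(\<Sum>x\<in>Basis. \<Sum>y\<in>Basis. \<Sum>z\<in>Basis. c x y z * c z x y) = Q"
  using cycle[of "\<lambda>x y z. c x y z * c z x y"] by (simp add: Q_def mult.commute)
 \<comment> \<open>Multiplying the cyclic identity by \<open>c x y z\<close> and summing relates the
   norm \<open>S\<close> to the cyclic product \<open>Q\<close>; the two mixed products have equal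
   sums after renaming.\<close>
 moreover have "(\<Sum>x\<in>Basis. \<Sum>y\<in>Basis. \<Sum>z\<in>Basis. c x y z * (c x y z + c y z x + c z x y)) = 0"
  by (simp add: c_cyc)
 ultimately have SQ: "S + 2 * Q = 0"
  by (simp add: S_def Q_def distrib_left sum.distrib)
 have "(\<Sum>y\<in>Basis. \<Sum>z\<in>Basis. \<phi> (br y z) \<bullet> \<phi> (br y z)) = (\<Sum>y\<in>Basis. \<Sum>z\<in>Basis. \<Sum>x\<in>Basis. c x y z * c x y z)"
  by (subst inner_sum_Basis) (simp add: c_def phi_skew inner_commute)
 also have "\<dots> = S" unfolding S_def using cycle[of "\<lambda>y z x. c x y z * c x y z"] by simp
 finally have S: "(\<Sum>y\<in>Basis. \<Sum>z\<in>Basis. \<phi> (br y z) \<bullet> \<phi> (br y z)) = S" .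
 \<comment> \<open>Expand \<open>br (br x (\<phi> x))\<close> as a commutator. Cyclicity of the
   trace leaves the failure of \<open>br (\<phi> x)\<close> to commute with \<open>\<phi>\<close>,
   which integrability expresses through \<open>br x\<close> alone.\<close>
 have kappa: "tr (\<lambda>y. \<phi> (br (br x (\<phi> x)) y)) = tr (\<lambda>y. br x (br x y)) + tr (\<lambda>y. br x (\<phi> (br x (\<phi> y))))" for x
 proof -
  let ?P = "br x" and ?Q = "br (\<phi> x)"
  have "br (br x (\<phi> x)) y = ?P (?Q y) - ?Q (?P y)" for y using br_jacobi[of x "\<phi> x" y] by simp
  then have "tr (\<lambda>y. \<phi> (br (br x (\<phi> x)) y)) = tr (\<lambda>y. \<phi> (?P (?Q y))) - tr (\<lambda>y. \<phi> (?Q (?P y)))"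
   by (simp add: tr_def phi_simps inner_diff_left sum_subtractf)
  also have "tr (\<lambda>y. \<phi> (?P (?Q y))) = tr (\<lambda>y. ?P (?Q (\<phi> y)))"
   using tr_commute[OF lin_phi linear_compose[OF linear_br(1)[of "\<phi> x"] linear_br(1)[of x]]] by (simp add: o_def)
  also have "tr (\<lambda>y. \<phi> (?Q (?P y))) = tr (\<lambda>y. ?P (\<phi> (?Q y)))"
   using tr_commute[OF linear_compose[OF linear_br(1)[of "\<phi> x"] lin_phi] linear_br(1)[of x]] by (simp add: o_def)
  also have "tr (\<lambda>y. ?P (?Q (\<phi> y))) - tr (\<lambda>y. ?P (\<phi> (?Q y))) = tr (\<lambda>y. ?P (?Q (\<phi> y) - \<phi> (?Q y)))"
   by (simp add: tr_def lin_simps sum_subtractf)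
  also have "\<dots> = tr (\<lambda>y. ?P (?P y + \<phi> (?P (\<phi> y))))"
   using integrable[of x] by (simp add: phi_simps)
  finally show ?thesis by (simp add: tr_def lin_simps sum.distrib)
 qed
 have "(\<Sum>x\<in>Basis. tr (\<lambda>y. \<phi> (br (br x (\<phi> x)) y))) = tr (\<lambda>y. \<phi> (br (\<Sum>x\<in>Basis. br x (\<phi> x)) y))"
  unfolding tr_def by (subst sum.swap) (simp add: linear_sum[OF linear_br(2)] phi_simps inner_sum_left)
 also have "\<dots> = 0" by (simp add: sum_br_phi br_simps xi_central phi_simps tr_def)
 finally have kappa0: "(\<Sum>x\<in>Basis. tr (\<lambda>y. \<phi> (br (br x (\<phi> x)) y))) = 0" .
 \<comment> \<open>The remaining trace is written in structure constants; skewness of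
   \<open>\<phi>\<close> and of the bracket brings its sum to \<open>- Q\<close>.\<close>
 have "br x (\<phi> (br x (\<phi> y))) \<bullet> y = - (\<Sum>w\<in>Basis. (\<phi> w \<bullet> br x (\<phi> y)) * (br x w \<bullet> y))" for x y
  by (subst linear_eq_sum_Basis[OF linear_br(1)], simp add: phi_skew inner_sum_left sum_negf)
   (simp add: phi_skew inner_commute sum_negf)
 then have "(\<Sum>x\<in>Basis. tr (\<lambda>y. br x (\<phi> (br x (\<phi> y)))))
   = - (\<Sum>x\<in>Basis. \<Sum>y\<in>Basis. \<Sum>w\<in>Basis. (\<phi> w \<bullet> br x (\<phi> y)) * (br x w \<bullet> y))"
  by (simp add: tr_def sum_negf)
 also have "\<dots> = - (\<Sum>x\<in>Basis. \<Sum>w\<in>Basis. \<Sum>y\<in>Basis. (\<phi> w \<bullet> br x (\<phi> y)) * (br x w \<bullet> y))"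
  by (intro arg_cong[where f=uminus] sum.cong refl sum.swap)
 also have "\<dots> = (\<Sum>x\<in>Basis. \<Sum>w\<in>Basis. \<Sum>y\<in>Basis. c w x y * c y x w)"
  using sum_phi_skew[OF bil_c(2)] by (simp add: sum_negf c_def inner_commute)
 also have "\<dots> = - (\<Sum>x\<in>Basis. \<Sum>w\<in>Basis. \<Sum>y\<in>Basis. c w x y * c y w x)"
 proof -
  have "c w x y * c y x w = - (c w x y * c y w x)" for x y w using c_anti[of y x w] by simp
  then show ?thesis by (simp only: sum_negf)
 qed
 also have "(\<Sum>x\<in>Basis. \<Sum>w\<in>Basis. \<Sum>y\<in>Basis. c w x y * c y w x)
   = (\<Sum>w\<in>Basis. \<Sum>x\<in>Basis. \<Sum>y\<in>Basis. c w x y * c y w x)" by (rule sum.swap)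
 also have "\<dots> = Q" by fact
 finally have "(\<Sum>x\<in>Basis. tr (\<lambda>y. br x (\<phi> (br x (\<phi> y))))) = - Q" .
 then have "(\<Sum>x\<in>Basis. tr (\<lambda>y. br x (br x y))) = Q"
  using kappa0 by (simp add: kappa sum.distrib)
 then show ?thesis using SQ S by simp
qed

section \<open>The bracket modulo the central vector \<open>\<xi>\<close>, realised on the
  complement of \<open>\<xi>\<close>\<close>

definition br' :: "'a => 'a => 'a" where
 "br' x y = br x y - (\<phi> x \<bullet> y) *\<^sub>R \<xi>"

lemma linear_br': "linear (br' x)" "linear (\<lambda>x. br' x y)"
 unfolding br'_def by (intro linearI; simp add: lin_simps)+

lemmas br'_simps = linear_0[OF linear_br'(1)] linear_0[OF linear_br'(2)]
 linear_add[OF linear_br'(1)] linear_add[OF linear_br'(2)]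
 linear_diff[OF linear_br'(1)] linear_diff[OF linear_br'(2)]
 linear_neg[OF linear_br'(1)] linear_neg[OF linear_br'(2)]
 linear_cmul[OF linear_br'(1)] linear_cmul[OF linear_br'(2)]

lemma br'_antisym: "br' x y = - br' y x"
 using br_antisym[of x y] phi_skew[of x y] by (simp add: br'_def inner_commute)

lemma xi_br': "\<xi> \<bullet> br' x y = 0" and A_br': "A \<bullet> br' x y = 0"
 by (simp_all add: br'_def inner_diff_right xi_br xi_unit A_br inner_commute[of A \<xi>] xi_A)

lemma br'_xi: "br' \<xi> x = 0" "br' x \<xi> = 0"
 using br'_antisym[of x \<xi>] by (simp_all add: br'_def xi_central phi_xi)

lemma phi_br': "\<phi> (br' x y) = \<phi> (br x y)"
 by (simp add: br'_def phi_simps phi_xi)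

lemma br'_br': "br' x (br' y z) = br' x (br y z)" "br' (br' x y) z = br' (br x y) z"
 by (simp_all add: br'_def[of y z] br'_def[of x y] br'_simps br'_xi)

text \<open>Modulo \<open>\<xi>\<close> this is the Jacobi identity of \<open>br\<close>, so the
  defect is a multiple of \<open>\<xi>\<close>; yet all values of \<open>br'\<close> are orthogonal
  to \<open>\<xi>\<close>.\<close>

lemma br'_jacobi: "br' x (br' y z) = br' (br' x y) z + br' y (br' x z)"
proof -
 let ?d = "br' x (br' y z) - (br' (br' x y) z + br' y (br' x z))"
 let ?c = "\<phi> x \<bullet> br y z - (\<phi> (br x y) \<bullet> z + \<phi> y \<bullet> br x z)"
 have "?d = - (?c *\<^sub>R \<xi>)"
  unfolding br'_br' using br_jacobi[of x y z] by (simp add: br'_def algebra_simps)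
 moreover have "\<xi> \<bullet> ?d = 0" by (simp add: inner_diff_right inner_add_right xi_br')
 ultimately have "?d = 0" by (simp add: xi_unit)
 then show ?thesis by simp
qed

lemma br'_inner: "br' x y \<bullet> br' x' y' = \<phi> (br x y) \<bullet> \<phi> (br x' y')"
 by (simp flip: phi_br' add: phi_phi_inner xi_br' A_br')

definition n0 :: "'a set" where "n0 = span {br' x y | x y. True}"

lemma br'_in_n0: "br' x y \<in> n0"
 unfolding n0_def by (rule span_base) auto

lemma subspace_n0: "subspace n0"
 by (simp add: n0_def)

lemma n0_orth: assumes "x \<in> n0" shows "\<xi> \<bullet> x = 0" "A \<bullet> x = 0"
 using assms unfolding n0_def
 by (induction rule: span_induct_alt) (auto simp: inner_add_right xi_br' A_br')

text \<open>The trace hypothesis speaks about brackets of \<open>br\<close>. A multiple of the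
  central \<open>\<xi>\<close> does not change the adjoint action, which carries the hypothesis over
  to \<open>n0\<close>.\<close>

lemma n0_derived:
 assumes "x \<in> n0" obtains c where "x + c *\<^sub>R \<xi> \<in> span {br x y | x y. True}"
proof -
 have "\<exists>c. x + c *\<^sub>R \<xi> \<in> span {br x y | x y. True}"
  using assms unfolding n0_def
 proof (induction rule: span_induct_alt)
  case base
  have "0 + 0 *\<^sub>R \<xi> \<in> span {br x y | x y. True}" by (simp add: span_0)
  then show ?case by blast
 next
  case (step k u v)
  then obtain x y c where u: "u = br' x y" and c: "v + c *\<^sub>R \<xi> \<in> span {br x y | x y. True}" by auto
  have "k *\<^sub>R br x y + (v + c *\<^sub>R \<xi>) \<in> span {br x y | x y. True}"
   by (intro span_add span_scale c span_base) auto
  moreover have "k *\<^sub>R br x y + (v + c *\<^sub>R \<xi>) = k *\<^sub>R u + v + (c + k * (\<phi> x \<bullet> y)) *\<^sub>R \<xi>"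
   by (simp add: u br'_def algebra_simps)
  ultimately show ?case by metis
 qed
 then show ?thesis using that by blast
qed

definition pn :: "'a => 'a" where "pn = (SOME p. orth_proj n0 p)"

lemma pn: "linear pn" "pn x \<in> n0" "x \<in> n0 ==> pn x = x" "pn x \<bullet> y = x \<bullet> pn y"
proof -
 have "orth_proj n0 pn"
  unfolding pn_def using orth_proj_exists[OF subspace_n0] by (metis someI)
 then show "linear pn" "pn x \<in> n0" "x \<in> n0 ==> pn x = x" "pn x \<bullet> y = x \<bullet> pn y"
  by (auto simp: orth_proj_def)
qed

text \<open>Projection to the complement of \<open>n0\<close> and \<open>\<xi>\<close>, the part
  that turns out to be abelian and to act by skew maps. The Lee vector \<open>A\<close> belongs to
  it.\<close>

definition pa :: "'a => 'a" where "pa x = x - pn x - (\<xi> \<bullet> x) *\<^sub>R \<xi>"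

lemma linear_pa: "linear pa"
 unfolding pa_def by (intro linearI) (simp_all add: linear_add[OF pn(1)] linear_cmul[OF pn(1)] algebra_simps inner_add_right)

lemma pn_xi: "pn \<xi> = 0"
proof -
 have "pn \<xi> \<bullet> y = 0" for y by (simp add: pn(4) n0_orth[OF pn(2)])
 then show ?thesis by (metis inner_eq_zero_iff)
qed

lemma pn_A: "pn A = 0"
proof -
 have "pn A \<bullet> y = 0" for y by (simp add: pn(4) n0_orth[OF pn(2)])
 then show ?thesis by (metis inner_eq_zero_iff)
qed

lemma pa_xi: "pa \<xi> = 0" and pa_A: "pa A = A" and pa_n0: "x \<in> n0 ==> pa x = 0" and pa_pn: "pa (pn x) = 0"
 by (simp_all add: pa_def pn_xi pn_A xi_unit xi_A pn n0_orth)

lemma pn_pn: "pn (pn x) = pn x" by (rule pn(3)[OF pn(2)])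

lemma pn_pa: "pn (pa x) = 0"
 by (simp add: pa_def linear_diff[OF pn(1)] linear_cmul[OF pn(1)] pn_pn pn_xi)

lemma pa_sym: "pa x \<bullet> y = x \<bullet> pa y"
 using pn(4)[of x y] by (simp add: pa_def inner_diff_left inner_diff_right inner_commute mult.commute)

lemma pa_br': "pa (br' x y) = 0" "pa (br x y) = 0"
proof -
 show 1: "pa (br' x y) = 0" by (rule pa_n0[OF br'_in_n0])
 have "br x y = br' x y + (\<phi> x \<bullet> y) *\<^sub>R \<xi>" by (simp add: br'_def)
 then show "pa (br x y) = 0" by (simp add: 1 linear_add[OF linear_pa] linear_cmul[OF linear_pa] pa_xi)
qed

lemma pn_br': "pn (br' x y) = br' x y"
 by (rule pn(3)[OF br'_in_n0])

lemma br'_split: "br' x y = br' (pa x) y + br' (pn x) y" "br' x y = br' x (pa y) + br' x (pn y)"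
 by (simp_all add: pa_def br'_simps br'_xi)

end

section \<open>Flatness of the transverse algebra\<close>

context transverse_kaehler begin

text \<open>The mixed sums vanish because the self-adjoint projections \<open>pn\<close> and
  \<open>pa\<close> annihilate each other.\<close>

lemma sum_split:
 fixes q :: "'a => 'a => real"
 assumes q: "bilinear q" and xi: "\<And>x. q \<xi> x = 0" "\<And>x. q x \<xi> = 0"
 shows "(\<Sum>b\<in>Basis. q b b) = (\<Sum>b\<in>Basis. q (pn b) (pn b)) + (\<Sum>b\<in>Basis. q (pa b) (pa b))"
proof -
 have l: "linear (q x)" "linear (\<lambda>x. q x y)" for x y using q by (auto simp: bilinear_def)
 have ex: "q x x = q (pn x) (pn x) + q (pa x) (pa x) + q (pn x) (pa x) + q (pa x) (pn x)" for x
 proof -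
  define u v c where "u = pn x" and "v = pa x" and "c = \<xi> \<bullet> x"
  have e: "x = u + v + c *\<^sub>R \<xi>" by (simp add: pa_def u_def v_def c_def)
  have "q x x = q (u + v + c *\<^sub>R \<xi>) (u + v + c *\<^sub>R \<xi>)" by (rule arg_cong2[OF e e])
  also have "\<dots> = q u u + q v v + q u v + q v u"
   by (simp add: linear_add[OF l(1)] linear_add[OF l(2)] linear_cmul[OF l(1)] linear_cmul[OF l(2)] xi)
  finally show ?thesis by (simp add: u_def v_def)
 qed
 have cross: "(\<Sum>b\<in>Basis. q (pn b) (pa b)) = 0" "(\<Sum>b\<in>Basis. q (pa b) (pn b)) = 0"
  by (subst sum_Basis_adjoint[OF q pn(1) pa_sym], simp add: pn_pa linear_0[OF l(2)])
   (subst sum_Basis_adjoint[OF q linear_pa pn(4)], simp add: pa_pn linear_0[OF l(2)])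
 have "(\<Sum>b\<in>Basis. q b b) = (\<Sum>b\<in>Basis. q (pn b) (pn b) + q (pa b) (pa b) + q (pn b) (pa b) + q (pa b) (pn b))"
  by (rule sum.cong[OF refl]) (rule ex)
 then show ?thesis by (simp add: sum.distrib cross)
qed

text \<open>As \<open>\<xi>\<close> is central, the two compositions differ by a multiple of
  \<open>\<xi>\<close>, and the trace of this difference pairs with
  \<open>br' x \<xi> = 0\<close>.\<close>

lemma trace_br':
 "tr (\<lambda>u. br x (br x u)) = (\<Sum>y\<in>Basis. br' x (br' x y) \<bullet> y)"
proof -
 have "br x (br x u) = br' x (br' x u) + (\<phi> x \<bullet> br' x u) *\<^sub>R \<xi>" for u
  using xi_phi[of x] by (simp add: br'_def br_simps central_xi inner_diff_right inner_commute)
 then have "tr (\<lambda>u. br x (br x u)) = (\<Sum>y\<in>Basis. br' x (br' x y) \<bullet> y) + (\<Sum>y\<in>Basis. (\<xi> \<bullet> y) * (\<phi> x \<bullet> br' x y))"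
  by (simp add: tr_def inner_add_left sum.distrib mult.commute)
 also have "(\<Sum>y\<in>Basis. (\<xi> \<bullet> y) * (\<phi> x \<bullet> br' x y)) = \<phi> x \<bullet> br' x \<xi>"
  by (subst linear_eq_sum_Basis[OF linear_br'(1)[of x], of \<xi>]) (simp add: inner_sum_right)
 finally show ?thesis by (simp add: br'_xi)
qed

text \<open>Milnor's argument: the scalar curvature of a unimodular solvable metric Lie algebra is a sum
 of nonpositive terms, whose vanishing is the structure of a flat metric Lie algebra.\<close>

lemma flat_structure:
 shows n0_abelian: "br' (pn x) (pn y) = 0"
  and a_abelian: "br' (pa x) (pa y) = 0"
  and a_skew: "br' (pa x) y \<bullet> z = - (y \<bullet> br' (pa x) z)"
proof -
 define t where "t = (\<lambda>x x'. \<Sum>y\<in>Basis. br' x (br' x' y) \<bullet> y)"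
 define q where "q = (\<lambda>(f :: 'a => 'a) x x'. \<Sum>y\<in>Basis. br' x (f y) \<bullet> br' x' (f y))"
 have li: "linear (\<lambda>x::'a. x \<bullet> w)" "linear (\<lambda>x::'a. w \<bullet> x)" for w
  by (simp_all add: bounded_linear.linear bounded_linear_inner_left bounded_linear_inner_right)
 have ln: "linear (\<lambda>x. br' x u \<bullet> w)" "linear (\<lambda>x. w \<bullet> br' x u)" "linear (\<lambda>x. w \<bullet> br' u x)"
  "linear (\<lambda>x. br' u x \<bullet> w)" "linear (\<lambda>x. br' w (br' x u) \<bullet> v)" for u v w
  using linear_compose[OF linear_br'(2) li(1)] linear_compose[OF linear_br'(2) li(2)]
   linear_compose[OF linear_br'(1) li(2)] linear_compose[OF linear_br'(1) li(1)]
   linear_compose[OF linear_compose[OF linear_br'(2) linear_br'(1)] li(1)] by (simp_all add: o_def)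
 have bil_t: "bilinear t" unfolding t_def by (intro bilinearI linear_compose_sum ballI ln)
 have bil_q: "bilinear (q f)" for f unfolding q_def by (intro bilinearI linear_compose_sum ballI ln)
 have bil_r: "bilinear (\<lambda>y y'. br' u y \<bullet> br' v y')" for u v by (intro bilinearI ln)
 \<comment> \<open>On \<open>n0\<close> the trace form is that of the derived algebra and vanishes,
   so only the directions of \<open>pa\<close> contribute to the trace term.\<close>
 have tn: "t (pn x) (pn x) = 0" for x
 proof -
  obtain c where "pn x + c *\<^sub>R \<xi> \<in> span {br x y | x y. True}" using n0_derived[OF pn(2)] by metis
  then have "t (pn x + c *\<^sub>R \<xi>) (pn x + c *\<^sub>R \<xi>) = 0" using solv_trace trace_br' by (simp add: t_def)
  then show ?thesis by (simp add: t_def br'_simps br'_xi)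
 qed
 define Snn where "Snn = (\<Sum>x\<in>Basis. \<Sum>y\<in>Basis. br' (pn x) (pn y) \<bullet> br' (pn x) (pn y))"
 define Saa where "Saa = (\<Sum>x\<in>Basis. \<Sum>y\<in>Basis. br' (pa x) (pa y) \<bullet> br' (pa x) (pa y))"
 define San where "San = (\<Sum>x\<in>Basis. \<Sum>y\<in>Basis. br' (pa x) (pn y) \<bullet> br' (pa x) (pn y))"
 define M where "M = (\<lambda>x y. br' (pa x) (pn y))"
 have Sna: "(\<Sum>x\<in>Basis. \<Sum>y\<in>Basis. br' (pn x) (pa y) \<bullet> br' (pn x) (pa y)) = San"
  unfolding San_def by (subst sum.swap) (simp add: br'_antisym[of "pn _" "pa _"])
 have q_split: "q (\<lambda>y. y) u u = q pn u u + q pa u u" for u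
  unfolding q_def by (rule sum_split[OF bil_r]) (simp_all add: br'_xi)
 have "(\<Sum>y\<in>Basis. \<Sum>z\<in>Basis. \<phi> (br y z) \<bullet> \<phi> (br y z)) = (\<Sum>x\<in>Basis. q (\<lambda>y. y) x x)"
  by (simp add: q_def br'_inner)
 also have "\<dots> = (\<Sum>x\<in>Basis. q (\<lambda>y. y) (pn x) (pn x)) + (\<Sum>x\<in>Basis. q (\<lambda>y. y) (pa x) (pa x))"
  by (rule sum_split[OF bil_q]) (simp_all add: q_def br'_xi)
 finally have S: "(\<Sum>y\<in>Basis. \<Sum>z\<in>Basis. \<phi> (br y z) \<bullet> \<phi> (br y z)) = Snn + 2 * San + Saa"
  using Sna unfolding q_split by (simp add: q_def sum.distrib Snn_def San_def Saa_def)
 have "(\<Sum>x\<in>Basis. tr (\<lambda>u. br x (br x u))) = (\<Sum>x\<in>Basis. t x x)"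
  by (simp add: trace_br' t_def)
 also have "\<dots> = (\<Sum>x\<in>Basis. t (pa x) (pa x))"
  by (subst sum_split[OF bil_t]) (simp_all add: tn, simp_all add: t_def br'_xi br'_simps)
 finally have T0: "(\<Sum>x\<in>Basis. tr (\<lambda>u. br x (br x u))) = (\<Sum>x\<in>Basis. t (pa x) (pa x))" .
 have "t (pa x) (pa x) = (\<Sum>y\<in>Basis. M x (M x y) \<bullet> y)" for x
 proof -
  let ?B = "br' (pa x)"
  \<comment> \<open>All values of \<open>br'\<close> lie in \<open>n0\<close>, so the trace may be
    taken on \<open>n0\<close>, where only the part \<open>M x\<close> of the action counts.\<close>
  have "?B (?B y) \<bullet> y = ?B (?B y) \<bullet> pn y" for y using pn(4)[of "?B (?B y)" y] by (simp add: pn_br')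
  then have "t (pa x) (pa x) = tr (\<lambda>y. pn (?B (?B y)))" by (simp add: t_def tr_def pn_br')
  also have "\<dots> = tr (\<lambda>y. ?B (?B (pn y)))"
   using tr_commute[OF pn(1) linear_compose[OF linear_br'(1) linear_br'(1)], of "pa x" "pa x"] by (simp add: o_def)
  finally show ?thesis by (simp add: tr_def M_def pn_br')
 qed
 then have T: "(\<Sum>x\<in>Basis. tr (\<lambda>u. br x (br x u))) = (\<Sum>x\<in>Basis. \<Sum>y\<in>Basis. M x (M x y) \<bullet> y)"
  using T0 by simp
 \<comment> \<open>\<open>R\<close> sums the squared entries of \<open>M x\<close> plus its
   transpose. Expanding the square gives twice the norm of \<open>M\<close> plus twice the trace of
   its square, exactly what the scalar curvature leaves besides \<open>Snn\<close> and
   \<open>Saa\<close>.\<close>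
 define R where "R = (\<Sum>x\<in>Basis. \<Sum>y\<in>Basis. \<Sum>z\<in>Basis. (M x y \<bullet> z + M x z \<bullet> y)\<^sup>2)"
 have lM: "linear (M x)" for x
  unfolding M_def using linear_compose[OF pn(1) linear_br'(1)] by (simp add: o_def)
 have "(\<Sum>y\<in>Basis. \<Sum>z\<in>Basis. (M x y \<bullet> z + M x z \<bullet> y)\<^sup>2)
   = 2 * (\<Sum>y\<in>Basis. M x y \<bullet> M x y) + 2 * (\<Sum>y\<in>Basis. M x (M x y) \<bullet> y)" for x
 proof -
  have a: "(\<Sum>y\<in>Basis. \<Sum>z\<in>Basis. (M x y \<bullet> z) * (M x y \<bullet> z)) = (\<Sum>y\<in>Basis. M x y \<bullet> M x y)"
   by (subst inner_sum_Basis[of "M x _" "M x _"]) simp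
  have b: "(\<Sum>y\<in>Basis. \<Sum>z\<in>Basis. (M x z \<bullet> y) * (M x z \<bullet> y)) = (\<Sum>y\<in>Basis. M x y \<bullet> M x y)"
   by (subst sum.swap) (rule a)
  have "M x (M x y) \<bullet> y = (\<Sum>z\<in>Basis. (M x y \<bullet> z) * (M x z \<bullet> y))" for y
   by (subst linear_eq_sum_Basis[OF lM]) (simp add: inner_sum_left)
  then have c: "(\<Sum>y\<in>Basis. M x (M x y) \<bullet> y) = (\<Sum>y\<in>Basis. \<Sum>z\<in>Basis. (M x y \<bullet> z) * (M x z \<bullet> y))"
   by simp
  have "(M x y \<bullet> z + M x z \<bullet> y)\<^sup>2 = (M x y \<bullet> z) * (M x y \<bullet> z) + (M x z \<bullet> y) * (M x z \<bullet> y)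
    + 2 * ((M x y \<bullet> z) * (M x z \<bullet> y))" for y z
   by (simp add: power2_eq_square algebra_simps)
  then show ?thesis
   unfolding c using a b by (simp only: sum.distrib sum_distrib_left[symmetric])
 qed
 then have "R = 2 * San + 2 * (\<Sum>x\<in>Basis. \<Sum>y\<in>Basis. M x (M x y) \<bullet> y)"
  by (simp add: R_def San_def M_def sum.distrib flip: sum_distrib_left)
 then have tot: "Snn + Saa + R = 0" using scalar_curvature S T by simp
 have nonneg: "Snn \<ge> 0" "Saa \<ge> 0" "R \<ge> 0"
  unfolding Snn_def Saa_def R_def by (intro sum_nonneg; simp)+
 then have z: "Snn = 0" "Saa = 0" "R = 0" using tot by linarith+
 have bl: "f x y = 0" if "bilinear f" "\<And>b c. b \<in> Basis ==> c \<in> Basis ==> f b c = 0"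
  for f :: "'a => 'a => 'b::real_vector" and x y
 proof -
  have l: "linear (f b)" "linear (\<lambda>x. f x y)" for b y using that(1) by (auto simp: bilinear_def)
  have "f b y = 0" if "b \<in> Basis" for b
   by (subst linear_eq_sum_Basis[OF l(1)]) (simp add: \<open>\<And>b c. b \<in> Basis ==> c \<in> Basis ==> f b c = 0\<close> that)
  then show ?thesis by (subst linear_eq_sum_Basis[OF l(2)]) simp
 qed
 have zero: "f b c = 0" if "(\<Sum>x\<in>Basis. \<Sum>y\<in>Basis. f x y \<bullet> f x y) = 0" "b \<in> Basis" "c \<in> Basis" for f :: "'a => 'a => 'a" and b c
  using that by (simp add: sum_nonneg_eq_0_iff sum_nonneg)
 have bil_nn: "bilinear (\<lambda>x y. br' (pn x) (pn y))"
  by (intro bilinearI linearI) (simp_all add: br'_simps linear_add[OF pn(1)] linear_cmul[OF pn(1)])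
 show "br' (pn x) (pn y) = 0"
  by (rule bl[OF bil_nn]) (rule zero[OF z(1)[unfolded Snn_def]])
 have bil_aa: "bilinear (\<lambda>x y. br' (pa x) (pa y))"
  by (intro bilinearI linearI) (simp_all add: br'_simps linear_add[OF linear_pa] linear_cmul[OF linear_pa])
 show aa: "br' (pa x) (pa y) = 0" for x y
  by (rule bl[OF bil_aa]) (rule zero[OF z(2)[unfolded Saa_def]])
 have M0: "M b c \<bullet> d + M b d \<bullet> c = 0" if "b \<in> Basis" "c \<in> Basis" "d \<in> Basis" for b c d
  using z(3) that unfolding R_def by (simp add: sum_nonneg_eq_0_iff sum_nonneg)
 then have "M b c \<bullet> z + M b z \<bullet> c = 0" if "b \<in> Basis" "c \<in> Basis" for b c z
 proof -
  have "linear (\<lambda>z. M b c \<bullet> z + M b z \<bullet> c)"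
   by (intro linearI) (simp_all add: linear_add[OF lM] linear_cmul[OF lM] inner_add_left inner_add_right algebra_simps)
  from linear_eq_sum_Basis[OF this, of z] show ?thesis using that M0 by simp
 qed
 note M1 = this
 have lM2: "linear (\<lambda>x. M x y)" for y
  unfolding M_def using linear_compose[OF linear_pa linear_br'(2)] by (simp add: o_def)
 have bilM: "bilinear (\<lambda>x y. M x y \<bullet> z + M x z \<bullet> y)"
 proof (intro bilinearI)
  show "linear (\<lambda>y. M x y \<bullet> z + M x z \<bullet> y)" for x
   by (intro linearI) (simp_all add: linear_add[OF lM] linear_cmul[OF lM] inner_add_left inner_add_right distrib_left)
  show "linear (\<lambda>x. M x y \<bullet> z + M x z \<bullet> y)" for y
   by (intro linearI) (simp_all add: linear_add[OF lM2] linear_cmul[OF lM2] inner_add_left distrib_left)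
 qed
 have "M x y \<bullet> z + M x z \<bullet> y = 0"
  by (rule bl[OF bilM]) (rule M1)
 moreover have "br' (pa x) u = M x u" for u using br'_split(2)[of "pa x" u] by (simp add: M_def aa)
 ultimately show "br' (pa x) y \<bullet> z = - (y \<bullet> br' (pa x) z)" by (simp add: inner_commute)
qed

end

section \<open>The transverse Levi-Civita connection and the left-symmetric product\<close>

context transverse_kaehler begin

text \<open>For a flat metric Lie algebra the Levi-Civita connection has this shape: the abelian
  complement acts by its skew adjoint maps, and \<open>n0\<close> acts by zero.\<close>

definition nab :: "'a => 'a => 'a" where "nab x y = br' (pa x) y"

lemma linear_nab: "linear (nab x)" "linear (\<lambda>x. nab x y)"
 using linear_br'(1)[of "pa x"] linear_compose[OF linear_pa linear_br'(2), of y]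
 by (simp_all add: nab_def[abs_def] o_def)

lemmas nab_simps = linear_0[OF linear_nab(1)] linear_0[OF linear_nab(2)]
 linear_add[OF linear_nab(1)] linear_add[OF linear_nab(2)]
 linear_diff[OF linear_nab(1)] linear_diff[OF linear_nab(2)]
 linear_neg[OF linear_nab(1)] linear_neg[OF linear_nab(2)]
 linear_cmul[OF linear_nab(1)] linear_cmul[OF linear_nab(2)]

lemma nab_torsion: "nab x y - nab y x = br' x y"
proof -
 have "br' x y = br' (pa x) (pa y) + br' (pa x) (pn y) + (br' (pn x) (pa y) + br' (pn x) (pn y))"
  using br'_split(1)[of x y] br'_split(2)[of "pa x" y] br'_split(2)[of "pn x" y] by simp
 also have "\<dots> = br' (pa x) (pn y) - br' (pa y) (pn x)"
  by (simp add: a_abelian n0_abelian br'_antisym[of "pn x" "pa y"])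
 finally show ?thesis
  using br'_split(2)[of "pa x" y] br'_split(2)[of "pa y" x] by (simp add: nab_def a_abelian)
qed

lemma nab_skew: "nab x y \<bullet> z = - (y \<bullet> nab x z)"
 unfolding nab_def by (rule a_skew)

text \<open>The combination \<open>k\<close> of the closedness of the fundamental form and the integrability, in which
 \<open>h x y z = \<langle>(\<nabla>\<^sub>x \<phi>) y, z\<rangle>\<close>, satisfies \<open>k x y z + k y z x = k z x y\<close> for all arguments, hence vanishes.\<close>

lemma nab_phi: "nab x (\<phi> y) = \<phi> (nab x y)"
proof -
 define h where "h = (\<lambda>x y z. (nab x (\<phi> y) - \<phi> (nab x y)) \<bullet> z)"
 have h_alt: "h x y z = \<phi> (nab x z) \<bullet> y - \<phi> (nab x y) \<bullet> z" for x y z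
  using nab_skew[of x "\<phi> y" z] phi_skew[of y "nab x z"] phi_skew[of "nab x z" y]
  by (simp add: h_def inner_diff_left inner_diff_right inner_commute)
 have h_anti: "h x y z = - h x z y" for x y z by (simp add: h_alt)
 have h_cyc: "h x y z + h y z x + h z x y = 0" for x y z
 proof -
  have "\<phi> (nab x y) \<bullet> z - \<phi> (nab y x) \<bullet> z = \<phi> (br x y) \<bullet> z" for x y z
   using nab_torsion[of x y] by (simp flip: phi_br' add: phi_simps inner_diff_left flip: nab_torsion)
  from this[of x y z] this[of y z x] this[of z x y] beta_closed[of x y z] show ?thesis
   by (simp add: h_alt)
 qed
 have phi2_nab: "\<phi> (\<phi> (nab x y)) = - nab x y" for x y
  by (simp add: phi_phi nab_def xi_br' A_br')
 have h_int: "h (\<phi> x) y z - h (\<phi> y) x z + h x y (\<phi> z) - h y x (\<phi> z) = 0" for x y z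
 proof -
  \<comment> \<open>The \<open>\<xi>\<close>-components removed from the brackets cancel because
    \<open>\<phi>\<close> preserves the inner product on its image, so integrability passes to
    \<open>br'\<close>.\<close>
  have "br' (\<phi> x) (\<phi> y) - br' x y - \<phi> (br' (\<phi> x) y + br' x (\<phi> y)) = (\<phi> x \<bullet> y - \<phi> (\<phi> x) \<bullet> \<phi> y) *\<^sub>R \<xi>"
   using integrable[of x y] by (simp add: br'_def phi_simps phi_xi algebra_simps)
  also have "\<dots> = 0"
   using phi_phi_inner[of "\<phi> x" y] by (simp add: xi_phi A_phi_0)
  finally have "br' (\<phi> x) (\<phi> y) - br' x y - \<phi> (br' (\<phi> x) y) - \<phi> (br' x (\<phi> y)) = 0"
   by (simp add: phi_simps)
  then have "(nab (\<phi> x) (\<phi> y) - \<phi> (nab (\<phi> x) y)) - (nab (\<phi> y) (\<phi> x) - \<phi> (nab (\<phi> y) x))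
    - \<phi> (nab x (\<phi> y) - \<phi> (nab x y)) + \<phi> (nab y (\<phi> x) - \<phi> (nab y x)) = 0"
   by (simp add: phi_simps phi2_nab flip: nab_torsion) (simp add: algebra_simps)
  then have "((nab (\<phi> x) (\<phi> y) - \<phi> (nab (\<phi> x) y)) - (nab (\<phi> y) (\<phi> x) - \<phi> (nab (\<phi> y) x))
    - \<phi> (nab x (\<phi> y) - \<phi> (nab x y)) + \<phi> (nab y (\<phi> x) - \<phi> (nab y x))) \<bullet> z = 0"
   by simp
  then show ?thesis
   by (simp add: h_def inner_diff_left inner_add_left phi_skew)
 qed
 define k where "k = (\<lambda>x y z. h (\<phi> x) y z)"
 have k_cyc: "k x y z + k y z x - k z x y = 0" for x y z
  using h_int[of x y z] h_cyc[of x y "\<phi> z"] h_anti[of y "\<phi> z" x] h_anti[of "\<phi> y" z x] by (simp add: k_def)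
 \<comment> \<open>Adding the relations for \<open>x\<close>, \<open>y\<close>, \<open>z\<close> and
   for \<open>z\<close>, \<open>x\<close>, \<open>y\<close> leaves twice
   \<open>k x y z\<close>.\<close>
 have k0: "k x y z = 0" for x y z
  using k_cyc[of x y z] k_cyc[of z x y] by simp
 \<comment> \<open>\<open>k\<close> only reaches first arguments in the image of
   \<open>\<phi>\<close>. In the direction \<open>A\<close> the assumption \<open>A_phi\<close>
   takes over, and in the direction \<open>\<xi>\<close> the connection is zero.\<close>
 have hA: "h A y z = 0" for y z
 proof -
  have "nab A y = br A y" for y by (simp add: nab_def pa_A br'_def phi_A)
  then show ?thesis by (simp add: h_def A_phi)
 qed
 have hxi: "h \<xi> y z = 0" for y z by (simp add: h_def nab_def pa_xi br'_simps phi_simps)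
 have lh: "linear (\<lambda>x. h x y z)" for y z
  by (intro linearI) (simp_all add: h_def nab_simps phi_simps inner_add_left inner_diff_left algebra_simps)
 have "h x y z = 0" for z
 proof -
  have "x = - \<phi> (\<phi> x) + (\<xi> \<bullet> x) *\<^sub>R \<xi> + (A \<bullet> x) *\<^sub>R A" by (simp add: phi_phi)
  then have "h x y z = h (- \<phi> (\<phi> x) + (\<xi> \<bullet> x) *\<^sub>R \<xi> + (A \<bullet> x) *\<^sub>R A) y z" by simp
  also have "\<dots> = 0"
   using k0[of "\<phi> x" y z] by (simp add: linear_add[OF lh] linear_neg[OF lh] linear_diff[OF lh] linear_cmul[OF lh] hA hxi k_def)
  finally show ?thesis .
 qed
 then have "nab x (\<phi> y) - \<phi> (nab x y) = 0" unfolding h_def by (metis inner_eq_zero_iff)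
 then show ?thesis by simp
qed

text \<open>The correction is alternating, so antisymmetrising doubles it: with the factor 1/2 the
  torsion gains exactly the \<open>\<xi>\<close>-component missing in \<open>br'\<close>, while
  \<open>star x x = nab x x\<close>.\<close>

definition star :: "'a => 'a => 'a" where
 "star x y = nab x y + ((\<phi> x \<bullet> y) / 2) *\<^sub>R \<xi>"

lemma bilinear_star: "bilinear star"
 unfolding star_def
 by (intro bilinearI linearI)
  (simp_all add: nab_simps phi_simps inner_add_left inner_add_right add_divide_distrib scaleR_left_distrib scaleR_right_distrib)

lemma star_torsion: "star x y - star y x = br x y"
 using nab_torsion[of x y] phi_skew[of y x]
 by (simp add: star_def br'_def inner_commute algebra_simps flip: scaleR_left.add)

lemma nab_nab: "nab x (nab y z) = nab y (nab x z)"
 using br'_jacobi[of "pa x" "pa y" z] by (simp add: nab_def a_abelian br'_simps)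

lemma nab_br: "nab (br x y) z = 0"
 by (simp add: nab_def pa_br' br'_simps)

text \<open>The operators \<open>nab x\<close> commute, and \<open>nab (br x y)\<close> is 0, which
  settles the part along \<open>nab\<close>. The \<open>\<xi>\<close>-part is \<open>\<phi> x
  \<bullet> nab y z - \<phi> y \<bullet> nab x z = \<phi> (br x y) \<bullet> z\<close>, a
  consequence of \<open>\<phi>\<close> being parallel.\<close>

lemma star_left_symmetric: "star x (star y z) - star y (star x z) = star (br x y) z"
proof -
 have nxi: "nab x \<xi> = 0" for x by (simp add: nab_def br'_xi)
 have star2: "star x (star y z) = nab x (nab y z) + ((\<phi> x \<bullet> nab y z) / 2) *\<^sub>R \<xi>" for x y
  by (simp add: star_def nab_simps nxi inner_add_right inner_commute[of _ \<xi>] xi_phi)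
 have "\<phi> x \<bullet> nab y z = - (\<phi> (nab y x) \<bullet> z)" for x y
  using nab_skew[of y "\<phi> x" z] by (simp add: nab_phi)
 then have "\<phi> x \<bullet> nab y z - \<phi> y \<bullet> nab x z = \<phi> (br x y) \<bullet> z"
  using nab_torsion[of x y] by (simp flip: phi_br' nab_torsion add: phi_simps inner_diff_left)
 then show ?thesis
  by (simp add: star2 nab_nab star_def[of "br x y"] nab_br flip: scaleR_left.diff diff_divide_distrib)
qed

text \<open>\<open>pa\<close> kills the right-hand side, so \<open>pa (v t)\<close> is a constant
  \<open>a\<close>, and the quadratic equation becomes the linear one with the skew map
  \<open>br' a\<close>, whose solutions keep their norm.\<close>

lemma star_complete:
 assumes I: "open I" "is_interval I" "t0 \<in> I"
  and v: "\<And>t. t \<in> I ==> (v has_vector_derivative - star (v t) (v t)) (at t)"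
 shows "\<exists>w. (\<forall>t::real. (w has_vector_derivative - star (w t) (w t)) (at t)) \<and> bounded (range w) \<and>
       (\<forall>t\<in>I. w t = v t)"
proof -
 have star_self: "star x x = nab x x" for x by (simp add: star_def phi_self)
 have cvx: "convex I" using I(2) is_interval_convex by blast
 have const: "f t = f s" if "convex S" "open S" "t \<in> S" "s \<in> S" "\<And>u. u \<in> S ==> (f has_vector_derivative 0) (at u)"
  for f :: "real => 'b::real_normed_vector" and S s t
  using has_derivative_zero_unique[OF that(1), of f t s] that
  by (simp add: has_vector_derivative_def has_derivative_at_withinI)
 have bpa: "bounded_linear pa" using linear_pa linear_conv_bounded_linear by blast
 define a where "a = pa (v t0)"
 have pav: "pa (v t) = a" if "t \<in> I" for t
  unfolding a_def
 proof (rule const[OF cvx I(1) that I(3)])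
  fix u assume "u \<in> I"
  from bounded_linear.has_vector_derivative[OF bpa v[OF this]]
  show "((\<lambda>t. pa (v t)) has_vector_derivative 0) (at u)"
   by (simp add: star_self nab_def linear_neg[OF linear_pa] pa_br')
 qed
 define L where "L = br' a"
 have L: "linear L" unfolding L_def by (rule linear_br'(1))
 have Lskew: "L x \<bullet> y = - (x \<bullet> L y)" for x y
  unfolding L_def a_def by (rule a_skew)
 have "linear (\<lambda>x. - L x)" by (rule linear_compose_neg[OF L])
 from linear_ode_solution[OF this, of t0 "v t0"]
 obtain w where w0: "w t0 = v t0" and w: "\<And>t. (w has_vector_derivative - L (w t)) (at t)" by blast
 have paw: "pa (w t) = a" for t
  unfolding a_def w0[symmetric]
 proof (rule const[OF convex_UNIV open_UNIV UNIV_I UNIV_I])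
  fix u
  from bounded_linear.has_vector_derivative[OF bpa w[of u]]
  show "((\<lambda>t. pa (w t)) has_vector_derivative 0) (at u)"
   by (simp add: L_def linear_neg[OF linear_pa] pa_br')
 qed
 \<comment> \<open>Used twice: for \<open>w\<close> it gives boundedness, for the difference of two
   solutions uniqueness.\<close>
 have energy: "(d t \<bullet> d t) = d s \<bullet> d s"
  if "convex S" "open S" "t \<in> S" "s \<in> S" "\<And>u. u \<in> S ==> (d has_vector_derivative - L (d u)) (at u)" for d S t s
 proof (rule const[OF that(1-4)])
  fix u assume "u \<in> S"
  have "((\<lambda>t. d t \<bullet> d t) has_vector_derivative (d u \<bullet> - L (d u) + - L (d u) \<bullet> d u)) (at u)"
   by (rule bounded_bilinear.has_vector_derivative[OF bounded_bilinear_inner that(5)[OF \<open>u \<in> S\<close>] that(5)[OF \<open>u \<in> S\<close>]])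
  then show "((\<lambda>t. d t \<bullet> d t) has_vector_derivative 0) (at u)"
   using Lskew[of "d u" "d u"] by (simp add: inner_commute)
 qed
 have "norm (w t) = norm (w t0)" for t
  using energy[OF convex_UNIV open_UNIV UNIV_I UNIV_I w] by (simp add: norm_eq_sqrt_inner)
 then have "bounded (range w)" unfolding bounded_iff by (metis order_refl rangeE)
 moreover have "w t = v t" if t: "t \<in> I" for t
 proof -
  have "(w t - v t) \<bullet> (w t - v t) = (w t0 - v t0) \<bullet> (w t0 - v t0)"
  proof (rule energy[OF cvx I(1) t I(3)])
   fix u assume "u \<in> I"
   have "((\<lambda>t. w t - v t) has_vector_derivative - L (w u) - - star (v u) (v u)) (at u)"
    by (rule has_vector_derivative_diff[OF w v[OF \<open>u \<in> I\<close>]])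
   then show "((\<lambda>t. w t - v t) has_vector_derivative - L (w u - v u)) (at u)"
    by (simp add: star_self nab_def pav[OF \<open>u \<in> I\<close>] linear_diff[OF L] flip: L_def)
  qed
  then show ?thesis using w0 by simp
 qed
 moreover have "(w has_vector_derivative - star (w t) (w t)) (at t)" for t
  using w[of t] by (simp add: star_self nab_def paw L_def)
 ultimately show ?thesis by blast
qed

theorem complete_lsa_star: "complete_lsa br star"
 unfolding complete_lsa_def
 using bilinear_star star_torsion star_left_symmetric star_complete by blast

end

section \<open>Sasakian and Vaisman structures as instances of the transverse axioms\<close>

lemma linear_on_UNIV: "linear_on UNIV f \<longleftrightarrow> linear f"
 by (auto simp: linear_on_def linear_iff)

text \<open>Two axioms take work, \<open>\<phi> \<xi> = 0\<close> and the skewness of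
  \<open>br \<xi>\<close>. For the latter, normality at \<open>\<xi>\<close> makes
  \<open>br \<xi>\<close> commute with \<open>\<phi>\<close>, and the Jacobi identity under
  \<open>\<eta>\<close> says that it preserves the fundamental form; together they make it skew on
  the image of \<open>\<phi>\<close>, and \<open>\<xi>\<close> itself it kills.\<close>

lemma sasakian_imp_complete_lsa:
 fixes br :: "'a::euclidean_space => 'a => 'a"
 assumes lie: "lie_algebra_on br" and uni: "\<And>x. tr (br x) = 0" and solv: "lie_algebra_on.der br N = {0}"
  and sas: "sasakian_structure_on UNIV br (\<bullet>) \<phi> \<xi> \<eta>"
 shows "\<exists>star. complete_lsa br star"
proof -
 interpret lie_algebra_on br by (rule lie)
 have lin: "linear \<phi>" "linear \<eta>" and eta_xi: "\<eta> \<xi> = 1"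
  and pp: "\<phi> (\<phi> x) = - x + \<eta> x *\<^sub>R \<xi>" and comp: "\<phi> x \<bullet> \<phi> y = x \<bullet> y - \<eta> x * \<eta> y"
  and N: "br (\<phi> x) (\<phi> y) + \<phi> (\<phi> (br x y)) - \<phi> (br (\<phi> x) y + br x (\<phi> y)) = \<eta> (br x y) *\<^sub>R \<xi>"
  and eta_br: "\<eta> (br x y) = \<phi> x \<bullet> y" for x y
  using sas by (auto simp: sasakian_structure_on_def linear_on_UNIV ce_d1_def)
 note ps = linear_0[OF lin(1)] linear_add[OF lin(1)] linear_neg[OF lin(1)] linear_cmul[OF lin(1)] linear_diff[OF lin(1)]
 \<comment> \<open>\<open>\<phi>\<close> kills \<open>u\<close>, so by the formula for its square
   \<open>u\<close> is a multiple of \<open>\<xi>\<close>; applying \<open>\<phi>\<close> once more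
   forces the multiple to be 0.\<close>
 define u where "u = \<phi> \<xi>"
 have pu: "\<phi> u = 0" using pp[of \<xi>] by (simp add: u_def eta_xi)
 then have u: "u = \<eta> u *\<^sub>R \<xi>" using pp[of u] by (simp add: ps)
 have "\<phi> (\<eta> u *\<^sub>R \<xi>) = 0" using pu u by simp
 then have "\<eta> u *\<^sub>R u = 0" by (simp add: ps u_def)
 then have "u = 0" using u by auto
 then have pxi: "\<phi> \<xi> = 0" by (simp add: u_def)
 have eta: "\<eta> x = \<xi> \<bullet> x" for x using comp[of x \<xi>] by (simp add: pxi eta_xi inner_commute)
 have skew: "\<phi> x \<bullet> y = - (x \<bullet> \<phi> y)" for x y
  using eta_br[of x y] eta_br[of y x] br_antisym[of x y] by (simp add: linear_neg[OF lin(2)] inner_commute)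
 have xi_phi: "\<xi> \<bullet> \<phi> x = 0" for x using skew[of \<xi> x] by (simp add: pxi)
 define E where "E = br \<xi>"
 have etaE: "\<eta> (E x) = 0" for x by (simp add: E_def eta_br pxi)
 have Ephi: "E (\<phi> x) = \<phi> (E x)" for x
 proof -
  have "\<phi> (\<phi> (br \<xi> x)) = \<phi> (br \<xi> (\<phi> x))"
   using N[of \<xi> x] by (simp add: pxi br_simps eta_br)
  then have "\<phi> (\<phi> (\<phi> (E x))) = \<phi> (\<phi> (E (\<phi> x)))" by (simp add: E_def)
  then show ?thesis by (simp add: pp[of "E (\<phi> x)"] etaE pp[of "E x"] ps)
 qed
 have E0: "E \<xi> = 0" by (simp add: E_def br_self)
 have Eskew: "E x \<bullet> y + x \<bullet> E y = 0" for x y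
 proof -
  have 1: "E (\<phi> x) \<bullet> y + \<phi> x \<bullet> E y = 0" for x
  proof -
   have "\<eta> (br (E x) y) + \<eta> (br x (E y)) = \<eta> (br \<xi> (br x y))"
    by (simp add: E_def br_jacobi[of \<xi>] linear_add[OF lin(2)])
   then show ?thesis by (simp add: eta_br pxi Ephi)
  qed
  have "x = - \<phi> (\<phi> x) + (\<xi> \<bullet> x) *\<^sub>R \<xi>" by (simp add: pp eta)
  then have "E x \<bullet> y + x \<bullet> E y = E (- \<phi> (\<phi> x) + (\<xi> \<bullet> x) *\<^sub>R \<xi>) \<bullet> y + (- \<phi> (\<phi> x) + (\<xi> \<bullet> x) *\<^sub>R \<xi>) \<bullet> E y"
   by simp
  also have "\<dots> = 0"
   using 1[of "\<phi> x"] etaE[of y] E0 by (simp add: E_def br_simps inner_add_left inner_diff_left eta)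
  finally show ?thesis .
 qed
 have "transverse_kaehler br \<phi> \<xi> 0"
 proof
  show "br (\<phi> x) (\<phi> y) = br x y + \<phi> (br (\<phi> x) y + br x (\<phi> y))" for x y
   using N[of x y] pp[of "br x y"] by (simp add: ps algebra_simps)
  show "br \<xi> x \<bullet> y = - (x \<bullet> br \<xi> y)" for x y using Eskew[of x y] by (simp add: E_def)
  show "tr (\<lambda>u. br z (br z u)) = 0" if "z \<in> span {br x y | x y. True}" for z
   using derived_trace_zero[OF solv] that by (simp add: der_1)
 qed (use lin pp eta eta_xi pxi skew uni eta_br in \<open>auto simp: br_simps ps\<close>)
 then show ?thesis using transverse_kaehler.complete_lsa_star by blast
qed

text \<open>With \<open>D = ad A\<close>, \<open>E = ad (J A)\<close> and \<open>F = J D - D J\<close>, the integrability and the closedness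
 of \<open>\<omega>\<close> up to \<open>\<theta>\<close> say that \<open>F\<close> is skew and equals the symmetric map \<open>E + E\<^sup>T\<close>; hence both vanish.\<close>

lemma vaisman_imp_complete_lsa:
 fixes br :: "'a::euclidean_space => 'a => 'a"
 assumes lie: "lie_algebra_on br" and uni: "\<And>x. tr (br x) = 0" and solv: "lie_algebra_on.der br N = {0}"
  and vai: "vaisman_structure_on UNIV br J (\<bullet>) \<theta>" and \<theta>: "\<And>x. \<theta> x = A \<bullet> x" and unit: "A \<bullet> A = 1"
 shows "\<exists>star. complete_lsa br star"
proof -
 interpret lie_algebra_on br by (rule lie)
 obtain nab where lc: "levi_civita_on UNIV br (\<bullet>) nab" and par: "\<And>x y. \<theta> (nab x y) = 0"
  using vai by (auto simp: vaisman_structure_on_def)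
 have linJ: "linear J" and JJ: "J (J x) = - x" and iso: "J x \<bullet> J y = x \<bullet> y"
  and NJ: "br (J x) (J y) - br x y - J (br (J x) y + br x (J y)) = 0"
  and A_br: "A \<bullet> br x y = 0"
  and dom: "- (J (br x y) \<bullet> z) + J (br x z) \<bullet> y - J (br y z) \<bullet> x
    = (A \<bullet> x) * (J y \<bullet> z) + (A \<bullet> y) * (J z \<bullet> x) + (A \<bullet> z) * (J x \<bullet> y)" for x y z
  using vai \<theta> by (auto simp: vaisman_structure_on_def complex_structure_on_def linear_on_UNIV ce_d1_def
    ce_d2_def wedge12_def Let_def)
 note js = linear_0[OF linJ] linear_add[OF linJ] linear_neg[OF linJ] linear_cmul[OF linJ] linear_diff[OF linJ]
 have Jskew: "J x \<bullet> y = - (x \<bullet> J y)" for x y using iso[of x "J y"] by (simp add: JJ)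
 define D where "D = br A"
 \<comment> \<open>A parallel Lee form means a parallel vector \<open>A\<close>; vanishing torsion
   then identifies \<open>br A\<close> with the skew operator \<open>nab A\<close>.\<close>
 have Dskew: "D x \<bullet> y = - (x \<bullet> D y)" for x y
 proof -
  have met: "nab x y \<bullet> z + y \<bullet> nab x z = 0" and tor: "nab x y - nab y x = br x y" for x y z
   using lc by (auto simp: levi_civita_on_def)
  have "nab x A \<bullet> y = 0" for x y using met[of x A y] par[of x y] by (simp add: \<theta>)
  then have "nab x A = 0" for x by (metis inner_eq_zero_iff)
  then have "D x = nab A x" for x using tor[of A x] by (simp add: D_def)
  then show ?thesis using met[of A x y] by simp
 qed
 define \<xi> where "\<xi> = J A"
 define E where "E = br \<xi>"
 have Jxi: "J \<xi> = - A" by (simp add: \<xi>_def JJ)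
 have xi_unit: "\<xi> \<bullet> \<xi> = 1" by (simp add: \<xi>_def iso unit)
 have xi_A: "\<xi> \<bullet> A = 0" using Jskew[of A A] by (simp add: \<xi>_def inner_commute)
 have AJ: "A \<bullet> J x = - (\<xi> \<bullet> x)" and xiJ: "\<xi> \<bullet> J x = A \<bullet> x" for x
  using Jskew[of A x] iso[of A x] by (simp_all add: \<xi>_def)
 define F where "F = (\<lambda>y. J (D y) - D (J y))"
 have EJ: "E (J y) = J (E y) + F (J y)" for y
  using NJ[of A y] by (simp add: E_def \<xi>_def F_def D_def JJ js br_simps algebra_simps)
 have Fskew: "F x \<bullet> y = - (x \<bullet> F y)" for x y
  using Jskew[of "D x" y] Dskew[of x "J y"] Dskew[of "J x" y] Jskew[of x "D y"]
  by (simp add: F_def inner_diff_left inner_diff_right)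
 have FJ: "J (F (J x)) = F x" for x
  by (simp add: F_def js JJ D_def br_simps)
 have JEsym: "J (E x) \<bullet> y = J (E y) \<bullet> x" for x y
 proof -
  have "J (br x y) \<bullet> \<xi> = 0" by (simp add: \<xi>_def iso A_br inner_commute[of _ A])
  moreover have "J y \<bullet> \<xi> = A \<bullet> y" for y by (simp add: \<xi>_def iso inner_commute)
  ultimately show ?thesis
   using dom[of \<xi> x y] by (simp add: E_def inner_commute[of A \<xi>] xi_A Jxi)
 qed
 have EF: "E x \<bullet> y + x \<bullet> E y = F x \<bullet> y" for x y
 proof -
  have "J (E (J x)) \<bullet> y = E y \<bullet> x" using JEsym[of "J x" y] by (simp add: iso)
  then show ?thesis by (simp add: EJ js JJ FJ inner_add_left inner_diff_left inner_diff_right inner_commute)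
 qed
 have "F x \<bullet> y = 0" for x y
  using EF[of x y] EF[of y x] Fskew[of y x] by (simp add: inner_commute)
 then have F0: "F x = 0" for x by (metis inner_eq_zero_iff)
 then have DJ: "D (J x) = J (D x)" and EJ': "E (J x) = J (E x)" and Eskew: "E x \<bullet> y = - (x \<bullet> E y)" for x y
  using EJ[of x] EF[of x y] F0[of x] F0[of "J x"] by (simp_all add: F_def eq_neg_iff_add_eq_0)
 have DA: "D A = 0" by (simp add: D_def br_self)
 have Dxi: "D \<xi> = 0" by (simp add: \<xi>_def DJ DA js)
 have EA: "E A = 0" using br_antisym[of \<xi> A] Dxi by (simp add: E_def D_def)
 have Exi: "E \<xi> = 0" by (simp add: E_def br_self)
 have DE_lin: "D (x + y) = D x + D y" "D (x - y) = D x - D y" "D (c *\<^sub>R x) = c *\<^sub>R D x"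
  "E (x + y) = E x + E y" "E (x - y) = E x - E y" "E (c *\<^sub>R x) = c *\<^sub>R E x" for x y c
  by (simp_all add: D_def E_def br_simps)
 \<comment> \<open>\<open>J\<close> turns \<open>A\<close> into \<open>\<xi>\<close> and
   \<open>\<xi>\<close> into \<open>- A\<close>; the two added terms cancel this and leave
   \<open>J\<close> on the complement.\<close>
 define \<phi> where "\<phi> = (\<lambda>x. J x + (\<xi> \<bullet> x) *\<^sub>R A - (A \<bullet> x) *\<^sub>R \<xi>)"
 have phi: "\<phi> x = J x + (\<xi> \<bullet> x) *\<^sub>R A - (A \<bullet> x) *\<^sub>R \<xi>" for x by (simp add: \<phi>_def)
 have lin: "linear \<phi>"
  unfolding \<phi>_def by (intro linearI) (simp_all add: js inner_add_right algebra_simps)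
 \<comment> \<open>Evaluate \<open>dom\<close> at \<open>A\<close>, \<open>x\<close>,
   \<open>y\<close>: since \<open>D\<close> is skew and commutes with \<open>J\<close>, its two
   contributions cancel.\<close>
 have xi_br: "\<xi> \<bullet> br x y = \<phi> x \<bullet> y" for x y
 proof -
  have "J (D y) \<bullet> x = J (D x) \<bullet> y"
   using Jskew[of "D y" x] Dskew[of y "J x"] by (simp add: DJ inner_commute)
  moreover have "J (br x y) \<bullet> A = - (\<xi> \<bullet> br x y)" "J y \<bullet> A = - (\<xi> \<bullet> y)"
   using AJ[of "br x y"] AJ[of y] by (simp_all add: inner_commute)
  ultimately show ?thesis
   using dom[of A x y] unit by (simp add: D_def \<phi>_def inner_add_left inner_diff_left flip: \<xi>_def)
 qed
 have skew: "\<phi> x \<bullet> y = - (x \<bullet> \<phi> y)" for x y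
  using Jskew[of x y] by (simp add: \<phi>_def inner_add_left inner_diff_left inner_add_right inner_diff_right inner_commute)
 have xi_phi: "\<xi> \<bullet> \<phi> x = 0" and A_phi: "A \<bullet> \<phi> x = 0" for x
  by (simp_all add: \<phi>_def inner_add_right inner_diff_right xiJ AJ xi_A xi_unit unit inner_commute[of A \<xi>])
 have pp: "\<phi> (\<phi> x) = - x + (\<xi> \<bullet> x) *\<^sub>R \<xi> + (A \<bullet> x) *\<^sub>R A" for x
 proof -
  have "\<phi> (\<phi> x) = J (\<phi> x) + (\<xi> \<bullet> \<phi> x) *\<^sub>R A - (A \<bullet> \<phi> x) *\<^sub>R \<xi>" by (rule phi)
  also have "\<dots> = J (\<phi> x)" by (simp add: xi_phi A_phi)
  also have "\<dots> = - x + (\<xi> \<bullet> x) *\<^sub>R J A + (A \<bullet> x) *\<^sub>R A" unfolding phi by (simp add: js JJ Jxi)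
  finally show ?thesis by (simp add: \<xi>_def)
 qed
 have "transverse_kaehler br \<phi> \<xi> A"
 proof
  \<comment> \<open>Replacing \<open>\<phi>\<close> by \<open>J\<close> costs only terms in
    \<open>D\<close> and \<open>E\<close>; these maps commute with \<open>J\<close>, so the terms
    match on both sides of the integrability of \<open>J\<close>.\<close>
  show "br (\<phi> x) (\<phi> y) = br x y + \<phi> (br (\<phi> x) y + br x (\<phi> y))" for x y
  proof -
   let ?w = "br (\<phi> x) y + br x (\<phi> y)"
   have "\<xi> \<bullet> ?w = 0" "A \<bullet> ?w = 0"
    using skew[of "\<phi> x" y] by (simp_all add: inner_add_right xi_br A_br)
   then have pw: "\<phi> ?w = J ?w" by (simp add: \<phi>_def)
   have c: "br z A = - D z" "br z \<xi> = - E z" for z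
    using br_antisym[of z A] br_antisym[of z \<xi>] by (simp_all add: D_def E_def)
   have "br (\<phi> x) (\<phi> y) = br (J x) (J y) - (\<xi> \<bullet> y) *\<^sub>R D (J x) + (A \<bullet> y) *\<^sub>R E (J x)
     + (\<xi> \<bullet> x) *\<^sub>R D (J y) - (A \<bullet> x) *\<^sub>R E (J y)"
    by (simp add: \<phi>_def br_simps c DE_lin DA Dxi EA Exi flip: D_def E_def)
   also have "\<dots> = br x y + J (br (J x) y + br x (J y)) - (\<xi> \<bullet> y) *\<^sub>R J (D x) + (A \<bullet> y) *\<^sub>R J (E x)
     + (\<xi> \<bullet> x) *\<^sub>R J (D y) - (A \<bullet> x) *\<^sub>R J (E y)"
    using NJ[of x y] by (simp add: DJ EJ' algebra_simps)
   also have "\<dots> = br x y + J ?w"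
    by (simp add: \<phi>_def br_simps c js DE_lin DA Dxi EA Exi algebra_simps flip: D_def E_def)
   finally show ?thesis by (simp add: pw)
  qed
  show "br A (\<phi> x) = \<phi> (br A x)" for x
  proof -
   have "\<xi> \<bullet> D x = 0" using xi_br[of A x] by (simp add: D_def \<phi>_def xi_A unit flip: \<xi>_def)
   then have "\<phi> (D x) = J (D x)" by (simp add: \<phi>_def A_br[of A x, folded D_def])
   moreover have "D (\<phi> x) = D (J x)"
    using DA Dxi by (simp add: \<phi>_def D_def br_simps)
   ultimately show ?thesis by (simp add: DJ D_def[symmetric])
  qed
  show "tr (\<lambda>u. br z (br z u)) = 0" if "z \<in> span {br x y | x y. True}" for z
   using derived_trace_zero[OF solv] that by (simp add: der_1)
  show "\<phi> \<xi> = 0" "\<phi> A = 0"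
   by (simp_all add: \<phi>_def Jxi xi_unit xi_A unit inner_commute[of A \<xi>] flip: \<xi>_def)
  show "br \<xi> x \<bullet> y = - (x \<bullet> br \<xi> y)" for x y using Eskew[of x y] by (simp add: E_def)
 qed (use pp skew xi_unit xi_A xi_br A_br uni in \<open>auto simp: linear_add[OF lin] linear_cmul[OF lin]\<close>)
 then show ?thesis using transverse_kaehler.complete_lsa_star by blast
qed

section \<open>Smooth maps from open subsets of Euclidean spaces\<close>

text \<open>The features of charts on which the calculus of plots relies, isolated so that they can
  be verified directly for products and for the coset space.\<close>

definition good_atlas :: "('a, 'e::euclidean_space) manifold => bool" where
 "good_atlas A \<longleftrightarrow> \<Union> (fst ` atlas A) = topspace (mtop A) \<and>
   (\<forall>(U, \<phi>)\<in>atlas A. openin (mtop A) U \<and> inj_on \<phi> U \<and> (\<forall>W. openin (mtop A) W \<and> W \<subseteq> U \<longrightarrow> open (\<phi> ` W)))"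

lemma good_atlas_chart:
 assumes "good_atlas A" "(U, \<phi>) \<in> atlas A"
 shows "openin (mtop A) U" "inj_on \<phi> U" "openin (mtop A) W ==> W \<subseteq> U ==> open (\<phi> ` W)"
 using assms by (auto simp: good_atlas_def)

lemma good_atlas_cover:
 assumes "good_atlas A" "x \<in> topspace (mtop A)"
 obtains U \<phi> where "(U, \<phi>) \<in> atlas A" "x \<in> U"
 using assms by (force simp: good_atlas_def)

lemma smooth_manifold_good_atlas:
 assumes "smooth_manifold M"
 shows "good_atlas M"
 unfolding good_atlas_def
proof (intro conjI ballI)
 show "\<Union> (fst ` atlas M) = topspace (mtop M)" using assms by (simp add: smooth_manifold_def)
 fix c assume "c \<in> atlas M"
 then obtain U \<phi> where c: "c = (U, \<phi>)" "(U, \<phi>) \<in> atlas M" by (cases c) auto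
 then have U: "openin (mtop M) U" "open (\<phi> ` U)"
   "homeomorphic_map (subtopology (mtop M) U) (top_of_set (\<phi> ` U)) \<phi>"
  using assms by (auto simp: smooth_manifold_def)
 have top: "topspace (subtopology (mtop M) U) = U" using U(1) openin_subset by (auto simp: topspace_subtopology)
 have "inj_on \<phi> U" using homeomorphic_imp_injective_map[OF U(3)] by (simp only: top)
 moreover have "open (\<phi> ` W)" if "openin (mtop M) W" "W \<subseteq> U" for W
 proof -
  have "openin (subtopology (mtop M) U) W" using that U(1) by (simp add: openin_open_subtopology)
  then have "openin (top_of_set (\<phi> ` U)) (\<phi> ` W)"
   using homeomorphic_imp_open_map[OF U(3)] by (simp add: open_map_def)
  then show ?thesis using U(2) openin_open_eq by blast
 qed
 ultimately show "case c of (U, \<phi>) => openin (mtop M) U \<and> inj_on \<phi> U \<and> (\<forall>W. openin (mtop M) W \<and> W \<subseteq> U \<longrightarrow> open (\<phi> ` W))"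
  using c U by auto
qed

lemma good_atlas_prod:
 assumes "good_atlas A" "good_atlas B"
 shows "good_atlas (prod_manifold A B)"
 unfolding good_atlas_def
proof (intro conjI ballI)
 have A: "\<Union> (fst ` atlas A) = topspace (mtop A)" and B: "\<Union> (fst ` atlas B) = topspace (mtop B)"
  using assms by (auto simp: good_atlas_def)
 show "\<Union> (fst ` atlas (prod_manifold A B)) = topspace (mtop (prod_manifold A B))"
  unfolding prod_manifold_def by (simp flip: A B) (force simp: image_iff)
 fix c assume "c \<in> atlas (prod_manifold A B)"
 then obtain U \<phi> V \<psi> where c: "c = (U \<times> V, map_prod \<phi> \<psi>)" "(U, \<phi>) \<in> atlas A" "(V, \<psi>) \<in> atlas B"
  by (auto simp: prod_manifold_def)
 note U = good_atlas_chart[OF assms(1) c(2)] and V = good_atlas_chart[OF assms(2) c(3)]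
 have "open (map_prod \<phi> \<psi> ` W)" if W: "openin (prod_topology (mtop A) (mtop B)) W" "W \<subseteq> U \<times> V" for W
 proof (subst open_subopen, intro ballI)
  fix z assume "z \<in> map_prod \<phi> \<psi> ` W"
  then obtain x y where xy: "(x, y) \<in> W" "z = (\<phi> x, \<psi> y)" by auto
  then obtain P Q where PQ: "openin (mtop A) P" "openin (mtop B) Q" "x \<in> P" "y \<in> Q" "P \<times> Q \<subseteq> W"
   using W(1) unfolding openin_prod_topology_alt by metis
  let ?P = "P \<inter> U" and ?Q = "Q \<inter> V"
  have "open (\<phi> ` ?P \<times> \<psi> ` ?Q)" using PQ U V by (intro open_Times U(3) V(3)) auto
  moreover have "\<phi> ` ?P \<times> \<psi> ` ?Q \<subseteq> map_prod \<phi> \<psi> ` W" using PQ(5) by force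
  moreover have "z \<in> \<phi> ` ?P \<times> \<psi> ` ?Q" using xy W(2) PQ by auto
  ultimately show "\<exists>T. open T \<and> z \<in> T \<and> T \<subseteq> map_prod \<phi> \<psi> ` W" by blast
 qed
 then show "case c of (U, \<phi>) => openin (mtop (prod_manifold A B)) U \<and> inj_on \<phi> U \<and>
   (\<forall>W. openin (mtop (prod_manifold A B)) W \<and> W \<subseteq> U \<longrightarrow> open (\<phi> ` W))"
  using c U V by (auto simp: prod_manifold_def openin_prod_Times_iff map_prod_inj_on)
qed

lemma good_atlas_open_submanifold: "open S ==> good_atlas (open_submanifold S)"
 by (auto simp: good_atlas_def open_submanifold_def openin_open_eq)

section \<open>Plots: smooth maps from open sets of Euclidean spaces, closed under composition and
  pairing\<close>

definition plot :: "('a, 'e::euclidean_space) manifold => 'f::euclidean_space set => ('f => 'a) => bool" where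
 "plot M S p \<longleftrightarrow> open S \<and> smooth_map (open_submanifold S) M p"

lemma plot_open: "plot M S p ==> open S"
 by (simp add: plot_def)

lemma plot_continuous: "plot M S p ==> continuous_map (top_of_set S) (mtop M) p"
 by (simp add: plot_def smooth_map_def open_submanifold_def)

lemma plot_in: "plot M S p ==> s \<in> S ==> p s \<in> topspace (mtop M)"
 using continuous_map_image_subset_topspace[OF plot_continuous] by fastforce

lemma plot_preimage_open:
 assumes "plot M S p" "openin (mtop M) V"
 shows "open {s \<in> S. p s \<in> V}"
 using openin_continuous_map_preimage[OF plot_continuous[OF assms(1)] assms(2)] plot_open[OF assms(1)]
 by (simp add: openin_open_eq)

lemma plot_chart_smooth:
 assumes p: "plot M S p" and M: "good_atlas M" and c: "(V, \<psi>) \<in> atlas M"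
 shows "smooth_on {s \<in> S. p s \<in> V} (\<lambda>s. \<psi> (p s))"
proof -
 have "smooth_on (S \<inter> p -` V) (\<psi> \<circ> p \<circ> inv_into S id)"
  using p c by (auto simp: plot_def smooth_map_def open_submanifold_def)
 moreover have "S \<inter> p -` V = {s \<in> S. p s \<in> V}" by auto
 ultimately have s: "smooth_on {s \<in> S. p s \<in> V} (\<psi> \<circ> p \<circ> inv_into S id)" by simp
 have inv: "inv_into S id s = s" if "s \<in> S" for s using inv_into_f_f[of id S s] that by simp
 show ?thesis
  by (rule smooth_on_cong[THEN iffD1, OF plot_preimage_open[OF p good_atlas_chart(1)[OF M c]] _ s]) (simp add: inv)
qed

lemma plotI:
 assumes "open S" and c: "continuous_map (top_of_set S) (mtop M) p" and M: "good_atlas M"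
  and s: "\<And>V \<psi>. (V, \<psi>) \<in> atlas M ==> smooth_on {s \<in> S. p s \<in> V} (\<lambda>s. \<psi> (p s))"
 shows "plot M S p"
proof -
 have "smooth_on (S \<inter> p -` V) (\<psi> \<circ> p \<circ> inv_into S id)" if V: "(V, \<psi>) \<in> atlas M" for V \<psi>
 proof -
  have inv: "inv_into S id s = s" if "s \<in> S" for s using inv_into_f_f[of id S s] that by simp
  have eq: "S \<inter> p -` V = {s \<in> S. p s \<in> V}" by auto
  have "open {s \<in> S. p s \<in> V}"
   using openin_continuous_map_preimage[OF c good_atlas_chart(1)[OF M V]] assms(1) by (simp add: openin_open_eq)
  then show ?thesis
   unfolding eq by (rule smooth_on_cong[THEN iffD2, OF _ _ s[OF V]]) (simp add: inv)
 qed
 then show ?thesis using assms(1) c by (auto simp: plot_def smooth_map_def open_submanifold_def)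
qed

text \<open>\<open>smooth_map\<close> speaks about chart expressions, so smoothness is tested near
  each parameter through a chart of \<open>A\<close> around the point reached there.\<close>

lemma plot_smooth_map:
 assumes p: "plot A S p" and f: "smooth_map A B f" and A: "good_atlas A" and B: "good_atlas B"
 shows "plot B S (\<lambda>s. f (p s))"
proof (rule plotI[OF plot_open[OF p] _ B])
 have cf: "continuous_map (mtop A) (mtop B) f" using f by (simp add: smooth_map_def)
 show cfp: "continuous_map (top_of_set S) (mtop B) (\<lambda>s. f (p s))"
  using continuous_map_compose[OF plot_continuous[OF p] cf] by (simp add: o_def)
 fix V \<psi> assume V: "(V, \<psi>) \<in> atlas B"
 show "smooth_on {s \<in> S. f (p s) \<in> V} (\<lambda>s. \<psi> (f (p s)))"
 proof (rule smooth_on_local)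
  fix s assume s: "s \<in> {s \<in> S. f (p s) \<in> V}"
  then obtain U \<phi> where U: "(U, \<phi>) \<in> atlas A" "p s \<in> U"
   using good_atlas_cover[OF A plot_in[OF p]] by blast
  note cU = good_atlas_chart[OF A U(1)]
  define W where "W = {x \<in> topspace (mtop A). f x \<in> V} \<inter> U"
  have W: "openin (mtop A) W"
   unfolding W_def using openin_continuous_map_preimage[OF cf good_atlas_chart(1)[OF B V]] cU(1) by blast
  have WU: "W = U \<inter> f -` V" using openin_subset[OF cU(1)] by (auto simp: W_def)
  let ?N = "{s \<in> S. p s \<in> W}"
  have N: "open ?N" by (rule plot_preimage_open[OF p W])
  have "smooth_on ?N (\<lambda>s. (\<psi> \<circ> f \<circ> inv_into U \<phi>) (\<phi> (p s)))"
  proof (rule smooth_on_compose[OF N, where T="\<phi> ` W" and f="\<lambda>s. \<phi> (p s)" and g="\<psi> \<circ> f \<circ> inv_into U \<phi>"])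
   show "open (\<phi> ` W)" by (rule cU(3)[OF W]) (simp add: W_def)
   show "smooth_on ?N (\<lambda>s. \<phi> (p s))"
    by (rule smooth_on_subset[OF plot_chart_smooth[OF p A U(1)]]) (auto simp: W_def)
   show "smooth_on (\<phi> ` W) (\<psi> \<circ> f \<circ> inv_into U \<phi>)"
    using f U(1) V unfolding smooth_map_def WU by fastforce
  qed auto
  then have "smooth_on ?N (\<lambda>s. \<psi> (f (p s)))"
   by (rule smooth_on_cong[THEN iffD1, OF N, rotated]) (simp add: W_def inv_into_f_f[OF cU(2)])
  then show "\<exists>T. open T \<and> s \<in> T \<and> smooth_on T (\<lambda>s. \<psi> (f (p s)))"
   using N s U plot_in[OF p] by (intro exI[of _ ?N]) (auto simp: W_def)
 qed
qed

lemma plot_Pair: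
 assumes p: "plot A S p" and q: "plot B S q" and A: "good_atlas A" and B: "good_atlas B"
 shows "plot (prod_manifold A B) S (\<lambda>s. (p s, q s))"
proof (rule plotI[OF plot_open[OF p] _ good_atlas_prod[OF A B]])
 show "continuous_map (top_of_set S) (mtop (prod_manifold A B)) (\<lambda>s. (p s, q s))"
  using plot_continuous[OF p] plot_continuous[OF q] by (simp add: prod_manifold_def continuous_map_paired)
 fix V \<psi> assume "(V, \<psi>) \<in> atlas (prod_manifold A B)"
 then obtain U \<phi> W \<phi>2 where c: "V = U \<times> W" "\<psi> = map_prod \<phi> \<phi>2" "(U, \<phi>) \<in> atlas A" "(W, \<phi>2) \<in> atlas B"
  by (auto simp: prod_manifold_def)
 have eq: "{s \<in> S. (p s, q s) \<in> V} = {s \<in> S. p s \<in> U} \<inter> {s \<in> S. q s \<in> W}" using c by auto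
 have "open \<dots>"
  by (intro open_Int plot_preimage_open[OF p] plot_preimage_open[OF q] good_atlas_chart(1)[OF A c(3)]
    good_atlas_chart(1)[OF B c(4)])
 then show "smooth_on {s \<in> S. (p s, q s) \<in> V} (\<lambda>s. \<psi> (p s, q s))"
  unfolding eq c(2) map_prod_simp
  by (intro smooth_on_Pair smooth_on_subset[OF plot_chart_smooth[OF p A c(3)]]
    smooth_on_subset[OF plot_chart_smooth[OF q B c(4)]]) auto
qed

lemma plot_const:
 assumes "open S" "x \<in> topspace (mtop M)" "good_atlas M"
 shows "plot M S (\<lambda>s. x)"
proof (rule plotI[OF assms(1) _ assms(3)])
 fix V \<psi>
 have "open {s \<in> S. x \<in> V}" using assms(1) by (cases "x \<in> V") auto
 then show "smooth_on {s \<in> S. x \<in> V} (\<lambda>s. \<psi> x)" by (rule smooth_on_const)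
qed (use assms in auto)

lemma plot_compose:
 assumes p: "plot M T p" and h: "smooth_on S h" "open S" "h ` S \<subseteq> T" and M: "good_atlas M"
 shows "plot M S (\<lambda>s. p (h s))"
proof (rule plotI[OF h(2) _ M])
 have ch: "continuous_on S h" by (rule smooth_on_imp_continuous_on[OF h(1)])
 have "continuous_map (top_of_set S) (top_of_set T) h"
  using ch h(3) by (auto simp: continuous_map_in_subtopology)
 from continuous_map_compose[OF this plot_continuous[OF p]]
 show "continuous_map (top_of_set S) (mtop M) (\<lambda>s. p (h s))" by (simp add: o_def)
 fix V \<psi> assume V: "(V, \<psi>) \<in> atlas M"
 let ?T = "{t \<in> T. p t \<in> V}"
 have T: "open ?T" by (rule plot_preimage_open[OF p good_atlas_chart(1)[OF M V]])
 have eq: "{s \<in> S. p (h s) \<in> V} = S \<inter> h -` ?T" using h(3) by auto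
 have "open (S \<inter> h -` ?T)" by (rule continuous_open_preimage[OF ch h(2) T])
 then show "smooth_on {s \<in> S. p (h s) \<in> V} (\<lambda>s. \<psi> (p (h s)))"
  unfolding eq
  by (rule smooth_on_compose[OF _ T smooth_on_subset[OF h(1)] _ plot_chart_smooth[OF p M V]]) auto
qed

lemma plot_subset: "plot M T p ==> open S ==> S \<subseteq> T ==> good_atlas M ==> plot M S p"
 using plot_compose[of M T p S "\<lambda>x. x"] by (simp add: smooth_on_ident)

lemma plot_local:
 assumes M: "good_atlas M" and loc: "\<And>s. s \<in> S ==> \<exists>T q. s \<in> T \<and> T \<subseteq> S \<and> plot M T q \<and> (\<forall>t\<in>T. p t = q t)"
 shows "plot M S p"
proof -
 obtain T q where T: "\<And>s. s \<in> S ==> s \<in> T s" "\<And>s. s \<in> S ==> T s \<subseteq> S" "\<And>s. s \<in> S ==> plot M (T s) (q s)"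
  and eq: "\<And>s t. s \<in> S ==> t \<in> T s ==> p t = q s t" using loc by metis
 have "S = (\<Union>s\<in>S. T s)" using T by blast
 then have S: "open S" using T(3) plot_open by (metis open_UN)
 have pre: "open {s \<in> S. p s \<in> V}" if "openin (mtop M) V" for V
 proof (subst open_subopen, intro ballI)
  fix s assume s: "s \<in> {s \<in> S. p s \<in> V}"
  let ?N = "{t \<in> T s. q s t \<in> V}"
  have "open ?N" using s T that by (intro plot_preimage_open) auto
  moreover have "s \<in> ?N" "?N \<subseteq> {s \<in> S. p s \<in> V}" using s T eq by auto
  ultimately show "\<exists>N. open N \<and> s \<in> N \<and> N \<subseteq> {s \<in> S. p s \<in> V}" by blast
 qed
 show ?thesis
 proof (rule plotI[OF S _ M])
  show "continuous_map (top_of_set S) (mtop M) p"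
   unfolding continuous_map
  proof (intro conjI allI impI)
   show "p ` topspace (top_of_set S) \<subseteq> topspace (mtop M)" using T eq plot_in by fastforce
   fix V assume "openin (mtop M) V"
   then show "openin (top_of_set S) {x \<in> topspace (top_of_set S). p x \<in> V}" using pre S by (auto simp: openin_open_eq)
  qed
  fix V \<psi> assume V: "(V, \<psi>) \<in> atlas M"
  show "smooth_on {s \<in> S. p s \<in> V} (\<lambda>s. \<psi> (p s))"
  proof (rule smooth_on_local)
   fix s assume s: "s \<in> {s \<in> S. p s \<in> V}"
   let ?N = "{t \<in> T s. q s t \<in> V}"
   have N: "open ?N" using s T good_atlas_chart(1)[OF M V] by (intro plot_preimage_open) auto
   have "smooth_on ?N (\<lambda>t. \<psi> (q s t))" using s by (intro plot_chart_smooth[OF T(3) M V]) auto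
   then have "smooth_on ?N (\<lambda>t. \<psi> (p t))" by (rule smooth_on_cong[THEN iffD1, OF N, rotated]) (use s eq in auto)
   then show "\<exists>N. open N \<and> s \<in> N \<and> smooth_on N (\<lambda>t. \<psi> (p t))" using N s T eq by (intro exI[of _ ?N]) auto
  qed
 qed
qed

lemma plot_inv_chart:
 assumes M: "smooth_manifold M" and c: "(U, \<phi>) \<in> atlas M"
 shows "plot M (\<phi> ` U) (inv_into U \<phi>)"
proof (rule plotI[OF _ _ smooth_manifold_good_atlas[OF M]])
 have U: "openin (mtop M) U" "open (\<phi> ` U)"
   "homeomorphic_map (subtopology (mtop M) U) (top_of_set (\<phi> ` U)) \<phi>"
  using assms by (auto simp: smooth_manifold_def)
 note inj = good_atlas_chart(2)[OF smooth_manifold_good_atlas[OF M] c]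
 show "open (\<phi> ` U)" by fact
 show "continuous_map (top_of_set (\<phi> ` U)) (mtop M) (inv_into U \<phi>)"
  unfolding continuous_map
 proof (intro conjI allI impI)
  show "inv_into U \<phi> ` topspace (top_of_set (\<phi> ` U)) \<subseteq> topspace (mtop M)"
   using openin_subset[OF U(1)] by (auto simp: inv_into_f_f[OF inj])
  fix V assume V: "openin (mtop M) V"
  have "{x \<in> topspace (top_of_set (\<phi> ` U)). inv_into U \<phi> x \<in> V} = \<phi> ` (U \<inter> V)"
   by (auto simp: inv_into_f_f[OF inj])
  moreover have "open (\<phi> ` (U \<inter> V))"
   using good_atlas_chart(3)[OF smooth_manifold_good_atlas[OF M] c, of "U \<inter> V"] U(1) V by auto
  ultimately show "openin (top_of_set (\<phi> ` U)) {x \<in> topspace (top_of_set (\<phi> ` U)). inv_into U \<phi> x \<in> V}"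
   using U(2) by (auto simp: openin_open_eq)
 qed
 fix V \<psi> assume V: "(V, \<psi>) \<in> atlas M"
 have "{s \<in> \<phi> ` U. inv_into U \<phi> s \<in> V} = \<phi> ` (U \<inter> V)" by (auto simp: inv_into_f_f[OF inj])
 moreover have "smooth_on (\<phi> ` (U \<inter> V)) (\<psi> \<circ> inv_into U \<phi>)"
  using M c V unfolding smooth_manifold_def by blast
 ultimately show "smooth_on {s \<in> \<phi> ` U. inv_into U \<phi> s \<in> V} (\<lambda>s. \<psi> (inv_into U \<phi> s))"
  by (simp add: o_def)
qed

lemma plot_real_iff: "plot (open_submanifold UNIV) S f \<longleftrightarrow> open S \<and> smooth_on S f" for f :: "'a::euclidean_space => 'b::euclidean_space"
proof
 assume p: "plot (open_submanifold UNIV) S f"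
 have "(UNIV, id) \<in> atlas (open_submanifold UNIV :: ('b, 'b) manifold)" by (simp add: open_submanifold_def)
 from plot_chart_smooth[OF p good_atlas_open_submanifold[OF open_UNIV] this] plot_open[OF p]
 show "open S \<and> smooth_on S f" by simp
next
 assume "open S \<and> smooth_on S f"
 then show "plot (open_submanifold UNIV) S f"
  by (intro plotI good_atlas_open_submanifold)
   (auto simp: open_submanifold_def smooth_on_imp_continuous_on)
qed

lemma smooth_functions_plot:
 assumes "F \<in> smooth_functions M" "plot M S p" "good_atlas M"
 shows "smooth_on S (\<lambda>s. F (p s))"
 using plot_smooth_map[OF assms(2) _ assms(3) good_atlas_open_submanifold[OF open_UNIV], of F] assms(1)
 by (simp add: smooth_functions_def plot_real_iff)

lemma smooth_functionsI:
 assumes M: "smooth_manifold M" and F0: "\<And>x. x \<notin> topspace (mtop M) ==> F x = 0"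
  and F: "\<And>U \<phi>. (U, \<phi>) \<in> atlas M ==> smooth_on (\<phi> ` U) (\<lambda>y. F (inv_into U \<phi> y))"
 shows "F \<in> smooth_functions M"
proof -
 note gM = smooth_manifold_good_atlas[OF M]
 have "continuous_map (mtop M) euclideanreal F"
  unfolding continuous_map
 proof (intro conjI allI impI)
  fix V :: "real set" assume "openin euclideanreal V"
  then have V: "open V" by simp
  show "openin (mtop M) {x \<in> topspace (mtop M). F x \<in> V}"
  proof (subst openin_subopen, intro ballI)
   fix x assume x: "x \<in> {x \<in> topspace (mtop M). F x \<in> V}"
   then obtain U \<phi> where U: "(U, \<phi>) \<in> atlas M" "x \<in> U" using good_atlas_cover[OF gM] by blast
   note cU = good_atlas_chart[OF gM U(1)]
   have hU: "homeomorphic_map (subtopology (mtop M) U) (top_of_set (\<phi> ` U)) \<phi>" "open (\<phi> ` U)"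
    using M U(1) by (auto simp: smooth_manifold_def)
   let ?V = "(\<phi> ` U) \<inter> (\<lambda>y. F (inv_into U \<phi> y)) -` V"
   have oV: "open ?V"
    by (rule continuous_open_preimage[OF smooth_on_imp_continuous_on[OF F[OF U(1)]] hU(2) V])
   let ?N = "{z \<in> U. F z \<in> V}"
   have top: "topspace (subtopology (mtop M) U) = U" using cU(1) openin_subset by (auto simp: topspace_subtopology)
   have "openin (subtopology (mtop M) U) {z \<in> topspace (subtopology (mtop M) U). \<phi> z \<in> ?V}"
    using homeomorphic_imp_continuous_map[OF hU(1)] oV hU(2)
    by (intro openin_continuous_map_preimage[of _ "top_of_set (\<phi> ` U)"]) (auto simp: openin_open_eq)
   moreover have "{z \<in> topspace (subtopology (mtop M) U). \<phi> z \<in> ?V} = ?N"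
    unfolding top using inv_into_f_f[OF cU(2)] by auto (metis imageI)+
   ultimately have "openin (mtop M) ?N" using cU(1) by (simp add: openin_open_subtopology)
   then show "\<exists>T. openin (mtop M) T \<and> x \<in> T \<and> T \<subseteq> {x \<in> topspace (mtop M). F x \<in> V}"
    using x U openin_subset[OF cU(1)] by (intro exI[of _ ?N]) auto
  qed
 qed auto
 then show ?thesis
  using F0 F by (auto simp: smooth_functions_def smooth_map_def open_submanifold_def o_def)
qed

section \<open>Lie groups\<close>

lemma scaleR_fun_apply: "(c *\<^sub>R f) x = c *\<^sub>R f x"
 by (simp add: scaleR_fun_def)

text \<open>One chart, centred at the identity; left translation carries it to every point, and the
  other charts are met through plots. \<open>\<phi>\<close> is smooth relative to some atlas chart
  rather than being one itself, which leaves room for linear changes of the frame.\<close>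

locale lie_chart =
 fixes G :: "('g, 'm) monoid_scheme" (structure) and M :: "('g, 'e::euclidean_space) manifold"
  and r :: real and \<psi> :: "'e => 'g" and \<phi> :: "'g => 'e"
 assumes lie: "lie_group G M" and r_pos: "r > 0"
  and psi_plot: "plot M (ball 0 r) \<psi>" and psi_0: "\<psi> 0 = \<one>"
  and phi_psi: "y \<in> ball 0 r ==> \<phi> (\<psi> y) = y"
  and psi_open: "open W ==> W \<subseteq> ball 0 r ==> openin (mtop M) (\<psi> ` W)"
  and phi_chart: "\<exists>U \<phi>0. (U, \<phi>0) \<in> atlas M \<and> \<psi> ` ball 0 r \<subseteq> U \<and>
    smooth_on (\<phi>0 ` (\<psi> ` ball 0 r)) (\<lambda>z. \<phi> (inv_into U \<phi>0 z))"
begin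

sublocale group G
 using lie by (simp add: lie_group_def)

lemma manifold_M: "smooth_manifold M" and topspace_M: "topspace (mtop M) = carrier G"
 using lie by (auto simp: lie_group_def)

lemma gM: "good_atlas M"
 by (rule smooth_manifold_good_atlas[OF manifold_M])

lemma plot_carrier: "plot M S p ==> s \<in> S ==> p s \<in> carrier G"
 using plot_in topspace_M by blast

lemma plot_mult:
 assumes "plot M S p" "plot M S q"
 shows "plot M S (\<lambda>s. p s \<otimes> q s)"
proof -
 have "smooth_map (prod_manifold M M) M (\<lambda>(x, y). x \<otimes> y)" using lie by (simp add: lie_group_def)
 from plot_smooth_map[OF plot_Pair[OF assms gM gM] this good_atlas_prod[OF gM gM] gM] show ?thesis by simp
qed

lemma plot_inv: "plot M S p ==> plot M S (\<lambda>s. inv (p s))"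
 using plot_smooth_map[OF _ _ gM gM, of S p "m_inv G"] lie by (simp add: lie_group_def)

lemma plot_cst: "open S ==> x \<in> carrier G ==> plot M S (\<lambda>s. x)"
 using plot_const[OF _ _ gM] topspace_M by blast

lemmas plot_comp = plot_compose[OF _ _ _ _ gM]
lemmas plot_sub = plot_subset[OF _ _ _ gM]

lemma plot_fst:
 assumes p: "plot M S p" and T: "open T"
 shows "plot M (S \<times> T) (\<lambda>z. p (fst z))"
proof (rule plot_comp[OF p])
 show ST: "open (S \<times> T)" using plot_open[OF p] T by (rule open_Times)
 show "smooth_on (S \<times> T) fst" by (rule smooth_on_linear[OF ST bounded_linear_fst smooth_on_ident[OF ST]])
qed auto

lemma plot_snd:
 assumes p: "plot M T p" and S: "open S"
 shows "plot M (S \<times> T) (\<lambda>z. p (snd z))"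
proof (rule plot_comp[OF p])
 show ST: "open (S \<times> T)" using S plot_open[OF p] by (rule open_Times)
 show "smooth_on (S \<times> T) snd" by (rule smooth_on_linear[OF ST bounded_linear_snd smooth_on_ident[OF ST]])
qed auto

definition U0 :: "'g set" where "U0 = \<psi> ` ball 0 r"

lemma psi_carrier: "y \<in> ball 0 r ==> \<psi> y \<in> carrier G"
 by (rule plot_carrier[OF psi_plot])

lemma U0_open: "openin (mtop M) U0"
 unfolding U0_def by (rule psi_open) auto

lemma psi_phi: "x \<in> U0 ==> \<psi> (\<phi> x) = x" and phi_ball: "x \<in> U0 ==> \<phi> x \<in> ball 0 r"
 using phi_psi by (auto simp: U0_def)

lemma one_U0: "\<one> \<in> U0"
 using imageI[of 0 "ball 0 r" \<psi>] psi_0 r_pos by (simp add: U0_def)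

lemma phi_1: "\<phi> \<one> = 0"
 using phi_psi[of 0] psi_0 r_pos by simp

lemma zero_ball: "0 \<in> ball (0::'e) r"
 using r_pos by simp

lemma phi_plot:
 assumes p: "plot M S p"
 shows "smooth_on {s \<in> S. p s \<in> U0} (\<lambda>s. \<phi> (p s))"
proof -
 obtain U \<phi>0 where c: "(U, \<phi>0) \<in> atlas M" "U0 \<subseteq> U" "smooth_on (\<phi>0 ` U0) (\<lambda>z. \<phi> (inv_into U \<phi>0 z))"
  using phi_chart by (auto simp: U0_def)
 note cU = good_atlas_chart[OF gM c(1)]
 have op: "open {s \<in> S. p s \<in> U0}" by (rule plot_preimage_open[OF p U0_open])
 have "smooth_on {s \<in> S. p s \<in> U0} (\<lambda>s. \<phi>0 (p s))"
  using c(2) by (intro smooth_on_subset[OF plot_chart_smooth[OF p gM c(1)]]) blast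
 from smooth_on_compose[OF op cU(3)[OF U0_open c(2)] this _ c(3)]
 have s: "smooth_on {s \<in> S. p s \<in> U0} (\<lambda>s. \<phi> (inv_into U \<phi>0 (\<phi>0 (p s))))" by blast
 have "inv_into U \<phi>0 (\<phi>0 (p s)) = p s" if "p s \<in> U0" for s
  using that c(2) by (intro inv_into_f_f[OF cU(2)]) blast
 then show ?thesis
  by (intro smooth_on_cong[THEN iffD1, OF op _ s]) simp
qed

lemma cont_lmult:
 assumes "x \<in> carrier G"
 shows "continuous_map (mtop M) (mtop M) (\<lambda>y. x \<otimes> y)"
proof -
 have m: "continuous_map (prod_topology (mtop M) (mtop M)) (mtop M) (\<lambda>(x, y). x \<otimes> y)"
  using lie by (simp add: lie_group_def smooth_map_def prod_manifold_def)
 have "continuous_map (mtop M) (prod_topology (mtop M) (mtop M)) (\<lambda>y. (x, y))"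
  using assms topspace_M by (simp add: continuous_map_paired)
 from continuous_map_compose[OF this m] show ?thesis by (simp add: o_def)
qed

lemma lcancel: "x \<in> carrier G ==> y \<in> carrier G ==> x \<otimes> (inv x \<otimes> y) = y"
 "x \<in> carrier G ==> y \<in> carrier G ==> inv x \<otimes> (x \<otimes> y) = y"
 by (simp_all add: m_assoc[symmetric])

lemma open_lmult:
 assumes "x \<in> carrier G" "openin (mtop M) W"
 shows "openin (mtop M) ((\<lambda>y. x \<otimes> y) ` W)"
proof -
 have W: "W \<subseteq> carrier G" using openin_subset[OF assms(2)] topspace_M by simp
 have "(\<lambda>y. x \<otimes> y) ` W = {z \<in> topspace (mtop M). inv x \<otimes> z \<in> W}"
 proof (intro subset_antisym subsetI)
  fix z assume "z \<in> {z \<in> topspace (mtop M). inv x \<otimes> z \<in> W}"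
  then have "x \<otimes> (inv x \<otimes> z) = z" "inv x \<otimes> z \<in> W" using assms(1) by (simp_all add: topspace_M lcancel)
  then show "z \<in> (\<lambda>y. x \<otimes> y) ` W" by (metis imageI)
 next
  fix z assume "z \<in> (\<lambda>y. x \<otimes> y) ` W"
  then obtain y where "y \<in> W" "z = x \<otimes> y" by blast
  then show "z \<in> {z \<in> topspace (mtop M). inv x \<otimes> z \<in> W}"
   using assms(1) subsetD[OF W \<open>y \<in> W\<close>] by (simp add: topspace_M lcancel)
 qed
 then show ?thesis using openin_continuous_map_preimage[OF cont_lmult assms(2)] assms(1) by simp
qed

subsection \<open>Smooth functions and left invariant derivatives\<close>

abbreviation SF :: "('g => real) set" where "SF \<equiv> smooth_functions M"

lemma SF_plot: "F \<in> SF ==> plot M S p ==> smooth_on S (\<lambda>s. F (p s))"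
 by (rule smooth_functions_plot[OF _ _ gM])

lemma SF_0: "F \<in> SF ==> x \<notin> carrier G ==> F x = 0"
 by (simp add: smooth_functions_def topspace_M)

text \<open>Near \<open>x\<close> the map \<open>\<phi> (inv x \<otimes> q)\<close> serves as a
  coordinate and is smooth along every plot, so smoothness in the translated chart transfers to the
  atlas. The neighbourhood may depend on \<open>x\<close> because bump functions are controlled on
  small balls only.\<close>

lemma SF_I:
 assumes F0: "\<And>x. x \<notin> carrier G ==> F x = 0"
  and F: "\<And>x. x \<in> carrier G ==> \<exists>N. open N \<and> 0 \<in> N \<and> N \<subseteq> ball 0 r \<and> smooth_on N (\<lambda>y. F (x \<otimes> \<psi> y))"
 shows "F \<in> SF"
proof (rule smooth_functionsI[OF manifold_M])
 fix U c assume c: "(U, c) \<in> atlas M"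
 note cU = good_atlas_chart[OF gM c] and pU = plot_inv_chart[OF manifold_M c]
 show "smooth_on (c ` U) (\<lambda>y. F (inv_into U c y))"
 proof (rule smooth_on_local)
  fix o0 assume o0: "o0 \<in> c ` U"
  define x where "x = inv_into U c o0"
  have x: "x \<in> carrier G" unfolding x_def by (rule plot_carrier[OF pU o0])
  obtain N where N: "open N" "0 \<in> N" "N \<subseteq> ball 0 r" "smooth_on N (\<lambda>y. F (x \<otimes> \<psi> y))" using F[OF x] by blast
  define q where "q = (\<lambda>s. inv x \<otimes> inv_into U c s)"
  have q: "plot M (c ` U) q"
   unfolding q_def by (intro plot_mult plot_cst pU plot_open[OF pU] inv_closed x)
  let ?N = "{s \<in> c ` U. q s \<in> \<psi> ` N}"
  have oN: "open ?N" by (rule plot_preimage_open[OF q psi_open[OF N(1,3)]])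
  have sub: "\<psi> ` N \<subseteq> U0" using N(3) by (auto simp: U0_def)
  have "smooth_on ?N (\<lambda>s. (\<lambda>y. F (x \<otimes> \<psi> y)) (\<phi> (q s)))"
  proof (rule smooth_on_compose[OF oN N(1) _ _ N(4)])
   show "smooth_on ?N (\<lambda>s. \<phi> (q s))" by (rule smooth_on_subset[OF phi_plot[OF q]]) (use sub in auto)
   show "(\<lambda>s. \<phi> (q s)) ` ?N \<subseteq> N" using N(3) phi_psi by (force simp: subset_iff)
  qed
  then have "smooth_on ?N (\<lambda>s. F (inv_into U c s))"
  proof (rule smooth_on_cong[THEN iffD1, OF oN, rotated])
   fix s assume "s \<in> ?N"
   then have "\<psi> (\<phi> (q s)) = q s" "inv_into U c s \<in> carrier G" using sub psi_phi plot_carrier[OF pU] by auto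
   then show "F (x \<otimes> \<psi> (\<phi> (q s))) = F (inv_into U c s)" using x by (simp add: q_def lcancel)
  qed
  moreover have "o0 \<in> ?N"
  proof -
   have "q o0 = \<psi> 0" using x by (simp add: q_def psi_0 flip: x_def)
   then show ?thesis using o0 N(2) by auto
  qed
  ultimately show "\<exists>T. open T \<and> o0 \<in> T \<and> smooth_on T (\<lambda>y. F (inv_into U c y))" using oN by blast
 qed
qed (use F0 topspace_M in auto)

lemma lpsi_plot: "x \<in> carrier G ==> plot M (ball 0 r) (\<lambda>y. x \<otimes> \<psi> y)"
 by (intro plot_mult plot_cst psi_plot open_ball)

lemma SF_lpsi: "F \<in> SF ==> x \<in> carrier G ==> smooth_on (ball 0 r) (\<lambda>y. F (x \<otimes> \<psi> y))"
 by (rule SF_plot[OF _ lpsi_plot])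

lemma SF_I_ball:
 assumes "\<And>x. x \<notin> carrier G ==> F x = 0"
  and "\<And>x. x \<in> carrier G ==> smooth_on (ball 0 r) (\<lambda>y. F (x \<otimes> \<psi> y))"
 shows "F \<in> SF"
proof (rule SF_I)
 fix x assume "x \<in> carrier G"
 from assms(2)[OF this]
 show "\<exists>N. open N \<and> 0 \<in> N \<and> N \<subseteq> ball 0 r \<and> smooth_on N (\<lambda>y. F (x \<otimes> \<psi> y))"
  using open_ball zero_ball by blast
qed (rule assms(1))

lemma SF_add: assumes "F \<in> SF" "H \<in> SF" shows "F + H \<in> SF"
 by (rule SF_I_ball)
  (simp add: SF_0[OF assms(1)] SF_0[OF assms(2)], unfold plus_fun_apply,
   intro smooth_on_add open_ball SF_lpsi[OF assms(1)] SF_lpsi[OF assms(2)])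

lemma SF_mult: assumes "F \<in> SF" "H \<in> SF" shows "F * H \<in> SF"
 by (rule SF_I_ball)
  (simp add: SF_0[OF assms(1)] SF_0[OF assms(2)], unfold times_fun_apply,
   intro smooth_on_mult open_ball SF_lpsi[OF assms(1)] SF_lpsi[OF assms(2)])

lemma SF_scale: assumes "F \<in> SF" shows "c *\<^sub>R F \<in> SF"
 by (rule SF_I_ball)
  (simp add: SF_0[OF assms(1)] scaleR_fun_def, unfold scaleR_fun_def,
   intro smooth_on_scaleR smooth_on_const open_ball SF_lpsi[OF assms(1)])

lemma SF_zero: "0 \<in> SF"
 by (rule SF_I_ball) (simp_all add: smooth_on_const)

text \<open>The left invariant field with value \<open>v\<close> at the identity. The zeros off
  \<open>SF\<close> and off the group follow the normalisation of vector fields.\<close>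

definition E :: "'e => 'g vfield" where
 "E v F x = (if F \<in> SF \<and> x \<in> carrier G then frechet_derivative (\<lambda>y. F (x \<otimes> \<psi> y)) (at 0) v else 0)"

lemma E_deriv:
 assumes "F \<in> SF" "x \<in> carrier G"
 shows "((\<lambda>y. F (x \<otimes> \<psi> y)) has_derivative (\<lambda>v. E v F x)) (at 0)"
 using smooth_on_has_derivative[OF SF_lpsi[OF assms] zero_ball] assms by (simp add: E_def)

lemma linear_E: "linear (\<lambda>v. E v F x)"
proof (cases "F \<in> SF \<and> x \<in> carrier G")
 case True
 then show ?thesis using has_derivative_linear[OF E_deriv] by blast
next
 case False
 have "E v F x = 0" for v using False by (simp only: E_def if_False)
 then show ?thesis by (simp add: linear_iff)
qed

lemmas E_lin = linear_0[OF linear_E] linear_add[OF linear_E] linear_cmul[OF linear_E] linear_diff[OF linear_E]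
 linear_neg[OF linear_E] linear_sum[OF linear_E]

section \<open>Logarithmic derivatives of plots, that is the pulled-back Maurer-Cartan form\<close>

definition mc :: "('f::euclidean_space => 'g) => 'f => 'f => 'e" where
 "mc p s d = frechet_derivative (\<lambda>s'. \<phi> (inv (p s) \<otimes> p s')) (at s) d"

lemma mc_domain:
 assumes p: "plot M S p"
 shows "plot M (S \<times> S) (\<lambda>z. inv (p (fst z)) \<otimes> p (snd z))"
  and "open {z \<in> S \<times> S. inv (p (fst z)) \<otimes> p (snd z) \<in> U0}"
  and "s \<in> S ==> (s, s) \<in> {z \<in> S \<times> S. inv (p (fst z)) \<otimes> p (snd z) \<in> U0}"
  and "smooth_on {z \<in> S \<times> S. inv (p (fst z)) \<otimes> p (snd z) \<in> U0} (\<lambda>(s, s'). \<phi> (inv (p s) \<otimes> p s'))"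
proof -
 show 1: "plot M (S \<times> S) (\<lambda>z. inv (p (fst z)) \<otimes> p (snd z))"
  by (intro plot_mult plot_inv plot_fst plot_snd p plot_open[OF p])
 show "open {z \<in> S \<times> S. inv (p (fst z)) \<otimes> p (snd z) \<in> U0}" by (rule plot_preimage_open[OF 1 U0_open])
 show "smooth_on {z \<in> S \<times> S. inv (p (fst z)) \<otimes> p (snd z) \<in> U0} (\<lambda>(s, s'). \<phi> (inv (p s) \<otimes> p s'))"
  using phi_plot[OF 1] by (simp add: case_prod_unfold)
 show "s \<in> S ==> (s, s) \<in> {z \<in> S \<times> S. inv (p (fst z)) \<otimes> p (snd z) \<in> U0}"
  using plot_carrier[OF p] one_U0 by simp
qed

lemma mc_deriv:
 assumes p: "plot M S p" and s: "s \<in> S"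
 shows "((\<lambda>s'. \<phi> (inv (p s) \<otimes> p s')) has_derivative mc p s) (at s)"
proof -
 have "((\<lambda>s'. (s, s')) has_derivative (\<lambda>v. (0, v))) (at s)" by (auto intro!: derivative_eq_intros)
 from has_derivative_compose[OF this smooth_on_has_derivative[OF mc_domain(4)[OF p] mc_domain(3)[OF p s]]]
 have "(\<lambda>s'. \<phi> (inv (p s) \<otimes> p s')) differentiable (at s)" by (auto simp: differentiable_def)
 moreover have "mc p s = frechet_derivative (\<lambda>s'. \<phi> (inv (p s) \<otimes> p s')) (at s)"
  by (rule ext) (rule mc_def)
 ultimately show ?thesis by (simp only: frechet_derivative_works)
qed

lemma linear_mc: "plot M S p ==> s \<in> S ==> linear (mc p s)"
 by (rule has_derivative_linear[OF mc_deriv])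

text \<open>\<open>mc p s\<close> is a partial derivative, on the diagonal, of a function of two
  points; keeping both variables apart makes the dependence on \<open>s\<close> visibly
  smooth.\<close>

lemma mc_smooth:
 assumes p: "plot M S p"
 shows "smooth_on S (\<lambda>s. mc p s d)"
proof -
 let ?O = "{z \<in> S \<times> S. inv (p (fst z)) \<otimes> p (snd z) \<in> U0}"
 let ?f = "\<lambda>(s, s'). \<phi> (inv (p s) \<otimes> p s')"
 note O = mc_domain[OF p]
 have S: "open S" by (rule plot_open[OF p])
 have "smooth_on S (\<lambda>s. (\<lambda>z. frechet_derivative ?f (at z) (0, d)) (s, s))"
  by (rule smooth_on_compose[OF S O(2) smooth_on_Pair[OF S smooth_on_ident[OF S] smooth_on_ident[OF S]] _
     smooth_on_frechet_derivative[OF O(4)]]) (use O(3) in blast)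
 then show ?thesis
  by (rule smooth_on_cong[THEN iffD1, OF S, rotated])
   (simp add: mc_def smooth_on_partial_snd[OF O(2,4,3)])
qed

lemma mc_cong:
 assumes "open S" "s \<in> S" "\<And>s. s \<in> S ==> p s = q s"
 shows "mc p s d = mc q s d"
 unfolding mc_def using assms(2,3)
 by (intro fun_cong[OF frechet_derivative_cong_on[OF assms(1,2)]]) simp

lemma mc_lmult:
 assumes p: "plot M S p" and s: "s \<in> S" and g: "g \<in> carrier G"
 shows "mc (\<lambda>s. g \<otimes> p s) s d = mc p s d"
proof -
 have "inv (g \<otimes> p s) \<otimes> (g \<otimes> p s') = inv (p s) \<otimes> p s'" if "s' \<in> S" for s'
  using plot_carrier[OF p] s that g by (simp add: inv_mult_group m_assoc lcancel)
 then show ?thesis unfolding mc_def by (intro fun_cong[OF frechet_derivative_cong_on[OF plot_open[OF p] s]]) simp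
qed

text \<open>Near \<open>s\<close> the plot is \<open>p s\<close> times \<open>\<psi>\<close> of its
  coordinate relative to \<open>p s\<close>, so the ordinary chain rule applies with inner
  derivative \<open>mc p s\<close>.\<close>

lemma SF_chain:
 assumes F: "F \<in> SF" and p: "plot M S p" and s: "s \<in> S"
 shows "((\<lambda>s'. F (p s')) has_derivative (\<lambda>d. E (mc p s d) F (p s))) (at s)"
proof -
 have ps: "p s \<in> carrier G" by (rule plot_carrier[OF p s])
 let ?q = "\<lambda>s'. inv (p s) \<otimes> p s'"
 have q: "plot M S ?q" by (intro plot_mult plot_cst inv_closed ps p plot_open[OF p])
 let ?N = "{s' \<in> S. ?q s' \<in> U0}"
 have N: "open ?N" "s \<in> ?N" using plot_preimage_open[OF q U0_open] s ps one_U0 by auto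
 have "((\<lambda>y. F (p s \<otimes> \<psi> y)) has_derivative (\<lambda>v. E v F (p s))) (at (\<phi> (?q s)))"
  using E_deriv[OF F ps] ps by (simp add: phi_1)
 from has_derivative_compose[OF mc_deriv[OF p s] this]
 show ?thesis
 proof (rule has_derivative_transform_within_open[OF _ N])
  fix s' assume "s' \<in> ?N"
  then show "F (p s \<otimes> \<psi> (\<phi> (?q s'))) = F (p s')"
   using psi_phi ps plot_carrier[OF p] by (simp add: lcancel)
 qed
qed

lemma E_SF: "E v F \<in> SF"
proof (cases "F \<in> SF")
 case F: True
 show ?thesis
 proof (rule SF_I_ball)
  fix x assume x: "x \<in> carrier G"
  let ?B = "ball (0::'e) r"
  let ?f = "\<lambda>(y, z). F (x \<otimes> \<psi> y \<otimes> \<psi> z)"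
  have B: "open (?B \<times> ?B)" by (intro open_Times) auto
  have "plot M (?B \<times> ?B) (\<lambda>w. x \<otimes> \<psi> (fst w) \<otimes> \<psi> (snd w))"
   by (intro plot_mult plot_cst[OF B x] plot_fst plot_snd psi_plot open_ball)
  from SF_plot[OF F this] have f: "smooth_on (?B \<times> ?B) ?f" by (simp add: case_prod_unfold)
  have "smooth_on ?B (\<lambda>y. (\<lambda>w. frechet_derivative ?f (at w) (0, v)) (y, 0))"
   by (rule smooth_on_compose[OF open_ball B smooth_on_Pair[OF open_ball smooth_on_ident[OF open_ball] smooth_on_const[OF open_ball]]
      _ smooth_on_frechet_derivative[OF f]]) (use r_pos in auto)
  then show "smooth_on ?B (\<lambda>y. E v F (x \<otimes> \<psi> y))"
  proof (rule smooth_on_cong[THEN iffD1, OF open_ball, rotated])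
   fix y assume y: "y \<in> ?B"
   then have "(y, 0) \<in> ?B \<times> ?B" using r_pos by simp
   from smooth_on_partial_snd[OF B f this, of v]
   show "frechet_derivative ?f (at (y, 0)) (0, v) = E v F (x \<otimes> \<psi> y)"
    using F x psi_carrier[OF y] by (simp add: E_def)
  qed
 qed (simp add: E_def)
next
 case False
 then have "E v F = 0" by (auto simp: E_def)
 then show ?thesis by (simp add: SF_zero)
qed

lemma E_add: "F \<in> SF ==> H \<in> SF ==> E v (F + H) x = E v F x + E v H x"
 and E_scale: "F \<in> SF ==> E v (c *\<^sub>R F) x = c * E v F x"
 and E_mult: "F \<in> SF ==> H \<in> SF ==> E v (F * H) x = E v F x * H x + F x * E v H x"
proof -
 assume F: "F \<in> SF"
 show "E v (c *\<^sub>R F) x = c * E v F x"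
 proof (cases "x \<in> carrier G")
  case x: True
  have "((\<lambda>y. (c *\<^sub>R F) (x \<otimes> \<psi> y)) has_derivative (\<lambda>v. c * E v F x)) (at 0)"
   unfolding scaleR_fun_def real_scaleR_def by (intro has_derivative_mult_right E_deriv F x)
  from fun_cong[OF has_derivative_unique[OF this E_deriv[OF SF_scale[OF F] x]], of v] show ?thesis by simp
 qed (simp add: E_def)
 assume H: "H \<in> SF"
 show "E v (F + H) x = E v F x + E v H x"
 proof (cases "x \<in> carrier G")
  case x: True
  have "((\<lambda>y. (F + H) (x \<otimes> \<psi> y)) has_derivative (\<lambda>v. E v F x + E v H x)) (at 0)"
   unfolding plus_fun_apply by (intro has_derivative_add E_deriv F H x)
  from fun_cong[OF has_derivative_unique[OF this E_deriv[OF SF_add[OF F H] x]], of v] show ?thesis by simp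
 qed (simp add: E_def)
 show "E v (F * H) x = E v F x * H x + F x * E v H x"
 proof (cases "x \<in> carrier G")
  case x: True
  have "((\<lambda>y. (F * H) (x \<otimes> \<psi> y)) has_derivative (\<lambda>v. F (x \<otimes> \<psi> 0) * E v H x + E v F x * H (x \<otimes> \<psi> 0))) (at 0)"
   unfolding times_fun_apply by (intro has_derivative_mult E_deriv F H x)
  from fun_cong[OF has_derivative_unique[OF this E_deriv[OF SF_mult[OF F H] x]], of v] show ?thesis
   using x by (simp add: psi_0)
 qed (simp add: E_def SF_0[OF F] SF_0[OF H])
qed

lemma E_zero: "F \<notin> SF ==> E v F = 0"
 by (auto simp: E_def)

lemma E_vector_field: "E v \<in> vector_fields M"
 unfolding vector_fields_def linear_on_def
 by (auto simp: E_SF E_zero fun_eq_iff E_add E_scale E_mult scaleR_fun_apply)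

lemma left_translate_SF:
 assumes a: "a \<in> carrier G" and F: "F \<in> SF"
 shows "left_translate G a F \<in> SF"
proof (rule SF_I_ball)
 fix x assume x: "x \<in> carrier G"
 have "smooth_on (ball 0 r) (\<lambda>y. F ((a \<otimes> x) \<otimes> \<psi> y))" using SF_lpsi[OF F] a x by simp
 then show "smooth_on (ball 0 r) (\<lambda>y. left_translate G a F (x \<otimes> \<psi> y))"
  by (rule smooth_on_cong[THEN iffD1, OF open_ball, rotated]) (use a x psi_carrier in \<open>simp add: left_translate_def m_assoc\<close>)
qed (simp add: left_translate_def)

lemma E_left_translate:
 assumes a: "a \<in> carrier G" and F: "F \<in> SF" and x: "x \<in> carrier G"
 shows "E v (left_translate G a F) x = E v F (a \<otimes> x)"
proof -
 have "((\<lambda>y. F ((a \<otimes> x) \<otimes> \<psi> y)) has_derivative (\<lambda>v. E v F (a \<otimes> x))) (at 0)"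
  by (rule E_deriv) (use a x F in auto)
 then have "((\<lambda>y. left_translate G a F (x \<otimes> \<psi> y)) has_derivative (\<lambda>v. E v F (a \<otimes> x))) (at 0)"
  by (rule has_derivative_transform_within_open[OF _ open_ball zero_ball])
   (use a x psi_carrier in \<open>simp add: left_translate_def m_assoc\<close>)
 from fun_cong[OF has_derivative_unique[OF this E_deriv[OF left_translate_SF[OF a F] x]], of v] show ?thesis by simp
qed

lemma E_lie_algebra: "E v \<in> lie_algebra G M"
proof -
 have "E v (left_translate G a F) = left_translate G a (E v F)" if "a \<in> carrier G" "F \<in> SF" for a F
  using E_left_translate[OF that] by (intro ext) (simp add: left_translate_def E_def)
 then show ?thesis by (simp add: lie_algebra_def E_vector_field)
qed

end

subsection \<open>Point derivations\<close>

lemma linear_on_sum: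
 assumes "linear_on C D" and "0 \<in> C" "\<And>f g. f \<in> C ==> g \<in> C ==> f + g \<in> C"
  and "\<And>i. i \<in> I ==> f i \<in> C" and "finite I"
 shows "(\<Sum>i\<in>I. f i) \<in> C \<and> D (\<Sum>i\<in>I. f i) = (\<Sum>i\<in>I. D (f i))"
 using assms(5,4)
proof (induction I rule: finite_induct)
 case empty
 have "D (0 *\<^sub>R 0) = 0 *\<^sub>R D 0" using assms(1,2) unfolding linear_on_def by blast
 then show ?case using assms(2) by simp
next
 case (insert i I)
 have "D (f i + (\<Sum>i\<in>I. f i)) = D (f i) + D (\<Sum>i\<in>I. f i)"
  using assms(1) insert unfolding linear_on_def by blast
 then show ?case using insert assms(3) by simp
qed

lemma sum_fun_apply: "(\<Sum>i\<in>I. f i) x = (\<Sum>i\<in>I. f i x)"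
 by (induction I rule: infinite_finite_induct) auto

context lie_chart begin

lemma small_words:
 fixes p :: "'f::euclidean_space => 'g"
 assumes "plot M S p" "0 \<in> S" "openin (mtop M) W" "p 0 \<in> W"
 obtains \<rho> where "\<rho> > 0" "\<And>s. s \<in> ball 0 \<rho> ==> s \<in> S \<and> p s \<in> W"
proof -
 have "open {s \<in> S. p s \<in> W}" "0 \<in> {s \<in> S. p s \<in> W}"
  using assms by (auto intro: plot_preimage_open)
 then obtain \<rho> where "\<rho> > 0" "ball 0 \<rho> \<subseteq> {s \<in> S. p s \<in> W}" using open_contains_ball by blast
 then show ?thesis using that[of \<rho>] by blast
qed

lemma psi_linear_plot:
 fixes h :: "'f::euclidean_space => 'e"
 assumes "bounded_linear h" "\<And>z. norm (h z) \<le> norm z"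
 shows "plot M (ball 0 r) (\<lambda>z. \<psi> (h z))"
proof (rule plot_comp[OF psi_plot])
 show "smooth_on (ball 0 r) h" by (rule smooth_on_linear[OF open_ball assms(1) smooth_on_ident[OF open_ball]])
 show "h ` ball 0 r \<subseteq> ball 0 r" using assms(2) by (auto intro: le_less_trans[OF assms(2)])
qed simp

text \<open>Continuity of a group word at the identity. Four slots allow comparing two elements of
  \<open>\<Gamma>\<close> that relate points of one small translate to points of another.\<close>

lemma small_translates:
 assumes W: "openin (mtop M) W" "\<one> \<in> W" and x0: "x0 \<in> carrier G"
 obtains \<rho> where "0 < \<rho>" "\<rho> \<le> r"
  "\<And>y1 y2 y3 y4. [| y1 \<in> ball 0 \<rho>; y2 \<in> ball 0 \<rho>; y3 \<in> ball 0 \<rho>; y4 \<in> ball 0 \<rho> |] ==>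
    x0 \<otimes> \<psi> y1 \<otimes> inv (\<psi> y2) \<otimes> \<psi> y3 \<otimes> inv (\<psi> y4) \<otimes> inv x0 \<in> W"
proof -
 let ?B = "ball 0 r :: ('e \<times> 'e \<times> 'e \<times> 'e) set"
 let ?p = "\<lambda>z :: 'e \<times> 'e \<times> 'e \<times> 'e. x0 \<otimes> \<psi> (fst z) \<otimes> inv (\<psi> (fst (snd z))) \<otimes> \<psi> (fst (snd (snd z)))
    \<otimes> inv (\<psi> (snd (snd (snd z)))) \<otimes> inv x0"
 have n: "norm (fst z) \<le> norm z" "norm (snd z) \<le> norm z" for z :: "'a::real_normed_vector \<times> 'b::real_normed_vector"
  using norm_fst_le[of "fst z" "snd z"] norm_snd_le[of "snd z" "fst z"] by simp_all
 note bf = bounded_linear_fst and bs = bounded_linear_snd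
 have p1: "plot M ?B (\<lambda>z. \<psi> (fst z))" by (rule psi_linear_plot[OF bf n(1)])
 have p2: "plot M ?B (\<lambda>z. \<psi> (fst (snd z)))"
  by (rule psi_linear_plot[OF bounded_linear_compose[OF bf bs] order_trans[OF n(1) n(2)]])
 have p3: "plot M ?B (\<lambda>z. \<psi> (fst (snd (snd z))))"
  by (rule psi_linear_plot[OF bounded_linear_compose[OF bf bounded_linear_compose[OF bs bs]]
     order_trans[OF n(1) order_trans[OF n(2) n(2)]]])
 have p4: "plot M ?B (\<lambda>z. \<psi> (snd (snd (snd z))))"
  by (rule psi_linear_plot[OF bounded_linear_compose[OF bs bounded_linear_compose[OF bs bs]]
     order_trans[OF n(2) order_trans[OF n(2) n(2)]]])
 have p: "plot M ?B ?p"
  by (rule plot_mult[OF plot_mult[OF plot_mult[OF plot_mult[OF plot_mult[OF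
     plot_cst[OF open_ball x0] p1] plot_inv[OF p2]] p3] plot_inv[OF p4]] plot_cst[OF open_ball inv_closed[OF x0]]])
 have z0: "0 \<in> ?B" using r_pos by simp
 have pz: "?p 0 \<in> W" using x0 W(2) by (simp add: psi_0)
 from small_words[OF p z0 W(1) pz]
 obtain \<rho> where \<rho>: "\<rho> > 0" "\<And>z. z \<in> ball 0 \<rho> ==> z \<in> ?B \<and> ?p z \<in> W" by blast
 \<comment> \<open>The norm of a quadruple is at most the sum of the four norms, hence the
   quarter.\<close>
 show ?thesis
 proof (rule that[of "min r (\<rho> / 4)"])
  fix y1 y2 y3 y4 :: 'e assume y: "y1 \<in> ball 0 (min r (\<rho> / 4))" "y2 \<in> ball 0 (min r (\<rho> / 4))"
   "y3 \<in> ball 0 (min r (\<rho> / 4))" "y4 \<in> ball 0 (min r (\<rho> / 4))"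
  have "norm (y1, y2, y3, y4) \<le> norm y1 + (norm y2 + (norm y3 + norm y4))"
   by (intro order_trans[OF norm_Pair_le] add_left_mono norm_Pair_le)
  also have "\<dots> < \<rho>" using y by auto
  finally show "x0 \<otimes> \<psi> y1 \<otimes> inv (\<psi> y2) \<otimes> \<psi> y3 \<otimes> inv (\<psi> y4) \<otimes> inv x0 \<in> W"
   using \<rho>(2)[of "(y1, y2, y3, y4)"] by simp
 qed (use \<rho> r_pos in auto)
qed

lemma Hausdorff_M: "Hausdorff_space (mtop M)"
 using manifold_M by (simp add: smooth_manifold_def)

lemma psi_cball_closed:
 assumes "s < r"
 shows "closedin (mtop M) (\<psi> ` cball 0 s)"
proof -
 have "compactin (top_of_set (ball 0 r)) (cball (0::'e) s)"
  using assms by (auto simp: compactin_subtopology)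
 from image_compactin[OF this plot_continuous[OF psi_plot]]
 show ?thesis by (rule compactin_imp_closedin[OF Hausdorff_M])
qed

text \<open>Two open sets cover the domain: the preimage of the small ball, and that of the
  complement of the closed ball of half the radius, whose image is closed as a compact set in a
  Hausdorff space. On the second the expression is 0.\<close>

lemma bump_extension_smooth:
 assumes q: "plot M S q" and \<rho>: "0 < \<rho>" "\<rho> \<le> r"
  and \<beta>: "smooth_on UNIV \<beta>" "\<And>y. \<rho> / 2 \<le> norm y ==> \<beta> y = 0" and h: "smooth_on (ball 0 \<rho>) h"
 shows "smooth_on S (\<lambda>s. if q s \<in> \<psi> ` ball 0 \<rho> then \<beta> (\<phi> (q s)) * h (\<phi> (q s)) else (0::real))"
proof (rule smooth_on_local)
 fix s assume s: "s \<in> S"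
 let ?K = "\<lambda>s. if q s \<in> \<psi> ` ball 0 \<rho> then \<beta> (\<phi> (q s)) * h (\<phi> (q s)) else (0::real)"
 let ?N1 = "{s \<in> S. q s \<in> \<psi> ` ball 0 \<rho>}" and ?N2 = "{s \<in> S. q s \<in> carrier G - \<psi> ` cball 0 (\<rho> / 2)}"
 have sub: "\<psi> ` ball 0 \<rho> \<subseteq> U0" using \<rho> by (auto simp: U0_def)
 have N1: "open ?N1" by (rule plot_preimage_open[OF q psi_open]) (use \<rho> in auto)
 have "openin (mtop M) (topspace (mtop M) - \<psi> ` cball 0 (\<rho> / 2))"
  using psi_cball_closed[of "\<rho> / 2"] \<rho> by (intro openin_diff) auto
 then have N2: "open ?N2" unfolding topspace_M by (rule plot_preimage_open[OF q])
 have "smooth_on ?N1 (\<lambda>s. \<beta> (\<phi> (q s)) * h (\<phi> (q s)))"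
 proof (rule smooth_on_mult[OF N1])
  have sp: "smooth_on ?N1 (\<lambda>s. \<phi> (q s))" by (rule smooth_on_subset[OF phi_plot[OF q]]) (use sub in auto)
  have im: "(\<lambda>s. \<phi> (q s)) ` ?N1 \<subseteq> ball 0 \<rho>" using phi_psi \<rho> by auto
  show "smooth_on ?N1 (\<lambda>s. \<beta> (\<phi> (q s)))" by (rule smooth_on_compose[OF N1 open_UNIV sp subset_UNIV \<beta>(1)])
  show "smooth_on ?N1 (\<lambda>s. h (\<phi> (q s)))" by (rule smooth_on_compose[OF N1 open_ball sp im h])
 qed
 then have K1: "smooth_on ?N1 ?K" by (rule smooth_on_cong[THEN iffD1, OF N1, rotated]) simp
 have K2: "smooth_on ?N2 ?K"
 proof (rule smooth_on_cong[THEN iffD1, OF N2 _ smooth_on_const[OF N2]])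
  fix s assume s: "s \<in> ?N2"
  show "0 = ?K s"
  proof (cases "q s \<in> \<psi> ` ball 0 \<rho>")
   case True
   then obtain y where y: "y \<in> ball 0 \<rho>" "q s = \<psi> y" by blast
   then have "y \<notin> cball 0 (\<rho> / 2)" using s by auto
   then show ?thesis using \<beta>(2)[of y] y phi_psi[of y] \<rho> by simp
  qed simp
 qed
 have "s \<in> ?N1 \<or> s \<in> ?N2"
 proof (cases "q s \<in> \<psi> ` cball 0 (\<rho> / 2)")
  case True
  moreover have "cball (0::'e) (\<rho> / 2) \<subseteq> ball 0 \<rho>" using \<rho> by auto
  ultimately show ?thesis using s by blast
 next
  case False
  then show ?thesis using s plot_carrier[OF q s] by simp
 qed
 then show "\<exists>T. open T \<and> s \<in> T \<and> smooth_on T ?K" using K1 K2 N1 N2 by blast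
qed

lemma mult_inv_eqI: "[| a \<otimes> b = c; a \<in> carrier G; b \<in> carrier G |] ==> a = c \<otimes> inv b"
 by (metis inv_solve_right m_closed)

text \<open>The trivial subgroup is included, so that functions on the group and on the quotient are
  treated by one construction.\<close>

definition discrete :: "'g set => bool" where
 "discrete \<Gamma> \<longleftrightarrow> subgroup \<Gamma> G \<and> (\<exists>W. openin (mtop M) W \<and> W \<inter> \<Gamma> = {\<one>})"

definition SFI :: "'g set => ('g => real) set" where
 "SFI \<Gamma> = {F \<in> SF. \<forall>\<gamma>\<in>\<Gamma>. \<forall>x\<in>carrier G. F (\<gamma> \<otimes> x) = F x}"

text \<open>\<open>P\<close> extends a function \<open>h\<close> given in the chart at \<open>x0\<close>, multiplied by the cut-off \<open>\<beta>\<close>, periodically.\<close>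

lemma periodic_bump:
 assumes "discrete \<Gamma>" and x0: "x0 \<in> carrier G"
 obtains \<rho> \<beta> P where "0 < \<rho>" "\<rho> \<le> r" "\<And>y::'e. norm y \<le> \<rho> / 4 ==> \<beta> y = (1::real)"
  "\<And>h. smooth_on (ball 0 \<rho>) h ==> P h \<in> SFI \<Gamma>"
  "\<And>h y. y \<in> ball 0 \<rho> ==> P h (x0 \<otimes> \<psi> y) = \<beta> y * h y"
  "\<And>h x. (\<And>\<gamma> y. [| \<gamma> \<in> \<Gamma>; y \<in> ball 0 \<rho> |] ==> x \<noteq> \<gamma> \<otimes> (x0 \<otimes> \<psi> y)) ==> P h x = 0"
proof -
 obtain W where \<Gamma>: "subgroup \<Gamma> G" and W: "openin (mtop M) W" "W \<inter> \<Gamma> = {\<one>}"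
  using assms(1) by (auto simp: discrete_def)
 interpret \<Gamma>: subgroup \<Gamma> G by (rule \<Gamma>)
 have \<Gamma>c: "\<gamma> \<in> carrier G" if "\<gamma> \<in> \<Gamma>" for \<gamma> using that by (rule \<Gamma>.mem_carrier)
 have "\<one> \<in> W" using W(2) by blast
 from small_translates[OF W(1) this x0] obtain \<rho> where \<rho>: "0 < \<rho>" "\<rho> \<le> r"
  and small: "\<And>y1 y2 y3 y4. [| y1 \<in> ball 0 \<rho>; y2 \<in> ball 0 \<rho>; y3 \<in> ball 0 \<rho>; y4 \<in> ball 0 \<rho> |] ==>
    x0 \<otimes> \<psi> y1 \<otimes> inv (\<psi> y2) \<otimes> \<psi> y3 \<otimes> inv (\<psi> y4) \<otimes> inv x0 \<in> W" by metis
 have pc: "\<psi> y \<in> carrier G" if "y \<in> ball 0 \<rho>" for y using that \<rho> by (intro psi_carrier) auto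
 \<comment> \<open>If a small translate of \<open>x\<close> meets the small ball at
   \<open>x0\<close> moved by \<open>\<gamma>\<close> and by \<open>\<gamma>'\<close>, then
   \<open>inv \<gamma> \<otimes> \<gamma>'\<close> is a word of the kind controlled above, lies in
   \<open>W\<close>, and is \<open>\<one>\<close>. So near every point at most one of the moved
   bumps is alive.\<close>
 have key: "\<gamma> = \<gamma>'" if g: "\<gamma> \<in> \<Gamma>" "\<gamma>' \<in> \<Gamma>" and x: "x \<in> carrier G"
  and y: "z \<in> ball 0 \<rho>" "z' \<in> ball 0 \<rho>" "y \<in> ball 0 \<rho>" "y' \<in> ball 0 \<rho>"
  and eq: "x \<otimes> \<psi> z = \<gamma> \<otimes> (x0 \<otimes> \<psi> y)" "x \<otimes> \<psi> z' = \<gamma>' \<otimes> (x0 \<otimes> \<psi> y')" for x \<gamma> \<gamma>' z z' y y'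
 proof -
  note c = pc[OF y(1)] pc[OF y(2)] pc[OF y(3)] pc[OF y(4)] x0 x \<Gamma>c[OF g(1)] \<Gamma>c[OF g(2)]
  have "x = \<gamma> \<otimes> (x0 \<otimes> \<psi> y) \<otimes> inv (\<psi> z)" by (rule mult_inv_eqI[OF eq(1)]) (use c in auto)
  moreover have "\<gamma>' = x \<otimes> \<psi> z' \<otimes> inv (x0 \<otimes> \<psi> y')" by (rule mult_inv_eqI[OF eq(2)[symmetric]]) (use c in auto)
  ultimately have "inv \<gamma> \<otimes> \<gamma>' = x0 \<otimes> \<psi> y \<otimes> inv (\<psi> z) \<otimes> \<psi> z' \<otimes> inv (\<psi> y') \<otimes> inv x0"
   using c by (simp add: m_assoc inv_mult_group lcancel)
  then have "inv \<gamma> \<otimes> \<gamma>' \<in> W" using small[OF y(3,1,2,4)] by simp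
  moreover have "inv \<gamma> \<otimes> \<gamma>' \<in> \<Gamma>" using g by simp
  ultimately have "inv \<gamma> \<otimes> \<gamma>' = \<one>" using W(2) by blast
  then have "\<gamma> \<otimes> (inv \<gamma> \<otimes> \<gamma>') = \<gamma>" using c by simp
  then show ?thesis using c by (simp add: lcancel)
 qed
 obtain \<beta> :: "'e => real" where \<beta>: "smooth_on UNIV \<beta>" "\<And>x. norm x \<le> \<rho> / 4 ==> \<beta> x = 1" "\<And>x. \<rho> / 2 \<le> norm x ==> \<beta> x = 0"
  using bump_function[of "\<rho> / 4" "\<rho> / 2"] \<rho> by auto
 define rel where "rel = (\<lambda>x \<gamma> y. \<gamma> \<in> \<Gamma> \<and> y \<in> ball 0 \<rho> \<and> x = \<gamma> \<otimes> (x0 \<otimes> \<psi> y))"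
 \<comment> \<open>The choice is harmless: by \<open>key\<close> the coordinate of a point relative
   to the moved balls is unique.\<close>
 define P where "P = (\<lambda>h x. if \<exists>\<gamma> y. rel x \<gamma> y then (let y = (SOME y. \<exists>\<gamma>. rel x \<gamma> y) in \<beta> y * h y) else (0::real))"
 have rel_unique: "y = y'" if "rel x \<gamma> y" "rel x \<gamma>' y'" for x \<gamma> \<gamma>' y y'
 proof -
  have xc: "x \<in> carrier G" using that(1) x0 \<Gamma>c pc by (auto simp: rel_def)
  have "\<gamma> = \<gamma>'"
   by (rule key[of \<gamma> \<gamma>' x 0 0 y y']) (use that xc \<rho> in \<open>auto simp: rel_def psi_0\<close>)
  then have "\<psi> y = \<psi> y'" using that x0 \<Gamma>c pc by (auto simp: rel_def)
  then show ?thesis using that phi_psi \<rho> by (metis rel_def mem_ball dual_order.strict_trans1)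
 qed
 have P_rel: "P h x = \<beta> y * h y" if "rel x \<gamma> y" for h x \<gamma> y
 proof -
  have "(SOME y. \<exists>\<gamma>. rel x \<gamma> y) = y"
   using that rel_unique by (intro some_equality) blast+
  then show ?thesis using that by (auto simp: P_def)
 qed
 have P_0: "P h x = 0" if "\<And>\<gamma> y. \<not> rel x \<gamma> y" for h x using that by (auto simp: P_def)
 show ?thesis
 proof (rule that[of \<rho> \<beta> P])
  have inv: "P h (\<gamma> \<otimes> x) = P h x" if g: "\<gamma> \<in> \<Gamma>" and x: "x \<in> carrier G" for h \<gamma> x
  proof (cases "\<exists>\<gamma>' y. rel x \<gamma>' y")
   case True
   then obtain \<gamma>' y where ry: "rel x \<gamma>' y" by blast
   then have "rel (\<gamma> \<otimes> x) (\<gamma> \<otimes> \<gamma>') y" using g x x0 \<Gamma>c pc by (auto simp: rel_def m_assoc)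
   from P_rel[OF this] P_rel[OF ry] show ?thesis by simp
  next
   case False
   have "\<not> rel (\<gamma> \<otimes> x) \<gamma>' y" for \<gamma>' y
   proof
    assume ry: "rel (\<gamma> \<otimes> x) \<gamma>' y"
    then have "\<gamma> \<otimes> x = \<gamma>' \<otimes> (x0 \<otimes> \<psi> y)" by (simp add: rel_def)
    then have "inv \<gamma> \<otimes> (\<gamma> \<otimes> x) = inv \<gamma> \<otimes> (\<gamma>' \<otimes> (x0 \<otimes> \<psi> y))" by simp
    then have "x = inv \<gamma> \<otimes> \<gamma>' \<otimes> (x0 \<otimes> \<psi> y)"
     using g x x0 \<Gamma>c pc ry by (simp add: lcancel m_assoc rel_def)
    then have "rel x (inv \<gamma> \<otimes> \<gamma>') y" using ry g by (simp add: rel_def)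
    then show False using False by blast
   qed
   then show ?thesis using P_0[of x h] P_0[of "\<gamma> \<otimes> x" h] False by metis
  qed
  show "P h (x0 \<otimes> \<psi> y) = \<beta> y * h y" if "y \<in> ball 0 \<rho>" for h y
   by (rule P_rel[of _ \<one>]) (use that x0 pc in \<open>simp add: rel_def\<close>)
  show "P h x = 0" if "\<And>\<gamma> y. [| \<gamma> \<in> \<Gamma>; y \<in> ball 0 \<rho> |] ==> x \<noteq> \<gamma> \<otimes> (x0 \<otimes> \<psi> y)" for h x
   by (rule P_0) (use that in \<open>auto simp: rel_def\<close>)
  fix h :: "'e => real" assume h: "smooth_on (ball 0 \<rho>) h"
  have "P h \<in> SF"
  proof (rule SF_I)
   fix x assume "x \<notin> carrier G"
   then show "P h x = 0" by (intro P_0) (use x0 \<Gamma>c pc in \<open>auto simp: rel_def\<close>)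
  next
   fix x assume x: "x \<in> carrier G"
   have "smooth_on (ball 0 \<rho>) (\<lambda>z. P h (x \<otimes> \<psi> z))"
   proof (cases "\<exists>z1\<in>ball 0 \<rho>. \<exists>\<gamma> y. rel (x \<otimes> \<psi> z1) \<gamma> y")
    case False
    then have "P h (x \<otimes> \<psi> z) = 0" if "z \<in> ball 0 \<rho>" for z using that P_0 by metis
    then show ?thesis by (intro smooth_on_cong[THEN iffD2, OF open_ball _ smooth_on_const[OF open_ball]])
   next
    case True
    then obtain z1 \<gamma>1 y1 where 1: "z1 \<in> ball 0 \<rho>" "rel (x \<otimes> \<psi> z1) \<gamma>1 y1" by blast
    then have g1: "\<gamma>1 \<in> \<Gamma>" "\<gamma>1 \<in> carrier G" using \<Gamma>c by (auto simp: rel_def)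
    define q where "q = (\<lambda>z. inv x0 \<otimes> inv \<gamma>1 \<otimes> (x \<otimes> \<psi> z))"
    have q: "plot M (ball 0 \<rho>) q"
     unfolding q_def using \<rho> x x0 g1(2)
     by (intro plot_mult plot_cst open_ball inv_closed plot_sub[OF psi_plot]) auto
    have rel_q: "rel (x \<otimes> \<psi> z) \<gamma>1 y \<longleftrightarrow> y \<in> ball 0 \<rho> \<and> q z = \<psi> y" if "z \<in> ball 0 \<rho>" for z y
    proof
     assume "rel (x \<otimes> \<psi> z) \<gamma>1 y"
     then show "y \<in> ball 0 \<rho> \<and> q z = \<psi> y"
      using x0 g1(2) pc[of y] by (auto simp: rel_def q_def m_assoc lcancel)
    next
     assume y: "y \<in> ball 0 \<rho> \<and> q z = \<psi> y"
     then have "\<gamma>1 \<otimes> (x0 \<otimes> \<psi> y) = \<gamma>1 \<otimes> (x0 \<otimes> q z)" by simp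
     also have "\<dots> = x \<otimes> \<psi> z" using x0 g1(2) x pc[OF that] by (simp add: q_def m_assoc lcancel)
     finally show "rel (x \<otimes> \<psi> z) \<gamma>1 y" using y g1(1) by (simp add: rel_def)
    qed
    have P_q: "P h (x \<otimes> \<psi> z) = (if q z \<in> \<psi> ` ball 0 \<rho> then \<beta> (\<phi> (q z)) * h (\<phi> (q z)) else 0)"
     if z: "z \<in> ball 0 \<rho>" for z
    proof (cases "q z \<in> \<psi> ` ball 0 \<rho>")
     case True
     then obtain y where y: "y \<in> ball 0 \<rho>" "q z = \<psi> y" by blast
     then have "\<phi> (q z) = y" using phi_psi \<rho> by auto
     moreover have "rel (x \<otimes> \<psi> z) \<gamma>1 y" using rel_q[OF z] y by blast
     ultimately show ?thesis using P_rel True by simp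
    next
     case False
     have "\<not> rel (x \<otimes> \<psi> z) \<gamma> y" for \<gamma> y
     proof
      assume ry: "rel (x \<otimes> \<psi> z) \<gamma> y"
      have "\<gamma>1 = \<gamma>"
       by (rule key[of \<gamma>1 \<gamma> x z1 z y1 y]) (use 1 ry x z in \<open>auto simp: rel_def\<close>)
      then show False using rel_q[OF z, of y] ry False by blast
     qed
     then show ?thesis using P_0 False by simp
    qed
    show ?thesis
     by (rule smooth_on_cong[THEN iffD2, OF open_ball P_q bump_extension_smooth[OF q \<rho> \<beta>(1,3) h]])
   qed
   then show "\<exists>N. open N \<and> 0 \<in> N \<and> N \<subseteq> ball 0 r \<and> smooth_on N (\<lambda>y. P h (x \<otimes> \<psi> y))"
    using \<rho> by (intro exI[of _ "ball 0 \<rho>"]) auto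
  qed
  then show "P h \<in> SFI \<Gamma>" using inv by (simp add: SFI_def)
 qed (use \<rho> \<beta> in auto)
qed

lemma SFI_SF: "F \<in> SFI \<Gamma> ==> F \<in> SF"
 by (simp add: SFI_def)

lemma SFI_add: "F \<in> SFI \<Gamma> ==> H \<in> SFI \<Gamma> ==> F + H \<in> SFI \<Gamma>"
 and SFI_mult: "F \<in> SFI \<Gamma> ==> H \<in> SFI \<Gamma> ==> F * H \<in> SFI \<Gamma>"
 and SFI_scale: "F \<in> SFI \<Gamma> ==> c *\<^sub>R F \<in> SFI \<Gamma>"
 and SFI_zero: "0 \<in> SFI \<Gamma>"
 by (simp_all add: SFI_def SF_add SF_mult SF_scale SF_zero scaleR_fun_apply)

text \<open>The expansion of \<open>f\<close> holds only near \<open>x\<close>; multiplied by bumps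
  it becomes an identity between global periodic functions, to which the product rule applies. The
  coordinates of \<open>a\<close> are the values of \<open>D\<close> on the cut-off coordinate
  functions.\<close>

lemma point_derivation:
 assumes \<Gamma>: "discrete \<Gamma>" and x: "x \<in> carrier G" and D: "linear_on (SFI \<Gamma>) D"
  "\<And>f g. f \<in> SFI \<Gamma> ==> g \<in> SFI \<Gamma> ==> D (f * g) = D f * g x + f x * (D g :: real)"
 shows "\<exists>a. \<forall>f\<in>SFI \<Gamma>. D f = E a f x"
proof -
 obtain \<rho> \<beta> P where P: "0 < \<rho>" "\<rho> \<le> r" "\<And>y::'e. norm y \<le> \<rho> / 4 ==> \<beta> y = (1::real)"
  "\<And>h. smooth_on (ball 0 \<rho>) h ==> P h \<in> SFI \<Gamma>"
  "\<And>h y. y \<in> ball 0 \<rho> ==> P h (x \<otimes> \<psi> y) = \<beta> y * h y"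
  "\<And>h z. (\<And>\<gamma> y. [| \<gamma> \<in> \<Gamma>; y \<in> ball 0 \<rho> |] ==> z \<noteq> \<gamma> \<otimes> (x \<otimes> \<psi> y)) ==> P h z = 0"
  apply (rule periodic_bump[OF \<Gamma> x])
  subgoal premises prems for \<rho> \<beta> P by (rule prems(1)[of \<rho> \<beta> P, OF prems(2-7)])
  done
 have sm: "smooth_on (ball 0 \<rho>) (\<lambda>y. 1::real)" "smooth_on (ball (0::'e) \<rho>) (\<lambda>y. y \<bullet> b)" for b
  by (auto intro!: smooth_on_const smooth_on_inner smooth_on_ident)
 have x0: "P h x = h 0" for h using P(5)[of 0 h] P(1,3) x by (simp add: psi_0)
 define u where "u = P (\<lambda>y. 1)"
 have u: "u \<in> SFI \<Gamma>" "u x = 1" using P(4)[OF sm(1)] x0 by (auto simp: u_def)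
 define a where "a = (\<Sum>b\<in>Basis. D (P (\<lambda>y. y \<bullet> b)) *\<^sub>R b)"
 have "D f = E a f x" if f: "f \<in> SFI \<Gamma>" for f
 proof -
  let ?F = "\<lambda>y. f (x \<otimes> \<psi> y)"
  have smooth: "smooth_on (ball 0 \<rho>) ?F"
   by (rule smooth_on_subset[OF SF_lpsi[OF SFI_SF[OF f] x]]) (use P(2) in auto)
  obtain g where g: "\<And>b. smooth_on (ball 0 \<rho>) (g b)"
   and eq: "\<And>y. y \<in> ball 0 \<rho> ==> ?F y = ?F 0 + (\<Sum>b\<in>Basis. (y \<bullet> b) * g b y)"
   and g0: "\<And>b. g b 0 = frechet_derivative ?F (at 0) b"
   apply (rule Hadamard_lemma[OF smooth P(1)])
   subgoal premises prems for g by (rule prems(1)[of g, OF prems(2-4)])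
   done
  define s where "s b = P (\<lambda>y. y \<bullet> b) * P (g b)" for b
  have s: "s b \<in> SFI \<Gamma>" for b unfolding s_def by (intro SFI_mult P g sm)
  \<comment> \<open>The square of \<open>u\<close> appears since each remainder is a product of two
    functions that both carry the cut-off \<open>\<beta>\<close>. Off the moved balls both sides are
    0.\<close>
  have fun_eq: "u * u * f = f x *\<^sub>R (u * u) + (\<Sum>b\<in>Basis. s b)"
  proof
   fix q
   have "u q * u q * f q = f x * (u q * u q) + (\<Sum>b\<in>Basis. s b q)"
   proof (cases "\<exists>\<gamma>\<in>\<Gamma>. \<exists>y\<in>ball 0 \<rho>. q = \<gamma> \<otimes> (x \<otimes> \<psi> y)")
    case True
    then obtain \<gamma> y where y: "\<gamma> \<in> \<Gamma>" "y \<in> ball 0 \<rho>" "q = \<gamma> \<otimes> (x \<otimes> \<psi> y)" by blast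
    have "x \<otimes> \<psi> y \<in> carrier G" using x psi_carrier[of y] y(2) P(2) by simp
    then have q: "F q = F (x \<otimes> \<psi> y)" if "F \<in> SFI \<Gamma>" for F using that y(1,3) by (simp add: SFI_def)
    have "u q = \<beta> y" using q[OF u(1)] P(5)[OF y(2)] by (simp add: u_def)
    moreover have "s b q = \<beta> y * \<beta> y * ((y \<bullet> b) * g b y)" for b
     using q[OF s[of b]] P(5)[OF y(2)] by (simp add: s_def)
    then have "(\<Sum>b\<in>Basis. s b q) = \<beta> y * \<beta> y * (\<Sum>b\<in>Basis. (y \<bullet> b) * g b y)"
     by (simp only: sum_distrib_left)
    moreover have "f q = f x + (\<Sum>b\<in>Basis. (y \<bullet> b) * g b y)"
     using q[OF f] eq[OF y(2)] x by (simp add: psi_0)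
    ultimately show ?thesis by (simp only: distrib_left mult.commute)
   next
    case False
    then have "P h q = 0" for h by (intro P(6)) blast
    then show ?thesis by (simp add: u_def s_def)
   qed
   then show "(u * u * f) q = (f x *\<^sub>R (u * u) + (\<Sum>b\<in>Basis. s b)) q"
    by (simp add: sum_fun_apply scaleR_fun_apply)
  qed
  have uu: "u * u \<in> SFI \<Gamma>" by (intro SFI_mult u)
  have sum: "(\<Sum>b\<in>Basis. s b) \<in> SFI \<Gamma>" "D (\<Sum>b\<in>Basis. s b) = (\<Sum>b\<in>Basis. D (s b))"
   using linear_on_sum[where f=s and I=Basis, OF D(1) SFI_zero SFI_add s finite_Basis] by auto
  \<comment> \<open>As \<open>u x = 1\<close>, the product rule yields \<open>D f\<close> plus a
    term that occurs on the other side too and cancels; nothing about \<open>D u\<close> has to be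
    known.\<close>
  have "D (u * u) * f x + D f = D (u * u * f)" using D(2)[OF uu f] u(2) by simp
  also have "\<dots> = D (f x *\<^sub>R (u * u)) + D (\<Sum>b\<in>Basis. s b)"
   unfolding fun_eq using D(1) SFI_scale[OF uu] sum(1) unfolding linear_on_def by blast
  also have "D (f x *\<^sub>R (u * u)) = f x *\<^sub>R D (u * u)"
   using D(1) uu unfolding linear_on_def by blast
  finally have "D f = (\<Sum>b\<in>Basis. D (s b))"
   by (simp only: sum(2) real_scaleR_def mult.commute[of "f x"] add_left_cancel)
  moreover have "D (s b) = D (P (\<lambda>y. y \<bullet> b)) * g b 0" for b
   using D(2)[OF P(4)[OF sm(2)] P(4)[OF g], of b b] by (simp add: s_def x0)
  ultimately have "D f = (\<Sum>b\<in>Basis. D (P (\<lambda>y. y \<bullet> b)) * E b f x)"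
   using SFI_SF[OF f] x by (simp add: g0 E_def)
  also have "\<dots> = E a f x" by (simp add: a_def E_lin)
  finally show ?thesis .
 qed
 then show ?thesis by blast
qed

text \<open>The cut-off chart coordinates at \<open>x\<close>, on the ball where the cut-off is 1.
  They read off tangent vectors not only at \<open>x\<close> but at all nearby points, as smoothness
  of components will require.\<close>

lemma local_coordinates:
 assumes \<Gamma>: "discrete \<Gamma>" and x: "x \<in> carrier G"
 obtains \<rho> \<kappa> where "0 < \<rho>" "\<rho> \<le> r" "\<And>b. \<kappa> b \<in> SFI \<Gamma>"
  "\<And>b y d. y \<in> ball 0 \<rho> ==> E (mc \<psi> y d) (\<kappa> b) (x \<otimes> \<psi> y) = d \<bullet> b"
proof -
 obtain \<rho> \<beta> P where P: "0 < \<rho>" "\<rho> \<le> r" "\<And>y::'e. norm y \<le> \<rho> / 4 ==> \<beta> y = (1::real)"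
  "\<And>h. smooth_on (ball 0 \<rho>) h ==> P h \<in> SFI \<Gamma>"
  "\<And>h y. y \<in> ball 0 \<rho> ==> P h (x \<otimes> \<psi> y) = \<beta> y * h y"
  using periodic_bump[OF \<Gamma> x] by metis
 have sub: "ball 0 (\<rho> / 4) \<subseteq> ball (0::'e) \<rho>" "ball 0 (\<rho> / 4) \<subseteq> ball (0::'e) r" using P(1,2) by auto
 have pl: "plot M (ball 0 (\<rho> / 4)) \<psi>" by (rule plot_sub[OF psi_plot open_ball sub(2)])
 have K: "P (\<lambda>y. y \<bullet> b) \<in> SFI \<Gamma>" for b
  by (intro P smooth_on_inner smooth_on_ident smooth_on_const open_ball)
 show ?thesis
 proof (rule that[of "\<rho> / 4" "\<lambda>b. P (\<lambda>y. y \<bullet> b)"])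
  fix b y d :: 'e assume y: "y \<in> ball 0 (\<rho> / 4)"
  let ?K = "P (\<lambda>y. y \<bullet> b)"
  have "((\<lambda>y. ?K (x \<otimes> \<psi> y)) has_derivative (\<lambda>d. E (mc (\<lambda>y. x \<otimes> \<psi> y) y d) ?K (x \<otimes> \<psi> y))) (at y)"
   by (rule SF_chain[OF SFI_SF[OF K] plot_mult[OF plot_cst[OF open_ball x] pl] y])
  moreover have "((\<lambda>y. ?K (x \<otimes> \<psi> y)) has_derivative (\<lambda>d. d \<bullet> b)) (at y)"
  proof (rule has_derivative_transform_within_open[OF _ open_ball y])
   show "((\<lambda>y. y \<bullet> b) has_derivative (\<lambda>d. d \<bullet> b)) (at y)" by (intro has_derivative_inner_left has_derivative_ident)
   show "z \<bullet> b = ?K (x \<otimes> \<psi> z)" if "z \<in> ball 0 (\<rho> / 4)" for z using P(3)[of z] P(5)[of z] that sub(1) by auto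
  qed
  ultimately have "E (mc (\<lambda>y. x \<otimes> \<psi> y) y d) ?K (x \<otimes> \<psi> y) = d \<bullet> b"
   by (rule fun_cong[OF has_derivative_unique])
  then show "E (mc \<psi> y d) ?K (x \<otimes> \<psi> y) = d \<bullet> b" by (simp only: mc_lmult[OF pl y x])
 qed (use P K in auto)
qed

lemma mc_psi: "mc \<psi> 0 v = v"
proof -
 have "frechet_derivative (\<lambda>s'. \<phi> (inv (\<psi> 0) \<otimes> \<psi> s')) (at 0) = frechet_derivative (\<lambda>s'. s') (at 0)"
  by (rule frechet_derivative_cong_on[OF open_ball zero_ball]) (simp add: psi_0 psi_carrier phi_psi del: mem_ball)
 then show ?thesis by (simp add: mc_def)
qed

lemma E_inj_SFI:
 assumes \<Gamma>: "discrete \<Gamma>" and x: "x \<in> carrier G" and eq: "\<And>F. F \<in> SFI \<Gamma> ==> E v F x = E w F x"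
 shows "v = w"
proof (rule euclidean_eqI)
 fix b
 obtain \<rho> \<kappa> where k: "0 < \<rho>" "\<And>b. \<kappa> b \<in> SFI \<Gamma>"
  "\<And>b y d. y \<in> ball 0 \<rho> ==> E (mc \<psi> y d) (\<kappa> b) (x \<otimes> \<psi> y) = d \<bullet> b"
  using local_coordinates[OF \<Gamma> x] by metis
 have "E d (\<kappa> b) x = d \<bullet> b" for d using k(3)[of 0 d b] k(1) x by (simp add: mc_psi psi_0)
 then show "v \<bullet> b = w \<bullet> b" using eq[OF k(2)] by metis
qed

lemma discrete_trivial: "discrete {\<one>}"
 using openin_topspace[of "mtop M"] by (auto simp: discrete_def triv_subgroup topspace_M)

lemma SFI_trivial: "SFI {\<one>} = SF"
 by (auto simp: SFI_def)

lemmas E_inj_pt = E_inj_SFI[OF discrete_trivial, unfolded SFI_trivial]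

text \<open>The bump with value 1 at \<open>x\<close> puts \<open>x'\<close> into the chart ball,
  and the cut-off coordinates then vanish at \<open>x'\<close>. This reduces constancy of
  group-valued curves to constancy of real functions.\<close>

lemma SF_separates:
 assumes x: "x \<in> carrier G" and eq: "\<And>F. F \<in> SF ==> F x = F x'"
 shows "x = x'"
proof -
 obtain \<rho> \<beta> P where P: "0 < \<rho>" "\<rho> \<le> r" "\<And>y::'e. norm y \<le> \<rho> / 4 ==> \<beta> y = (1::real)"
  "\<And>h. smooth_on (ball 0 \<rho>) h ==> P h \<in> SFI {\<one>}"
  "\<And>h y. y \<in> ball 0 \<rho> ==> P h (x \<otimes> \<psi> y) = \<beta> y * h y"
  "\<And>h z. (\<And>\<gamma> y. [| \<gamma> \<in> {\<one>}; y \<in> ball 0 \<rho> |] ==> z \<noteq> \<gamma> \<otimes> (x \<otimes> \<psi> y)) ==> P h z = 0"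
  apply (rule periodic_bump[OF discrete_trivial x])
  subgoal premises prems for \<rho> \<beta> P by (rule prems(1)[of \<rho> \<beta> P, OF prems(2-7)])
  done
 have x0: "P h x' = h 0" if "smooth_on (ball 0 \<rho>) h" for h
  using P(5)[of 0 h] P(1,3) x eq[of "P h"] P(4)[OF that] by (simp add: psi_0 SFI_trivial)
 have 1: "P (\<lambda>y. 1) x' = 1" by (rule x0) (simp add: smooth_on_const)
 then obtain \<gamma> y where y: "\<gamma> \<in> {\<one>}" "y \<in> ball 0 \<rho>" "x' = \<gamma> \<otimes> (x \<otimes> \<psi> y)"
  using P(6)[of x' "\<lambda>y. 1"] by fastforce
 then have x': "x' = x \<otimes> \<psi> y" using x psi_carrier[of y] P(2) by simp
 have \<beta>: "\<beta> y = 1" using P(5)[OF y(2), of "\<lambda>y. 1"] 1 by (simp only: x' mult_1_right)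
 have "y \<bullet> b = 0" for b
  using P(5)[OF y(2), of "\<lambda>y. y \<bullet> b"] x0[of "\<lambda>y. y \<bullet> b"] \<beta>
  by (simp add: x' smooth_on_inner smooth_on_ident smooth_on_const)
 then have "y = 0" by (metis inner_eq_zero_iff)
 then show ?thesis using x' x by (simp add: psi_0)
qed

end

subsection \<open>The Maurer--Cartan form, the adjoint representation and the bracket\<close>

text \<open>Differentiating the Hadamard form twice at 0 gives an expression that is visibly
  symmetric in the two directions.\<close>

lemma mixed_partials:
 fixes f :: "'a::euclidean_space => real"
 assumes S: "open S" "0 \<in> S" and f: "smooth_on S f"
 shows "frechet_derivative (\<lambda>z. frechet_derivative f (at z) v) (at 0) w
    = frechet_derivative (\<lambda>z. frechet_derivative f (at z) w) (at 0) v"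
proof -
 obtain r where r: "r > 0" "ball 0 r \<subseteq> S" using S open_contains_ball by blast
 obtain g where g: "\<And>b. smooth_on (ball 0 r) (g b)"
  and eq: "\<And>y. y \<in> ball 0 r ==> f y = f 0 + (\<Sum>b\<in>Basis. (y \<bullet> b) * g b y)"
  using Hadamard_lemma[OF smooth_on_subset[OF f r(2)] r(1)] by metis
 let ?G = "\<lambda>b v z. frechet_derivative (g b) (at z) v"
 have 0: "0 \<in> ball (0::'a) r" using r by simp
 have d: "frechet_derivative f (at z) v = (\<Sum>b\<in>Basis. (z \<bullet> b) * ?G b v z + (v \<bullet> b) * g b z)"
  if z: "z \<in> ball 0 r" for z v
 proof -
  have "((\<lambda>y. f 0 + (\<Sum>b\<in>Basis. (y \<bullet> b) * g b y)) has_derivative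
    (\<lambda>v. 0 + (\<Sum>b\<in>Basis. (z \<bullet> b) * ?G b v z + (v \<bullet> b) * g b z))) (at z)"
   by (intro has_derivative_add has_derivative_const has_derivative_sum has_derivative_mult
     has_derivative_inner_left has_derivative_ident smooth_on_has_derivative[OF g z])
  from fun_cong[OF frechet_derivative_at[OF this], of v]
  show ?thesis using frechet_derivative_cong_on[OF open_ball z eq] by simp
 qed
 have "frechet_derivative (\<lambda>z. frechet_derivative f (at z) v) (at 0) w
   = (\<Sum>b\<in>Basis. (w \<bullet> b) * ?G b v 0 + (v \<bullet> b) * ?G b w 0)" for v w
 proof -
  have "((\<lambda>z. \<Sum>b\<in>Basis. (z \<bullet> b) * ?G b v z + (v \<bullet> b) * g b z) has_derivative
    (\<lambda>w. \<Sum>b\<in>Basis. ((0 \<bullet> b) * frechet_derivative (?G b v) (at 0) w + (w \<bullet> b) * ?G b v 0) + (v \<bullet> b) * ?G b w 0)) (at 0)"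
   by (intro has_derivative_add has_derivative_sum has_derivative_mult has_derivative_mult_right has_derivative_inner_left
     has_derivative_ident smooth_on_has_derivative[OF g 0] smooth_on_has_derivative[OF smooth_on_frechet_derivative[OF g] 0])
  from fun_cong[OF frechet_derivative_at[OF this], of w]
  show ?thesis using frechet_derivative_cong_on[OF open_ball 0 d] by simp
 qed
 from this[of v w] this[of w v] show ?thesis by (simp only: add.commute)
qed

context lie_chart begin

text \<open>Invariance reduces a field to its point derivation at the identity, which is a
  directional derivative.\<close>

lemma lie_algebra_eq: "lie_algebra G M = range E"
proof (intro subset_antisym subsetI)
 fix X assume X: "X \<in> lie_algebra G M"
 then have Xv: "X \<in> vector_fields M"
  and Xl: "\<And>a F. a \<in> carrier G ==> F \<in> SF ==> X (left_translate G a F) = left_translate G a (X F)"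
  by (auto simp: lie_algebra_def)
 have XSF: "X F \<in> SF" if "F \<in> SF" for F using Xv that by (auto simp: vector_fields_def)
 have "\<exists>v. \<forall>F\<in>SF. X F \<one> = E v F \<one>"
 proof (rule point_derivation[OF discrete_trivial one_closed, where D="\<lambda>F. X F \<one>", unfolded SFI_trivial])
  show "linear_on SF (\<lambda>F. X F \<one>)"
   using Xv by (auto simp: vector_fields_def linear_on_def scaleR_fun_apply)
  show "X (f * g) \<one> = X f \<one> * g \<one> + f \<one> * X g \<one>" if "f \<in> SF" "g \<in> SF" for f g
   using Xv that by (auto simp: vector_fields_def)
 qed
 then obtain v where rep: "\<And>F. F \<in> SF ==> X F \<one> = E v F \<one>" by blast
 have "X F x = E v F x" for F x
 proof (cases "F \<in> SF \<and> x \<in> carrier G")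
  case True
  then have "X F x = X (left_translate G x F) \<one>" using Xl[of x F] by (simp add: left_translate_def)
  also have "\<dots> = E v (left_translate G x F) \<one>" by (rule rep) (use True left_translate_SF in auto)
  also have "\<dots> = E v F x" using E_left_translate[of x F \<one>] True by simp
  finally show ?thesis .
 next
  case False
  then consider "F \<notin> SF" | "F \<in> SF" "x \<notin> carrier G" by blast
  then show ?thesis
  proof cases
   case 1
   then have "X F = 0" using Xv by (auto simp: vector_fields_def)
   then show ?thesis using 1 by (simp add: E_def)
  next
   case 2
   then show ?thesis using SF_0[OF XSF] by (simp add: E_def)
  qed
 qed
 then have "X = E v" by (intro ext)
 then show "X \<in> range E" by blast
qed (use E_lie_algebra in auto)

lemma mc_compose:
 assumes p: "plot M T p" and h: "(h has_derivative h') (at s)" "h s \<in> T"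
 shows "mc (\<lambda>s. p (h s)) s d = mc p (h s) (h' d)"
 unfolding mc_def[of "\<lambda>s. p (h s)"] by (rule frechet_derivative_chain[OF h(1) mc_deriv[OF p h(2)]])

lemma mc_const: "mc (\<lambda>s. x) s d = 0"
 by (simp add: mc_def)

definition Ad :: "'g => 'e => 'e" where
 "Ad g v = mc (\<lambda>y. g \<otimes> \<psi> y \<otimes> inv g) 0 v"

lemma conj_plot: "g \<in> carrier G ==> plot M (ball 0 r) (\<lambda>y. g \<otimes> \<psi> y \<otimes> inv g)"
 by (intro plot_mult plot_cst psi_plot open_ball inv_closed)

lemma linear_Ad: "g \<in> carrier G ==> linear (Ad g)"
 using linear_mc[OF conj_plot zero_ball] by (simp add: Ad_def[abs_def])

text \<open>\<open>inv (p s \<otimes> h) \<otimes> (p s' \<otimes> h)\<close> is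
  \<open>inv (p s) \<otimes> p s'\<close> conjugated by \<open>inv h\<close>.\<close>

lemma mc_rmult:
 assumes p: "plot M S p" and s: "s \<in> S" and h: "h \<in> carrier G"
 shows "mc (\<lambda>s. p s \<otimes> h) s d = Ad (inv h) (mc p s d)"
proof -
 let ?c = "\<lambda>y. inv h \<otimes> \<psi> y \<otimes> inv (inv h)"
 let ?q = "\<lambda>s'. inv (p s) \<otimes> p s'"
 have ps: "p s \<in> carrier G" by (rule plot_carrier[OF p s])
 have q: "plot M S ?q" by (intro plot_mult plot_cst inv_closed ps p plot_open[OF p])
 let ?N = "{s' \<in> S. ?q s' \<in> U0}"
 have N: "open ?N" "s \<in> ?N" using plot_preimage_open[OF q U0_open] s ps one_U0 by auto
 have "((\<lambda>y. \<phi> (inv (?c 0) \<otimes> ?c y)) has_derivative mc ?c 0) (at (\<phi> (?q s)))"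
  using mc_deriv[OF conj_plot[OF inv_closed[OF h]] zero_ball] ps by (simp add: phi_1)
 from frechet_derivative_chain[OF mc_deriv[OF p s] this, of d]
 have "frechet_derivative (\<lambda>s'. \<phi> (inv (?c 0) \<otimes> ?c (\<phi> (?q s')))) (at s) d = Ad (inv h) (mc p s d)"
  by (simp add: Ad_def)
 moreover have "frechet_derivative (\<lambda>s'. \<phi> (inv (?c 0) \<otimes> ?c (\<phi> (?q s')))) (at s)
   = frechet_derivative (\<lambda>s'. \<phi> (inv (p s \<otimes> h) \<otimes> (p s' \<otimes> h))) (at s)"
 proof (rule frechet_derivative_cong_on[OF N])
  fix s' assume s': "s' \<in> ?N"
  then have c: "p s' \<in> carrier G" "\<psi> (\<phi> (?q s')) = ?q s'" using plot_carrier[OF p] psi_phi by auto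
  show "\<phi> (inv (?c 0) \<otimes> ?c (\<phi> (?q s'))) = \<phi> (inv (p s \<otimes> h) \<otimes> (p s' \<otimes> h))"
   using c h ps by (simp add: psi_0 inv_mult_group m_assoc)
 qed
 ultimately show ?thesis by (simp add: mc_def)
qed

text \<open>Separate the two occurrences of \<open>s\<close> and split the derivative on the
  diagonal into partial derivatives: one belongs to a right, the other to a left translation. Smooth
  functions detect the resulting equality of vectors.\<close>

lemma mc_mult:
 assumes p: "plot M S p" and q: "plot M S q" and s: "s \<in> S"
 shows "mc (\<lambda>s. p s \<otimes> q s) s d = Ad (inv (q s)) (mc p s d) + mc q s d"
proof (rule E_inj_pt)
 have c: "p s \<in> carrier G" "q s \<in> carrier G" using plot_carrier p q s by auto
 then show "p s \<otimes> q s \<in> carrier G" by simp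
 fix F assume F: "F \<in> SF"
 have S: "open S" by (rule plot_open[OF p])
 let ?f = "\<lambda>(s1, s2). F (p s1 \<otimes> q s2)"
 have "plot M (S \<times> S) (\<lambda>z. p (fst z) \<otimes> q (snd z))" by (intro plot_mult plot_fst plot_snd p q S)
 from SF_plot[OF F this] have f: "smooth_on (S \<times> S) ?f" by (simp add: case_prod_unfold)
 have SS: "open (S \<times> S)" "(s, s) \<in> S \<times> S" using S s by (auto intro: open_Times)
 let ?D = "frechet_derivative ?f (at (s, s))"
 note D = smooth_on_has_derivative[OF f SS(2)]
 have "((\<lambda>s. (s, s)) has_derivative (\<lambda>d. (d, d))) (at s)" by (auto intro!: derivative_eq_intros)
 from has_derivative_compose[OF this D]
 have "((\<lambda>s'. F (p s' \<otimes> q s')) has_derivative (\<lambda>d. ?D (d, d))) (at s)" by simp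
 from has_derivative_unique[OF this SF_chain[OF F plot_mult[OF p q] s]]
 have "E (mc (\<lambda>s. p s \<otimes> q s) s d) F (p s \<otimes> q s) = ?D (d, d)" by metis
 also have "\<dots> = ?D (d, 0) + ?D (0, d)"
  using linear_add[OF has_derivative_linear[OF D], of "(d, 0)" "(0, d)"] by simp
 also have "?D (d, 0) = frechet_derivative (\<lambda>s1. F (p s1 \<otimes> q s)) (at s) d"
  by (rule smooth_on_partial_fst[OF SS(1) f SS(2), symmetric])
 also have "\<dots> = E (mc (\<lambda>s'. p s' \<otimes> q s) s d) F (p s \<otimes> q s)"
  using frechet_derivative_at[OF SF_chain[OF F plot_mult[OF p plot_cst[OF S c(2)]] s]] by metis
 also have "mc (\<lambda>s'. p s' \<otimes> q s) s d = Ad (inv (q s)) (mc p s d)" by (rule mc_rmult[OF p s c(2)])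
 also have "?D (0, d) = frechet_derivative (\<lambda>s2. F (p s \<otimes> q s2)) (at s) d"
  by (rule smooth_on_partial_snd[OF SS(1) f SS(2), symmetric])
 also have "\<dots> = E (mc (\<lambda>s'. p s \<otimes> q s') s d) F (p s \<otimes> q s)"
  using frechet_derivative_at[OF SF_chain[OF F plot_mult[OF plot_cst[OF S c(1)] q] s]] by metis
 also have "mc (\<lambda>s'. p s \<otimes> q s') s d = mc q s d" by (rule mc_lmult[OF q s c(1)])
 finally show "E (mc (\<lambda>s. p s \<otimes> q s) s d) F (p s \<otimes> q s) = E (Ad (inv (q s)) (mc p s d) + mc q s d) F (p s \<otimes> q s)"
  by (simp add: E_lin)
qed

lemma mc_inv:
 assumes p: "plot M S p" and s: "s \<in> S"
 shows "mc (\<lambda>s. inv (p s)) s d = - Ad (p s) (mc p s d)"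
proof -
 have "mc (\<lambda>s. p s \<otimes> inv (p s)) s d = mc (\<lambda>s. \<one>) s d"
  by (rule mc_cong[OF plot_open[OF p] s]) (use plot_carrier[OF p] in simp)
 then show ?thesis
  using mc_mult[OF p plot_inv[OF p] s, of d] plot_carrier[OF p s] by (simp add: mc_const eq_neg_iff_add_eq_0 add.commute)
qed

lemma mc_conj:
 assumes p: "plot M S p" and s: "s \<in> S" and g: "g \<in> carrier G"
 shows "mc (\<lambda>s. g \<otimes> p s \<otimes> inv g) s d = Ad g (mc p s d)"
 using mc_rmult[OF plot_mult[OF plot_cst[OF plot_open[OF p] g] p] s inv_closed[OF g]] mc_lmult[OF p s g] g by simp

lemma Ad_one: "Ad \<one> v = v"
proof -
 have "Ad \<one> v = mc \<psi> 0 v"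
  unfolding Ad_def by (rule mc_cong[OF open_ball zero_ball]) (simp add: psi_carrier del: mem_ball)
 then show ?thesis by (simp add: mc_psi)
qed

lemma Ad_mult:
 assumes "g \<in> carrier G" "h \<in> carrier G"
 shows "Ad (g \<otimes> h) v = Ad g (Ad h v)"
proof -
 have "Ad (g \<otimes> h) v = mc (\<lambda>y. g \<otimes> (h \<otimes> \<psi> y \<otimes> inv h) \<otimes> inv g) 0 v"
  unfolding Ad_def using assms
  by (intro mc_cong[OF open_ball zero_ball]) (simp add: psi_carrier inv_mult_group m_assoc del: mem_ball)
 also have "\<dots> = Ad g (mc (\<lambda>y. h \<otimes> \<psi> y \<otimes> inv h) 0 v)"
  by (rule mc_conj[OF conj_plot[OF assms(2)] zero_ball assms(1)])
 finally show ?thesis by (simp add: Ad_def[of h])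
qed

lemma Ad_smooth:
 assumes p: "plot M S p"
 shows "smooth_on S (\<lambda>s. Ad (p s) v)"
proof -
 have S: "open S" by (rule plot_open[OF p])
 let ?B = "ball (0::'e) r"
 let ?c = "\<lambda>z. p (fst z) \<otimes> \<psi> (snd z) \<otimes> inv (p (fst z))"
 let ?f = "\<lambda>(s, y). \<phi> (p s \<otimes> \<psi> y \<otimes> inv (p s))"
 have c: "plot M (S \<times> ?B) ?c" by (intro plot_mult plot_inv plot_fst plot_snd p psi_plot S open_ball)
 let ?O = "{z \<in> S \<times> ?B. ?c z \<in> U0}"
 have O: "open ?O" by (rule plot_preimage_open[OF c U0_open])
 have f: "smooth_on ?O ?f" using phi_plot[OF c] by (simp add: case_prod_unfold)
 have sO: "(s, 0) \<in> ?O" if "s \<in> S" for s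
  using that plot_carrier[OF p that] zero_ball one_U0 by (simp add: psi_0)
 have "smooth_on S (\<lambda>s. (\<lambda>z. frechet_derivative ?f (at z) (0, v)) (s, 0))"
  by (rule smooth_on_compose[OF S O smooth_on_Pair[OF S smooth_on_ident[OF S] smooth_on_const[OF S]] _
     smooth_on_frechet_derivative[OF f]]) (use sO in blast)
 then show ?thesis
 proof (rule smooth_on_cong[THEN iffD1, OF S, rotated])
  fix s assume s: "s \<in> S"
  then have ps: "p s \<in> carrier G" by (rule plot_carrier[OF p])
  have "frechet_derivative (\<lambda>y. \<phi> (inv (p s \<otimes> \<psi> 0 \<otimes> inv (p s)) \<otimes> (p s \<otimes> \<psi> y \<otimes> inv (p s)))) (at 0)
    = frechet_derivative (\<lambda>y. \<phi> (p s \<otimes> \<psi> y \<otimes> inv (p s))) (at 0)"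
   using ps by (intro frechet_derivative_cong_on[OF open_ball zero_ball]) (simp add: psi_0 psi_carrier del: mem_ball)
  then show "frechet_derivative ?f (at (s, 0)) (0, v) = Ad (p s) v"
   using smooth_on_partial_snd[OF O f sO[OF s], of v] by (simp add: Ad_def mc_def)
 qed
qed

text \<open>The derivative of \<open>Ad\<close> at the identity, that is \<open>ad\<close>; the
  commutator of the fields \<open>E v\<close> and \<open>E w\<close> is identified with it
  afterwards.\<close>

definition lbr :: "'e => 'e => 'e" where
 "lbr v w = frechet_derivative (\<lambda>y. Ad (\<psi> y) w) (at 0) v"

lemma lbr_deriv: "((\<lambda>y. Ad (\<psi> y) w) has_derivative (\<lambda>v. lbr v w)) (at 0)"
 using smooth_on_has_derivative[OF Ad_smooth[OF psi_plot] zero_ball] by (simp add: lbr_def)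

lemma Ad_deriv:
 assumes p: "plot M S p" and s: "s \<in> S" and ps: "p s = \<one>"
 shows "((\<lambda>s'. Ad (p s') w) has_derivative (\<lambda>d. lbr (mc p s d) w)) (at s)"
proof -
 let ?N = "{s' \<in> S. p s' \<in> U0}"
 have N: "open ?N" "s \<in> ?N" using plot_preimage_open[OF p U0_open] s ps one_U0 by auto
 have "((\<lambda>s'. \<phi> (inv (p s) \<otimes> p s')) has_derivative mc p s) (at s)" by (rule mc_deriv[OF p s])
 then have 1: "((\<lambda>s'. \<phi> (p s')) has_derivative mc p s) (at s)"
  by (rule has_derivative_transform_within_open[OF _ plot_open[OF p] s]) (use plot_carrier[OF p] ps in simp)
 have "((\<lambda>y. Ad (\<psi> y) w) has_derivative (\<lambda>v. lbr v w)) (at (\<phi> (p s)))"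
  using lbr_deriv by (simp add: ps phi_1)
 from has_derivative_compose[OF 1 this] show ?thesis
  by (rule has_derivative_transform_within_open[OF _ N]) (simp add: psi_phi)
qed

lemma E_product_rule:
 assumes F: "F \<in> SF" and x: "x \<in> carrier G" and b: "(b has_derivative b') (at 0)"
 shows "((\<lambda>y. E (b y) F (x \<otimes> \<psi> y)) has_derivative (\<lambda>v. E (b' v) F x + E v (E (b 0) F) x)) (at 0)"
proof -
 have sum: "(\<Sum>c\<in>Basis. (w \<bullet> c) * E c F z) = E w F z" for w z
  using linear_eq_sum_Basis[OF linear_E[of F z], of w] by simp
 have "E (b 0) F = (\<Sum>c\<in>Basis. (b 0 \<bullet> c) *\<^sub>R E c F)"
  by (intro ext) (simp add: sum_fun_apply scaleR_fun_apply sum)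
 moreover have "linear_on SF (\<lambda>H. E v H x)" for v by (auto simp: linear_on_def E_add E_scale)
 from linear_on_sum[OF this SF_zero SF_add, of Basis "\<lambda>c. (b 0 \<bullet> c) *\<^sub>R E c F"]
 have "E v (\<Sum>c\<in>Basis. (b 0 \<bullet> c) *\<^sub>R E c F) x = (\<Sum>c\<in>Basis. E v ((b 0 \<bullet> c) *\<^sub>R E c F) x)" for v
  by (simp add: SF_scale E_SF)
 ultimately have E0: "E v (E (b 0) F) x = (\<Sum>c\<in>Basis. (b 0 \<bullet> c) * E v (E c F) x)" for v
  by (simp add: E_scale E_SF)
 have "((\<lambda>y. \<Sum>c\<in>Basis. (b y \<bullet> c) * E c F (x \<otimes> \<psi> y)) has_derivative
   (\<lambda>v. \<Sum>c\<in>Basis. (b 0 \<bullet> c) * E v (E c F) x + (b' v \<bullet> c) * E c F (x \<otimes> \<psi> 0))) (at 0)"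
  by (intro has_derivative_sum has_derivative_mult has_derivative_inner_left b E_deriv[OF E_SF x])
 moreover have "(\<lambda>v. \<Sum>c\<in>Basis. (b 0 \<bullet> c) * E v (E c F) x + (b' v \<bullet> c) * E c F (x \<otimes> \<psi> 0))
   = (\<lambda>v. E (b' v) F x + E v (E (b 0) F) x)"
  using x by (simp add: psi_0 sum.distrib sum E0 add.commute)
 ultimately show ?thesis by (simp only: sum)
qed

text \<open>Both iterated derivatives are mixed partials of \<open>F (x \<psi>(z) \<psi>(y))\<close>, but in the second
 one \<open>\<psi>(z)\<close> has to be moved past \<open>\<psi>(y)\<close>.\<close>

lemma E_commutator:
 assumes F: "F \<in> SF" and x: "x \<in> carrier G"
 shows "E v (E w F) x - E w (E v F) x = E (lbr v w) F x"
proof -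
 let ?B = "ball (0::'e) r"
 let ?f = "\<lambda>(z, y). F (x \<otimes> \<psi> z \<otimes> \<psi> y)"
 have xp: "plot M ?B (\<lambda>z. x \<otimes> \<psi> z)" by (rule lpsi_plot[OF x])
 have S: "open (?B \<times> ?B)" by (intro open_Times open_ball)
 have S0: "(z, 0) \<in> ?B \<times> ?B" "(0, z) \<in> ?B \<times> ?B" if "z \<in> ?B" for z using that r_pos by auto
 have "plot M (?B \<times> ?B) (\<lambda>z. x \<otimes> \<psi> (fst z) \<otimes> \<psi> (snd z))"
  by (intro plot_mult plot_cst S x plot_fst plot_snd psi_plot open_ball)
 from SF_plot[OF F this] have f: "smooth_on (?B \<times> ?B) ?f" by (simp add: case_prod_unfold)
 have f': "smooth_on (?B \<times> ?B) (\<lambda>(z, y). frechet_derivative ?f (at (z, y)) u)" for u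
  using smooth_on_frechet_derivative[OF f, of u] by (simp add: case_prod_unfold)
 have e1: "frechet_derivative ?f (at (z, 0)) (0, v) = E v F (x \<otimes> \<psi> z)" if z: "z \<in> ?B" for z
  using smooth_on_partial_snd[OF S f S0(1)[OF z], of v] F x psi_carrier[OF z] by (simp add: E_def)
 have e2: "frechet_derivative ?f (at (0, y)) (w, 0) = E (Ad (inv (\<psi> y)) w) F (x \<otimes> \<psi> y)" if y: "y \<in> ?B" for y
 proof -
  have c: "\<psi> y \<in> carrier G" by (rule psi_carrier[OF y])
  have "frechet_derivative ?f (at (0, y)) (w, 0) = frechet_derivative (\<lambda>z. F (x \<otimes> \<psi> z \<otimes> \<psi> y)) (at 0) w"
   by (rule smooth_on_partial_fst[OF S f S0(2)[OF y], symmetric])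
  also have "\<dots> = E (mc (\<lambda>z. x \<otimes> \<psi> z \<otimes> \<psi> y) 0 w) F (x \<otimes> \<psi> 0 \<otimes> \<psi> y)"
   using frechet_derivative_at[OF SF_chain[OF F plot_mult[OF xp plot_cst[OF open_ball c]] zero_ball]] by metis
  finally show ?thesis
   using mc_rmult[OF xp zero_ball c, of w] mc_lmult[OF psi_plot zero_ball x, of w] x by (simp add: mc_psi psi_0)
 qed
 have "frechet_derivative (\<lambda>z. frechet_derivative ?f (at z) (0, v)) (at (0, 0)) (w, 0)
   = frechet_derivative (\<lambda>z. frechet_derivative ?f (at (z, 0)) (0, v)) (at 0) w"
  using smooth_on_partial_fst[OF S f' S0(1)[OF zero_ball], of "(0, v)" w] by (simp add: case_prod_unfold)
 also have "\<dots> = frechet_derivative (\<lambda>z. E v F (x \<otimes> \<psi> z)) (at 0) w"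
  by (intro fun_cong[OF frechet_derivative_cong_on[OF open_ball zero_ball]] e1)
 also have "\<dots> = E w (E v F) x" using x by (simp add: E_def[of w] E_SF)
 finally have m1: "frechet_derivative (\<lambda>z. frechet_derivative ?f (at z) (0, v)) (at (0, 0)) (w, 0) = E w (E v F) x" .
 have "((\<lambda>y. Ad (inv (\<psi> y)) w) has_derivative (\<lambda>d. lbr (mc (\<lambda>y. inv (\<psi> y)) 0 d) w)) (at 0)"
  by (rule Ad_deriv[OF plot_inv[OF psi_plot] zero_ball]) (simp add: psi_0)
 moreover have "mc (\<lambda>y. inv (\<psi> y)) 0 d = - d" for d
  using mc_inv[OF psi_plot zero_ball, of d] by (simp add: psi_0 Ad_one mc_psi)
 ultimately have "((\<lambda>y. Ad (inv (\<psi> y)) w) has_derivative (\<lambda>d. lbr (- d) w)) (at 0)" by simp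
 from fun_cong[OF frechet_derivative_at[OF E_product_rule[OF F x this]], of v]
 have "frechet_derivative (\<lambda>y. E (Ad (inv (\<psi> y)) w) F (x \<otimes> \<psi> y)) (at 0) v = E v (E w F) x - E (lbr v w) F x"
  by (simp add: psi_0 Ad_one linear_neg[OF has_derivative_linear[OF lbr_deriv]] E_lin)
 moreover have "frechet_derivative (\<lambda>z. frechet_derivative ?f (at z) (w, 0)) (at (0, 0)) (0, v)
   = frechet_derivative (\<lambda>y. frechet_derivative ?f (at (0, y)) (w, 0)) (at 0) v"
  using smooth_on_partial_snd[OF S f' S0(2)[OF zero_ball], of "(w, 0)" v] by (simp add: case_prod_unfold)
 moreover have "\<dots> = frechet_derivative (\<lambda>y. E (Ad (inv (\<psi> y)) w) F (x \<otimes> \<psi> y)) (at 0) v"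
  by (intro fun_cong[OF frechet_derivative_cong_on[OF open_ball zero_ball]] e2)
 moreover have "0 \<in> ?B \<times> ?B" using S0(1)[OF zero_ball] by (simp only: zero_prod_def)
 note m1[symmetric, folded zero_prod_def, unfolded mixed_partials[OF S this f, of "(0, v)" "(w, 0)"], unfolded zero_prod_def]
 ultimately show ?thesis by (simp only:)
qed

lemma E_diff: "F \<in> SF ==> H \<in> SF ==> E v (F - H) x = E v F x - E v H x"
proof -
 assume F: "F \<in> SF" and H: "H \<in> SF"
 have "E v (F + (-1) *\<^sub>R H) x = E v F x + (-1) * E v H x"
  by (simp only: E_add[OF F SF_scale[OF H]] E_scale[OF H])
 moreover have "F + (-1) *\<^sub>R H = F - H" by (simp add: fun_eq_iff scaleR_fun_apply)
 ultimately show ?thesis by simp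
qed

lemma E_lbr:
 assumes F: "F \<in> SF"
 shows "E (lbr v w) F = E v (E w F) - E w (E v F)"
proof
 fix x
 show "E (lbr v w) F x = (E v (E w F) - E w (E v F)) x"
  using E_commutator[OF F, of x v w] by (cases "x \<in> carrier G") (simp_all add: E_def)
qed

lemma vf_bracket_E: "vf_bracket (E v) (E w) = E (lbr v w)"
proof (intro ext)
 fix F x
 show "vf_bracket (E v) (E w) F x = E (lbr v w) F x"
 proof (cases "F \<in> SF")
  case True
  then show ?thesis by (simp add: vf_bracket_def E_lbr)
 next
  case False
  have "E u 0 = 0" for u using E_scale[OF SF_zero, of u 0] by (intro ext) simp
  then show ?thesis using False by (simp add: vf_bracket_def E_zero)
 qed
qed

lemma E_eq_iff: "E v = E w \<longleftrightarrow> v = w"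
 using E_inj_pt[OF one_closed] by metis

lemma lbr_antisym: "lbr v w = - lbr w v"
proof (rule E_inj_pt[OF one_closed])
 fix F assume "F \<in> SF"
 then show "E (lbr v w) F \<one> = E (- lbr w v) F \<one>" by (simp add: E_lin E_lbr)
qed

lemma linear_lbr: "linear (\<lambda>v. lbr v w)" "linear (lbr v)"
proof -
 show 1: "linear (\<lambda>v. lbr v w)" for w by (rule has_derivative_linear[OF lbr_deriv])
 have "lbr v = (\<lambda>w. - lbr w v)" using lbr_antisym by (intro ext)
 then show "linear (lbr v)" using linear_compose_neg[OF 1] by simp
qed

lemma lie_algebra_on_lbr: "lie_algebra_on lbr"
proof
 show "bilinear lbr" using linear_lbr by (simp add: bilinear_def)
 show "lbr x y = - lbr y x" for x y by (rule lbr_antisym)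
 show "lbr x (lbr y z) = lbr (lbr x y) z + lbr y (lbr x z)" for x y z
 proof (rule E_inj_pt[OF one_closed])
  fix F assume F: "F \<in> SF"
  show "E (lbr x (lbr y z)) F \<one> = E (lbr (lbr x y) z + lbr y (lbr x z)) F \<one>"
   using F by (simp add: E_lin E_lbr E_SF E_diff)
 qed
qed

end

subsection \<open>Solvability of the Lie algebra\<close>

context lie_chart begin

text \<open>\<open>H\<close> may be any subgroup, such as a term of the derived series, which need
  not be closed; so tangent vectors are velocities of curves in \<open>G\<close> that stay in
  \<open>H\<close>.\<close>

definition tangents :: "'g set => 'e set" where
 "tangents H = {v. \<exists>S p. 0 \<in> S \<and> plot M (S::real set) p \<and> p 0 = \<one> \<and> (\<forall>t\<in>S. p t \<in> H) \<and> mc p 0 1 = v}"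

lemma tangentsI:
 "[| 0 \<in> S; plot M (S::real set) p; p 0 = \<one>; \<And>t. t \<in> S ==> p t \<in> H; mc p 0 1 = v |] ==> v \<in> tangents H"
 by (auto simp: tangents_def)

lemma tangents_carrier: "tangents (carrier G) = UNIV"
proof -
 have "u \<in> tangents (carrier G)" for u
 proof -
  define T where "T = {t::real. t *\<^sub>R u \<in> ball 0 r}"
  have "open (UNIV \<inter> (\<lambda>t::real. t *\<^sub>R u) -` ball 0 r)"
   by (intro continuous_open_preimage continuous_intros) auto
  then have T: "open T" by (simp add: T_def vimage_def)
  have p: "plot M T (\<lambda>t. \<psi> (t *\<^sub>R u))"
   by (rule plot_comp[OF psi_plot smooth_on_linear[OF T bounded_linear_scaleR_left smooth_on_ident[OF T]] T])
    (auto simp: T_def)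
  have "((\<lambda>t. t *\<^sub>R u) has_derivative (\<lambda>t. t *\<^sub>R u)) (at (0::real))"
   by (rule bounded_linear_imp_has_derivative[OF bounded_linear_scaleR_left])
  from mc_compose[OF psi_plot this, of 1] have "mc (\<lambda>t. \<psi> (t *\<^sub>R u)) 0 1 = u" using zero_ball by (simp add: mc_psi)
  with p show ?thesis
   by (intro tangentsI[OF _ p] plot_carrier[OF p]) (auto simp: T_def psi_0 r_pos)
 qed
 then show ?thesis by blast
qed

lemma tangents_one: "tangents {\<one>} = {0}"
proof -
 have "v = 0" if v: "v \<in> tangents {\<one>}" for v
 proof -
  obtain S :: "real set" and p where p: "0 \<in> S" "plot M S p" "\<And>t. t \<in> S ==> p t = \<one>" "mc p 0 1 = v"
   using v by (auto simp: tangents_def)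
  have "mc p 0 1 = mc (\<lambda>t::real. \<one>) 0 1" by (rule mc_cong[OF plot_open[OF p(2)] p(1)]) (rule p(3))
  then show ?thesis using p(4) by (simp add: mc_const)
 qed
 moreover have "0 \<in> tangents {\<one>}"
  by (rule tangentsI[OF _ plot_cst[OF open_UNIV one_closed]]) (auto simp: mc_const)
 ultimately show ?thesis by blast
qed

lemma subspace_tangents:
 assumes "subgroup H G"
 shows "subspace (tangents H)"
 unfolding subspace_def
proof (intro conjI ballI allI)
 interpret H: subgroup H G by (rule assms)
 show "0 \<in> tangents H"
  by (rule tangentsI[OF _ plot_cst[OF open_UNIV one_closed]]) (auto simp: mc_const)
 fix v assume "v \<in> tangents H"
 then obtain S :: "real set" and p where p: "0 \<in> S" "plot M S p" "p 0 = \<one>" "\<And>t. t \<in> S ==> p t \<in> H" "mc p 0 1 = v"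
  by (auto simp: tangents_def)
 show "c *\<^sub>R v \<in> tangents H" for c
 proof -
  let ?T = "{t. c * t \<in> S}"
  have "open (UNIV \<inter> (\<lambda>t. c * t) -` S)"
   using plot_open[OF p(2)] by (intro continuous_open_preimage continuous_intros) auto
  then have T: "open ?T" by (simp add: vimage_def)
  have q: "plot M ?T (\<lambda>t. p (c * t))"
   by (rule plot_comp[OF p(2) smooth_on_mult[OF T smooth_on_const[OF T] smooth_on_ident[OF T]] T]) auto
  have "((\<lambda>t. c * t) has_derivative (\<lambda>t. c * t)) (at 0)"
   by (rule bounded_linear_imp_has_derivative[OF bounded_linear_mult_right])
  from mc_compose[OF p(2) this, of 1] have "mc (\<lambda>t. p (c * t)) 0 1 = mc p 0 c" using p(1) by simp
  also have "\<dots> = c *\<^sub>R mc p 0 1" using linear_cmul[OF linear_mc[OF p(2,1)], of c 1] by simp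
  finally show ?thesis by (intro tangentsI[OF _ q]) (use p in auto)
 qed
 fix w assume "w \<in> tangents H"
 then obtain T :: "real set" and q where q: "0 \<in> T" "plot M T q" "q 0 = \<one>" "\<And>t. t \<in> T ==> q t \<in> H" "mc q 0 1 = w"
  by (auto simp: tangents_def)
 have "open (S \<inter> T)" using plot_open[OF p(2)] plot_open[OF q(2)] by (rule open_Int)
 then have pq: "plot M (S \<inter> T) p" "plot M (S \<inter> T) q" by (auto intro: plot_sub[OF p(2)] plot_sub[OF q(2)])
 show "v + w \<in> tangents H"
 proof (rule tangentsI[OF _ plot_mult[OF pq]])
  show "mc (\<lambda>t. p t \<otimes> q t) 0 1 = v + w"
   using mc_mult[OF pq, of 0 1] p q by (simp add: Ad_one)
 qed (use p q in auto)
qed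

text \<open>Test against the orthogonal complement: there the pairing is locally 0.\<close>

lemma has_derivative_in_subspace:
 fixes f :: "real => 'e"
 assumes V: "subspace V" and f: "(f has_derivative f') (at 0)" and S: "open S" "0 \<in> S" "\<And>t. t \<in> S ==> f t \<in> V"
 shows "f' d \<in> V"
proof -
 have "f' d \<bullet> w = 0" if w: "w \<in> V\<^sup>\<bottom>" for w
 proof -
  have 1: "((\<lambda>t. f t \<bullet> w) has_derivative (\<lambda>d. f' d \<bullet> w)) (at 0)" by (intro has_derivative_inner_left f)
  have 2: "((\<lambda>t. f t \<bullet> w) has_derivative (\<lambda>d. 0)) (at 0)"
  proof (rule has_derivative_transform_within_open[OF _ S(1,2)])
   show "((\<lambda>t. 0::real) has_derivative (\<lambda>d. 0)) (at (0::real))" by (rule has_derivative_const)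
   show "0 = f t \<bullet> w" if "t \<in> S" for t
    using S(3)[OF that] w by (simp add: orthogonal_comp_def orthogonal_def)
  qed
  show ?thesis by (rule fun_cong[OF has_derivative_unique[OF 1 2]])
 qed
 then have "f' d \<in> (V\<^sup>\<bottom>)\<^sup>\<bottom>" by (auto simp: orthogonal_comp_def orthogonal_def inner_commute)
 then show ?thesis by (simp add: orthogonal_comp_self[OF V])
qed

text \<open>For fixed \<open>t\<close> the commutators of \<open>p t\<close> with the curve
  \<open>q\<close> form a curve in the derived subgroup with velocity \<open>Ad (p t) w - w\<close>.
  These vectors lie in one subspace, hence so does their derivative in \<open>t\<close>, which is
  the bracket.\<close>

lemma lbr_tangents:
 assumes H: "subgroup H G" and v: "v \<in> tangents H" and w: "w \<in> tangents H"
 shows "lbr v w \<in> tangents (derived G H)"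
proof -
 interpret H: subgroup H G by (rule H)
 have D: "subgroup (derived G H) G" by (rule derived_is_subgroup[OF H.subset])
 have commD: "x \<otimes> y \<otimes> inv x \<otimes> inv y \<in> derived G H" if "x \<in> H" "y \<in> H" for x y
  using that by (auto simp: derived_def intro!: generate.incl)
 obtain S :: "real set" and p where p: "0 \<in> S" "plot M S p" "p 0 = \<one>" "\<And>t. t \<in> S ==> p t \<in> H" "mc p 0 1 = v"
  using v by (auto simp: tangents_def)
 obtain T :: "real set" and q where q: "0 \<in> T" "plot M T q" "q 0 = \<one>" "\<And>t. t \<in> T ==> q t \<in> H" "mc q 0 1 = w"
  using w by (auto simp: tangents_def)
 have *: "Ad (p t) w - w \<in> tangents (derived G H)" if t: "t \<in> S" for t
 proof -
  have c: "p t \<in> carrier G" by (rule plot_carrier[OF p(2) t])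
  have pl: "plot M T (\<lambda>s. p t \<otimes> q s \<otimes> inv (p t))"
   by (intro plot_mult plot_cst inv_closed c q plot_open[OF q(2)])
  show ?thesis
  proof (rule tangentsI[OF q(1) plot_mult[OF pl plot_inv[OF q(2)]]])
   show "mc (\<lambda>s. p t \<otimes> q s \<otimes> inv (p t) \<otimes> inv (q s)) 0 1 = Ad (p t) w - w"
    using mc_mult[OF pl plot_inv[OF q(2)] q(1), of 1] mc_conj[OF q(2,1) c, of 1] mc_inv[OF q(2,1), of 1] q(3,5)
    by (simp add: Ad_one)
   show "p t \<otimes> q 0 \<otimes> inv (p t) \<otimes> inv (q 0) = \<one>" using c q(3) by simp
   show "p t \<otimes> q s \<otimes> inv (p t) \<otimes> inv (q s) \<in> derived G H" if "s \<in> T" for s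
    by (rule commD[OF p(4)[OF t] q(4)[OF that]])
  qed
 qed
 have "((\<lambda>t. Ad (p t) w - w) has_derivative (\<lambda>d. lbr (mc p 0 d) w - 0)) (at 0)"
  by (intro has_derivative_diff has_derivative_const Ad_deriv[OF p(2,1,3)])
 from has_derivative_in_subspace[OF subspace_tangents[OF D] this plot_open[OF p(2)] p(1) *, of 1]
 show ?thesis using p(5) by simp
qed

text \<open>By induction the \<open>n\<close>-th derived algebra consists of tangent vectors of the
  \<open>n\<close>-th derived subgroup, and the trivial subgroup has only the zero vector.\<close>

lemma lbr_solvable:
 assumes "solvable G"
 shows "\<exists>N. lie_algebra_on.der lbr N = {0}"
proof -
 interpret L: lie_algebra_on lbr by (rule lie_algebra_on_lbr)
 obtain N where N: "(derived G ^^ N) (carrier G) = {\<one>}"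
  using assms solvable_iff_trivial_derived_seq by blast
 have sub: "subgroup ((derived G ^^ n) (carrier G)) G" for n
  by (rule exp_of_derived_is_subgroup[OF subgroup_self])
 have "L.der n \<subseteq> tangents ((derived G ^^ n) (carrier G))" for n
 proof (induction n)
  case 0
  then show ?case by (simp add: tangents_carrier)
 next
  case (Suc n)
  have "lbr x y \<in> tangents ((derived G ^^ Suc n) (carrier G))" if "x \<in> L.der n" "y \<in> L.der n" for x y
   using lbr_tangents[OF sub] that Suc by auto
  then show ?case
   unfolding L.der.simps by (intro span_minimal subspace_tangents sub) blast
 qed
 from this[of N] have "L.der N \<subseteq> {0}" by (simp add: N tangents_one)
 moreover have "0 \<in> L.der N" by (cases N) (simp_all add: span_zero)
 ultimately show ?thesis by blast
qed

end

section \<open>Unimodularity\<close>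

text \<open>The change of variables results of the library are stated for \<open>real ^ 'n\<close> with a well-ordered
 index type; the type below indexes the standard basis of an arbitrary Euclidean space.\<close>

typedef (overloaded) 'e bidx = "Basis :: 'e::euclidean_space set"
 by (rule ex_in_conv[THEN iffD2]) simp

instance bidx :: (euclidean_space) finite
proof
 have "inj (Rep_bidx :: 'a bidx => 'a)" by (simp add: inj_on_def Rep_bidx_inject)
 moreover have "range (Rep_bidx :: 'a bidx => 'a) \<subseteq> Basis" using Rep_bidx by blast
 ultimately show "finite (UNIV :: 'a bidx set)" by (meson finite_Basis finite_subset finite_imageD)
qed

definition bnum :: "'e::euclidean_space bidx => nat" where
 "bnum = (SOME h. inj h)"

lemma inj_bnum: "inj (bnum :: 'e::euclidean_space bidx => nat)"
proof -
 have "\<exists>h :: 'e bidx => nat. inj h" using finite_imp_inj_to_nat_seg[OF finite[of UNIV]] by blast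
 then show ?thesis unfolding bnum_def by (rule someI_ex)
qed

instantiation bidx :: (euclidean_space) wellorder
begin

definition less_eq_bidx :: "'a bidx => 'a bidx => bool" where "less_eq_bidx x y \<longleftrightarrow> bnum x \<le> bnum y"
definition less_bidx :: "'a bidx => 'a bidx => bool" where "less_bidx x y \<longleftrightarrow> bnum x < bnum y"

instance
proof
 fix P :: "'a bidx => bool" and a
 assume "\<And>x. (\<And>y. y < x ==> P y) ==> P x"
 then show "P a" unfolding less_bidx_def by (rule measure_induct_rule[of bnum])
qed (auto simp: less_eq_bidx_def less_bidx_def dest: injD[OF inj_bnum])

end

section \<open>Volume and determinants through standard coordinates\<close>

definition to_vec :: "'e::euclidean_space => real ^ 'e bidx" where
 "to_vec x = (\<chi> i. x \<bullet> Rep_bidx i)"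

definition of_vec :: "real ^ 'e bidx => 'e::euclidean_space" where
 "of_vec y = (\<Sum>i\<in>UNIV. (y $ i) *\<^sub>R Rep_bidx i)"

lemma range_Rep_bidx: "range Rep_bidx = (Basis :: 'e::euclidean_space set)"
 by (rule type_definition.Rep_range[OF type_definition_bidx])

lemma sum_bidx: "(\<Sum>i\<in>UNIV. f (Rep_bidx i)) = (\<Sum>b\<in>(Basis :: 'e::euclidean_space set). f b)"
 unfolding range_Rep_bidx[symmetric] by (simp add: sum.reindex inj_on_def Rep_bidx_inject)

lemma of_to_vec: "of_vec (to_vec x) = x"
 by (simp add: of_vec_def to_vec_def sum_bidx[of "\<lambda>b. (x \<bullet> b) *\<^sub>R b"] euclidean_representation)

lemma inner_Rep_bidx: "Rep_bidx i \<bullet> Rep_bidx j = (if i = j then 1 else 0)"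
 using inner_Basis[OF Rep_bidx[of i] Rep_bidx[of j]] by (simp add: Rep_bidx_inject)

lemma of_vec_inner: "of_vec y \<bullet> Rep_bidx i = y $ i"
proof -
 have "of_vec y \<bullet> Rep_bidx i = (\<Sum>j\<in>UNIV. y $ j * (if j = i then 1 else 0))"
  by (simp only: of_vec_def inner_sum_left inner_scaleR_left inner_Rep_bidx)
 also have "\<dots> = (\<Sum>j\<in>UNIV. if j = i then y $ j else 0)" by (intro sum.cong) auto
 finally show ?thesis by simp
qed

lemma to_of_vec: "to_vec (of_vec y) = y"
 by (simp add: to_vec_def of_vec_inner)

lemma bounded_linear_to_vec: "bounded_linear to_vec"
 by (rule linear_conv_bounded_linear[THEN iffD1]) (auto simp: linear_iff to_vec_def vec_eq_iff inner_add_left)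

lemma bounded_linear_of_vec: "bounded_linear of_vec"
 by (rule linear_conv_bounded_linear[THEN iffD1]) (auto simp: linear_iff of_vec_def sum.distrib scaleR_add_left scaleR_sum_right)

lemma to_vec_image: "to_vec ` S = of_vec -` S"
 by (auto simp: of_to_vec to_of_vec intro: image_eqI[of _ _ "of_vec _"])

text \<open>The coordinate map matches boxes with boxes of equal volume, which characterises
  Lebesgue measure.\<close>

lemma distr_of_vec: "distr lborel borel (of_vec :: real ^ 'e bidx => 'e::euclidean_space) = lborel"
proof (rule lborel_eqI[symmetric])
 fix l u :: 'e assume lu: "\<And>b. b \<in> Basis ==> l \<bullet> b \<le> u \<bullet> b"
 have m: "of_vec \<in> borel_measurable (lborel :: (real ^ 'e bidx) measure)"
  using borel_measurable_continuous_onI[OF linear_continuous_on[OF bounded_linear_of_vec]] by simp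
 have "of_vec -` box l u = box (to_vec l) (to_vec u)"
 proof -
  have "of_vec y \<in> box l u \<longleftrightarrow> y \<in> box (to_vec l) (to_vec u)" for y
  proof -
   have "of_vec y \<in> box l u \<longleftrightarrow> (\<forall>i. l \<bullet> Rep_bidx i < of_vec y \<bullet> Rep_bidx i \<and> of_vec y \<bullet> Rep_bidx i < u \<bullet> Rep_bidx i)"
    unfolding mem_box(1) range_Rep_bidx[symmetric] by blast
   then show ?thesis by (simp add: mem_box_cart of_vec_inner to_vec_def)
  qed
  then show ?thesis by blast
 qed
 moreover have "emeasure lborel (box (to_vec l) (to_vec u)) = (\<Prod>b\<in>Basis. (u - l) \<bullet> b)"
 proof -
  have "emeasure lborel (box (to_vec l) (to_vec u)) = (\<Prod>b\<in>Basis. (to_vec u - to_vec l) \<bullet> b)"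
  proof (rule emeasure_lborel_box)
   fix b :: "real ^ 'e bidx" assume "b \<in> Basis"
   then obtain i where "b = axis i 1" by (auto simp: Basis_vec_def)
   then show "to_vec l \<bullet> b \<le> to_vec u \<bullet> b" using lu[OF Rep_bidx, of i] by (simp add: inner_axis to_vec_def)
  qed
  also have "(\<Prod>b\<in>Basis. (to_vec u - to_vec l) \<bullet> b) = (\<Prod>i\<in>UNIV. (to_vec u - to_vec l) $ i)"
  proof -
   have eq: "(Basis :: (real ^ 'e bidx) set) = (\<lambda>i. axis i 1) ` UNIV" by (auto simp: Basis_vec_def)
   show ?thesis unfolding eq by (subst prod.reindex) (auto simp: inj_on_def axis_eq_axis inner_axis)
  qed
  also have "\<dots> = (\<Prod>i\<in>UNIV. (u - l) \<bullet> Rep_bidx i)" by (simp add: to_vec_def inner_diff_left)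
  also have "\<dots> = (\<Prod>b\<in>Basis. (u - l) \<bullet> b)"
   unfolding range_Rep_bidx[symmetric] by (simp add: prod.reindex inj_on_def Rep_bidx_inject)
  finally show ?thesis .
 qed
 ultimately show "emeasure (distr lborel borel of_vec) (box l u) = (\<Prod>b\<in>Basis. (u - l) \<bullet> b)"
  using m by (simp add: emeasure_distr)
qed simp

lemma measure_to_vec_image:
 fixes S :: "'e::euclidean_space set"
 assumes "S \<in> sets borel"
 shows "to_vec ` S \<in> sets borel" "measure lborel (to_vec ` S) = measure lborel S"
proof -
 have m: "(of_vec :: _ => 'e) \<in> borel_measurable borel"
  using borel_measurable_continuous_onI[OF linear_continuous_on[OF bounded_linear_of_vec]] .
 show "to_vec ` S \<in> sets borel"
  using measurable_sets[OF m assms] by (simp add: to_vec_image)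
 have "measure lborel S = measure (distr lborel borel (of_vec :: _ => 'e)) S" by (simp add: distr_of_vec)
 also have "\<dots> = measure lborel (to_vec ` S)"
  using m assms by (simp add: measure_distr to_vec_image)
 finally show "measure lborel (to_vec ` S) = measure lborel S" ..
qed

definition detE :: "('e::euclidean_space => 'e) => real" where
 "detE L = det (\<chi> i j. L (Rep_bidx j) \<bullet> Rep_bidx i :: real ^ 'e bidx ^ 'e bidx)"

lemma detE_matrix:
 fixes L :: "'e::euclidean_space => 'e"
 shows "detE L = det (matrix (\<lambda>x. to_vec (L (of_vec x))))"
proof -
 have "of_vec (axis j 1) = (Rep_bidx j :: 'e)" for j :: "'e bidx"
 proof -
  have "of_vec (axis j 1) = (\<Sum>i\<in>UNIV. (if i = j then Rep_bidx i else 0) :: 'e)"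
   unfolding of_vec_def by (intro sum.cong) (auto simp: axis_def)
  then show ?thesis by simp
 qed
 then show ?thesis by (simp add: detE_def matrix_def to_vec_def)
qed

lemma detE_mult:
 fixes K L :: "'e::euclidean_space => 'e"
 assumes "linear K" "linear L"
 shows "detE (\<lambda>x. K (L x)) = detE K * detE L"
proof -
 have l: "linear (\<lambda>x. to_vec (F (of_vec x)))" if "linear F" for F :: "'e => 'e"
  using linear_compose[OF linear_compose[OF bounded_linear.linear[OF bounded_linear_of_vec] that]
    bounded_linear.linear[OF bounded_linear_to_vec]] by (simp add: o_def)
 show ?thesis
  using matrix_compose[OF l[OF assms(2)] l[OF assms(1)]] by (simp add: detE_matrix o_def of_to_vec det_mul)
qed

lemma detE_ident: "detE (\<lambda>x::'e::euclidean_space. x) = 1"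
proof -
 have "(\<chi> i j. Rep_bidx j \<bullet> Rep_bidx i) = (mat 1 :: real ^ 'e bidx ^ 'e bidx)"
  by (simp add: vec_eq_iff mat_def inner_Rep_bidx)
 then show ?thesis by (simp only: detE_def det_I)
qed

lemma detE_continuous:
 assumes "\<And>b. continuous_on S (\<lambda>s. L s b)"
 shows "continuous_on S (\<lambda>s. detE (L s))"
 unfolding detE_def det_def by (simp, intro continuous_intros assms)

text \<open>Jacobi's formula at the identity: after one factor is differentiated, a permutation
  other than the identity still has an off-diagonal factor 0.\<close>

lemma detE_deriv:
 fixes L :: "real => 'e::euclidean_space => 'e"
 assumes L: "\<And>b. ((\<lambda>t. L t b) has_vector_derivative L' b) (at 0)" and L0: "\<And>x. L 0 x = x"
 shows "((\<lambda>t. detE (L t)) has_real_derivative tr L') (at 0)"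
proof -
 let ?P = "{p. p permutes (UNIV :: 'e bidx set)}"
 let ?a = "\<lambda>i j t. L t (Rep_bidx j) \<bullet> Rep_bidx i" and ?a' = "\<lambda>i j. L' (Rep_bidx j) \<bullet> Rep_bidx i"
 have a: "((\<lambda>t. ?a i j t) has_derivative (\<lambda>t. t * ?a' i j)) (at 0)" for i j :: "'e bidx"
  using has_derivative_inner_left[OF L[of "Rep_bidx j", unfolded has_vector_derivative_def], of "Rep_bidx i"] by simp
 have P: "finite ?P" by simp
 have "((\<lambda>t. \<Sum>p\<in>?P. of_int (sign p) * (\<Prod>i\<in>UNIV. ?a i (p i) t)) has_derivative
   (\<lambda>t. \<Sum>p\<in>?P. of_int (sign p) * (\<Sum>i\<in>UNIV. (t * ?a' i (p i)) * (\<Prod>j\<in>UNIV - {i}. ?a j (p j) 0)))) (at 0)"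
  by (intro has_derivative_sum has_derivative_mult_right has_derivative_prod a)
 moreover have "(\<lambda>t. \<Sum>p\<in>?P. of_int (sign p) * (\<Sum>i\<in>UNIV. (t * ?a' i (p i)) * (\<Prod>j\<in>UNIV - {i}. ?a j (p j) 0))) = (*) (tr L')"
 proof
  fix t :: real
  have z: "(\<Prod>j\<in>UNIV - {i}. ?a j (p j) 0) = 0" if p: "p \<in> ?P" "p \<noteq> id" for p i
  proof -
   \<comment> \<open>A permutation fixing everything except possibly \<open>i\<close> fixes
     \<open>i\<close> as well, by injectivity.\<close>
   have "\<exists>j. j \<noteq> i \<and> p j \<noteq> j"
   proof (rule ccontr)
    assume c: "\<not> ?thesis"
    then have "p j = j" for j using p(1) by (metis mem_Collect_eq permutes_inj injD)
    then show False using p(2) by (simp add: fun_eq_iff)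
   qed
   then obtain j where j: "j \<noteq> i" "p j \<noteq> j" by blast
   then have "?a j (p j) 0 = 0" by (simp add: L0 inner_Rep_bidx)
   then show ?thesis using j by (intro prod_zero) auto
  qed
  have "(\<Sum>p\<in>?P. of_int (sign p) * (\<Sum>i\<in>UNIV. (t * ?a' i (p i)) * (\<Prod>j\<in>UNIV - {i}. ?a j (p j) 0)))
    = (\<Sum>p\<in>{id}. of_int (sign p) * (\<Sum>i\<in>UNIV. (t * ?a' i (p i)) * (\<Prod>j\<in>UNIV - {i}. ?a j (p j) 0)))"
   by (rule sum.mono_neutral_right[OF P]) (auto simp: permutes_id z)
  also have "\<dots> = t * (\<Sum>i\<in>UNIV. ?a' i i)"
   by (simp add: L0 inner_Rep_bidx sign_id sum_distrib_left)
  also have "(\<Sum>i\<in>UNIV. ?a' i i) = tr L'" by (simp add: tr_def sum_bidx[of "\<lambda>b. L' b \<bullet> b"])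
  finally show "(\<Sum>p\<in>?P. of_int (sign p) * (\<Sum>i\<in>UNIV. (t * ?a' i (p i)) * (\<Prod>j\<in>UNIV - {i}. ?a j (p j) 0))) = tr L' * t"
   by simp
 qed
 ultimately show ?thesis by (simp add: has_field_derivative_def detE_def det_def)
qed

lemma measure_differentiable_image_le:
 fixes k :: "'e::euclidean_space => 'e"
 assumes F: "open F" "bounded F" and kF: "open (k ` F)"
  and k: "\<And>x. x \<in> F ==> (k has_derivative k' x) (at x)" and c: "continuous_on F (\<lambda>x. detE (k' x))"
  and B: "\<And>x. x \<in> F ==> \<bar>detE (k' x)\<bar> \<le> B"
 shows "measure lborel (k ` F) \<le> B * measure lborel F"
proof -
 let ?k = "\<lambda>y. to_vec (k (of_vec y))"
 have bF: "F \<in> sets borel" "k ` F \<in> sets borel" using F kF by auto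
 note mF = measure_to_vec_image[OF bF(1)] and mkF = measure_to_vec_image[OF bF(2)]
 have "bounded (to_vec ` F)" by (rule bounded_linear_image[OF F(2) bounded_linear_to_vec])
 then have lm: "to_vec ` F \<in> lmeasurable" using mF(1) by (intro bounded_set_imp_lmeasurable) auto
 have "measure lebesgue (?k ` to_vec ` F) \<le> B * measure lebesgue (to_vec ` F)"
 proof (rule measure_bounded_differentiable_image)
  show "to_vec ` F \<in> lmeasurable" by (rule lm)
  have "continuous_on (to_vec ` F) (\<lambda>y. \<bar>detE (k' (of_vec y))\<bar>)"
   by (intro continuous_intros continuous_on_compose2[OF c] linear_continuous_on[OF bounded_linear_of_vec])
    (auto simp: of_to_vec)
  then have "(\<lambda>y. \<bar>detE (k' (of_vec y))\<bar>) \<in> borel_measurable (lebesgue_on (to_vec ` F))"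
   using fmeasurableD[OF lm] by (rule continuous_imp_measurable_on_sets_lebesgue)
  then have "(\<lambda>y. \<bar>detE (k' (of_vec y))\<bar>) integrable_on to_vec ` F"
   by (rule measurable_bounded_by_integrable_imp_integrable[OF _ integrable_on_const[OF lm, of B] _ fmeasurableD[OF lm]])
    (auto simp: of_to_vec B)
  then show "(\<lambda>y. \<bar>det (matrix (\<lambda>x. to_vec (k' (of_vec y) (of_vec x))))\<bar>) integrable_on to_vec ` F"
   by (simp add: detE_matrix)
  fix y assume "y \<in> to_vec ` F"
  then have y: "of_vec y \<in> F" by (auto simp: of_to_vec)
  have "(of_vec has_derivative of_vec) (at y)" by (rule bounded_linear_imp_has_derivative[OF bounded_linear_of_vec])
  from bounded_linear.has_derivative[OF bounded_linear_to_vec has_derivative_compose[OF this k[OF y]]]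
  show "(?k has_derivative (\<lambda>x. to_vec (k' (of_vec y) (of_vec x)))) (at y within to_vec ` F)"
   by (rule has_derivative_at_withinI)
  show "\<bar>det (matrix (\<lambda>x. to_vec (k' (of_vec y) (of_vec x))))\<bar> \<le> B" using B[OF y] by (simp add: detE_matrix)
 qed
 moreover have "?k ` to_vec ` F = to_vec ` k ` F" by (simp add: image_image of_to_vec)
 ultimately show ?thesis using mF mkF by (simp add: measure_completion)
qed

section \<open>The coset projection of a cocompact lattice\<close>

locale lie_lattice = lie_chart G M r \<psi> \<phi>
 for G :: "('g, 'm) monoid_scheme" (structure) and M :: "('g, 'e::euclidean_space) manifold"
  and r :: real and \<psi> :: "'e => 'g" and \<phi> :: "'g => 'e" +
 fixes \<Gamma> :: "'g set"
 assumes lattice: "lattice_subgroup G M \<Gamma>"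
begin

lemma subgroup_\<Gamma>: "subgroup \<Gamma> G"
 using lattice by (simp add: lattice_subgroup_def)

lemma \<Gamma>_carrier: "\<gamma> \<in> \<Gamma> ==> \<gamma> \<in> carrier G"
 by (rule subgroup.mem_carrier[OF subgroup_\<Gamma>])

lemma \<Gamma>_closed: "\<one> \<in> \<Gamma>" "\<gamma> \<in> \<Gamma> ==> inv \<gamma> \<in> \<Gamma>" "\<gamma> \<in> \<Gamma> ==> \<delta> \<in> \<Gamma> ==> \<gamma> \<otimes> \<delta> \<in> \<Gamma>"
 using subgroup_\<Gamma> by (auto intro: subgroup.one_closed subgroup.m_inv_closed subgroup.m_closed)

abbreviation N :: "('g set, 'e) manifold" where "N \<equiv> coset_space G M \<Gamma>"

definition \<pi> :: "'g => 'g set" where "\<pi> x = \<Gamma> #> x"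

lemma \<pi>_eq_iff:
 assumes "x \<in> carrier G" "y \<in> carrier G"
 shows "\<pi> x = \<pi> y \<longleftrightarrow> (\<exists>\<gamma>\<in>\<Gamma>. y = \<gamma> \<otimes> x)"
proof
 assume "\<pi> x = \<pi> y"
 then have "y \<in> \<Gamma> #> x" using repr_independenceD[OF subgroup_\<Gamma> assms(2)] by (simp add: \<pi>_def)
 then show "\<exists>\<gamma>\<in>\<Gamma>. y = \<gamma> \<otimes> x" by (auto simp: r_coset_def)
next
 assume "\<exists>\<gamma>\<in>\<Gamma>. y = \<gamma> \<otimes> x"
 then have "y \<in> \<Gamma> #> x" by (auto simp: r_coset_def)
 from repr_independence[OF this assms(1) subgroup_\<Gamma>] show "\<pi> x = \<pi> y" by (simp add: \<pi>_def)
qed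

lemma \<pi>_mult: "\<gamma> \<in> \<Gamma> ==> x \<in> carrier G ==> \<pi> (\<gamma> \<otimes> x) = \<pi> x"
 using \<pi>_eq_iff[of x "\<gamma> \<otimes> x"] \<Gamma>_carrier by force

lemma rcosets_eq: "rcosets \<Gamma> = \<pi> ` carrier G"
 by (auto simp: RCOSETS_def \<pi>_def)

lemma openin_N: "openin (mtop N) S \<longleftrightarrow> S \<subseteq> \<pi> ` carrier G \<and> openin (mtop M) {x \<in> carrier G. \<pi> x \<in> S}"
 by (simp add: openin_coset_space rcosets_eq \<pi>_def)

lemma topspace_N: "topspace (mtop N) = \<pi> ` carrier G"
proof -
 have "{x \<in> carrier G. \<pi> x \<in> \<pi> ` carrier G} = topspace (mtop M)" by (auto simp: topspace_M)
 then have "openin (mtop N) (\<pi> ` carrier G)" by (simp add: openin_N)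
 then show ?thesis using openin_N openin_subset openin_topspace by (metis subset_antisym)
qed

lemma \<pi>_preimage_image:
 assumes "W \<subseteq> carrier G"
 shows "{x \<in> carrier G. \<pi> x \<in> \<pi> ` W} = (\<Union>\<gamma>\<in>\<Gamma>. (\<lambda>x. \<gamma> \<otimes> x) ` W)"
proof (intro subset_antisym subsetI)
 fix x assume "x \<in> {x \<in> carrier G. \<pi> x \<in> \<pi> ` W}"
 then obtain w where w: "x \<in> carrier G" "w \<in> W" "\<pi> w = \<pi> x" by auto
 then obtain \<gamma> where "\<gamma> \<in> \<Gamma>" "x = \<gamma> \<otimes> w" using \<pi>_eq_iff[of w x] assms by blast
 then show "x \<in> (\<Union>\<gamma>\<in>\<Gamma>. (\<lambda>x. \<gamma> \<otimes> x) ` W)" using w by blast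
next
 fix x assume "x \<in> (\<Union>\<gamma>\<in>\<Gamma>. (\<lambda>x. \<gamma> \<otimes> x) ` W)"
 then obtain \<gamma> w where "\<gamma> \<in> \<Gamma>" "w \<in> W" "x = \<gamma> \<otimes> w" by blast
 then show "x \<in> {x \<in> carrier G. \<pi> x \<in> \<pi> ` W}" using assms \<Gamma>_carrier \<pi>_mult by auto
qed

lemma open_\<pi>:
 assumes "openin (mtop M) W"
 shows "openin (mtop N) (\<pi> ` W)"
proof -
 have W: "W \<subseteq> carrier G" using openin_subset[OF assms] topspace_M by simp
 have "openin (mtop M) (\<Union>\<gamma>\<in>\<Gamma>. (\<lambda>x. \<gamma> \<otimes> x) ` W)"
  by (intro openin_Union) (auto intro: open_lmult[OF \<Gamma>_carrier assms])
 then show ?thesis unfolding openin_N \<pi>_preimage_image[OF W] using W by blast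
qed

lemma continuous_\<pi>: "continuous_map (mtop M) (mtop N) \<pi>"
 by (simp add: continuous_map_def topspace_M topspace_N openin_N)

lemma discrete_\<Gamma>: "discrete \<Gamma>"
proof -
 have "openin (subtopology (mtop M) \<Gamma>) {\<one>}"
  using lattice \<Gamma>_closed by (simp add: lattice_subgroup_def)
 then show ?thesis using subgroup_\<Gamma> by (auto simp: openin_subtopology discrete_def)
qed

text \<open>The projection is open, so the images of small translated balls cover the compact
  quotient, and finitely many centres suffice.\<close>

lemma cocompact:
 assumes "0 < \<rho>" "\<rho> \<le> r"
 obtains Y where "finite Y" "Y \<subseteq> carrier G"
  "\<And>x. x \<in> carrier G ==> \<exists>y\<in>Y. \<exists>\<gamma>\<in>\<Gamma>. \<exists>u\<in>ball 0 \<rho>. x = \<gamma> \<otimes> (y \<otimes> \<psi> u)"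
proof -
 let ?V = "\<lambda>y. \<pi> ` (\<lambda>x. y \<otimes> x) ` \<psi> ` ball 0 \<rho>"
 have V: "openin (mtop N) (?V y)" if "y \<in> carrier G" for y
  by (intro open_\<pi> open_lmult that psi_open) (use assms in auto)
 have cov: "\<pi> y \<in> ?V y" if "y \<in> carrier G" for y
 proof -
  have "\<pi> y = \<pi> (y \<otimes> \<psi> 0)" using that by (simp add: psi_0)
  then show ?thesis using assms(1) by (metis imageI centre_in_ball)
 qed
 have "compactin (mtop N) (topspace (mtop N))"
  using lattice by (simp add: lattice_subgroup_def compact_space_def)
 moreover have "\<forall>U\<in>?V ` carrier G. openin (mtop N) U" using V by blast
 moreover have "topspace (mtop N) \<subseteq> \<Union> (?V ` carrier G)"
 proof
  fix q assume "q \<in> topspace (mtop N)"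
  then obtain y where y: "y \<in> carrier G" "q = \<pi> y" unfolding topspace_N by blast
  show "q \<in> \<Union> (?V ` carrier G)" unfolding y(2) by (rule UN_I[OF y(1)]) (rule cov[OF y(1)])
 qed
 ultimately have "\<exists>\<F>. finite \<F> \<and> \<F> \<subseteq> ?V ` carrier G \<and> topspace (mtop N) \<subseteq> \<Union>\<F>"
  unfolding compactin_def by meson
 then obtain \<F> where \<F>: "finite \<F>" "\<F> \<subseteq> ?V ` carrier G" "topspace (mtop N) \<subseteq> \<Union>\<F>" by blast
 from finite_subset_image[OF \<F>(1,2)] obtain Y where Y: "Y \<subseteq> carrier G" "finite Y" "\<F> = ?V ` Y" by metis
 have cov': "\<pi> ` carrier G \<subseteq> (\<Union>y\<in>Y. ?V y)" using \<F>(3) unfolding Y(3) topspace_N .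
 show ?thesis
 proof (rule that[OF Y(2,1)])
  fix x assume x: "x \<in> carrier G"
  then obtain y u where yu: "y \<in> Y" "u \<in> ball 0 \<rho>" "\<pi> x = \<pi> (y \<otimes> \<psi> u)" using cov' by blast
  then have "y \<otimes> \<psi> u \<in> carrier G" using Y(1) assms psi_carrier[of u] by auto
  then show "\<exists>y\<in>Y. \<exists>\<gamma>\<in>\<Gamma>. \<exists>u\<in>ball 0 \<rho>. x = \<gamma> \<otimes> (y \<otimes> \<psi> u)"
   using \<pi>_eq_iff[of "y \<otimes> \<psi> u" x] x yu by metis
 qed
qed

end

context lie_chart begin

text \<open>\<open>detE (mc \<psi> u)\<close> is the density of left Haar measure in the chart; on a
  small ball it differs from 1 by at most a factor 2, so Lebesgue measure can stand in for Haar
  measure.\<close>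

lemma detE_mc_psi_near_1:
 obtains \<rho> where "0 < \<rho>" "\<rho> \<le> r" "\<And>u. u \<in> ball 0 \<rho> ==> 1 / 2 \<le> detE (mc \<psi> u) \<and> detE (mc \<psi> u) \<le> 2"
proof -
 have c: "continuous_on (ball 0 r) (\<lambda>u. detE (mc \<psi> u))"
  by (intro detE_continuous smooth_on_imp_continuous_on mc_smooth psi_plot)
 have "detE (mc \<psi> 0) = 1" using mc_psi detE_ident by (metis ext)
 moreover have "isCont (\<lambda>u. detE (mc \<psi> u)) 0"
  using c zero_ball by (simp add: continuous_on_eq_continuous_at del: mem_ball)
 ultimately obtain d where d: "d > 0" "\<And>u. dist u 0 < d ==> dist (detE (mc \<psi> u)) 1 < 1 / 2"
  unfolding continuous_at_eps_delta by (metis half_gt_zero_iff zero_less_one)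
 show ?thesis
 proof (rule that[of "min d r"])
  fix u :: 'e assume "u \<in> ball 0 (min d r)"
  then have "dist (detE (mc \<psi> u)) 1 < 1 / 2" by (intro d) (simp add: dist_commute)
  then have "\<bar>detE (mc \<psi> u) - 1\<bar> < 1 / 2" by (simp only: dist_real_def)
  then show "1 / 2 \<le> detE (mc \<psi> u) \<and> detE (mc \<psi> u) \<le> 2" by linarith
 qed (use d r_pos in auto)
qed

text \<open>The map \<open>k\<close> expresses in the chart the passage from \<open>x\<close> to
  \<open>h \<otimes> x \<otimes> inv g\<close>. Left translation preserves logarithmic derivatives
  and right translation changes them by \<open>Ad g\<close>; the two densities, each between 1/2 and
  2, account for the factor 4.\<close>

lemma measure_translate:
 assumes \<rho>: "0 < \<rho>" "\<rho> \<le> r" "\<And>u. u \<in> ball 0 \<rho> ==> 1 / 2 \<le> detE (mc \<psi> u) \<and> detE (mc \<psi> u) \<le> 2"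
  and h: "h \<in> carrier G" and g: "g \<in> carrier G"
 shows "measure lborel {z \<in> ball 0 \<rho>. inv h \<otimes> \<psi> z \<otimes> g \<in> \<psi> ` ball 0 \<rho>}
  \<le> 4 * \<bar>detE (Ad g)\<bar> * measure lborel {u \<in> ball 0 \<rho>. h \<otimes> \<psi> u \<otimes> inv g \<in> \<psi> ` ball 0 \<rho>}"
  (is "measure lborel ?K \<le> _ * measure lborel ?F")
proof -
 let ?B = "ball (0::'e) \<rho>"
 define p where "p = (\<lambda>u. h \<otimes> \<psi> u \<otimes> inv g)"
 define k where "k = (\<lambda>u. \<phi> (p u))"
 have pc: "\<psi> u \<in> carrier G" if "u \<in> ?B" for u using that \<rho> by (intro psi_carrier) auto
 have inj: "\<phi> (\<psi> u) = u" if "u \<in> ?B" for u using that \<rho> by (intro phi_psi) auto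
 have B: "plot M ?B \<psi>" by (rule plot_sub[OF psi_plot]) (use \<rho> in auto)
 have p: "plot M ?B p" unfolding p_def by (intro plot_mult plot_cst B h g inv_closed open_ball)
 have q: "plot M ?B (\<lambda>z. inv h \<otimes> \<psi> z \<otimes> g)" by (intro plot_mult plot_cst B h g inv_closed open_ball)
 have opB: "openin (mtop M) (\<psi> ` ?B)" by (rule psi_open) (use \<rho> in auto)
 have F: "open ?F" using plot_preimage_open[OF p opB] by (simp add: p_def)
 have K: "open ?K" by (rule plot_preimage_open[OF q opB])
 have kF: "k u \<in> ?B" "\<psi> (k u) = p u" if "u \<in> ?F" for u
  using that inj by (auto simp: k_def p_def)
 have kim: "k ` ?F = ?K"
 proof (intro subset_antisym subsetI)
  fix z assume "z \<in> k ` ?F"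
  then obtain u where u: "u \<in> ?F" "z = k u" by blast
  then have "inv h \<otimes> \<psi> z \<otimes> g = \<psi> u" using kF[OF u(1)] pc[of u] h g by (simp add: p_def m_assoc lcancel)
  then show "z \<in> ?K" using u kF by auto
 next
  fix z assume z: "z \<in> ?K"
  then obtain u where u: "u \<in> ?B" "inv h \<otimes> \<psi> z \<otimes> g = \<psi> u" by auto
  have "h \<otimes> \<psi> u \<otimes> inv g = \<psi> z"
   unfolding u(2)[symmetric] using z pc[of z] h g by (simp add: m_assoc lcancel)
  then have "u \<in> ?F" "k u = z" using u z inj by (auto simp: k_def p_def)
  then show "z \<in> k ` ?F" by blast
 qed
 have Fsub: "?F \<subseteq> {u \<in> ?B. p u \<in> U0}" using \<rho> by (auto simp: p_def U0_def)
 have ks: "smooth_on ?F k" unfolding k_def by (rule smooth_on_subset[OF phi_plot[OF p] Fsub])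
 let ?k' = "\<lambda>u. frechet_derivative k (at u)"
 have kd: "(k has_derivative ?k' u) (at u)" if "u \<in> ?F" for u by (rule smooth_on_has_derivative[OF ks that])
 have det: "detE (mc \<psi> (k u)) * detE (?k' u) = detE (Ad g) * detE (mc \<psi> u)" if u: "u \<in> ?F" for u
 proof -
  have uB: "u \<in> ?B" using u by blast
  have "mc \<psi> (k u) (?k' u d) = Ad g (mc \<psi> u d)" for d
  proof -
   have "mc \<psi> (k u) (?k' u d) = mc (\<lambda>u. \<psi> (k u)) u d" by (rule mc_compose[OF B kd[OF u] kF(1)[OF u], symmetric])
   also have "\<dots> = mc p u d" by (rule mc_cong[OF F u]) (rule kF)
   also have "\<dots> = Ad g (mc (\<lambda>u. h \<otimes> \<psi> u) u d)"
    using mc_rmult[OF plot_mult[OF plot_cst[OF open_ball h] B] uB inv_closed[OF g]] g by (simp add: p_def)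
   also have "mc (\<lambda>u. h \<otimes> \<psi> u) u d = mc \<psi> u d" by (rule mc_lmult[OF B uB h])
   finally show ?thesis .
  qed
  then have "(\<lambda>d. mc \<psi> (k u) (?k' u d)) = (\<lambda>d. Ad g (mc \<psi> u d))" by (intro ext)
  then show ?thesis
   using detE_mult[OF linear_mc[OF B kF(1)[OF u]] has_derivative_linear[OF kd[OF u]]]
    detE_mult[OF linear_Ad[OF g] linear_mc[OF B uB]] by simp
 qed
 have bound: "\<bar>detE (?k' u)\<bar> \<le> 4 * \<bar>detE (Ad g)\<bar>" if u: "u \<in> ?F" for u
 proof -
  have 1: "1 / 2 \<le> detE (mc \<psi> (k u))" "0 \<le> detE (mc \<psi> u)" "detE (mc \<psi> u) \<le> 2"
   using \<rho>(3)[OF kF(1)[OF u]] \<rho>(3)[of u] u by auto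
  have "1 / 2 * \<bar>detE (?k' u)\<bar> \<le> detE (mc \<psi> (k u)) * \<bar>detE (?k' u)\<bar>" by (rule mult_right_mono[OF 1(1)]) simp
  also have "\<dots> = \<bar>detE (Ad g)\<bar> * detE (mc \<psi> u)" using arg_cong[OF det[OF u], of abs] 1 by (simp add: abs_mult)
  also have "\<dots> \<le> \<bar>detE (Ad g)\<bar> * 2" by (rule mult_left_mono[OF 1(3)]) simp
  finally show ?thesis by simp
 qed
 have "measure lborel (k ` ?F) \<le> (4 * \<bar>detE (Ad g)\<bar>) * measure lborel ?F"
 proof (rule measure_differentiable_image_le[OF F _ _ kd _ bound])
  show "bounded ?F" by (rule bounded_subset[OF bounded_ball[of 0 \<rho>]]) auto
  show "open (k ` ?F)" using K kim by simp
  show "continuous_on ?F (\<lambda>u. detE (?k' u))"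
   by (intro detE_continuous smooth_on_imp_continuous_on smooth_on_frechet_derivative ks)
 qed
 then show ?thesis by (simp only: kim)
qed

end

context lie_lattice begin

text \<open>The translate \<open>\<psi>(B) g\<close> of a small ball embeds into the quotient, which is covered by finitely many
 charts; hence its volume is bounded independently of \<open>g\<close>.\<close>

lemma detE_Ad_bounded_below:
 "\<exists>c>0. \<forall>g\<in>carrier G. c \<le> \<bar>detE (Ad g)\<bar>"
proof -
 obtain W where W: "openin (mtop M) W" "W \<inter> \<Gamma> = {\<one>}" using discrete_\<Gamma> by (auto simp: discrete_def)
 then have one_W: "\<one> \<in> W" by blast
 obtain \<rho>1 where \<rho>1: "0 < \<rho>1" "\<rho>1 \<le> r"
  "\<And>y1 y2 y3 y4. [| y1 \<in> ball 0 \<rho>1; y2 \<in> ball 0 \<rho>1; y3 \<in> ball 0 \<rho>1; y4 \<in> ball 0 \<rho>1 |] ==>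
    \<one> \<otimes> \<psi> y1 \<otimes> inv (\<psi> y2) \<otimes> \<psi> y3 \<otimes> inv (\<psi> y4) \<otimes> inv \<one> \<in> W"
  apply (rule small_translates[OF W(1) one_W one_closed])
  subgoal premises prems for \<rho> by (rule prems(1)[OF prems(2-4)])
  done
 obtain \<rho>2 where \<rho>2: "0 < \<rho>2" "\<rho>2 \<le> r" "\<And>u. u \<in> ball 0 \<rho>2 ==> 1 / 2 \<le> detE (mc \<psi> u) \<and> detE (mc \<psi> u) \<le> 2"
  apply (rule detE_mc_psi_near_1)
  subgoal premises prems for \<rho> by (rule prems(1)[OF prems(2-4)])
  done
 define \<rho> where "\<rho> = min \<rho>1 \<rho>2"
 have \<rho>: "0 < \<rho>" "\<rho> \<le> r" "\<And>u. u \<in> ball 0 \<rho> ==> 1 / 2 \<le> detE (mc \<psi> u) \<and> detE (mc \<psi> u) \<le> 2"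
  using \<rho>1(1,2) \<rho>2 by (auto simp: \<rho>_def)
 let ?B = "ball (0::'e) \<rho>"
 have pc: "\<psi> u \<in> carrier G" if "u \<in> ?B" for u using that \<rho> by (intro psi_carrier) auto
 have small: "\<psi> u \<otimes> inv (\<psi> v) \<in> W" if "u \<in> ?B" "v \<in> ?B" for u v
  using \<rho>1(3)[of u v 0 0] that pc[OF that(1)] pc[OF that(2)] \<rho>1(1) by (simp add: \<rho>_def psi_0)
 obtain Y where Y: "finite Y" "Y \<subseteq> carrier G"
  "\<And>x. x \<in> carrier G ==> \<exists>y\<in>Y. \<exists>\<gamma>\<in>\<Gamma>. \<exists>u\<in>?B. x = \<gamma> \<otimes> (y \<otimes> \<psi> u)"
  apply (rule cocompact[OF \<rho>(1,2)])
  subgoal premises prems for Y by (rule prems(1)[OF prems(2-4)])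
  done
 define m where "m = measure lborel (cball (0::'e) (\<rho> / 2))"
 \<comment> \<open>The 4 is the distortion in \<open>measure_translate\<close>; for each of the
   finitely many \<open>y\<close>, disjoint subsets of the ball have total volume at most that of
   the ball.\<close>
 define C where "C = 4 * real (card Y) * measure lborel ?B"
 have m: "m > 0" using \<rho>(1) by (simp add: m_def)
 have le: "m \<le> \<bar>detE (Ad g)\<bar> * C" if g: "g \<in> carrier G" for g
 proof -
  \<comment> \<open>For a pair of \<open>\<gamma>\<close> and \<open>y\<close>, \<open>K\<close>
    collects the points of the ball whose right translate by \<open>g\<close> falls into the small
    ball at \<open>\<gamma> \<otimes> y\<close>, and \<open>F\<close> their coordinates in that
    ball.\<close>
  define F where "F = (\<lambda>(\<gamma>, y). {u \<in> ?B. (\<gamma> \<otimes> y) \<otimes> \<psi> u \<otimes> inv g \<in> \<psi> ` ?B})"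
  define K where "K = (\<lambda>(\<gamma>, y). {z \<in> ?B. inv (\<gamma> \<otimes> y) \<otimes> \<psi> z \<otimes> g \<in> \<psi> ` ?B})"
  have B: "plot M ?B \<psi>" by (rule plot_sub[OF psi_plot]) (use \<rho> in auto)
  have opB: "openin (mtop M) (\<psi> ` ?B)" by (rule psi_open) (use \<rho> in auto)
  have yc: "y \<in> carrier G" if "y \<in> Y" for y using that Y(2) by blast
  have K: "open (K c)" and F: "open (F c)" if "c \<in> \<Gamma> \<times> Y" for c
  proof -
   obtain \<gamma> y where c: "c = (\<gamma>, y)" "\<gamma> \<in> carrier G" "y \<in> carrier G" using \<Gamma>_carrier yc \<open>c \<in> \<Gamma> \<times> Y\<close> by blast
   have "plot M ?B (\<lambda>z. inv (\<gamma> \<otimes> y) \<otimes> \<psi> z \<otimes> g)" "plot M ?B (\<lambda>z. \<gamma> \<otimes> y \<otimes> \<psi> z \<otimes> inv g)"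
    by (intro plot_mult plot_cst B c g inv_closed open_ball m_closed)+
   from plot_preimage_open[OF this(1) opB] plot_preimage_open[OF this(2) opB]
   show "open (K c)" "open (F c)" by (simp_all add: K_def F_def c(1))
  qed
  have KF: "measure lborel (K c) \<le> 4 * \<bar>detE (Ad g)\<bar> * measure lborel (F c)" if "c \<in> \<Gamma> \<times> Y" for c
  proof -
   obtain \<gamma> y where c: "c = (\<gamma>, y)" "\<gamma> \<otimes> y \<in> carrier G" using \<Gamma>_carrier yc \<open>c \<in> \<Gamma> \<times> Y\<close> by blast
   show ?thesis using measure_translate[OF \<rho> c(2) g] by (simp add: K_def F_def c(1))
  qed
  have cov: "cball 0 (\<rho> / 2) \<subseteq> (\<Union>c\<in>\<Gamma> \<times> Y. K c)"
  proof
   fix z :: 'e assume "z \<in> cball 0 (\<rho> / 2)"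
   then have z: "z \<in> ?B" using \<rho>(1) by simp
   obtain y \<gamma> u where *: "y \<in> Y" "\<gamma> \<in> \<Gamma>" "u \<in> ?B" "\<psi> z \<otimes> g = \<gamma> \<otimes> (y \<otimes> \<psi> u)"
    using Y(3)[of "\<psi> z \<otimes> g"] pc[OF z] g by auto
   then have "inv (\<gamma> \<otimes> y) \<otimes> (\<psi> z \<otimes> g) = \<psi> u"
    using \<Gamma>_carrier[of \<gamma>] yc[of y] pc[of u] by (simp add: inv_mult_group m_assoc lcancel)
   then have "inv (\<gamma> \<otimes> y) \<otimes> \<psi> z \<otimes> g = \<psi> u"
    using \<Gamma>_carrier[of \<gamma>] yc[of y] pc[OF z] g * by (simp add: m_assoc)
   then have "z \<in> K (\<gamma>, y)" using z *(3) by (simp add: K_def)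
   then show "z \<in> (\<Union>c\<in>\<Gamma> \<times> Y. K c)" using * by blast
  qed
  \<comment> \<open>Finitely many pairs already cover the compact ball of half the radius, so sums
    over an infinite lattice are avoided.\<close>
  obtain C' where C': "C' \<subseteq> \<Gamma> \<times> Y" "finite C'" "cball 0 (\<rho> / 2) \<subseteq> (\<Union>c\<in>C'. K c)"
   using compactE_image[OF compact_cball K cov] by blast
  let ?\<Gamma>' = "fst ` C'"
  have sub: "C' \<subseteq> ?\<Gamma>' \<times> Y" "?\<Gamma>' \<subseteq> \<Gamma>" "finite ?\<Gamma>'" using C' by force+
  have fin: "S \<in> fmeasurable lborel" if "open S" "S \<subseteq> ?B" for S :: "'e set"
  proof (rule fmeasurableI2[of ?B])
   show "?B \<in> fmeasurable lborel" using emeasure_lborel_ball_finite[of 0 \<rho>] by (intro fmeasurableI) simp_all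
  qed (use that in auto)
  have KB: "K c \<subseteq> ?B" "F c \<subseteq> ?B" for c by (auto simp: K_def F_def split: prod.splits)
  \<comment> \<open>A point common to two of the sets would give \<open>\<psi> z \<otimes> inv
    (\<psi> z') = \<gamma> \<otimes> inv \<delta>\<close> with the left side in \<open>W\<close>.
    This is where the translated ball embeds into the quotient.\<close>
  have disj: "(\<Sum>\<gamma>\<in>?\<Gamma>'. measure lborel (F (\<gamma>, y))) \<le> measure lborel ?B" if y: "y \<in> Y" for y
  proof -
   have "F (\<gamma>, y) \<inter> F (\<delta>, y) = {}" if gd: "\<gamma> \<in> \<Gamma>" "\<delta> \<in> \<Gamma>" "\<gamma> \<noteq> \<delta>" for \<gamma> \<delta>
   proof (rule ccontr)
    assume "F (\<gamma>, y) \<inter> F (\<delta>, y) \<noteq> {}"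
    then obtain u z z' where u: "u \<in> ?B" "z \<in> ?B" "z' \<in> ?B"
     and 1: "\<gamma> \<otimes> y \<otimes> \<psi> u \<otimes> inv g = \<psi> z" and 2: "\<delta> \<otimes> y \<otimes> \<psi> u \<otimes> inv g = \<psi> z'"
     by (auto simp: F_def)
    have cc: "\<gamma> \<in> carrier G" "\<delta> \<in> carrier G" "y \<in> carrier G" "\<psi> u \<in> carrier G"
     using gd \<Gamma>_carrier yc[OF y] pc u by auto
    have "\<psi> z \<otimes> inv (\<psi> z') = \<gamma> \<otimes> inv \<delta>"
     unfolding 1[symmetric] 2[symmetric] using cc g by (simp add: inv_mult_group m_assoc lcancel)
    then have "\<gamma> \<otimes> inv \<delta> \<in> W \<inter> \<Gamma>" using small[OF u(2,3)] gd \<Gamma>_closed by auto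
    then have "\<gamma> \<otimes> inv \<delta> = \<one>" using W(2) by blast
    then show False using inv_solve_right'[of \<one> \<gamma> \<delta>] cc gd(3) by simp
   qed
   then have "pairwise (\<lambda>\<gamma> \<delta>. disjnt (F (\<gamma>, y)) (F (\<delta>, y))) ?\<Gamma>'"
    using sub(2) by (auto simp: pairwise_def disjnt_def)
   moreover have Ff: "F (\<gamma>, y) \<in> fmeasurable lborel" if "\<gamma> \<in> ?\<Gamma>'" for \<gamma>
    by (rule fin[OF F KB(2)]) (use that sub y in auto)
   ultimately have "(\<Sum>\<gamma>\<in>?\<Gamma>'. measure lborel (F (\<gamma>, y))) = measure lborel (\<Union>\<gamma>\<in>?\<Gamma>'. F (\<gamma>, y))"
    by (intro measure_UNION'[symmetric] sub)
   also have "\<dots> \<le> measure lborel ?B"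
   proof (rule measure_mono_fmeasurable)
    show "(\<Union>\<gamma>\<in>?\<Gamma>'. F (\<gamma>, y)) \<subseteq> ?B" using KB(2) by blast
    show "(\<Union>\<gamma>\<in>?\<Gamma>'. F (\<gamma>, y)) \<in> sets lborel" by (intro sets.finite_UN sub fmeasurableD Ff)
   qed (rule fin, auto)
   finally show ?thesis .
  qed
  have "m \<le> measure lborel (\<Union>c\<in>C'. K c)"
   unfolding m_def
  proof (rule measure_mono_fmeasurable[OF C'(3)])
   show "(\<Union>c\<in>C'. K c) \<in> fmeasurable lborel"
   proof (rule fin)
    show "open (\<Union>c\<in>C'. K c)" by (intro open_UN ballI K) (use C'(1) in blast)
    show "(\<Union>c\<in>C'. K c) \<subseteq> ?B" using KB(1) by blast
   qed
  qed auto
  also have "\<dots> \<le> (\<Sum>c\<in>C'. measure lborel (K c))"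
   by (rule measure_UNION_le[OF C'(2)]) (use K C'(1) in auto)
  also have "\<dots> \<le> (\<Sum>c\<in>C'. 4 * \<bar>detE (Ad g)\<bar> * measure lborel (F c))"
   by (rule sum_mono) (use KF C'(1) in auto)
  also have "\<dots> \<le> (\<Sum>c\<in>?\<Gamma>' \<times> Y. 4 * \<bar>detE (Ad g)\<bar> * measure lborel (F c))"
   by (rule sum_mono2) (use sub Y(1) in auto)
  also have "\<dots> = 4 * \<bar>detE (Ad g)\<bar> * (\<Sum>y\<in>Y. \<Sum>\<gamma>\<in>?\<Gamma>'. measure lborel (F (\<gamma>, y)))"
  proof -
   have "(\<Sum>c\<in>?\<Gamma>' \<times> Y. measure lborel (F c)) = (\<Sum>\<gamma>\<in>?\<Gamma>'. \<Sum>y\<in>Y. measure lborel (F (\<gamma>, y)))"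
    unfolding sum.cartesian_product by (intro sum.cong) auto
   also have "\<dots> = (\<Sum>y\<in>Y. \<Sum>\<gamma>\<in>?\<Gamma>'. measure lborel (F (\<gamma>, y)))" by (rule sum.swap)
   finally show ?thesis by (simp only: sum_distrib_left[symmetric])
  qed
  also have "\<dots> \<le> 4 * \<bar>detE (Ad g)\<bar> * (\<Sum>y\<in>Y. measure lborel ?B)"
   by (intro mult_left_mono sum_mono disj) auto
  finally show ?thesis by (simp add: C_def mult_ac)
 qed
 have C: "C \<ge> 0" by (simp add: C_def)
 \<comment> \<open>Dividing by \<open>C + 1\<close> sidesteps the case \<open>C = 0\<close>.\<close>
 have "m / (C + 1) \<le> \<bar>detE (Ad g)\<bar>" if "g \<in> carrier G" for g
 proof -
  have "m \<le> \<bar>detE (Ad g)\<bar> * (C + 1)" using le[OF that] by (simp add: distrib_left)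
  then show ?thesis using C by (simp add: pos_divide_le_eq)
 qed
 then show ?thesis using m C by (intro exI[of _ "m / (C + 1)"]) simp
qed

text \<open>A multiplicative function bounded away from 0 has no value of modulus below 1, since its
  powers would tend to 0; for \<open>g\<close> and its inverse together this leaves modulus
  1.\<close>

lemma detE_Ad_abs:
 assumes g: "g \<in> carrier G"
 shows "\<bar>detE (Ad g)\<bar> = 1"
proof -
 have mult: "detE (Ad (h \<otimes> k)) = detE (Ad h) * detE (Ad k)" if "h \<in> carrier G" "k \<in> carrier G" for h k
 proof -
  have "Ad (h \<otimes> k) = (\<lambda>v. Ad h (Ad k v))" by (intro ext Ad_mult that)
  then show ?thesis by (simp add: detE_mult[OF linear_Ad[OF that(1)] linear_Ad[OF that(2)]])
 qed
 have one: "detE (Ad \<one>) = 1" using Ad_one detE_ident by (metis ext)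
 obtain c where c: "c > 0" "\<And>g. g \<in> carrier G ==> c \<le> \<bar>detE (Ad g)\<bar>" using detE_Ad_bounded_below by blast
 have ge: "1 \<le> \<bar>detE (Ad h)\<bar>" if h: "h \<in> carrier G" for h
 proof (rule ccontr)
  assume "\<not> ?thesis"
  then have "\<bar>detE (Ad h)\<bar> < 1" by simp
  from real_arch_pow_inv[OF c(1) this] obtain n where n: "\<bar>detE (Ad h)\<bar> ^ n < c" by blast
  have "detE (Ad (h [^] n)) = detE (Ad h) ^ n" for n :: nat
   by (induction n) (simp_all add: one mult h)
  then show False using c(2)[of "h [^] n"] h n by (simp add: power_abs)
 qed
 have "\<bar>detE (Ad g)\<bar> * \<bar>detE (Ad (inv g))\<bar> = 1"
  using mult[OF g inv_closed[OF g]] g one by (simp flip: abs_mult)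
 moreover have "\<bar>detE (Ad g)\<bar> * 1 \<le> \<bar>detE (Ad g)\<bar> * \<bar>detE (Ad (inv g))\<bar>"
  by (rule mult_left_mono[OF ge]) (use g in auto)
 ultimately show ?thesis using ge[OF g] by simp
qed

text \<open>Along a curve with velocity \<open>v\<close> the square of the determinant is constantly
  1, and squaring avoids a discussion of its sign; the derivative at 0 is twice the trace.\<close>

lemma tr_lbr: "tr (lbr v) = 0"
proof -
 have "v \<in> tangents (carrier G)" by (simp add: tangents_carrier)
 then obtain S :: "real set" and p where p: "0 \<in> S" "plot M S p" "p 0 = \<one>" "mc p 0 1 = v"
  by (auto simp: tangents_def)
 have mc: "mc p 0 d = d *\<^sub>R v" for d using linear_cmul[OF linear_mc[OF p(2,1)], of d 1] p(4) by simp
 have "((\<lambda>t. Ad (p t) b) has_vector_derivative lbr v b) (at 0)" for b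
  using Ad_deriv[OF p(2,1,3), of b] by (simp add: has_vector_derivative_def linear_cmul[OF linear_lbr(1)] mc)
 from detE_deriv[of "\<lambda>t. Ad (p t)", OF this]
 have 1: "((\<lambda>t. detE (Ad (p t))) has_real_derivative tr (lbr v)) (at 0)" by (simp add: p(3) Ad_one)
 have id: "detE (Ad (p 0)) = 1" using Ad_one detE_ident p(3) by (metis ext)
 have sq: "detE (Ad (p t)) * detE (Ad (p t)) = 1" if "t \<in> S" for t
  using detE_Ad_abs[OF plot_carrier[OF p(2) that]] abs_mult_self_eq[of "detE (Ad (p t))"] by simp
 from DERIV_mult[OF 1 1] have "((\<lambda>t. 1) has_real_derivative tr (lbr v) + tr (lbr v)) (at 0)"
  using id by (intro has_field_derivative_transform_within_open[OF _ plot_open[OF p(2)] p(1) sq]) simp_all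
 from DERIV_unique[OF this DERIV_const] show ?thesis by simp
qed

end

section \<open>The quotient manifold\<close>

context lie_lattice begin

lemma atlas_N:
 "(V, c) \<in> atlas N \<longleftrightarrow> (\<exists>U \<phi>0 W. V = \<pi> ` W \<and> c = \<phi>0 \<circ> inv_into W \<pi> \<and>
   (U, \<phi>0) \<in> atlas M \<and> openin (mtop M) W \<and> W \<subseteq> U \<and> inj_on \<pi> W)"
 unfolding coset_space_def manifold.simps \<pi>_def[abs_def] by blast

lemma injective_translates:
 assumes x: "x \<in> carrier G"
 obtains \<rho> where "0 < \<rho>" "\<rho> \<le> r" "\<And>u v \<gamma>. [| u \<in> ball 0 \<rho>; v \<in> ball 0 \<rho>; \<gamma> \<in> \<Gamma>; x \<otimes> \<psi> u = \<gamma> \<otimes> (x \<otimes> \<psi> v) |] ==> u = v"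
proof -
 obtain W where W: "openin (mtop M) W" "W \<inter> \<Gamma> = {\<one>}" using discrete_\<Gamma> by (auto simp: discrete_def)
 then have one_W: "\<one> \<in> W" by blast
 obtain \<rho> where \<rho>: "0 < \<rho>" "\<rho> \<le> r"
  and small: "\<And>y1 y2 y3 y4. [| y1 \<in> ball 0 \<rho>; y2 \<in> ball 0 \<rho>; y3 \<in> ball 0 \<rho>; y4 \<in> ball 0 \<rho> |] ==>
    x \<otimes> \<psi> y1 \<otimes> inv (\<psi> y2) \<otimes> \<psi> y3 \<otimes> inv (\<psi> y4) \<otimes> inv x \<in> W"
  apply (rule small_translates[OF W(1) one_W x])
  subgoal premises prems for \<rho> by (rule prems(1)[OF prems(2-4)])
  done
 have pc: "\<psi> u \<in> carrier G" if "u \<in> ball 0 \<rho>" for u using that \<rho> by (intro psi_carrier) auto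
 have "u = v" if uv: "u \<in> ball 0 \<rho>" "v \<in> ball 0 \<rho>" and g: "\<gamma> \<in> \<Gamma>" and eq: "x \<otimes> \<psi> u = \<gamma> \<otimes> (x \<otimes> \<psi> v)" for u v \<gamma>
 proof -
  note c = pc[OF uv(1)] pc[OF uv(2)] x \<Gamma>_carrier[OF g]
  have "\<gamma> = x \<otimes> \<psi> u \<otimes> inv (x \<otimes> \<psi> v)" by (rule mult_inv_eqI[OF eq[symmetric]]) (use c in auto)
  also have "\<dots> = x \<otimes> \<psi> u \<otimes> inv (\<psi> v) \<otimes> \<psi> 0 \<otimes> inv (\<psi> 0) \<otimes> inv x"
   using c by (simp add: psi_0 inv_mult_group m_assoc)
  also have "\<dots> \<in> W" by (rule small[OF uv]) (use \<rho> in auto)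
  finally have "\<gamma> = \<one>" using g W(2) by blast
  then have "\<psi> u = \<psi> v" using eq c by simp
  then have "\<phi> (\<psi> u) = \<phi> (\<psi> v)" by simp
  moreover have "u \<in> ball 0 r" "v \<in> ball 0 r" using uv \<rho>(2) by auto
  ultimately show ?thesis by (simp only: phi_psi)
 qed
 with \<rho> show ?thesis by (rule that)
qed

lemma chart_N_at:
 assumes x: "x \<in> carrier G"
 obtains U \<phi>0 W where "(U, \<phi>0) \<in> atlas M" "openin (mtop M) W" "W \<subseteq> U" "inj_on \<pi> W" "x \<in> W"
proof -
 obtain \<rho> where \<rho>: "0 < \<rho>" "\<rho> \<le> r"
  and inj: "\<And>u v \<gamma>. [| u \<in> ball 0 \<rho>; v \<in> ball 0 \<rho>; \<gamma> \<in> \<Gamma>; x \<otimes> \<psi> u = \<gamma> \<otimes> (x \<otimes> \<psi> v) |] ==> u = v"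
  apply (rule injective_translates[OF x])
  subgoal premises prems for \<rho> by (rule prems(1)[OF prems(2-4)])
  done
 obtain U \<phi>0 where U: "(U, \<phi>0) \<in> atlas M" "x \<in> U"
  using good_atlas_cover[OF gM, of x] x topspace_M by metis
 let ?W = "(\<lambda>y. x \<otimes> y) ` \<psi> ` ball 0 \<rho>"
 have W: "openin (mtop M) ?W" by (intro open_lmult x psi_open) (use \<rho> in auto)
 have pc: "\<psi> u \<in> carrier G" if "u \<in> ball 0 \<rho>" for u using that \<rho> by (intro psi_carrier) auto
 have "inj_on \<pi> ?W"
 proof (rule inj_onI)
  fix a b assume a: "a \<in> ?W" and b: "b \<in> ?W" and eq: "\<pi> a = \<pi> b"
  obtain u where u: "u \<in> ball 0 \<rho>" "a = x \<otimes> \<psi> u" using a by blast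
  obtain v where v: "v \<in> ball 0 \<rho>" "b = x \<otimes> \<psi> v" using b by blast
  have "\<pi> b = \<pi> a" using eq by simp
  then obtain \<gamma> where \<gamma>: "\<gamma> \<in> \<Gamma>" "a = \<gamma> \<otimes> b" using \<pi>_eq_iff[of b a] x pc u v by auto
  have "x \<otimes> \<psi> u = \<gamma> \<otimes> (x \<otimes> \<psi> v)" unfolding u(2)[symmetric] v(2)[symmetric] by (rule \<gamma>(2))
  from inj[OF u(1) v(1) \<gamma>(1) this] have "u = v" .
  then show "a = b" unfolding u(2) v(2) by simp
 qed
 then have "inj_on \<pi> (?W \<inter> U)" by (rule inj_on_subset) blast
 moreover have "x \<in> ?W"
 proof -
  have "x = x \<otimes> \<psi> 0" using x by (simp add: psi_0)
  then show ?thesis using \<rho>(1) by (intro image_eqI[of _ _ "\<psi> 0"] imageI) simp_all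
 qed
 ultimately show ?thesis
  using U W good_atlas_chart(1)[OF gM U(1)] by (intro that[of U \<phi>0 "?W \<inter> U"]) (auto intro: openin_Int)
qed

lemma good_atlas_N: "good_atlas N"
 unfolding good_atlas_def
proof (intro conjI)
 have sub: "W \<subseteq> carrier G" if "openin (mtop M) W" for W using openin_subset[OF that] topspace_M by simp
 show "\<Union> (fst ` atlas N) = topspace (mtop N)"
 proof (intro subset_antisym subsetI)
  fix q assume "q \<in> \<Union> (fst ` atlas N)"
  then obtain V c where "(V, c) \<in> atlas N" "q \<in> V" by force
  then show "q \<in> topspace (mtop N)" unfolding atlas_N topspace_N using sub by blast
 next
  fix q assume "q \<in> topspace (mtop N)"
  then obtain x where x: "x \<in> carrier G" "q = \<pi> x" unfolding topspace_N by blast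
  obtain U \<phi>0 W where W: "(U, \<phi>0) \<in> atlas M" "openin (mtop M) W" "W \<subseteq> U" "inj_on \<pi> W" "x \<in> W"
   by (rule chart_N_at[OF x(1)])
  then have "(\<pi> ` W, \<phi>0 \<circ> inv_into W \<pi>) \<in> atlas N" unfolding atlas_N by blast
  moreover have "q \<in> \<pi> ` W" using W(5) x(2) by blast
  ultimately show "q \<in> \<Union> (fst ` atlas N)" by force
 qed
 show "\<forall>(V, c)\<in>atlas N. openin (mtop N) V \<and> inj_on c V \<and> (\<forall>S. openin (mtop N) S \<and> S \<subseteq> V \<longrightarrow> open (c ` S))"
 proof (intro ballI, clarify)
  fix V c assume "(V, c) \<in> atlas N"
  then obtain U \<phi>0 W where V: "V = \<pi> ` W" "c = \<phi>0 \<circ> inv_into W \<pi>"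
   and W: "(U, \<phi>0) \<in> atlas M" "openin (mtop M) W" "W \<subseteq> U" "inj_on \<pi> W" unfolding atlas_N by blast
  note cU = good_atlas_chart[OF gM W(1)]
  have inv: "inv_into W \<pi> (\<pi> w) = w" if "w \<in> W" for w by (rule inv_into_f_f[OF W(4) that])
  have "inj_on c V"
  proof (rule inj_onI)
   fix a b assume "a \<in> V" "b \<in> V" and eq: "c a = c b"
   then obtain w v where w: "w \<in> W" "a = \<pi> w" "v \<in> W" "b = \<pi> v" unfolding V by blast
   then have "\<phi>0 w = \<phi>0 v" using eq inv by (simp add: V(2))
   then have "w = v" using inj_onD[OF cU(2)] w W(3) by blast
   then show "a = b" using w by simp
  qed
  moreover have "open (c ` S)" if S: "openin (mtop N) S" "S \<subseteq> V" for S
  proof -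
   have "openin (mtop M) {x \<in> carrier G. \<pi> x \<in> S}" using S by (simp add: openin_N)
   then have "openin (mtop M) (W \<inter> {x \<in> carrier G. \<pi> x \<in> S})" using W(2) by blast
   then have "open (\<phi>0 ` (W \<inter> {x \<in> carrier G. \<pi> x \<in> S}))" by (rule cU(3)) (use W(3) in blast)
   moreover have "c ` S = \<phi>0 ` (W \<inter> {x \<in> carrier G. \<pi> x \<in> S})"
   proof (intro subset_antisym subsetI)
    fix y assume "y \<in> c ` S"
    then obtain w where "w \<in> W" "\<pi> w \<in> S" "y = c (\<pi> w)" using S(2) V(1) by blast
    then show "y \<in> \<phi>0 ` (W \<inter> {x \<in> carrier G. \<pi> x \<in> S})" using sub[OF W(2)] inv by (auto simp: V(2))
   next
    fix y assume "y \<in> \<phi>0 ` (W \<inter> {x \<in> carrier G. \<pi> x \<in> S})"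
    then obtain w where w: "w \<in> W" "\<pi> w \<in> S" "y = \<phi>0 w" by blast
    then have "y = c (\<pi> w)" by (simp add: V(2) inv)
    then show "y \<in> c ` S" using w by blast
   qed
   ultimately show ?thesis by simp
  qed
  ultimately show "openin (mtop N) V \<and> inj_on c V \<and> (\<forall>S. openin (mtop N) S \<and> S \<subseteq> V \<longrightarrow> open (c ` S))"
   using open_\<pi>[OF W(2)] V(1) by blast
 qed
qed

lemma plot_\<pi>:
 assumes p: "plot M S p"
 shows "plot N S (\<lambda>s. \<pi> (p s))"
proof (rule plotI)
 show S: "open S" by (rule plot_open[OF p])
 show cont: "continuous_map (top_of_set S) (mtop N) (\<lambda>s. \<pi> (p s))"
  using continuous_map_compose[OF plot_continuous[OF p] continuous_\<pi>] by (simp add: o_def)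
 fix V c assume "(V, c) \<in> atlas N"
 then obtain U \<phi>0 W where V: "V = \<pi> ` W" "c = \<phi>0 \<circ> inv_into W \<pi>"
  and W: "(U, \<phi>0) \<in> atlas M" "openin (mtop M) W" "W \<subseteq> U" "inj_on \<pi> W" unfolding atlas_N by blast
 have sub: "W \<subseteq> carrier G" using openin_subset[OF W(2)] topspace_M by simp
 show "smooth_on {s \<in> S. \<pi> (p s) \<in> V} (\<lambda>s. c (\<pi> (p s)))"
 proof (rule smooth_on_local)
  fix s0 assume s0: "s0 \<in> {s \<in> S. \<pi> (p s) \<in> V}"
  then obtain w where w: "w \<in> W" "\<pi> (p s0) = \<pi> w" using V(1) by blast
  have ps: "p s0 \<in> carrier G" using plot_carrier[OF p] s0 by blast
  \<comment> \<open>The chart domain \<open>W\<close> may contain only a translate of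
    \<open>p s0\<close>; left translation by \<open>\<gamma>\<close> moves the whole plot there
    without changing its projection.\<close>
  obtain \<gamma> where \<gamma>: "\<gamma> \<in> \<Gamma>" "w = \<gamma> \<otimes> p s0" using \<pi>_eq_iff[OF ps, of w] w sub by blast
  have q: "plot M S (\<lambda>s. \<gamma> \<otimes> p s)" by (intro plot_mult plot_cst p S \<Gamma>_carrier \<gamma>)
  let ?T = "{s \<in> S. \<gamma> \<otimes> p s \<in> W}"
  have T: "open ?T" by (rule plot_preimage_open[OF q W(2)])
  have "smooth_on ?T (\<lambda>s. \<phi>0 (\<gamma> \<otimes> p s))"
   by (rule smooth_on_subset[OF plot_chart_smooth[OF q gM W(1)]]) (use W(3) in blast)
  then have "smooth_on ?T (\<lambda>s. c (\<pi> (p s)))"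
  proof (rule smooth_on_cong[THEN iffD1, OF T, rotated])
   fix s assume s: "s \<in> ?T"
   then have "\<pi> (p s) = \<pi> (\<gamma> \<otimes> p s)" using \<pi>_mult[OF \<gamma>(1)] plot_carrier[OF p] by simp
   then show "\<phi>0 (\<gamma> \<otimes> p s) = c (\<pi> (p s))" using s inv_into_f_f[OF W(4)] by (simp add: V(2))
  qed
  moreover have "s0 \<in> ?T" using s0 w \<gamma> by simp
  ultimately show "\<exists>T. open T \<and> s0 \<in> T \<and> smooth_on T (\<lambda>s. c (\<pi> (p s)))" using T by blast
 qed
qed (rule good_atlas_N)

text \<open>The quotient chart followed by the inverse chart of \<open>G\<close> is a local section
  of the projection. Local lifts suffice for velocities and covariant derivatives.\<close>

lemma plot_lift:
 assumes c: "plot N S c" and s0: "s0 \<in> S"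
 obtains T u where "open T" "s0 \<in> T" "T \<subseteq> S" "plot M T u" "\<And>t. t \<in> T ==> c t = \<pi> (u t)"
proof -
 obtain x where x: "x \<in> carrier G" "c s0 = \<pi> x" using plot_in[OF c s0] unfolding topspace_N by blast
 obtain U \<phi>0 W where W: "(U, \<phi>0) \<in> atlas M" "openin (mtop M) W" "W \<subseteq> U" "inj_on \<pi> W" "x \<in> W"
  by (rule chart_N_at[OF x(1)])
 let ?k = "\<phi>0 \<circ> inv_into W \<pi>"
 have k: "(\<pi> ` W, ?k) \<in> atlas N" unfolding atlas_N using W by blast
 let ?T = "{s \<in> S. c s \<in> \<pi> ` W}"
 have T: "open ?T" by (rule plot_preimage_open[OF c open_\<pi>[OF W(2)]])
 have inW: "inv_into W \<pi> (c s) \<in> W" if "s \<in> ?T" for s using that by (intro inv_into_into) blast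
 have "plot M ?T (\<lambda>s. inv_into U \<phi>0 (?k (c s)))"
 proof (rule plot_comp[OF plot_inv_chart[OF manifold_M W(1)] plot_chart_smooth[OF c good_atlas_N k] T])
  show "(\<lambda>s. ?k (c s)) ` ?T \<subseteq> \<phi>0 ` U" using inW W(3) by auto
 qed
 moreover have "c t = \<pi> (inv_into U \<phi>0 (?k (c t)))" if t: "t \<in> ?T" for t
 proof -
  have "inv_into U \<phi>0 (\<phi>0 (inv_into W \<pi> (c t))) = inv_into W \<pi> (c t)"
   using inW[OF t] W(3) by (intro inv_into_f_f good_atlas_chart(2)[OF gM W(1)]) blast
  then show ?thesis using t by (simp add: f_inv_into_f)
 qed
 moreover have "s0 \<in> ?T" using s0 x(2) W(5) by blast
 ultimately show ?thesis using that[OF T] by blast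
qed

subsection \<open>Functions on the quotient\<close>

abbreviation SFN :: "('g set => real) set" where "SFN \<equiv> smooth_functions N"

definition lift :: "('g set => real) => 'g => real" where
 "lift f x = (if x \<in> carrier G then f (\<pi> x) else 0)"

lemma SFN_0: "f \<in> SFN ==> q \<notin> \<pi> ` carrier G ==> f q = 0"
 by (simp add: smooth_functions_def topspace_N)

lemma SFN_plot: "f \<in> SFN ==> plot N S p ==> smooth_on S (\<lambda>s. f (p s))"
 by (rule smooth_functions_plot[OF _ _ good_atlas_N])

lemma lift_SF: "f \<in> SFN ==> lift f \<in> SF"
proof (rule SF_I_ball)
 fix x assume f: "f \<in> SFN" and x: "x \<in> carrier G"
 have "smooth_on (ball 0 r) (\<lambda>y. f (\<pi> (x \<otimes> \<psi> y)))" by (rule SFN_plot[OF f plot_\<pi>[OF lpsi_plot[OF x]]])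
 then show "smooth_on (ball 0 r) (\<lambda>y. lift f (x \<otimes> \<psi> y))"
  by (rule smooth_on_cong[THEN iffD1, OF open_ball, rotated]) (simp add: lift_def x psi_carrier del: mem_ball)
qed (simp add: lift_def)

text \<open>Charts of the quotient are restricted charts of \<open>G\<close>, so continuity and
  smoothness of \<open>f\<close> can be tested on its lift.\<close>

lemma SFN_I:
 assumes f0: "\<And>q. q \<notin> \<pi> ` carrier G ==> f q = 0" and F: "lift f \<in> SF"
 shows "f \<in> SFN"
proof -
 have Fm: "smooth_map M (open_submanifold UNIV) (lift f)" using F by (simp add: smooth_functions_def)
 have cF: "continuous_map (mtop M) euclidean (lift f)" using Fm by (simp add: smooth_map_def open_submanifold_def)
 have "continuous_map (mtop N) euclidean f"
  unfolding continuous_map_def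
 proof (intro conjI allI impI)
  fix S :: "real set" assume "openin euclidean S"
  then have "openin (mtop M) {x \<in> topspace (mtop M). lift f x \<in> S}"
   by (rule openin_continuous_map_preimage[OF cF])
  moreover have "{x \<in> topspace (mtop M). lift f x \<in> S} = {x \<in> carrier G. \<pi> x \<in> {q \<in> topspace (mtop N). f q \<in> S}}"
   by (auto simp: topspace_M topspace_N lift_def)
  ultimately show "openin (mtop N) {q \<in> topspace (mtop N). f q \<in> S}"
   unfolding openin_N by (auto simp: topspace_N)
 qed simp
 moreover have "smooth_on (c ` V) (f \<circ> inv_into V c)" if Vc: "(V, c) \<in> atlas N" for V c
 proof -
  obtain U \<phi>0 W where V: "V = \<pi> ` W" "c = \<phi>0 \<circ> inv_into W \<pi>"
   and W: "(U, \<phi>0) \<in> atlas M" "openin (mtop M) W" "W \<subseteq> U" "inj_on \<pi> W" using Vc unfolding atlas_N by blast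
  note cU = good_atlas_chart[OF gM W(1)] and cN = good_atlas_chart[OF good_atlas_N Vc]
  have sub: "W \<subseteq> carrier G" using openin_subset[OF W(2)] topspace_M by simp
  have inv: "inv_into W \<pi> (\<pi> w) = w" if "w \<in> W" for w by (rule inv_into_f_f[OF W(4) that])
  have im: "c ` V = \<phi>0 ` W" by (simp add: V image_image inv)
  have op: "open (\<phi>0 ` W)" by (rule cU(3)[OF W(2,3)])
  have "plot M (\<phi>0 ` W) (inv_into U \<phi>0)"
   by (rule plot_sub[OF plot_inv_chart[OF manifold_M W(1)] op]) (use W(3) in blast)
  from SF_plot[OF F this] show ?thesis
   unfolding im
  proof (rule smooth_on_cong[THEN iffD1, OF op, rotated])
   fix y assume "y \<in> \<phi>0 ` W"
   then obtain w where w: "w \<in> W" "y = \<phi>0 w" by blast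
   have "inv_into V c y = \<pi> w"
    using inv_into_f_f[OF cN(2), of "\<pi> w"] w V inv by auto
   moreover have "inv_into U \<phi>0 y = w" using inv_into_f_f[OF cU(2), of w] w W(3) by blast
   ultimately show "lift f (inv_into U \<phi>0 y) = (f \<circ> inv_into V c) y" using w sub by (auto simp: lift_def)
  qed
 qed
 ultimately show ?thesis
  using f0 by (auto simp: smooth_functions_def smooth_map_def open_submanifold_def topspace_N)
qed

lemma lift_invariant: "\<gamma> \<in> \<Gamma> ==> x \<in> carrier G ==> lift f (\<gamma> \<otimes> x) = lift f x"
 by (simp add: lift_def \<Gamma>_carrier \<pi>_mult)

lemma lift_SFI: "f \<in> SFN ==> lift f \<in> SFI \<Gamma>"
 by (simp add: SFI_def lift_SF lift_invariant)

lemma lift_eqD: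
 assumes "f \<in> SFN" "h \<in> SFN" "\<And>x. x \<in> carrier G ==> lift f x = lift h x"
 shows "f = h"
proof
 fix q show "f q = h q"
 proof (cases "q \<in> \<pi> ` carrier G")
  case True
  then obtain x where x: "x \<in> carrier G" "q = \<pi> x" by blast
  then show ?thesis using assms(3)[OF x(1)] by (simp add: lift_def)
 qed (simp add: SFN_0 assms)
qed

definition rep :: "'g set => 'g" where "rep q = (SOME x. x \<in> carrier G \<and> \<pi> x = q)"

lemma rep: "q \<in> \<pi> ` carrier G ==> rep q \<in> carrier G \<and> \<pi> (rep q) = q"
 unfolding rep_def by (rule someI_ex) blast

definition descend :: "('g => 'b::zero) => 'g set => 'b" where
 "descend F q = (if q \<in> \<pi> ` carrier G then F (rep q) else 0)"

lemma descend_\<pi>: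
 assumes "\<And>\<gamma> x. \<gamma> \<in> \<Gamma> ==> x \<in> carrier G ==> F (\<gamma> \<otimes> x) = F x" and x: "x \<in> carrier G"
 shows "descend F (\<pi> x) = F x"
proof -
 have "rep (\<pi> x) \<in> carrier G" "\<pi> (rep (\<pi> x)) = \<pi> x" using rep[of "\<pi> x"] x by auto
 then obtain \<gamma> where "\<gamma> \<in> \<Gamma>" "x = \<gamma> \<otimes> rep (\<pi> x)" using \<pi>_eq_iff[of "rep (\<pi> x)" x] x by blast
 then have "F x = F (rep (\<pi> x))" using assms(1)[of \<gamma> "rep (\<pi> x)"] \<open>rep (\<pi> x) \<in> carrier G\<close> by metis
 then show ?thesis using x by (simp add: descend_def)
qed

lemma descend_SFN:
 assumes "F \<in> SFI \<Gamma>"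
 shows "descend F \<in> SFN" "lift (descend F) = F"
proof -
 have F: "F \<in> SF" by (rule SFI_SF[OF assms])
 show l: "lift (descend F) = F"
 proof
  fix x show "lift (descend F) x = F x"
  proof (cases "x \<in> carrier G")
   case True
   have "descend F (\<pi> x) = F x" by (rule descend_\<pi>[OF _ True]) (use assms in \<open>simp add: SFI_def\<close>)
   then show ?thesis using True by (simp add: lift_def)
  qed (simp add: lift_def SF_0[OF F])
 qed
 show "descend F \<in> SFN" by (rule SFN_I) (simp_all add: l F descend_def)
qed

lemma descend_lift: "f \<in> SFN ==> descend (lift f) = f"
 by (rule ext) (use rep in \<open>auto simp: descend_def lift_def SFN_0\<close>)

lemma lift_add: "lift (f + h) = lift f + lift h"
 and lift_mult: "lift (f * h) = lift f * lift h"
 and lift_scale: "lift (c *\<^sub>R f) = c *\<^sub>R lift f"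
 and lift_zero: "lift 0 = 0"
 by (auto simp: lift_def fun_eq_iff scaleR_fun_apply)

lemma SFN_add: "f \<in> SFN ==> h \<in> SFN ==> f + h \<in> SFN"
 by (rule SFN_I) (simp_all add: SFN_0 lift_add lift_SF SF_add)

lemma SFN_mult: "f \<in> SFN ==> h \<in> SFN ==> f * h \<in> SFN"
 by (rule SFN_I) (simp_all add: SFN_0 lift_mult lift_SF SF_mult)

lemma SFN_scale: "f \<in> SFN ==> c *\<^sub>R f \<in> SFN"
 by (rule SFN_I) (simp_all add: SFN_0 lift_scale lift_SF SF_scale scaleR_fun_apply)

lemma SFN_zero: "0 \<in> SFN"
 by (rule SFN_I) (simp_all add: lift_zero SF_zero)

end

subsection \<open>Vector fields on the quotient\<close>

context lie_chart begin

text \<open>The coordinate expression at \<open>y\<close> of the left invariant field with value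
  \<open>v\<close>, inverse to \<open>mc \<psi> y\<close>; differential equations on the group are
  written with it.\<close>

definition mci :: "'e => 'e => 'e" where
 "mci y v = frechet_derivative (\<lambda>z. \<phi> (\<psi> y \<otimes> \<psi> z)) (at 0) v"

lemma mci_domain:
 "open {z \<in> ball 0 r \<times> ball 0 r. \<psi> (fst z) \<otimes> \<psi> (snd z) \<in> U0}" (is "open ?O")
 "smooth_on {z \<in> ball 0 r \<times> ball 0 r. \<psi> (fst z) \<otimes> \<psi> (snd z) \<in> U0} (\<lambda>(y, z). \<phi> (\<psi> y \<otimes> \<psi> z))"
 "y \<in> ball 0 r ==> (y, 0) \<in> {z \<in> ball 0 r \<times> ball 0 r. \<psi> (fst z) \<otimes> \<psi> (snd z) \<in> U0}"
proof -
 have p: "plot M (ball 0 r \<times> ball 0 r) (\<lambda>z. \<psi> (fst z) \<otimes> \<psi> (snd z))"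
  by (intro plot_mult plot_fst plot_snd psi_plot open_ball)
 show "open ?O" by (rule plot_preimage_open[OF p U0_open])
 show "smooth_on ?O (\<lambda>(y, z). \<phi> (\<psi> y \<otimes> \<psi> z))" using phi_plot[OF p] by (simp add: case_prod_unfold)
 assume y: "y \<in> ball 0 r"
 have "\<psi> y \<otimes> \<psi> 0 = \<psi> y" using psi_carrier[OF y] by (simp add: psi_0)
 moreover have "\<psi> y \<in> U0" using y by (simp add: U0_def)
 ultimately show "(y, 0) \<in> ?O" using y r_pos by simp
qed

lemma mci_deriv:
 assumes y: "y \<in> ball 0 r"
 shows "((\<lambda>z. \<phi> (\<psi> y \<otimes> \<psi> z)) has_derivative mci y) (at 0)"
proof -
 have "((\<lambda>z. (y, z)) has_derivative (\<lambda>v. (0, v))) (at 0)" by (auto intro!: derivative_eq_intros)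
 from has_derivative_compose[OF this smooth_on_has_derivative[OF mci_domain(2) mci_domain(3)[OF y]]]
 have "(\<lambda>z. \<phi> (\<psi> y \<otimes> \<psi> z)) differentiable (at 0)" by (auto simp: differentiable_def)
 moreover have "mci y = frechet_derivative (\<lambda>z. \<phi> (\<psi> y \<otimes> \<psi> z)) (at 0)" by (rule ext) (rule mci_def)
 ultimately show ?thesis by (simp only: frechet_derivative_works)
qed

lemma linear_mci: "y \<in> ball 0 r ==> linear (mci y)"
 by (rule has_derivative_linear[OF mci_deriv])

lemma mci_smooth: "smooth_on (ball 0 r) (\<lambda>y. mci y v)"
proof -
 let ?f = "\<lambda>(y, z). \<phi> (\<psi> y \<otimes> \<psi> z)"
 have "smooth_on (ball 0 r) (\<lambda>y. (\<lambda>z. frechet_derivative ?f (at z) (0, v)) (y, 0))"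
  by (rule smooth_on_compose[OF open_ball mci_domain(1) smooth_on_Pair[OF open_ball smooth_on_ident[OF open_ball] smooth_on_const[OF open_ball]]
     _ smooth_on_frechet_derivative[OF mci_domain(2)]]) (use mci_domain(3) in blast)
 then show ?thesis
  by (rule smooth_on_cong[THEN iffD1, OF open_ball, rotated])
   (simp add: mci_def smooth_on_partial_snd[OF mci_domain(1,2,3)])
qed

lemma mc_mci:
 assumes y: "y \<in> ball 0 r"
 shows "mc \<psi> y (mci y v) = v"
proof -
 let ?p = "\<lambda>z. \<psi> y \<otimes> \<psi> z"
 have yc: "\<psi> y \<in> carrier G" by (rule psi_carrier[OF y])
 have p: "plot M (ball 0 r) ?p" by (rule lpsi_plot[OF yc])
 let ?N = "{z \<in> ball 0 r. ?p z \<in> U0}"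
 have N: "open ?N" by (rule plot_preimage_open[OF p U0_open])
 have N0: "0 \<in> ?N" using mci_domain(3)[OF y] zero_ball by simp
 have k0: "\<phi> (?p 0) = y" using y yc by (simp add: psi_0 phi_psi)
 have "mc \<psi> y (mci y v) = mc (\<lambda>z. \<psi> (\<phi> (?p z))) 0 v"
  using mc_compose[OF psi_plot mci_deriv[OF y], of v] k0 y by simp
 also have "\<dots> = mc ?p 0 v" by (rule mc_cong[OF N N0]) (simp add: psi_phi)
 also have "\<dots> = v" using mc_lmult[OF psi_plot zero_ball yc] by (simp add: mc_psi)
 finally show ?thesis .
qed

end

context lie_lattice begin

lemma E_lift_inj:
 assumes x: "x \<in> carrier G" and eq: "\<And>f. f \<in> SFN ==> E v (lift f) x = E w (lift f) x"
 shows "v = w"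
proof (rule E_inj_SFI[OF discrete_\<Gamma> x])
 fix F assume F: "F \<in> SFI \<Gamma>"
 show "E v F x = E w F x" using eq[OF descend_SFN(1)[OF F]] by (simp only: descend_SFN(2)[OF F])
qed

text \<open>The coordinates, in the left invariant frame at \<open>x\<close>, of a tangent vector of
  the quotient given as a point derivation \<open>D\<close> at the coset of
  \<open>x\<close>.\<close>

definition dcomp :: "(('g set => real) => real) => 'g => 'e" where
 "dcomp D x = (THE a. \<forall>f\<in>SFN. D f = E a (lift f) x)"

lemma dcomp_eq:
 assumes "x \<in> carrier G" "\<And>f. f \<in> SFN ==> D f = E a (lift f) x"
 shows "dcomp D x = a"
 unfolding dcomp_def
proof (rule the_equality)
 fix c assume "\<forall>f\<in>SFN. D f = E c (lift f) x"
 then show "c = a" by (intro E_lift_inj[OF assms(1)]) (simp add: assms(2)[symmetric])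
qed (use assms(2) in blast)

lemma dcomp:
 assumes "x \<in> carrier G" "linear_on SFN D"
  "\<And>f g. f \<in> SFN ==> g \<in> SFN ==> D (f * g) = D f * g (\<pi> x) + f (\<pi> x) * D g" and f: "f \<in> SFN"
 shows "D f = E (dcomp D x) (lift f) x"
proof -
 have 0: "descend (F + H) = descend F + descend H" "descend (F * H) = descend F * descend H"
  "descend (c *\<^sub>R F) = c *\<^sub>R descend F" for F H :: "'g => real" and c :: real
  by (auto simp: descend_def fun_eq_iff scaleR_fun_apply)
 have l: "linear_on (SFI \<Gamma>) (\<lambda>F. D (descend F))"
  using assms(2) descend_SFN(1) unfolding linear_on_def 0 by blast
 have p: "descend F (\<pi> x) = F x" if "F \<in> SFI \<Gamma>" for F
  using fun_cong[OF descend_SFN(2)[OF that], of x] assms(1) by (simp add: lift_def)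
 have "\<exists>a. \<forall>F\<in>SFI \<Gamma>. D (descend F) = E a F x"
  by (rule point_derivation[OF discrete_\<Gamma> assms(1) l]) (simp only: 0 assms(3) descend_SFN(1) p)
 then obtain a where "\<forall>F\<in>SFI \<Gamma>. D (descend F) = E a F x" by blast
 then have a: "\<forall>f\<in>SFN. D f = E a (lift f) x" using lift_SFI descend_lift by metis
 have "dcomp D x = a" by (rule dcomp_eq[OF assms(1)]) (use a in blast)
 then show ?thesis using a f by simp
qed

text \<open>Near a point the periodic coordinates \<open>\<kappa> b\<close> recover the vector
  \<open>d\<close> with \<open>a s = mc \<psi> (y s) d\<close>, so \<open>a\<close> is a sum of
  products of the given smooth functions with smooth vectors.\<close>

lemma smooth_components:
 fixes u :: "'f::euclidean_space => 'g"
 assumes u: "plot M T u" and a: "\<And>f. f \<in> SFN ==> smooth_on T (\<lambda>s. E (a s) (lift f) (u s))"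
 shows "smooth_on T a"
proof (rule smooth_on_local)
 fix s0 assume s0: "s0 \<in> T"
 define x where "x = u s0"
 have x: "x \<in> carrier G" unfolding x_def by (rule plot_carrier[OF u s0])
 obtain \<rho> \<kappa> where k: "0 < \<rho>" "\<rho> \<le> r" "\<And>b. \<kappa> b \<in> SFI \<Gamma>"
  "\<And>b y d. y \<in> ball 0 \<rho> ==> E (mc \<psi> y d) (\<kappa> b) (x \<otimes> \<psi> y) = d \<bullet> b"
  using local_coordinates[OF discrete_\<Gamma> x] by metis
 have T: "open T" by (rule plot_open[OF u])
 have q: "plot M T (\<lambda>s. inv x \<otimes> u s)" by (intro plot_mult plot_cst T inv_closed x u)
 let ?N = "{s \<in> T. inv x \<otimes> u s \<in> \<psi> ` ball 0 \<rho>}"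
 have N: "open ?N" by (rule plot_preimage_open[OF q psi_open]) (use k in auto)
 define y where "y = (\<lambda>s. \<phi> (inv x \<otimes> u s))"
 have y: "smooth_on ?N y" unfolding y_def by (rule smooth_on_subset[OF phi_plot[OF q]]) (use k(2) in \<open>auto simp: U0_def\<close>)
 have yb: "y s \<in> ball 0 \<rho>" "x \<otimes> \<psi> (y s) = u s" if s: "s \<in> ?N" for s
 proof -
  obtain z where z: "z \<in> ball 0 \<rho>" "inv x \<otimes> u s = \<psi> z" using s by blast
  then have yz: "y s = z" using k(2) by (simp add: y_def phi_psi)
  show "y s \<in> ball 0 \<rho>" using z(1) yz by simp
  have "x \<otimes> \<psi> (y s) = x \<otimes> (inv x \<otimes> u s)" by (simp only: yz z(2))
  then show "x \<otimes> \<psi> (y s) = u s" using x plot_carrier[OF u] s by (simp add: lcancel)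
 qed
 have yr: "y s \<in> ball 0 r" if "s \<in> ?N" for s using yb(1)[OF that] k(2) by simp
 have "smooth_on ?N (\<lambda>s. \<Sum>b\<in>Basis. E (a s) (\<kappa> b) (u s) *\<^sub>R mc \<psi> (y s) b)"
 proof (intro smooth_on_sum smooth_on_scaleR N)
  fix b :: 'e
  show "smooth_on ?N (\<lambda>s. E (a s) (\<kappa> b) (u s))"
   using smooth_on_subset[OF a[OF descend_SFN(1)[OF k(3)]], of ?N b] by (auto simp: descend_SFN(2)[OF k(3)])
  show "smooth_on ?N (\<lambda>s. mc \<psi> (y s) b)"
   by (rule smooth_on_compose[OF N open_ball y _ mc_smooth[OF psi_plot]]) (use yr in blast)
 qed
 then have "smooth_on ?N a"
 proof (rule smooth_on_cong[THEN iffD1, OF N, rotated])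
  fix s assume s: "s \<in> ?N"
  define d where "d = mci (y s) (a s)"
  have ad: "a s = mc \<psi> (y s) d" unfolding d_def by (rule mc_mci[OF yr[OF s], symmetric])
  have "E (a s) (\<kappa> b) (u s) = d \<bullet> b" for b
   using k(4)[OF yb(1)[OF s], of d b] by (simp only: ad yb(2)[OF s])
  then show "(\<Sum>b\<in>Basis. E (a s) (\<kappa> b) (u s) *\<^sub>R mc \<psi> (y s) b) = a s"
   unfolding ad by (simp only: linear_eq_sum_Basis[OF linear_mc[OF psi_plot yr[OF s]], of d, symmetric])
 qed
 moreover have "s0 \<in> ?N"
 proof -
  have "inv x \<otimes> u s0 = \<psi> 0" using x by (simp add: psi_0 flip: x_def)
  then show ?thesis using s0 k(1) by (auto intro: imageI)
 qed
 ultimately show "\<exists>T. open T \<and> s0 \<in> T \<and> smooth_on T a" using N by blast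
qed

text \<open>\<open>b\<close> ranges over all vectors; testing with \<open>b = a x\<close> shows that
  these functions vanish off the group.\<close>

definition SV :: "('g => 'e) set" where "SV = {a. \<forall>b. (\<lambda>x. a x \<bullet> b) \<in> SF}"

definition ISV :: "('g => 'e) set" where
 "ISV = {a \<in> SV. \<forall>\<gamma>\<in>\<Gamma>. \<forall>x\<in>carrier G. a (\<gamma> \<otimes> x) = a x}"

lemma SV_0: "a \<in> SV ==> x \<notin> carrier G ==> a x = 0"
proof -
 assume "a \<in> SV" "x \<notin> carrier G"
 then have "a x \<bullet> a x = 0" using SF_0[of "\<lambda>z. a z \<bullet> a x" x] by (simp add: SV_def)
 then show ?thesis by simp
qed

lemma SV_plot:
 assumes a: "a \<in> SV" and p: "plot M S p"
 shows "smooth_on S (\<lambda>s. a (p s))"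
proof (rule smooth_on_componentwise[OF plot_open[OF p]])
 fix b :: 'e
 show "smooth_on S (\<lambda>s. a (p s) \<bullet> b)" using SF_plot[OF _ p, of "\<lambda>x. a x \<bullet> b"] a by (simp add: SV_def)
qed

lemma SV_I:
 assumes "\<And>x. x \<notin> carrier G ==> a x = 0"
  and "\<And>x. x \<in> carrier G ==> smooth_on (ball 0 r) (\<lambda>y. a (x \<otimes> \<psi> y))"
 shows "a \<in> SV"
 unfolding SV_def
proof (intro CollectI allI SF_I_ball)
 fix b x assume "x \<in> carrier G"
 show "smooth_on (ball 0 r) (\<lambda>y. a (x \<otimes> \<psi> y) \<bullet> b)"
  by (intro smooth_on_inner smooth_on_const open_ball assms(2) \<open>x \<in> carrier G\<close>)
qed (simp add: assms(1))

lemma E_SV_SF: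
 assumes a: "a \<in> SV" and F: "F \<in> SF"
 shows "(\<lambda>x. E (a x) F x) \<in> SF"
proof (rule SF_I_ball)
 fix x assume x: "x \<in> carrier G"
 have "smooth_on (ball 0 r) (\<lambda>y. \<Sum>b\<in>Basis. (a (x \<otimes> \<psi> y) \<bullet> b) * E b F (x \<otimes> \<psi> y))"
  by (intro smooth_on_sum smooth_on_mult smooth_on_inner smooth_on_const open_ball SV_plot[OF a lpsi_plot[OF x]] SF_lpsi E_SF x)
 moreover have "(\<Sum>b\<in>Basis. (a z \<bullet> b) * E b F z) = E (a z) F z" for z
  using linear_eq_sum_Basis[OF linear_E[of F z], of "a z"] by simp
 ultimately show "smooth_on (ball 0 r) (\<lambda>y. E (a (x \<otimes> \<psi> y)) F (x \<otimes> \<psi> y))" by simp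
qed (simp add: E_def)

lemma E_lift_invariant:
 assumes "\<gamma> \<in> \<Gamma>" "x \<in> carrier G" "f \<in> SFN"
 shows "E v (lift f) (\<gamma> \<otimes> x) = E v (lift f) x"
proof -
 have "left_translate G \<gamma> (lift f) = lift f"
  using lift_invariant[OF assms(1)] by (intro ext) (simp add: left_translate_def, simp add: lift_def)
 then show ?thesis using E_left_translate[OF \<Gamma>_carrier[OF assms(1)] lift_SF[OF assms(3)] assms(2), of v] by simp
qed

section \<open>Fields on the quotient as periodic functions with values in the Lie algebra\<close>

definition VF :: "('g => 'e) => 'g set vfield" where
 "VF a f = (if f \<in> SFN then descend (\<lambda>x. E (a x) (lift f) x) else 0)"

lemma VF_SFN:
 assumes a: "a \<in> ISV" and f: "f \<in> SFN"
 shows "VF a f \<in> SFN" "lift (VF a f) = (\<lambda>x. E (a x) (lift f) x)"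
proof -
 have inv: "E (a (\<gamma> \<otimes> x)) (lift f) (\<gamma> \<otimes> x) = E (a x) (lift f) x" if "\<gamma> \<in> \<Gamma>" "x \<in> carrier G" for \<gamma> x
  using E_lift_invariant[OF that f] a that by (simp add: ISV_def)
 have "(\<lambda>x. E (a x) (lift f) x) \<in> SF" by (rule E_SV_SF[OF _ lift_SF[OF f]]) (use a in \<open>simp add: ISV_def\<close>)
 then have "(\<lambda>x. E (a x) (lift f) x) \<in> SFI \<Gamma>" using inv by (simp add: SFI_def)
 from descend_SFN[OF this] f show "VF a f \<in> SFN" "lift (VF a f) = (\<lambda>x. E (a x) (lift f) x)"
  by (simp_all add: VF_def)
qed

lemma VF_apply: "a \<in> ISV ==> f \<in> SFN ==> x \<in> carrier G ==> VF a f (\<pi> x) = E (a x) (lift f) x"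
 using fun_cong[OF VF_SFN(2), of a f x] by (simp add: lift_def)

abbreviation VN :: "'g set vfield set" where "VN \<equiv> vector_fields N"

lemma VN_D:
 assumes "X \<in> VN"
 shows "f \<in> SFN ==> X f \<in> SFN" "linear_on SFN X" "f \<in> SFN ==> g \<in> SFN ==> X (f * g) = X f * g + f * X g"
  "f \<notin> SFN ==> X f = 0"
 using assms by (auto simp: vector_fields_def)

lemma VF_VN:
 assumes a: "a \<in> ISV"
 shows "VF a \<in> VN"
 unfolding vector_fields_def linear_on_def
proof (intro CollectI conjI ballI allI impI Pi_I)
 fix f assume f: "f \<in> SFN"
 note l = VF_SFN[OF a]
 show "VF a f \<in> SFN" by (rule l(1)[OF f])
 show "VF a (c *\<^sub>R f) = c *\<^sub>R VF a f" for c
 proof (rule lift_eqD[OF l(1)[OF SFN_scale[OF f]] SFN_scale[OF l(1)[OF f]]])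
  show "lift (VF a (c *\<^sub>R f)) x = lift (c *\<^sub>R VF a f) x" for x
   using l(2)[OF SFN_scale[OF f]] l(2)[OF f] E_scale[OF lift_SF[OF f]] by (simp add: lift_scale scaleR_fun_apply)
 qed
 fix g assume g: "g \<in> SFN"
 show "VF a (f + g) = VF a f + VF a g"
 proof (rule lift_eqD[OF l(1)[OF SFN_add[OF f g]] SFN_add[OF l(1)[OF f] l(1)[OF g]]])
  show "lift (VF a (f + g)) x = lift (VF a f + VF a g) x" for x
   using l(2)[OF SFN_add[OF f g]] l(2)[OF f] l(2)[OF g] E_add[OF lift_SF[OF f] lift_SF[OF g]] by (simp add: lift_add)
 qed
 show "VF a (f * g) = VF a f * g + f * VF a g"
 proof (rule lift_eqD[OF l(1)[OF SFN_mult[OF f g]]])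
  show "VF a f * g + f * VF a g \<in> SFN" by (intro SFN_add SFN_mult l(1) f g)
  show "lift (VF a (f * g)) x = lift (VF a f * g + f * VF a g) x" for x
   using l(2)[OF SFN_mult[OF f g]] l(2)[OF f] l(2)[OF g] E_mult[OF lift_SF[OF f] lift_SF[OF g]]
   by (simp add: lift_add lift_mult)
 qed
qed (simp add: VF_def)

definition comp :: "'g set vfield => 'g => 'e" where
 "comp X x = (if x \<in> carrier G then dcomp (\<lambda>f. X f (\<pi> x)) x else 0)"

lemma comp_apply:
 assumes X: "X \<in> VN" and f: "f \<in> SFN" and x: "x \<in> carrier G"
 shows "X f (\<pi> x) = E (comp X x) (lift f) x"
proof -
 have "X f (\<pi> x) = E (dcomp (\<lambda>f. X f (\<pi> x)) x) (lift f) x"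
 proof (rule dcomp[where D="\<lambda>f. X f (\<pi> x)", OF x _ _ f])
  show "linear_on SFN (\<lambda>f. X f (\<pi> x))" using VN_D(2)[OF X] by (simp add: linear_on_def scaleR_fun_apply)
  show "X (f * g) (\<pi> x) = X f (\<pi> x) * g (\<pi> x) + f (\<pi> x) * X g (\<pi> x)" if "f \<in> SFN" "g \<in> SFN" for f g
   using VN_D(3)[OF X that] by simp
 qed
 then show ?thesis using x by (simp add: comp_def)
qed

lemma comp_eq: "x \<in> carrier G ==> (\<And>f. f \<in> SFN ==> X f (\<pi> x) = E a (lift f) x) ==> comp X x = a"
 using dcomp_eq[of x "\<lambda>f. X f (\<pi> x)" a] by (simp add: comp_def)

lemma comp_0: "x \<notin> carrier G ==> comp X x = 0"
 by (simp add: comp_def)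

lemma comp_ISV:
 assumes X: "X \<in> VN"
 shows "comp X \<in> ISV"
proof -
 have "comp X \<in> SV"
 proof (rule SV_I)
  fix x assume x: "x \<in> carrier G"
  show "smooth_on (ball 0 r) (\<lambda>y. comp X (x \<otimes> \<psi> y))"
  proof (rule smooth_components[OF lpsi_plot[OF x]])
   fix f assume f: "f \<in> SFN"
   have "smooth_on (ball 0 r) (\<lambda>y. X f (\<pi> (x \<otimes> \<psi> y)))" by (rule SFN_plot[OF VN_D(1)[OF X f] plot_\<pi>[OF lpsi_plot[OF x]]])
   then show "smooth_on (ball 0 r) (\<lambda>y. E (comp X (x \<otimes> \<psi> y)) (lift f) (x \<otimes> \<psi> y))"
    by (rule smooth_on_cong[THEN iffD1, OF open_ball, rotated]) (rule comp_apply[OF X f m_closed[OF x psi_carrier]])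
  qed
 qed (rule comp_0)
 moreover have "comp X (\<gamma> \<otimes> x) = comp X x" if "\<gamma> \<in> \<Gamma>" "x \<in> carrier G" for \<gamma> x
 proof (rule comp_eq)
  show "\<gamma> \<otimes> x \<in> carrier G" using that \<Gamma>_carrier by simp
  fix f assume f: "f \<in> SFN"
  show "X f (\<pi> (\<gamma> \<otimes> x)) = E (comp X x) (lift f) (\<gamma> \<otimes> x)"
   using comp_apply[OF X f that(2)] E_lift_invariant[OF that f] \<pi>_mult[OF that] by simp
 qed
 ultimately show ?thesis by (simp add: ISV_def)
qed

lemma comp_VF: "a \<in> ISV ==> comp (VF a) = a"
proof
 fix x assume a: "a \<in> ISV"
 show "comp (VF a) x = a x"
 proof (cases "x \<in> carrier G")
  case True
  then show ?thesis by (rule comp_eq) (rule VF_apply[OF a _ True])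
 next
  case False
  then show ?thesis using a SV_0[of a x] by (simp add: comp_0 ISV_def)
 qed
qed

lemma VN_eqI:
 assumes X: "X \<in> VN" and Y: "Y \<in> VN" and eq: "\<And>x. x \<in> carrier G ==> comp X x = comp Y x"
 shows "X = Y"
proof
 fix f
 show "X f = Y f"
 proof (cases "f \<in> SFN")
  case f: True
  show ?thesis
  proof (rule lift_eqD[OF VN_D(1)[OF X f] VN_D(1)[OF Y f]])
   fix x assume x: "x \<in> carrier G"
   show "lift (X f) x = lift (Y f) x" using comp_apply[OF X f x] comp_apply[OF Y f x] eq[OF x] x by (simp add: lift_def)
  qed
 qed (simp add: VN_D(4)[OF X] VN_D(4)[OF Y])
qed

end

subsection \<open>The connection defined by a left symmetric product\<close>

locale lie_lattice_lsa = lie_lattice G M r \<psi> \<phi> \<Gamma>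
 for G :: "('g, 'm) monoid_scheme" (structure) and M :: "('g, 'e::euclidean_space) manifold"
  and r :: real and \<psi> :: "'e => 'g" and \<phi> :: "'g => 'e" and \<Gamma> :: "'g set" +
 fixes star :: "'e => 'e => 'e"
 assumes lsa: "complete_lsa lbr star"
begin

lemma bilinear_star: "bilinear star" and star_torsion: "star x y - star y x = lbr x y"
 and star_assoc: "star x (star y z) - star y (star x z) = star (lbr x y) z"
 using lsa by (auto simp: complete_lsa_def)

lemma bounded_bilinear_star: "bounded_bilinear star"
 using bilinear_star by (simp add: bilinear_conv_bounded_bilinear)

lemmas star_simps = bilinear_ladd[OF bilinear_star] bilinear_radd[OF bilinear_star]
 bilinear_lsub[OF bilinear_star] bilinear_rsub[OF bilinear_star]
 bilinear_lmul[OF bilinear_star] bilinear_rmul[OF bilinear_star]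
 bilinear_lzero[OF bilinear_star] bilinear_rzero[OF bilinear_star]

definition EV :: "'e => ('g => 'e) => 'g => 'e" where
 "EV v a x = (if x \<in> carrier G then frechet_derivative (\<lambda>y. a (x \<otimes> \<psi> y)) (at 0) v else 0)"

lemma EV_deriv:
 assumes "a \<in> SV" "x \<in> carrier G"
 shows "((\<lambda>y. a (x \<otimes> \<psi> y)) has_derivative (\<lambda>v. EV v a x)) (at 0)"
 using smooth_on_has_derivative[OF SV_plot[OF assms(1) lpsi_plot[OF assms(2)]] zero_ball] assms by (simp add: EV_def)

lemma EV_eqI:
 assumes "x \<in> carrier G" "((\<lambda>y. a (x \<otimes> \<psi> y)) has_derivative a') (at 0)"
 shows "EV v a x = a' v"
 using frechet_derivative_at[OF assms(2)] assms(1) by (simp add: EV_def)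

lemma linear_EV:
 assumes "a \<in> SV"
 shows "linear (\<lambda>v. EV v a x)"
proof (cases "x \<in> carrier G")
 case True
 then show ?thesis using has_derivative_linear[OF EV_deriv[OF assms]] by blast
next
 case False
 then have "(\<lambda>v. EV v a x) = (\<lambda>v. 0)" by (simp add: EV_def)
 then show ?thesis by (simp add: linear_iff)
qed

lemmas EV_lin = linear_0[OF linear_EV] linear_add[OF linear_EV] linear_cmul[OF linear_EV] linear_diff[OF linear_EV]

lemma SV_inner: "a \<in> SV ==> (\<lambda>z. a z \<bullet> b) \<in> SF"
 by (simp add: SV_def)

lemma EV_inner:
 assumes a: "a \<in> SV"
 shows "EV v a x \<bullet> b = E v (\<lambda>z. a z \<bullet> b) x"
proof (cases "x \<in> carrier G")
 case x: True
 show ?thesis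
  using fun_cong[OF has_derivative_unique[OF has_derivative_inner_left[OF EV_deriv[OF a x]] E_deriv[OF SV_inner[OF a] x]]] .
qed (simp add: EV_def E_def)

lemma EV_add: "a \<in> SV ==> b \<in> SV ==> x \<in> carrier G ==> EV v (\<lambda>x. a x + b x) x = EV v a x + EV v b x"
 by (rule EV_eqI[where a'="\<lambda>v. EV v a x + EV v b x"]) (auto intro: has_derivative_add EV_deriv)

lemma EV_scale:
 assumes F: "F \<in> SF" and a: "a \<in> SV" and x: "x \<in> carrier G"
 shows "EV v (\<lambda>x. F x *\<^sub>R a x) x = F x *\<^sub>R EV v a x + E v F x *\<^sub>R a x"
proof (rule EV_eqI[OF x, where a'="\<lambda>v. F x *\<^sub>R EV v a x + E v F x *\<^sub>R a x"])
 show "((\<lambda>y. F (x \<otimes> \<psi> y) *\<^sub>R a (x \<otimes> \<psi> y)) has_derivative (\<lambda>v. F x *\<^sub>R EV v a x + E v F x *\<^sub>R a x)) (at 0)"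
  using has_derivative_scaleR[OF E_deriv[OF F x] EV_deriv[OF a x]] x by (simp add: psi_0)
qed

lemma EV_star:
 assumes a: "a \<in> SV" and b: "b \<in> SV" and x: "x \<in> carrier G"
 shows "EV v (\<lambda>x. star (a x) (b x)) x = star (a x) (EV v b x) + star (EV v a x) (b x)"
proof (rule EV_eqI[OF x, where a'="\<lambda>v. star (a x) (EV v b x) + star (EV v a x) (b x)"])
 show "((\<lambda>y. star (a (x \<otimes> \<psi> y)) (b (x \<otimes> \<psi> y))) has_derivative
   (\<lambda>v. star (a x) (EV v b x) + star (EV v a x) (b x))) (at 0)"
  using bounded_bilinear.FDERIV[OF bounded_bilinear_star EV_deriv[OF a x] EV_deriv[OF b x]] x by (simp add: psi_0)
qed

lemma SV_add: "a \<in> SV ==> b \<in> SV ==> (\<lambda>x. a x + b x) \<in> SV"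
proof -
 assume a: "a \<in> SV" and b: "b \<in> SV"
 show ?thesis
 proof (rule SV_I)
  fix x assume x: "x \<in> carrier G"
  show "smooth_on (ball 0 r) (\<lambda>y. a (x \<otimes> \<psi> y) + b (x \<otimes> \<psi> y))"
   by (intro smooth_on_add open_ball SV_plot[OF a lpsi_plot[OF x]] SV_plot[OF b lpsi_plot[OF x]])
 qed (simp add: SV_0 a b)
qed

lemma SV_star: "a \<in> SV ==> b \<in> SV ==> (\<lambda>x. star (a x) (b x)) \<in> SV"
proof -
 assume a: "a \<in> SV" and b: "b \<in> SV"
 show ?thesis
 proof (rule SV_I)
  fix x assume x: "x \<in> carrier G"
  show "smooth_on (ball 0 r) (\<lambda>y. star (a (x \<otimes> \<psi> y)) (b (x \<otimes> \<psi> y)))"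
   by (rule smooth_on_bilinear[OF open_ball bounded_bilinear_star SV_plot[OF a lpsi_plot[OF x]] SV_plot[OF b lpsi_plot[OF x]]])
 qed (simp add: SV_0 a b star_simps)
qed

lemma SV_EV:
 assumes a: "a \<in> SV" and b: "b \<in> SV"
 shows "(\<lambda>x. EV (a x) b x) \<in> SV"
 unfolding SV_def by (auto simp: EV_inner[OF b] intro: E_SV_SF[OF a SV_inner[OF b]])

text \<open>Separates the derivative of the coefficients from the iterated derivative along fixed
  directions, whose commutator is known.\<close>

lemma E_along_SV:
 assumes b: "b \<in> SV" and F: "F \<in> SF" and x: "x \<in> carrier G"
 shows "E v (\<lambda>q. E (b q) F q) x = E (EV v b x) F x + E v (E (b x) F) x"
proof -
 have "((\<lambda>y. b (x \<otimes> \<psi> y)) has_derivative (\<lambda>v. EV v b x)) (at 0)" by (rule EV_deriv[OF b x])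
 from has_derivative_unique[OF E_deriv[OF E_SV_SF[OF b F] x] E_product_rule[OF F x this]]
 show ?thesis using x by (simp add: psi_0 fun_eq_iff)
qed

lemma E_SV_commutator:
 assumes a: "a \<in> SV" and b: "b \<in> SV" and F: "F \<in> SF" and x: "x \<in> carrier G"
 shows "E (a x) (\<lambda>q. E (b q) F q) x - E (b x) (\<lambda>q. E (a q) F q) x
  = E (EV (a x) b x - EV (b x) a x + lbr (a x) (b x)) F x"
 using E_commutator[OF F x, of "a x" "b x"] by (simp add: E_along_SV[OF _ F x] a b E_lin)

lemma EV_commutator:
 assumes a: "a \<in> SV" and b: "b \<in> SV" and c: "c \<in> SV" and x: "x \<in> carrier G"
 shows "EV (a x) (\<lambda>q. EV (b q) c q) x - EV (b x) (\<lambda>q. EV (a q) c q) x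
  = EV (EV (a x) b x - EV (b x) a x + lbr (a x) (b x)) c x" (is "?l = ?r")
proof -
 have "?l \<bullet> d = ?r \<bullet> d" for d
  using E_SV_commutator[OF a b SV_inner[OF c] x, of d]
  by (simp add: inner_diff_left EV_inner[OF c] EV_inner[OF SV_EV[OF a c]] EV_inner[OF SV_EV[OF b c]])
 then show ?thesis by (rule euclidean_eqI)
qed

text \<open>In the left invariant frame the connection has the constant Christoffel symbols
  \<open>star\<close>: on constant functions only the product remains.\<close>

definition nabv :: "('g => 'e) => ('g => 'e) => 'g => 'e" where
 "nabv a b x = EV (a x) b x + star (a x) (b x)"

lemma ISV_SV: "a \<in> ISV ==> a \<in> SV"
 by (simp add: ISV_def)

lemma EV_invariant:
 assumes b: "b \<in> ISV" and g: "\<gamma> \<in> \<Gamma>" and x: "x \<in> carrier G"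
 shows "EV v b (\<gamma> \<otimes> x) = EV v b x"
proof -
 have "frechet_derivative (\<lambda>y. b (\<gamma> \<otimes> x \<otimes> \<psi> y)) (at 0) = frechet_derivative (\<lambda>y. b (x \<otimes> \<psi> y)) (at 0)"
 proof (rule frechet_derivative_cong_on[OF open_ball zero_ball])
  fix y :: 'e assume "y \<in> ball 0 r"
  then have y: "\<psi> y \<in> carrier G" by (rule psi_carrier)
  have "b (\<gamma> \<otimes> (x \<otimes> \<psi> y)) = b (x \<otimes> \<psi> y)" using b g x y by (simp add: ISV_def)
  then show "b (\<gamma> \<otimes> x \<otimes> \<psi> y) = b (x \<otimes> \<psi> y)" using \<Gamma>_carrier[OF g] x y by (simp add: m_assoc)
 qed
 then show ?thesis using \<Gamma>_carrier[OF g] x by (simp add: EV_def)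
qed

lemma nabv_ISV:
 assumes a: "a \<in> ISV" and b: "b \<in> ISV"
 shows "nabv a b \<in> ISV"
proof -
 have "nabv a b \<in> SV"
  unfolding nabv_def[abs_def] by (intro SV_add SV_EV SV_star ISV_SV a b)
 moreover have "nabv a b (\<gamma> \<otimes> x) = nabv a b x" if "\<gamma> \<in> \<Gamma>" "x \<in> carrier G" for \<gamma> x
  using EV_invariant[OF b that] a b that by (simp add: nabv_def ISV_def)
 ultimately show ?thesis by (simp add: ISV_def)
qed

definition nab :: "'g set vfield => 'g set vfield => 'g set vfield" where
 "nab X Y = VF (nabv (comp X) (comp Y))"

lemma nab_VN: "X \<in> VN ==> Y \<in> VN ==> nab X Y \<in> VN"
 by (simp add: nab_def VF_VN nabv_ISV comp_ISV)

lemma comp_nab: "X \<in> VN ==> Y \<in> VN ==> comp (nab X Y) = nabv (comp X) (comp Y)"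
 by (simp add: nab_def comp_VF nabv_ISV comp_ISV)

lemma VN_vanish: "X \<in> VN ==> X 0 = 0"
proof -
 assume X: "X \<in> VN"
 have "X (0 *\<^sub>R 0) = 0 *\<^sub>R X 0" using VN_D(2)[OF X] SFN_zero unfolding linear_on_def by blast
 then show ?thesis by simp
qed

lemma VN_lin:
 assumes "X \<in> VN" "f \<in> SFN" "g \<in> SFN"
 shows "X (f + g) = X f + X g" "X (c *\<^sub>R f) = c *\<^sub>R X f"
 using VN_D(2)[OF assms(1)] assms(2,3) unfolding linear_on_def by blast+

section \<open>The module of vector fields and its components\<close>

lemma VN_I:
 assumes "\<And>f. f \<in> SFN ==> X f \<in> SFN" "\<And>f g. f \<in> SFN ==> g \<in> SFN ==> X (f + g) = X f + X g"
  "\<And>f c. f \<in> SFN ==> X (c *\<^sub>R f) = c *\<^sub>R X f"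
  "\<And>f g. f \<in> SFN ==> g \<in> SFN ==> X (f * g) = X f * g + f * X g" "\<And>f. f \<notin> SFN ==> X f = 0"
 shows "X \<in> VN"
 using assms by (auto simp: vector_fields_def linear_on_def)

lemma VN_add: "X \<in> VN ==> Y \<in> VN ==> X + Y \<in> VN"
 by (rule VN_I) (auto simp: VN_D VN_lin SFN_add scaleR_fun_apply fun_eq_iff algebra_simps)

lemma VN_scale: "X \<in> VN ==> c *\<^sub>R X \<in> VN"
 by (rule VN_I) (auto simp: VN_D VN_lin SFN_scale scaleR_fun_apply fun_eq_iff algebra_simps)

lemma SFN_diff: "f \<in> SFN ==> h \<in> SFN ==> f - h \<in> SFN"
 using SFN_add[OF _ SFN_scale, of f h "-1"] by (simp add: fun_eq_iff scaleR_fun_apply)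

lemma VN_diff: "X \<in> VN ==> Y \<in> VN ==> X - Y \<in> VN"
 using VN_add[OF _ VN_scale, of X Y "-1"] by (simp add: fun_eq_iff scaleR_fun_apply)

lemma VN_mult: "f \<in> SFN ==> X \<in> VN ==> vf_mult f X \<in> VN"
 by (rule VN_I) (auto simp: VN_D VN_lin SFN_mult vf_mult_def scaleR_fun_apply fun_eq_iff algebra_simps)

lemma VN_zero: "0 \<in> VN"
 by (rule VN_I) (auto simp: SFN_zero scaleR_fun_apply fun_eq_iff)

lemma VN_bracket:
 assumes X: "X \<in> VN" and Y: "Y \<in> VN"
 shows "vf_bracket X Y \<in> VN"
proof (rule VN_I)
 fix f assume f: "f \<in> SFN"
 note fs = f VN_D(1)[OF X f] VN_D(1)[OF Y f]
 show "vf_bracket X Y f \<in> SFN" by (simp add: vf_bracket_def SFN_diff VN_D X Y f)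
 show "vf_bracket X Y (c *\<^sub>R f) = c *\<^sub>R vf_bracket X Y f" for c
  by (simp add: vf_bracket_def VN_lin[OF X fs(1) fs(1)] VN_lin[OF Y fs(1) fs(1)] VN_lin[OF X fs(3) fs(3)]
    VN_lin[OF Y fs(2) fs(2)] scaleR_diff_right)
 fix g assume g: "g \<in> SFN"
 note gs = g VN_D(1)[OF X g] VN_D(1)[OF Y g]
 show "vf_bracket X Y (f + g) = vf_bracket X Y f + vf_bracket X Y g"
  by (simp add: vf_bracket_def VN_lin[OF X fs(1) gs(1)] VN_lin[OF Y fs(1) gs(1)] VN_lin[OF X fs(3) gs(3)]
    VN_lin[OF Y fs(2) gs(2)])
 have "X (Y (f * g)) = X (Y f) * g + Y f * X g + (X f * Y g + f * X (Y g))"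
  unfolding VN_D(3)[OF Y f g]
  by (simp only: VN_lin(1)[OF X SFN_mult[OF fs(3) g] SFN_mult[OF f gs(3)]] VN_D(3)[OF X fs(3) g] VN_D(3)[OF X f gs(3)])
 moreover have "Y (X (f * g)) = Y (X f) * g + X f * Y g + (Y f * X g + f * Y (X g))"
  unfolding VN_D(3)[OF X f g]
  by (simp only: VN_lin(1)[OF Y SFN_mult[OF fs(2) g] SFN_mult[OF f gs(2)]] VN_D(3)[OF Y fs(2) g] VN_D(3)[OF Y f gs(2)])
 ultimately show "vf_bracket X Y (f * g) = vf_bracket X Y f * g + f * vf_bracket X Y g"
  by (simp add: vf_bracket_def algebra_simps)
qed (simp add: vf_bracket_def VN_D(4)[OF X] VN_D(4)[OF Y] VN_vanish[OF X] VN_vanish[OF Y])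

lemma comp_add: "X \<in> VN ==> Y \<in> VN ==> comp (X + Y) x = comp X x + comp Y x"
 by (cases "x \<in> carrier G") (auto intro!: comp_eq simp: comp_apply E_lin comp_0)

lemma comp_diff: "X \<in> VN ==> Y \<in> VN ==> comp (X - Y) x = comp X x - comp Y x"
 by (cases "x \<in> carrier G") (auto intro!: comp_eq simp: comp_apply E_lin comp_0)

lemma comp_scale: "X \<in> VN ==> comp (c *\<^sub>R X) x = c *\<^sub>R comp X x"
 by (cases "x \<in> carrier G") (auto intro!: comp_eq simp: comp_apply E_lin comp_0 scaleR_fun_apply)

lemma comp_mult: "X \<in> VN ==> comp (vf_mult h X) x = lift h x *\<^sub>R comp X x"
 by (cases "x \<in> carrier G") (auto intro!: comp_eq simp: comp_apply E_lin comp_0 vf_mult_def lift_def[of h])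

lemma comp_zero: "comp 0 x = 0"
 by (cases "x \<in> carrier G") (auto intro!: comp_eq simp: E_lin comp_0)

lemma lift_VN: "X \<in> VN ==> f \<in> SFN ==> lift (X f) = (\<lambda>x. E (comp X x) (lift f) x)"
 by (rule ext) (simp add: lift_def comp_apply E_def[of _ "\<lambda>x. if x \<in> carrier G then f (\<pi> x) else 0"], simp add: E_def lift_def[abs_def])

lemma comp_bracket:
 assumes X: "X \<in> VN" and Y: "Y \<in> VN" and x: "x \<in> carrier G"
 shows "comp (vf_bracket X Y) x = EV (comp X x) (comp Y) x - EV (comp Y x) (comp X) x + lbr (comp X x) (comp Y x)"
proof (rule comp_eq[OF x])
 fix f assume f: "f \<in> SFN"
 have "vf_bracket X Y f (\<pi> x) = E (comp X x) (lift (Y f)) x - E (comp Y x) (lift (X f)) x"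
  by (simp add: vf_bracket_def comp_apply[OF X VN_D(1)[OF Y f] x] comp_apply[OF Y VN_D(1)[OF X f] x])
 also have "\<dots> = E (EV (comp X x) (comp Y) x - EV (comp Y x) (comp X) x + lbr (comp X x) (comp Y x)) (lift f) x"
  unfolding lift_VN[OF X f] lift_VN[OF Y f]
  by (rule E_SV_commutator[OF ISV_SV[OF comp_ISV[OF X]] ISV_SV[OF comp_ISV[OF Y]] lift_SF[OF f] x])
 finally show "vf_bracket X Y f (\<pi> x) = \<dots>" .
qed

lemma comp_SV: "X \<in> VN ==> comp X \<in> SV"
 by (rule ISV_SV[OF comp_ISV])

lemma comp_fun:
 shows "X \<in> VN ==> Y \<in> VN ==> comp (X + Y) = (\<lambda>x. comp X x + comp Y x)"
  and "X \<in> VN ==> comp (c *\<^sub>R X) = (\<lambda>x. c *\<^sub>R comp X x)"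
  and "X \<in> VN ==> comp (vf_mult h X) = (\<lambda>x. lift h x *\<^sub>R comp X x)"
 by (auto simp: comp_add comp_scale comp_mult)

lemma EV_cscale: "a \<in> SV ==> x \<in> carrier G ==> EV v (\<lambda>x. c *\<^sub>R a x) x = c *\<^sub>R EV v a x"
 by (rule EV_eqI[where a'="\<lambda>v. c *\<^sub>R EV v a x"]) (auto intro: has_derivative_scaleR_right EV_deriv)

lemma affine_connection_nab: "affine_connection N nab"
 unfolding affine_connection_def bilinear_on_def linear_on_def
proof (intro conjI ballI allI)
 fix X Y assume X: "X \<in> VN" and Y: "Y \<in> VN"
 note sv = comp_SV[OF X] comp_SV[OF Y]
 show "nab X Y \<in> VN" by (rule nab_VN[OF X Y])
 show "nab X (c *\<^sub>R Y) = c *\<^sub>R nab X Y" for c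
  by (rule VN_eqI) (simp_all add: nab_VN VN_scale X Y comp_scale comp_nab nabv_def comp_fun EV_cscale[OF sv(2)] star_simps scaleR_add_right)
 show "nab (c *\<^sub>R Y) X = c *\<^sub>R nab Y X" for c
  by (rule VN_eqI) (simp_all add: nab_VN VN_scale X Y comp_scale comp_nab nabv_def EV_lin[OF sv(1)] star_simps scaleR_add_right)
 fix Z assume Z: "Z \<in> VN"
 show "nab X (Y + Z) = nab X Y + nab X Z"
  by (rule VN_eqI) (simp_all add: nab_VN VN_add X Y Z comp_add comp_nab nabv_def comp_fun EV_add sv comp_SV[OF Z] star_simps)
 show "nab (Y + Z) X = nab Y X + nab Z X"
  by (rule VN_eqI) (simp_all add: nab_VN VN_add X Y Z comp_add comp_nab nabv_def EV_lin[OF sv(1)] star_simps)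
next
 fix f X Y assume f: "f \<in> SFN" and X: "X \<in> VN" and Y: "Y \<in> VN"
 note sv = comp_SV[OF X] comp_SV[OF Y]
 show "nab (vf_mult f X) Y = vf_mult f (nab X Y)"
  by (rule VN_eqI) (simp_all add: nab_VN VN_mult f X Y comp_mult comp_nab nabv_def EV_lin[OF sv(2)] star_simps scaleR_add_right)
 show "nab X (vf_mult f Y) = vf_mult (X f) Y + vf_mult f (nab X Y)"
  by (rule VN_eqI) (simp_all add: nab_VN VN_mult VN_add VN_D(1)[OF X f] f X Y comp_mult comp_add comp_nab nabv_def comp_fun
    EV_scale[OF lift_SF[OF f] sv(2)] lift_VN[OF X f] star_simps scaleR_add_right)
qed

lemma torsion_free_nab: "torsion_free_connection N nab"
 unfolding torsion_free_connection_def
proof (intro ballI)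
 fix X Y assume X: "X \<in> VN" and Y: "Y \<in> VN"
 show "nab X Y - nab Y X - vf_bracket X Y = 0"
  by (rule VN_eqI) (simp_all add: nab_VN VN_diff VN_bracket VN_zero X Y comp_diff comp_zero comp_nab nabv_def comp_bracket
    star_torsion[symmetric])
qed

text \<open>In components the second derivatives combine by \<open>EV_commutator\<close>, the terms
  with one derivative cancel in pairs, and the rest is left symmetry.\<close>

lemma flat_nab: "flat_connection N nab"
 unfolding flat_connection_def
proof (intro ballI)
 fix X Y Z assume X: "X \<in> VN" and Y: "Y \<in> VN" and Z: "Z \<in> VN"
 let ?a = "comp X" and ?b = "comp Y" and ?c = "comp Z"
 note a = comp_SV[OF X] and b = comp_SV[OF Y] and c = comp_SV[OF Z]
 have D: "EV v (nabv a c) x = EV v (\<lambda>q. EV (a q) c q) x + star (a x) (EV v c x) + star (EV v a x) (c x)"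
  if "x \<in> carrier G" "a \<in> SV" "c \<in> SV" for v x a c
  using EV_add[OF SV_EV[OF that(2,3)] SV_star[OF that(2,3)] that(1)] EV_star[OF that(2,3,1)]
  by (simp add: nabv_def[abs_def])
 have "comp (nab X (nab Y Z) - nab Y (nab X Z) - nab (vf_bracket X Y) Z) x = 0" if x: "x \<in> carrier G" for x
 proof -
  let ?w = "EV (?a x) ?b x - EV (?b x) ?a x + lbr (?a x) (?b x)"
  have "comp (nab X (nab Y Z) - nab Y (nab X Z) - nab (vf_bracket X Y) Z) x
    = nabv ?a (nabv ?b ?c) x - nabv ?b (nabv ?a ?c) x - nabv (comp (vf_bracket X Y)) ?c x"
   by (simp add: comp_diff comp_nab nab_VN VN_diff VN_bracket X Y Z)
  also have "nabv ?a (nabv ?b ?c) x = EV (?a x) (\<lambda>q. EV (?b q) ?c q) x + star (?b x) (EV (?a x) ?c x)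
    + star (EV (?a x) ?b x) (?c x) + star (?a x) (EV (?b x) ?c x) + star (?a x) (star (?b x) (?c x))"
   unfolding nabv_def[of ?a "nabv ?b ?c"] D[OF x b c] by (simp add: nabv_def star_simps)
  also have "nabv ?b (nabv ?a ?c) x = EV (?b x) (\<lambda>q. EV (?a q) ?c q) x + star (?a x) (EV (?b x) ?c x)
    + star (EV (?b x) ?a x) (?c x) + star (?b x) (EV (?a x) ?c x) + star (?b x) (star (?a x) (?c x))"
   unfolding nabv_def[of ?b "nabv ?a ?c"] D[OF x a c] by (simp add: nabv_def star_simps)
  also have "nabv (comp (vf_bracket X Y)) ?c x = EV ?w ?c x + star ?w (?c x)"
   by (simp add: nabv_def comp_bracket[OF X Y x])
  also have "EV ?w ?c x = EV (?a x) (\<lambda>q. EV (?b q) ?c q) x - EV (?b x) (\<lambda>q. EV (?a q) ?c q) x"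
   by (rule EV_commutator[OF a b c x, symmetric])
  also have "star ?w (?c x) = star (EV (?a x) ?b x) (?c x) - star (EV (?b x) ?a x) (?c x)
    + (star (?a x) (star (?b x) (?c x)) - star (?b x) (star (?a x) (?c x)))"
   by (simp add: star_simps star_assoc)
  finally show ?thesis by (rule trans) simp
 qed
 then show "nab X (nab Y Z) - nab Y (nab X Z) - nab (vf_bracket X Y) Z = 0"
  by (intro VN_eqI) (simp_all add: nab_VN VN_diff VN_bracket VN_zero X Y Z comp_zero)
qed

end

subsection \<open>Covariant derivatives along curves\<close>

definition vd :: "(real => 'a::euclidean_space) => real => 'a" where
 "vd v t = frechet_derivative v (at t) 1"

lemma vd_works:
 assumes "smooth_on I v" "t \<in> I"
 shows "(v has_vector_derivative vd v t) (at t)"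
proof -
 note d = smooth_on_has_derivative[OF assms]
 have "frechet_derivative v (at t) = (\<lambda>h. h *\<^sub>R vd v t)"
 proof
  fix h show "frechet_derivative v (at t) h = h *\<^sub>R vd v t"
   using linear_cmul[OF has_derivative_linear[OF d], of h 1] by (simp only: vd_def real_scaleR_def mult_1_right)
 qed
 then show ?thesis using d by (simp add: has_vector_derivative_def)
qed

lemma vd_eqI: "(v has_vector_derivative d) (at t) ==> vd v t = d"
 unfolding vd_def has_vector_derivative_def by (simp flip: frechet_derivative_at)

lemma vd_smooth: "smooth_on I v ==> smooth_on I (vd v)"
 unfolding vd_def[abs_def] by (rule smooth_on_frechet_derivative)

lemma smooth_functions_interval:
 assumes "open I"
 shows "h \<in> smooth_functions (open_submanifold I) \<longleftrightarrow> smooth_on I h \<and> (\<forall>t. t \<notin> I \<longrightarrow> h t = 0)"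
 using plot_real_iff[of I h] assms by (auto simp: smooth_functions_def plot_def open_submanifold_def)

context lie_lattice_lsa begin

lemma SV_chain:
 assumes a: "a \<in> SV" and p: "plot M S p" and s: "s \<in> S"
 shows "((\<lambda>s'. a (p s')) has_derivative (\<lambda>d. EV (mc p s d) a (p s))) (at s)"
proof -
 have "((\<lambda>s'. a (p s') \<bullet> b) has_derivative (\<lambda>d. EV (mc p s d) a (p s) \<bullet> b)) (at s)" for b
  using SF_chain[OF SV_inner[OF a] p s, of b] by (simp only: EV_inner[OF a])
 then show ?thesis by (subst has_derivative_componentwise_within) blast
qed

lemma E_lift_coset:
 assumes "x \<in> carrier G" "x' \<in> carrier G" "\<pi> x = \<pi> x'" "f \<in> SFN"
 shows "E v (lift f) x = E v (lift f) x'"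
proof -
 obtain \<gamma> where "\<gamma> \<in> \<Gamma>" "x' = \<gamma> \<otimes> x" using \<pi>_eq_iff[OF assms(1,2)] assms(3) by blast
 then show ?thesis using E_lift_invariant[OF _ assms(1,4), of \<gamma> v] by simp
qed

text \<open>The constant \<open>b\<close>, cut off outside the group as membership in
  \<open>SV\<close> demands; these functions give a global frame of left invariant fields on the
  quotient.\<close>

definition cfield :: "'e => 'g => 'e" where "cfield b x = (if x \<in> carrier G then b else 0)"

lemma cfield_ISV: "cfield b \<in> ISV"
proof -
 have "cfield b \<in> SV"
 proof (rule SV_I)
  fix x assume x: "x \<in> carrier G"
  show "smooth_on (ball 0 r) (\<lambda>y. cfield b (x \<otimes> \<psi> y))"
   by (rule smooth_on_cong[THEN iffD1, OF open_ball _ smooth_on_const[OF open_ball]])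
    (simp add: cfield_def x psi_carrier del: mem_ball)
 qed (simp add: cfield_def)
 then show ?thesis using \<Gamma>_carrier by (simp add: ISV_def cfield_def)
qed

lemma EV_cfield: "x \<in> carrier G ==> EV v (cfield b) x = 0"
proof (rule EV_eqI[where a'="\<lambda>v. 0"])
 assume x: "x \<in> carrier G"
 show "((\<lambda>y. cfield b (x \<otimes> \<psi> y)) has_derivative (\<lambda>v. 0)) (at 0)"
  by (rule has_derivative_transform_within_open[OF has_derivative_const[of b] open_ball zero_ball])
   (simp add: cfield_def x psi_carrier del: mem_ball)
qed

end

locale lie_lattice_curve = lie_lattice_lsa G M r \<psi> \<phi> \<Gamma> star
 for G :: "('g, 'm) monoid_scheme" (structure) and M :: "('g, 'e::euclidean_space) manifold"
  and r :: real and \<psi> :: "'e => 'g" and \<phi> :: "'g => 'e" and \<Gamma> :: "'g set" and star :: "'e => 'e => 'e" +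
 fixes I :: "real set" and c :: "real => 'g set"
 assumes curve: "plot N I c"
begin

abbreviation VA :: "'g set vfield_along set" where "VA \<equiv> vector_fields_along N I c"

lemma open_I: "open I"
 by (rule plot_open[OF curve])

lemma crep: "t \<in> I ==> rep (c t) \<in> carrier G" "t \<in> I ==> \<pi> (rep (c t)) = c t"
 using rep[of "c t"] plot_in[OF curve] by (auto simp: topspace_N)

text \<open>\<open>rep (c t)\<close> need not depend continuously on \<open>t\<close>. This does no
  harm: lifted functions are periodic and \<open>E\<close> is left invariant, so every
  representative gives the same component, and smoothness is checked with a local lift.\<close>

definition ccomp :: "'g set vfield_along => real => 'e" where
 "ccomp V t = dcomp (\<lambda>f. V f t) (rep (c t))"

definition mkf :: "(real => 'e) => 'g set vfield_along" where
 "mkf v f t = (if f \<in> SFN \<and> t \<in> I then E (v t) (lift f) (rep (c t)) else 0)"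

lemma ccomp_eq:
 assumes "t \<in> I" "x \<in> carrier G" "\<pi> x = c t" "\<And>f. f \<in> SFN ==> V f t = E a (lift f) x"
 shows "ccomp V t = a"
 unfolding ccomp_def
proof (rule dcomp_eq[OF crep(1)[OF assms(1)]])
 fix f assume f: "f \<in> SFN"
 show "V f t = E a (lift f) (rep (c t))"
  unfolding assms(4)[OF f] by (rule E_lift_coset) (use assms crep f in auto)
qed

lemma VA_D:
 assumes "V \<in> VA"
 shows "f \<in> SFN ==> V f \<in> smooth_functions (open_submanifold I)" "linear_on SFN V"
  "f \<in> SFN ==> g \<in> SFN ==> t \<in> I ==> V (f * g) t = V f t * g (c t) + f (c t) * V g t"
  "f \<notin> SFN ==> V f = 0"
 using assms by (auto simp: vector_fields_along_def)

lemma ccomp_apply: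
 assumes V: "V \<in> VA" and f: "f \<in> SFN" and t: "t \<in> I" and x: "x \<in> carrier G" "\<pi> x = c t"
 shows "V f t = E (ccomp V t) (lift f) x"
proof -
 have "V f t = E (dcomp (\<lambda>f. V f t) (rep (c t))) (lift f) (rep (c t))"
 proof (rule dcomp[where D="\<lambda>f. V f t", OF crep(1)[OF t] _ _ f])
  show "linear_on SFN (\<lambda>f. V f t)" using VA_D(2)[OF V] by (simp add: linear_on_def scaleR_fun_apply)
  show "V (f * g) t = V f t * g (\<pi> (rep (c t))) + f (\<pi> (rep (c t))) * V g t" if "f \<in> SFN" "g \<in> SFN" for f g
   using VA_D(3)[OF V that t] by (simp only: crep(2)[OF t])
 qed
 also have "\<dots> = E (ccomp V t) (lift f) x"
  unfolding ccomp_def by (rule E_lift_coset) (use t x crep f in auto)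
 finally show ?thesis .
qed

lemma ccomp_smooth:
 assumes V: "V \<in> VA"
 shows "smooth_on I (ccomp V)"
proof (rule smooth_on_local)
 fix t0 assume "t0 \<in> I"
 then obtain T u where T: "open T" "t0 \<in> T" "T \<subseteq> I" "plot M T u" "\<And>t. t \<in> T ==> c t = \<pi> (u t)"
  by (rule plot_lift[OF curve]) blast
 have "smooth_on T (ccomp V)"
 proof (rule smooth_components[OF T(4)])
  fix f assume f: "f \<in> SFN"
  have "smooth_on I (V f)" using VA_D(1)[OF V f] by (simp add: smooth_functions_interval open_I)
  then have "smooth_on T (V f)" by (rule smooth_on_subset[OF _ T(3)])
  then show "smooth_on T (\<lambda>s. E (ccomp V s) (lift f) (u s))"
   by (rule smooth_on_cong[THEN iffD1, OF T(1), rotated])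
    (rule ccomp_apply[OF V f _ plot_carrier[OF T(4)]], use T in auto)
 qed
 then show "\<exists>T. open T \<and> t0 \<in> T \<and> smooth_on T (ccomp V)" using T by blast
qed

lemma mkf_apply:
 assumes "f \<in> SFN" "t \<in> I" "x \<in> carrier G" "\<pi> x = c t"
 shows "mkf v f t = E (v t) (lift f) x"
 using E_lift_coset[of "rep (c t)" x f "v t"] assms crep[of t] by (simp add: mkf_def)

lemma mkf_VA:
 assumes v: "smooth_on I v"
 shows "mkf v \<in> VA"
 unfolding vector_fields_along_def linear_on_def
proof (intro CollectI conjI ballI allI impI Pi_I)
 fix f assume f: "f \<in> SFN"
 have "smooth_on I (mkf v f)"
 proof (rule smooth_on_local)
  fix t0 assume "t0 \<in> I"
  then obtain T u where T: "open T" "t0 \<in> T" "T \<subseteq> I" "plot M T u" "\<And>t. t \<in> T ==> c t = \<pi> (u t)"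
   by (rule plot_lift[OF curve]) blast
  have "smooth_on T (\<lambda>s. \<Sum>b\<in>Basis. (v s \<bullet> b) * E b (lift f) (u s))"
   by (intro smooth_on_sum smooth_on_mult smooth_on_inner smooth_on_const T(1) smooth_on_subset[OF v T(3)]
     SF_plot[OF E_SF T(4)])
  then have "smooth_on T (mkf v f)"
  proof (rule smooth_on_cong[THEN iffD1, OF T(1), rotated])
   fix s assume s: "s \<in> T"
   have "mkf v f s = E (v s) (lift f) (u s)"
    by (rule mkf_apply[OF f]) (use s T plot_carrier[OF T(4)] in auto)
   then show "(\<Sum>b\<in>Basis. (v s \<bullet> b) * E b (lift f) (u s)) = mkf v f s"
    using linear_eq_sum_Basis[OF linear_E[of "lift f" "u s"], of "v s"] by simp
  qed
  then show "\<exists>T. open T \<and> t0 \<in> T \<and> smooth_on T (mkf v f)" using T by blast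
 qed
 then show "mkf v f \<in> smooth_functions (open_submanifold I)"
  by (simp add: smooth_functions_interval open_I mkf_def)
 show "mkf v (a *\<^sub>R f) = a *\<^sub>R mkf v f" for a
  using f by (intro ext) (simp add: mkf_def SFN_scale lift_scale E_scale lift_SF scaleR_fun_apply)
 fix g assume g: "g \<in> SFN"
 show "mkf v (f + g) = mkf v f + mkf v g"
  using f g by (intro ext) (simp add: mkf_def SFN_add lift_add E_add lift_SF)
 fix t assume t: "t \<in> I"
 show "mkf v (f * g) t = mkf v f t * g (c t) + f (c t) * mkf v g t"
  using f g t crep[OF t] by (simp add: mkf_def SFN_mult lift_mult E_mult lift_SF) (simp add: lift_def)
qed (auto simp: mkf_def fun_eq_iff)

lemma ccomp_mkf: "t \<in> I ==> ccomp (mkf v) t = v t"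
 by (rule ccomp_eq[OF _ crep]) (simp_all add: mkf_def)

lemma mkf_ccomp:
 assumes V: "V \<in> VA"
 shows "mkf (ccomp V) = V"
proof (intro ext)
 fix f t
 show "mkf (ccomp V) f t = V f t"
 proof (cases "f \<in> SFN")
  case f: True
  have "V f t = 0" if "t \<notin> I" using VA_D(1)[OF V f] that by (simp add: smooth_functions_interval open_I)
  then show ?thesis using ccomp_apply[OF V f _ crep, of t] f by (auto simp: mkf_def)
 qed (simp add: mkf_def VA_D(4)[OF V])
qed

lemma mkf_cong: "(\<And>t. t \<in> I ==> v t = w t) ==> mkf v = mkf w"
 by (auto simp: mkf_def fun_eq_iff)

lemma mkf_add: "mkf (\<lambda>t. v t + w t) = mkf v + mkf w"
 by (auto simp: mkf_def fun_eq_iff E_lin)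

lemma mkf_scale: "mkf (\<lambda>t. a *\<^sub>R v t) = a *\<^sub>R mkf v"
 by (auto simp: mkf_def fun_eq_iff E_lin scaleR_fun_apply)

lemma mkf_times: "mkf (\<lambda>t. h t *\<^sub>R v t) = (\<lambda>g. h * mkf v g)"
 by (auto simp: mkf_def fun_eq_iff E_lin)

abbreviation vel :: "real => 'e" where "vel \<equiv> ccomp (velocity N I c)"

lemma velocity_lift:
 assumes T: "T \<subseteq> I" "plot M T u" "\<And>t. t \<in> T ==> c t = \<pi> (u t)" and t: "t \<in> T" and f: "f \<in> SFN"
 shows "velocity N I c f t = E (mc u t 1) (lift f) (u t)"
proof -
 note d = SF_chain[OF lift_SF[OF f] T(2) t]
 have eq: "(\<lambda>h. E (mc u t h) (lift f) (u t)) = (*) (E (mc u t 1) (lift f) (u t))"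
 proof
  fix h show "E (mc u t h) (lift f) (u t) = E (mc u t 1) (lift f) (u t) * h"
   using linear_cmul[OF has_derivative_linear[OF d], of h 1] by (simp only: real_scaleR_def mult_1_right mult.commute[of _ h])
 qed
 have "((\<lambda>s. lift f (u s)) has_field_derivative E (mc u t 1) (lift f) (u t)) (at t)"
  using d unfolding has_field_derivative_def eq .
 then have "((\<lambda>s. f (c s)) has_field_derivative E (mc u t 1) (lift f) (u t)) (at t)"
  by (rule has_field_derivative_transform_within_open[OF _ plot_open[OF T(2)] t])
   (use T(3) plot_carrier[OF T(2)] in \<open>simp add: lift_def\<close>)
 then have "deriv (\<lambda>s. f (c s)) t = E (mc u t 1) (lift f) (u t)" by (rule DERIV_imp_deriv)
 then show ?thesis using f t T(1) by (auto simp: velocity_def)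
qed

lemma vel_lift:
 assumes T: "T \<subseteq> I" "plot M T u" "\<And>t. t \<in> T ==> c t = \<pi> (u t)" and t: "t \<in> T"
 shows "vel t = mc u t 1"
 by (rule ccomp_eq[of t "u t"]) (use assms plot_carrier[OF T(2) t] velocity_lift[OF assms] in auto)

lemma vel_smooth: "smooth_on I vel"
proof (rule smooth_on_local)
 fix t0 assume "t0 \<in> I"
 then obtain T u where T: "open T" "t0 \<in> T" "T \<subseteq> I" "plot M T u" "\<And>t. t \<in> T ==> c t = \<pi> (u t)"
  by (rule plot_lift[OF curve]) blast
 have "smooth_on T vel"
  by (rule smooth_on_cong[THEN iffD1, OF T(1) _ mc_smooth[OF T(4)]]) (rule vel_lift[OF T(3,4,5), symmetric])
 then show "\<exists>T. open T \<and> t0 \<in> T \<and> smooth_on T vel" using T by blast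
qed

lemma velocity_mkf: "velocity N I c = mkf vel"
proof (intro ext)
 fix f t
 show "velocity N I c f t = mkf vel f t"
 proof (cases "f \<in> SFN \<and> t \<in> I")
  case True
  then obtain T u where T: "open T" "t \<in> T" "T \<subseteq> I" "plot M T u" "\<And>t. t \<in> T ==> c t = \<pi> (u t)"
   by (meson plot_lift[OF curve])
  have "velocity N I c f t = E (mc u t 1) (lift f) (u t)"
   using velocity_lift[OF T(3,4,5,2)] True by blast
  also have "\<dots> = mkf vel f t"
   using mkf_apply[of f t "u t" vel] True T plot_carrier[OF T(4,2)] vel_lift[OF T(3,4,5,2)] by simp
  finally show ?thesis .
 qed (auto simp: velocity_def mkf_def)
qed

lemma velocity_VA: "velocity N I c \<in> VA"
 by (rule subst[of "mkf vel" "velocity N I c" "\<lambda>V. V \<in> VA", OF velocity_mkf[symmetric] mkf_VA[OF vel_smooth]])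

definition DC :: "'g set vfield_along => 'g set vfield_along" where
 "DC V = mkf (\<lambda>t. vd (ccomp V) t + star (vel t) (ccomp V t))"

lemma DC_smooth: "smooth_on I v ==> smooth_on I (\<lambda>t. vd v t + star (vel t) (v t))"
 by (rule smooth_on_add[OF open_I vd_smooth smooth_on_bilinear[OF open_I bounded_bilinear_star vel_smooth]])

lemma vd_cong:
 assumes "\<And>t. t \<in> I ==> v t = w t" "t \<in> I"
 shows "vd v t = vd w t"
 unfolding vd_def using frechet_derivative_cong_on[OF open_I assms(2) assms(1)] by simp

lemma DC_mkf: "DC (mkf v) = mkf (\<lambda>t. vd v t + star (vel t) (v t))"
 unfolding DC_def by (rule mkf_cong) (simp add: ccomp_mkf vd_cong[of "ccomp (mkf v)" v])

lemma nab_cfield: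
 assumes f: "f \<in> SFN" and x: "x \<in> carrier G"
 shows "nab (VF (cfield a)) (VF (cfield b)) f (\<pi> x) = E (star a b) (lift f) x"
proof -
 have "nab (VF (cfield a)) (VF (cfield b)) f (\<pi> x) = E (nabv (cfield a) (cfield b) x) (lift f) x"
  unfolding nab_def comp_VF[OF cfield_ISV] by (rule VF_apply[OF nabv_ISV[OF cfield_ISV cfield_ISV] f x])
 then show ?thesis by (simp add: nabv_def EV_cfield[OF x]) (simp add: cfield_def x)
qed

lemma vf_restrict_mkf:
 assumes Y: "Y \<in> VN"
 shows "vf_restrict I c Y = mkf (\<lambda>t. comp Y (rep (c t)))"
proof (intro ext)
 fix f t
 show "vf_restrict I c Y f t = mkf (\<lambda>t. comp Y (rep (c t))) f t"
  using comp_apply[OF Y, of f "rep (c t)"] crep[of t] VN_D(4)[OF Y, of f] by (auto simp: vf_restrict_def mkf_def)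
qed

lemma comp_rep:
 assumes Y: "Y \<in> VN" and t: "t \<in> I" and x: "x \<in> carrier G" "\<pi> x = c t"
 shows "comp Y (rep (c t)) = comp Y x"
proof -
 obtain \<gamma> where "\<gamma> \<in> \<Gamma>" "rep (c t) = \<gamma> \<otimes> x" using \<pi>_eq_iff[OF x(1) crep(1)[OF t]] crep(2)[OF t] x by auto
 then show ?thesis using comp_ISV[OF Y] x(1) by (simp add: ISV_def)
qed

lemma comp_rep_deriv:
 assumes Y: "Y \<in> VN" and t: "t \<in> I"
 shows "((\<lambda>t. comp Y (rep (c t))) has_vector_derivative EV (vel t) (comp Y) (rep (c t))) (at t)"
proof -
 obtain T u where T: "open T" "t \<in> T" "T \<subseteq> I" "plot M T u" "\<And>t. t \<in> T ==> c t = \<pi> (u t)"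
  using t by (meson plot_lift[OF curve])
 have uc: "u s \<in> carrier G" if "s \<in> T" for s by (rule plot_carrier[OF T(4) that])
 note d = SV_chain[OF comp_SV[OF Y] T(4,2)]
 have eq: "(\<lambda>h. EV (mc u t h) (comp Y) (u t)) = (\<lambda>h. h *\<^sub>R EV (mc u t 1) (comp Y) (u t))"
 proof
  fix h show "EV (mc u t h) (comp Y) (u t) = h *\<^sub>R EV (mc u t 1) (comp Y) (u t)"
   using linear_cmul[OF has_derivative_linear[OF d], of h 1] by (simp only: real_scaleR_def mult_1_right)
 qed
 have "((\<lambda>s. comp Y (u s)) has_vector_derivative EV (mc u t 1) (comp Y) (u t)) (at t)"
  using d unfolding has_vector_derivative_def eq .
 then have "((\<lambda>t. comp Y (rep (c t))) has_vector_derivative EV (mc u t 1) (comp Y) (u t)) (at t)"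
 proof (rule has_vector_derivative_transform_within_open[OF _ T(1,2)])
  fix s assume s: "s \<in> T"
  show "comp Y (u s) = comp Y (rep (c s))"
   by (rule comp_rep[OF Y _ uc[OF s], symmetric]) (use s T in auto)
 qed
 moreover have "EV (mc u t 1) (comp Y) (u t) = EV (vel t) (comp Y) (rep (c t))"
 proof -
  obtain \<gamma> where "\<gamma> \<in> \<Gamma>" "rep (c t) = \<gamma> \<otimes> u t"
   using \<pi>_eq_iff[OF uc[OF T(2)] crep(1)[OF t]] crep(2)[OF t] T(5)[OF T(2)] by auto
  then show ?thesis using EV_invariant[OF comp_ISV[OF Y] _ uc[OF T(2)]] vel_lift[OF T(3,4,5,2)] by simp
 qed
 ultimately show ?thesis by simp
qed

text \<open>Existence of the covariant derivative. The restriction rule holds because along a local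
  lift the components of \<open>Y\<close> change by \<open>EV\<close> in the direction of the
  velocity.\<close>

lemma covariant_derivative_DC: "covariant_derivative_along N nab I c DC"
 unfolding covariant_derivative_along_def linear_on_def
proof (intro conjI ballI allI impI Pi_I)
 fix V assume V: "V \<in> VA"
 note v = ccomp_smooth[OF V]
 show "DC V \<in> VA" unfolding DC_def by (rule mkf_VA[OF DC_smooth[OF v]])
 show "DC (a *\<^sub>R V) = a *\<^sub>R DC V" for a
 proof -
  have "DC (a *\<^sub>R V) = DC (mkf (\<lambda>t. a *\<^sub>R ccomp V t))" by (simp only: mkf_scale mkf_ccomp[OF V])
  also have "\<dots> = mkf (\<lambda>t. a *\<^sub>R (vd (ccomp V) t + star (vel t) (ccomp V t)))"
   unfolding DC_mkf
  proof (rule mkf_cong)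
   fix t assume t: "t \<in> I"
   have "vd (\<lambda>t. a *\<^sub>R ccomp V t) t = a *\<^sub>R vd (ccomp V) t"
    by (rule vd_eqI[OF has_vector_derivative_scaleR[OF DERIV_const vd_works[OF v t], of a, simplified]])
   then show "vd (\<lambda>t. a *\<^sub>R ccomp V t) t + star (vel t) (a *\<^sub>R ccomp V t) = a *\<^sub>R (vd (ccomp V) t + star (vel t) (ccomp V t))"
    by (simp add: star_simps scaleR_add_right)
  qed
  finally show ?thesis by (simp only: mkf_scale DC_def)
 qed
 show "DC (V + W) = DC V + DC W" if W: "W \<in> VA" for W
 proof -
  note w = ccomp_smooth[OF W]
  have "DC (V + W) = DC (mkf (\<lambda>t. ccomp V t + ccomp W t))" by (simp only: mkf_add mkf_ccomp[OF V] mkf_ccomp[OF W])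
  also have "\<dots> = mkf (\<lambda>t. (vd (ccomp V) t + star (vel t) (ccomp V t)) + (vd (ccomp W) t + star (vel t) (ccomp W t)))"
   unfolding DC_mkf
  proof (rule mkf_cong)
   fix t assume t: "t \<in> I"
   have "vd (\<lambda>t. ccomp V t + ccomp W t) t = vd (ccomp V) t + vd (ccomp W) t"
    by (rule vd_eqI[OF has_vector_derivative_add[OF vd_works[OF v t] vd_works[OF w t]]])
   then show "vd (\<lambda>t. ccomp V t + ccomp W t) t + star (vel t) (ccomp V t + ccomp W t)
     = (vd (ccomp V) t + star (vel t) (ccomp V t)) + (vd (ccomp W) t + star (vel t) (ccomp W t))"
    by (simp add: star_simps)
  qed
  finally show ?thesis by (simp only: mkf_add DC_def)
 qed
 fix h f t assume h: "h \<in> smooth_functions (open_submanifold I)" and f: "f \<in> SFN" and t: "t \<in> I"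
 have hs: "smooth_on I h" using h by (simp add: smooth_functions_interval open_I)
 have h': "(h has_field_derivative deriv h t) (at t)"
  using smooth_on_has_derivative[OF hs t] by (metis field_differentiable_derivI has_field_derivative_def
    field_differentiable_def vd_works[OF hs t] has_real_derivative_iff_has_vector_derivative)
 have "(\<lambda>g. h * V g) = mkf (\<lambda>t. h t *\<^sub>R ccomp V t)" by (simp only: mkf_times mkf_ccomp[OF V])
 then have "DC (\<lambda>g. h * V g) f t = mkf (\<lambda>t. vd (\<lambda>t. h t *\<^sub>R ccomp V t) t + star (vel t) (h t *\<^sub>R ccomp V t)) f t"
  by (simp only: DC_mkf)
 also have "vd (\<lambda>t. h t *\<^sub>R ccomp V t) t = h t *\<^sub>R vd (ccomp V) t + deriv h t *\<^sub>R ccomp V t"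
  by (rule vd_eqI[OF has_vector_derivative_scaleR[OF h' vd_works[OF v t]]])
 then have "mkf (\<lambda>t. vd (\<lambda>t. h t *\<^sub>R ccomp V t) t + star (vel t) (h t *\<^sub>R ccomp V t)) f t
   = deriv h t * V f t + h t * DC V f t"
  using f t ccomp_apply[OF V f t crep[OF t]] by (simp add: mkf_def DC_def E_lin star_simps algebra_simps)
 finally show "DC (\<lambda>g. h * V g) f t = deriv h t * V f t + h t * DC V f t" .
next
 fix X Y t f assume X: "X \<in> VN" and Y: "Y \<in> VN" and t: "t \<in> I" and f: "f \<in> SFN"
  and Xv: "\<forall>f\<in>SFN. X f (c t) = velocity N I c f t"
 let ?x = "rep (c t)"
 note x = crep[OF t]
 have "comp X ?x = vel t"
 proof (rule comp_eq[OF x(1)])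
  fix f assume f: "f \<in> SFN"
  show "X f (\<pi> ?x) = E (vel t) (lift f) ?x"
   using Xv f ccomp_apply[OF velocity_VA f t x] x(2) by simp
 qed
 moreover have "vd (\<lambda>t. comp Y (rep (c t))) t = EV (vel t) (comp Y) ?x" by (rule vd_eqI[OF comp_rep_deriv[OF Y t]])
 ultimately have "DC (vf_restrict I c Y) f t = E (nabv (comp X) (comp Y) ?x) (lift f) ?x"
  using f t by (simp add: vf_restrict_mkf[OF Y] DC_mkf mkf_def nabv_def)
 also have "\<dots> = nab X Y f (c t)"
  using comp_apply[OF nab_VN[OF X Y] f x(1)] x(2) by (simp add: comp_nab X Y)
 finally show "DC (vf_restrict I c Y) f t = nab X Y f (c t)" .
qed

text \<open>Every field along the curve is a sum of functions times restrictions of the left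
  invariant frame, and on these the defining properties fix \<open>D\<close>. So being a geodesic
  does not depend on the choice of \<open>D\<close>.\<close>

lemma covariant_derivative_unique:
 assumes D: "covariant_derivative_along N nab I c D" and v: "smooth_on I v"
  and f: "f \<in> SFN" and t: "t \<in> I"
 shows "D (mkf v) f t = E (vd v t + star (vel t) (v t)) (lift f) (rep (c t))"
proof -
 let ?x = "rep (c t)"
 note x = crep[OF t]
 \<comment> \<open>Cut off outside \<open>I\<close> to be a normalised smooth function on the
   interval.\<close>
 define h where "h b t = (if t \<in> I then v t \<bullet> b else 0)" for b t
 define Y where "Y b = VF (cfield b)" for b
 have Y: "Y b \<in> VN" for b by (simp add: Y_def VF_VN cfield_ISV)
 have hs: "smooth_on I (h b)" for b
  by (rule smooth_on_cong[THEN iffD1, OF open_I _ smooth_on_inner[OF open_I v smooth_on_const[OF open_I, of b]]]) (simp add: h_def)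
 have hS: "h b \<in> smooth_functions (open_submanifold I)" for b
  using hs by (simp add: smooth_functions_interval open_I h_def)
 have restr: "vf_restrict I c (Y b) = mkf (\<lambda>t. b)" for b
  unfolding vf_restrict_mkf[OF Y]
  by (rule mkf_cong) (use crep in \<open>simp add: Y_def comp_VF cfield_ISV cfield_def\<close>)
 have rVA: "vf_restrict I c (Y b) \<in> VA" for b unfolding restr by (rule mkf_VA[OF smooth_on_const[OF open_I]])
 define V where "V b = (\<lambda>g. h b * vf_restrict I c (Y b) g)" for b
 have Vm: "V b = mkf (\<lambda>t. h b t *\<^sub>R b)" for b by (simp only: V_def restr mkf_times)
 have VVA: "V b \<in> VA" for b
  unfolding Vm by (rule mkf_VA[OF smooth_on_scaleR[OF open_I hs smooth_on_const[OF open_I]]])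
 have VA_add: "A + B \<in> VA" if "A \<in> VA" "B \<in> VA" for A B
  using mkf_VA[OF smooth_on_add[OF open_I ccomp_smooth[OF that(1)] ccomp_smooth[OF that(2)]]]
  by (simp only: mkf_add mkf_ccomp that)
 have VA_0: "0 \<in> VA"
  using mkf_VA[OF smooth_on_const[OF open_I, of 0]] mkf_scale[of 0 "\<lambda>t. 0"] by simp
 have sum: "mkf v = (\<Sum>b\<in>Basis. V b)"
 proof (intro ext)
  fix f t
  show "mkf v f t = (\<Sum>b\<in>Basis. V b) f t"
   using linear_eq_sum_Basis[OF linear_E[of "lift f" "rep (c t)"], of "v t"]
   by (cases "f \<in> SFN \<and> t \<in> I") (auto simp: sum_fun_apply Vm mkf_def E_lin h_def)
 qed
 have lin: "linear_on VA D" using D by (simp add: covariant_derivative_along_def)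
 have "D (mkf v) = (\<Sum>b\<in>Basis. D (V b))"
  unfolding sum using linear_on_sum[OF lin VA_0 VA_add, of Basis V] VVA by simp
 then have "D (mkf v) f t = (\<Sum>b\<in>Basis. D (V b) f t)" by (simp add: sum_fun_apply)
 also have "\<dots> = (\<Sum>b\<in>Basis. (vd v t \<bullet> b) * E b (lift f) ?x + (v t \<bullet> b) * E (star (vel t) b) (lift f) ?x)"
 proof (rule sum.cong[OF refl])
  fix b :: 'e
  have "((\<lambda>s. v s \<bullet> b) has_vector_derivative vd v t \<bullet> b) (at t)"
   using has_derivative_inner_left[OF vd_works[OF v t, unfolded has_vector_derivative_def], of b]
   by (simp add: has_vector_derivative_def)
  then have "(h b has_vector_derivative vd v t \<bullet> b) (at t)"
   by (rule has_vector_derivative_transform_within_open[OF _ open_I t]) (simp add: h_def)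
  then have dh: "deriv (h b) t = vd v t \<bullet> b"
   by (intro DERIV_imp_deriv) (simp add: has_real_derivative_iff_has_vector_derivative)
  have "D (V b) f t = deriv (h b) t * vf_restrict I c (Y b) f t + h b t * D (vf_restrict I c (Y b)) f t"
   using D hS rVA f t unfolding covariant_derivative_along_def V_def by blast
  moreover have "vf_restrict I c (Y b) f t = E b (lift f) ?x" using f t by (simp add: restr mkf_def)
  moreover have "D (vf_restrict I c (Y b)) f t = nab (VF (cfield (vel t))) (Y b) f (c t)"
  proof -
   \<comment> \<open>The invariant field with the components of the velocity at time
     \<open>t\<close> is a global field extending that single tangent vector, as the restriction
     rule demands.\<close>
   have "VF (cfield (vel t)) f (c t) = velocity N I c f t" if f: "f \<in> SFN" for f
    using VF_apply[OF cfield_ISV f x(1), of "vel t"] x ccomp_apply[OF velocity_VA f t x] by (simp add: cfield_def)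
   then show ?thesis
    using D VF_VN[OF cfield_ISV] Y t f unfolding covariant_derivative_along_def by blast
  qed
  moreover have "nab (VF (cfield (vel t))) (Y b) f (c t) = E (star (vel t) b) (lift f) ?x"
   using nab_cfield[OF f x(1)] x(2) by (simp add: Y_def)
  ultimately show "D (V b) f t = (vd v t \<bullet> b) * E b (lift f) ?x + (v t \<bullet> b) * E (star (vel t) b) (lift f) ?x"
   using t by (simp only: dh) (simp add: h_def)
 qed
 also have "\<dots> = E (vd v t) (lift f) ?x + E (star (vel t) (v t)) (lift f) ?x"
 proof -
  have "linear (\<lambda>w. E (star (vel t) w) (lift f) ?x)"
   using linear_compose[OF bounded_linear.linear[OF bounded_bilinear.bounded_linear_right[OF bounded_bilinear_star]] linear_E]
   by (simp add: o_def)
  from linear_eq_sum_Basis[OF this, of "v t"] linear_eq_sum_Basis[OF linear_E[of "lift f" ?x], of "vd v t"]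
  show ?thesis by (simp add: sum.distrib)
 qed
 finally show ?thesis by (simp add: E_lin)
qed

lemma geodesic_iff:
 "geodesic_on N nab I c \<longleftrightarrow> (\<forall>t\<in>I. (vel has_vector_derivative - star (vel t) (vel t)) (at t))"
proof
 assume "geodesic_on N nab I c"
 then obtain D where D: "covariant_derivative_along N nab I c D" "D (velocity N I c) = 0"
  by (auto simp: geodesic_on_def)
 show "\<forall>t\<in>I. (vel has_vector_derivative - star (vel t) (vel t)) (at t)"
 proof
  fix t assume t: "t \<in> I"
  have "vd vel t + star (vel t) (vel t) = 0"
  proof (rule E_lift_inj[OF crep(1)[OF t]])
   fix f assume f: "f \<in> SFN"
   show "E (vd vel t + star (vel t) (vel t)) (lift f) (rep (c t)) = E 0 (lift f) (rep (c t))"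
    using covariant_derivative_unique[OF D(1) vel_smooth f t] D(2) by (simp add: E_lin flip: velocity_mkf)
  qed
  then show "(vel has_vector_derivative - star (vel t) (vel t)) (at t)"
   using vd_works[OF vel_smooth t] by (simp add: eq_neg_iff_add_eq_0[symmetric])
 qed
next
 assume g: "\<forall>t\<in>I. (vel has_vector_derivative - star (vel t) (vel t)) (at t)"
 have "DC (velocity N I c) = mkf (\<lambda>t. vd vel t + star (vel t) (vel t))"
  by (simp only: DC_def)
 also have "\<dots> = mkf (\<lambda>t. 0)"
  by (rule mkf_cong) (use g vd_eqI in force)
 also have "\<dots> = 0" by (auto simp: mkf_def fun_eq_iff E_lin)
 finally have "DC (velocity N I c) = 0" .
 then show "geodesic_on N nab I c"
  using covariant_derivative_DC curve unfolding geodesic_on_def plot_def by blast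
qed

end

context lie_lattice_lsa begin

text \<open>Repackages the analysis of one curve outside its locale; \<open>w\<close> is
  characterised by local lifts, so that it can be compared with lifts built later.\<close>

lemma geodesic_imp:
 assumes I: "open I" and g: "geodesic_on N nab I c"
 obtains w where "plot N I c" "\<And>t. t \<in> I ==> (w has_vector_derivative - star (w t) (w t)) (at t)"
  "\<And>T u t. [| T \<subseteq> I; plot M T u; \<And>t. t \<in> T ==> c t = \<pi> (u t); t \<in> T |] ==> mc u t 1 = w t"
proof -
 have c: "plot N I c" using assms by (simp add: plot_def geodesic_on_def)
 interpret lie_lattice_curve G M r \<psi> \<phi> \<Gamma> star I c by unfold_locales (rule c)
 show ?thesis by (rule that[of vel, OF c]) (use geodesic_iff g vel_lift in auto)
qed

lemma geodesicI:
 assumes u: "plot M UNIV u" and w: "\<And>t. mc u t 1 = w t" "\<And>t. (w has_vector_derivative - star (w t) (w t)) (at t)"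
 shows "geodesic_on N nab UNIV (\<lambda>t. \<pi> (u t))"
proof -
 interpret lie_lattice_curve G M r \<psi> \<phi> \<Gamma> star UNIV "\<lambda>t. \<pi> (u t)" by unfold_locales (rule plot_\<pi>[OF u])
 have "vel = w"
 proof
  fix t show "vel t = w t" using vel_lift[of UNIV u t] u w(1) by simp
 qed
 then show ?thesis unfolding geodesic_iff using w(2) by simp
qed

end

subsection \<open>Geodesic completeness\<close>

lemma compact_norm_bound:
 assumes "compact C" "continuous_on C f"
 shows "\<exists>B. \<forall>x\<in>C. norm (f x) \<le> B"
 using compact_imp_bounded[OF compact_continuous_image[OF assms(2,1)]] unfolding bounded_iff by blast

lemma smooth_on_lipschitz:
 fixes f :: "'a::euclidean_space => 'b::euclidean_space"
 assumes f: "smooth_on S f" and C: "compact C" "convex C" "C \<subseteq> S"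
 obtains L where "0 \<le> L" "\<And>x y. x \<in> C ==> y \<in> C ==> norm (f x - f y) \<le> L * norm (x - y)"
proof -
 let ?D = "\<lambda>x. frechet_derivative f (at x)"
 have "\<exists>B. \<forall>x\<in>C. norm (?D x b) \<le> B" for b
  by (rule compact_norm_bound[OF C(1) continuous_on_subset[OF smooth_on_imp_continuous_on[OF smooth_on_frechet_derivative[OF f]] C(3)]])
 then obtain B where B: "\<And>b x. x \<in> C ==> norm (?D x b) \<le> B b" by metis
 define L where "L = (\<Sum>b\<in>Basis. \<bar>B b\<bar>)"
 have on: "onorm (?D x) \<le> L" if x: "x \<in> C" for x
 proof (rule onorm_le)
  fix h
  have xS: "x \<in> S" using x C(3) by blast
  have "norm (?D x h) = norm (\<Sum>b\<in>Basis. (h \<bullet> b) *\<^sub>R ?D x b)"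
   using linear_eq_sum_Basis[OF has_derivative_linear[OF smooth_on_has_derivative[OF f xS]], of h] by (simp only:)
  also have "\<dots> \<le> (\<Sum>b\<in>Basis. \<bar>B b\<bar> * norm h)"
  proof (rule sum_norm_le)
   fix b :: 'a assume b: "b \<in> Basis"
   have "\<bar>h \<bullet> b\<bar> * norm (?D x b) \<le> norm h * \<bar>B b\<bar>"
    using Basis_le_norm[OF b, of h] B[OF x, of b] by (intro mult_mono) auto
   then show "norm ((h \<bullet> b) *\<^sub>R ?D x b) \<le> \<bar>B b\<bar> * norm h" by (simp add: mult.commute)
  qed
  finally show "norm (?D x h) \<le> L * norm h" by (simp only: L_def sum_distrib_right)
 qed
 show ?thesis
 proof (rule that)
  show "0 \<le> L" by (simp add: L_def sum_nonneg)
  fix x y assume xy: "x \<in> C" "y \<in> C"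
  show "norm (f x - f y) \<le> L * norm (x - y)"
  proof (rule differentiable_bound[where f=f and f'="?D" and S=C, OF C(2) _ _ xy])
   show "onorm (?D z) \<le> L" if "z \<in> C" for z by (rule on[OF that])
   fix z assume "z \<in> C"
   then have "z \<in> S" using C(3) by blast
   from smooth_on_has_derivative[OF f this] show "(f has_derivative ?D z) (at z within C)"
    by (rule has_derivative_at_withinI)
  qed
 qed
qed

context lie_chart begin

text \<open>The equation for a curve with logarithmic derivative \<open>w\<close> is left invariant,
  so it is solved as \<open>x0 \<otimes> \<psi> (y t)\<close> with \<open>y\<close> starting at 0,
  and the time step is the same for all \<open>x0\<close>; the bound \<open>K\<close> makes it the
  same for all \<open>t0\<close>.\<close>

lemma local_flow:
 fixes w :: "real => 'e"
 assumes w: "smooth_on UNIV w" and K: "\<And>t. norm (w t) \<le> K"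
 obtains e where "e > 0" "\<And>t0 x0. x0 \<in> carrier G ==>
  \<exists>u. plot M {t0 - e<..<t0 + e} u \<and> u t0 = x0 \<and> (\<forall>t\<in>{t0 - e<..<t0 + e}. mc u t 1 = w t)"
proof -
 define C where "C = cball (0::'e) (r / 2)"
 have C: "compact C" "convex C" "closed C" "C \<noteq> {}" "C \<subseteq> ball 0 r" using r_pos by (auto simp: C_def)
 have "\<exists>L. 0 \<le> L \<and> (\<forall>x\<in>C. \<forall>y\<in>C. norm (mci x b - mci y b) \<le> L * norm (x - y))" for b
  by (rule smooth_on_lipschitz[OF mci_smooth[of b] C(1,2,5)]) blast
 then obtain L where L: "\<And>b. 0 \<le> L b" "\<And>b x y. x \<in> C ==> y \<in> C ==> norm (mci x b - mci y b) \<le> L b * norm (x - y)" by metis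
 have "\<exists>B. \<forall>x\<in>C. norm (mci x b) \<le> B" for b
  by (rule compact_norm_bound[OF C(1) continuous_on_subset[OF smooth_on_imp_continuous_on[OF mci_smooth] C(5)]])
 then obtain B where B: "\<And>b x. x \<in> C ==> norm (mci x b) \<le> B b" by metis
 \<comment> \<open>Projecting to the ball \<open>C\<close> makes the field globally Lipschitz and
   bounded, as the existence theorem wants; the time step keeps the solution in \<open>C\<close>,
   where the projection is the identity.\<close>
 define cp where "cp = closest_point C"
 have cpC: "cp y \<in> C" for y unfolding cp_def by (rule closest_point_in_set[OF C(3,4)])
 have cp_lip: "norm (cp x - cp y) \<le> norm (x - y)" for x y
  using closest_point_lipschitz[OF C(2,3,4), of x y] by (simp add: cp_def dist_norm)
 define F where "F = (\<lambda>t y. \<Sum>b\<in>Basis. (w t \<bullet> b) *\<^sub>R mci (cp y) b)"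
 have K0: "0 \<le> K" using K[of 0] norm_ge_zero order_trans by blast
 have wb: "\<bar>w t \<bullet> b\<bar> \<le> K" if "b \<in> Basis" for t b using Basis_le_norm[OF that, of "w t"] K[of t] by simp
 define L' where "L' = (\<Sum>b\<in>Basis. K * L b)"
 define B' where "B' = (\<Sum>b\<in>Basis. K * \<bar>B b\<bar>)"
 have L'0: "0 \<le> L'" "0 \<le> B'" using K0 L(1) by (auto simp: L'_def B'_def intro!: sum_nonneg)
 have cont: "continuous_on UNIV (\<lambda>(t, x). F t x)"
 proof -
  have 1: "continuous_on UNIV (\<lambda>z::real \<times> 'e. mci (cp (snd z)) b)" for b
  proof (rule continuous_on_compose2[OF smooth_on_imp_continuous_on[OF mci_smooth]])
   show "continuous_on UNIV (\<lambda>z::real \<times> 'e. cp (snd z))" unfolding cp_def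
    by (intro continuous_on_compose2[OF continuous_on_closest_point[OF C(2,3,4)]] continuous_intros) auto
  qed (use cpC C(5) in blast)
  have 2: "continuous_on UNIV (\<lambda>z::real \<times> 'e. w (fst z))"
   by (rule continuous_on_compose2[OF smooth_on_imp_continuous_on[OF w]]) (auto intro: continuous_intros)
  show ?thesis unfolding F_def case_prod_unfold by (intro continuous_intros 1 2)
 qed
 have lip: "norm (F t x - F t y) \<le> L' * norm (x - y)" for t x y
 proof -
  have "F t x - F t y = (\<Sum>b\<in>Basis. (w t \<bullet> b) *\<^sub>R (mci (cp x) b - mci (cp y) b))"
   by (simp add: F_def sum_subtractf scaleR_diff_right)
  also have "norm \<dots> \<le> (\<Sum>b\<in>Basis. K * L b * norm (x - y))"
  proof (rule sum_norm_le)
   fix b :: 'e assume b: "b \<in> Basis"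
   have "norm (mci (cp x) b - mci (cp y) b) \<le> L b * norm (x - y)"
    by (rule order_trans[OF L(2)[OF cpC cpC] mult_left_mono[OF cp_lip L(1)]])
   then have "\<bar>w t \<bullet> b\<bar> * norm (mci (cp x) b - mci (cp y) b) \<le> K * (L b * norm (x - y))"
    using wb[OF b] K0 by (intro mult_mono) auto
   then show "norm ((w t \<bullet> b) *\<^sub>R (mci (cp x) b - mci (cp y) b)) \<le> K * L b * norm (x - y)" by (simp add: mult.assoc)
  qed
  finally show ?thesis by (simp add: L'_def sum_distrib_right)
 qed
 have bd: "norm (F t x) \<le> B'" for t x
  unfolding F_def B'_def
 proof (rule sum_norm_le)
  fix b :: 'e assume b: "b \<in> Basis"
  have "\<bar>w t \<bullet> b\<bar> * norm (mci (cp x) b) \<le> K * \<bar>B b\<bar>"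
   using wb[OF b] K0 B[OF cpC, of x b] by (intro mult_mono) auto
  then show "norm ((w t \<bullet> b) *\<^sub>R mci (cp x) b) \<le> K * \<bar>B b\<bar>" by simp
 qed
 \<comment> \<open>The first term ensures the contraction, the second that the solution stays within
   distance \<open>r / 2\<close>; adding 1 avoids division by zero.\<close>
 define e where "e = min (1 / (L' + 1)) (r / 2 / (B' + 1)) / 2"
 have e: "e > 0" "L' * e < 1" "B' * e \<le> r / 2"
 proof -
  show e0: "e > 0" using L'0 r_pos by (simp add: e_def)
  have "2 * e \<le> 1 / (L' + 1)" "2 * e \<le> r / 2 / (B' + 1)" unfolding e_def by simp_all
  then have "e < 1 / (L' + 1)" "e \<le> r / 2 / (B' + 1)" using e0 by linarith+
  then have "e * (L' + 1) < 1" "e * (B' + 1) \<le> r / 2"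
   using pos_less_divide_eq[of "L' + 1" e 1] pos_le_divide_eq[of "B' + 1" e "r / 2"] L'0 by linarith+
  then show "L' * e < 1" "B' * e \<le> r / 2" using e0 by (simp_all add: algebra_simps)
 qed
 show ?thesis
 proof (rule that[OF e(1)])
  fix t0 :: real and x0 assume x0: "x0 \<in> carrier G"
  let ?J = "{t0 - e<..<t0 + e}"
  obtain y where y: "y t0 = 0" "\<And>t. \<bar>t - t0\<bar> < e ==> (y has_vector_derivative F t (y t)) (at t)"
    "\<And>t. norm (y t - 0) \<le> B' * e"
   by (rule Picard_Lindelof[OF cont lip bd e(1) L'0(1) e(2), of t0 0]) blast
  have yC: "y t \<in> C" for t using y(3)[of t] e(3) by (simp add: C_def)
  have yb: "y t \<in> ball 0 r" for t using yC C(5) by blast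
  have cpy: "cp (y t) = y t" for t unfolding cp_def by (rule closest_point_self[OF yC])
  have Fy: "F t (y t) = (\<Sum>b\<in>Basis. (w t \<bullet> b) *\<^sub>R mci (y t) b)" for t by (simp add: F_def cpy)
  have Fy': "F t (y t) = mci (y t) (w t)" for t
   unfolding Fy by (rule linear_eq_sum_Basis[OF linear_mci[OF yb], symmetric])
  have dy: "(y has_vector_derivative F t (y t)) (at t)" if "t \<in> ?J" for t
   by (rule y(2)) (use that in \<open>simp add: abs_less_iff\<close>)
  have ys: "smooth_on ?J y"
  proof (rule smooth_on_vector_derivI[OF open_greaterThanLessThan dy])
   fix k assume k: "ck_on k ?J y"
   have "ck_on k ?J w" using w ck_on_subset[of k UNIV w ?J] by (simp add: smooth_on_def)
   then have wk: "ck_on k ?J (\<lambda>t. w t \<bullet> b)" for b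
    by (rule ck_on_linear[OF open_greaterThanLessThan bounded_linear_inner_left])
   have mk: "ck_on k ?J (\<lambda>t. mci (y t) b)" for b
    by (rule ck_on_compose[OF open_greaterThanLessThan open_ball k]) (use yb mci_smooth[of b] in \<open>auto simp: smooth_on_def\<close>)
   show "ck_on k ?J (\<lambda>t. F t (y t))"
    unfolding Fy
    by (rule ck_on_sum[OF open_greaterThanLessThan ck_on_bilinear[OF open_greaterThanLessThan bounded_bilinear_scaleR wk mk]])
  qed
  have p: "plot M ?J (\<lambda>t. \<psi> (y t))"
   by (rule plot_comp[OF psi_plot ys open_greaterThanLessThan]) (use yb in blast)
  have "plot M ?J (\<lambda>t. x0 \<otimes> \<psi> (y t))" by (intro plot_mult plot_cst open_greaterThanLessThan x0 p)
  moreover have "x0 \<otimes> \<psi> (y t0) = x0" using x0 y(1) by (simp add: psi_0)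
  moreover have "mc (\<lambda>t. x0 \<otimes> \<psi> (y t)) t 1 = w t" if t: "t \<in> ?J" for t
  proof -
   have "mc (\<lambda>t. x0 \<otimes> \<psi> (y t)) t 1 = mc (\<lambda>t. \<psi> (y t)) t 1" by (rule mc_lmult[OF p t x0])
   also have "\<dots> = mc \<psi> (y t) (1 *\<^sub>R F t (y t))"
    by (rule mc_compose[OF psi_plot dy[OF t, unfolded has_vector_derivative_def] yb])
   also have "\<dots> = w t" by (simp add: Fy' mc_mci[OF yb])
   finally show ?thesis .
  qed
  ultimately show "\<exists>u. plot M ?J u \<and> u t0 = x0 \<and> (\<forall>t\<in>?J. mc u t 1 = w t)"
   by (intro exI[of _ "\<lambda>t. x0 \<otimes> \<psi> (y t)"]) blast
 qed
qed

text \<open>The curve \<open>u1 t \<otimes> inv (u2 t)\<close> has logarithmic derivative 0, so all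
  smooth functions are constant along it. The inverse stands on the right because the equation is
  invariant under left translations.\<close>

lemma same_mc:
 assumes J: "convex J" and u: "plot M (J::real set) u1" "plot M J u2"
  and eq: "\<And>t. t \<in> J ==> mc u1 t 1 = mc u2 t 1" and s: "s \<in> J" and t: "t \<in> J"
 shows "u1 t \<otimes> inv (u2 t) = u1 s \<otimes> inv (u2 s)"
proof -
 define q where "q = (\<lambda>t. u1 t \<otimes> inv (u2 t))"
 have q: "plot M J q" unfolding q_def by (intro plot_mult plot_inv u)
 have mcq: "mc q t d = 0" if t: "t \<in> J" for t d
 proof -
  have c: "u2 t \<in> carrier G" by (rule plot_carrier[OF u(2) t])
  have "mc q t 1 = 0"
   unfolding q_def using mc_mult[OF u(1) plot_inv[OF u(2)] t, of 1] mc_inv[OF u(2) t, of 1] c eq[OF t] by simp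
  then show ?thesis using linear_cmul[OF linear_mc[OF q t], of d 1] by simp
 qed
 have "q t = q s"
 proof (rule SF_separates[OF plot_carrier[OF q t]])
  fix F assume F: "F \<in> SF"
  have "((\<lambda>t. F (q t)) has_derivative (\<lambda>d. 0)) (at t within J)" if t: "t \<in> J" for t
   by (rule has_derivative_at_withinI[OF SF_chain[OF F q t, unfolded mcq[OF t] E_lin(1)]])
  from has_derivative_zero_constant[OF J this] obtain c where "\<And>t. t \<in> J ==> F (q t) = c" by blast
  then show "F (q t) = F (q s)" using s t by simp
 qed
 then show ?thesis by (simp add: q_def)
qed

lemma same_mc_eq:
 assumes "convex J" "plot M (J::real set) u1" "plot M J u2"
  "\<And>t. t \<in> J ==> mc u1 t 1 = mc u2 t 1" "s \<in> J" "u1 s = u2 s" and t: "t \<in> J"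
 shows "u1 t = u2 t"
proof -
 have c: "u1 t \<in> carrier G" "u2 t \<in> carrier G" "u2 s \<in> carrier G" using assms by (auto intro: plot_carrier)
 have "u1 t \<otimes> inv (u2 t) = u1 s \<otimes> inv (u2 s)" by (rule same_mc[OF assms(1-5) t])
 also have "\<dots> = \<one>" using c by (simp add: assms(6))
 finally show ?thesis using c inv_solve_right'[of \<one> "u1 t" "u2 t"] by simp
qed

lemma glue:
 assumes J: "convex J1" "convex J2" and u: "plot M (J1::real set) u1" "plot M J2 u2"
  and w: "\<And>t. t \<in> J1 ==> mc u1 t 1 = w t" "\<And>t. t \<in> J2 ==> mc u2 t 1 = w t"
  and s: "s \<in> J1" "s \<in> J2" "u1 s = u2 s"
 obtains u where "plot M (J1 \<union> J2) u" "\<And>t. t \<in> J1 \<union> J2 ==> mc u t 1 = w t" "\<And>t. t \<in> J1 ==> u t = u1 t"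
proof -
 define u where "u = (\<lambda>t. if t \<in> J1 then u1 t else u2 t)"
 have op: "open J1" "open J2" using u plot_open by auto
 have agree: "u1 t = u2 t" if t: "t \<in> J1 \<inter> J2" for t
 proof (rule same_mc_eq[of "J1 \<inter> J2"])
  show "plot M (J1 \<inter> J2) u1" by (rule plot_sub[OF u(1) open_Int[OF op]]) blast
  show "plot M (J1 \<inter> J2) u2" by (rule plot_sub[OF u(2) open_Int[OF op]]) blast
 qed (use J s t w in \<open>auto intro: convex_Int\<close>)
 have u_eq: "u t = u1 t" if "t \<in> J1" for t using that by (simp add: u_def)
 have u_eq2: "u t = u2 t" if "t \<in> J2" for t using that agree by (simp add: u_def)
 show ?thesis
 proof (rule that)
  show "plot M (J1 \<union> J2) u"
  proof (rule plot_local[OF gM])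
   fix s assume "s \<in> J1 \<union> J2"
   then show "\<exists>T q. s \<in> T \<and> T \<subseteq> J1 \<union> J2 \<and> plot M T q \<and> (\<forall>t\<in>T. u t = q t)"
   proof
    assume "s \<in> J1" then show ?thesis using u(1) u_eq by (intro exI[of _ J1] exI[of _ u1]) auto
   next
    assume "s \<in> J2" then show ?thesis using u(2) u_eq2 by (intro exI[of _ J2] exI[of _ u2]) auto
   qed
  qed
  show "mc u t 1 = w t" if t: "t \<in> J1 \<union> J2" for t
   using t
  proof
   assume t: "t \<in> J1"
   have "mc u t 1 = mc u1 t 1" by (rule mc_cong[OF op(1) t]) (rule u_eq)
   then show ?thesis using w(1)[OF t] by simp
  next
   assume t: "t \<in> J2"
   have "mc u t 1 = mc u2 t 1" by (rule mc_cong[OF op(2) t]) (rule u_eq2)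
   then show ?thesis using w(2)[OF t] by simp
  qed
 qed (rule u_eq)
qed

text \<open>Admitting initial data at every time of \<open>J\<close> makes the property pass to
  unions of overlapping intervals.\<close>

definition flows :: "(real => 'e) => real set => bool" where
 "flows w J \<longleftrightarrow> (\<forall>s\<in>J. \<forall>x\<in>carrier G. \<exists>u. plot M J u \<and> u s = x \<and> (\<forall>t\<in>J. mc u t 1 = w t))"

lemma flows_Un:
 assumes "convex J1" "convex J2" "flows w J1" "flows w J2" "a \<in> J1 \<inter> J2"
 shows "flows w (J1 \<union> J2)"
proof -
 have *: "\<exists>u. plot M (J1 \<union> J2) u \<and> u s = x \<and> (\<forall>t\<in>J1 \<union> J2. mc u t 1 = w t)"
  if J: "convex J1" "convex J2" and F: "flows w J1" "flows w J2" and a: "a \<in> J1" "a \<in> J2" and s: "s \<in> J1" and x: "x \<in> carrier G"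
  for J1 J2 s x
 proof -
  obtain u1 where u1: "plot M J1 u1" "u1 s = x" "\<And>t. t \<in> J1 ==> mc u1 t 1 = w t" using F(1) s x unfolding flows_def by blast
  obtain u2 where u2: "plot M J2 u2" "u1 a = u2 a" "\<And>t. t \<in> J2 ==> mc u2 t 1 = w t"
   using F(2) a(2) plot_carrier[OF u1(1) a(1)] unfolding flows_def by metis
  obtain u where "plot M (J1 \<union> J2) u" "\<And>t. t \<in> J1 \<union> J2 ==> mc u t 1 = w t" "\<And>t. t \<in> J1 ==> u t = u1 t"
   by (rule glue[OF J u1(1) u2(1) u1(3) u2(3) a u2(2)]) blast+
  then show ?thesis using u1(2) s by metis
 qed
 show ?thesis
  unfolding flows_def
 proof (intro ballI)
  fix s x assume s: "s \<in> J1 \<union> J2" and x: "x \<in> carrier G"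
  show "\<exists>u. plot M (J1 \<union> J2) u \<and> u s = x \<and> (\<forall>t\<in>J1 \<union> J2. mc u t 1 = w t)"
   using *[of J1 J2 s x] *[of J2 J1 s x] assms s x unfolding Un_commute[of J2] by blast
 qed
qed

lemma global_flow:
 fixes w :: "real => 'e"
 assumes w: "smooth_on UNIV w" and K: "\<And>t. norm (w t) \<le> K" and x0: "x0 \<in> carrier G"
 obtains u where "plot M UNIV u" "u t0 = x0" "\<And>t. mc u t 1 = w t"
proof -
 obtain e where e: "e > 0" and flow: "\<And>t0 x0. x0 \<in> carrier G ==>
  \<exists>u. plot M {t0 - e<..<t0 + e} u \<and> u t0 = x0 \<and> (\<forall>t\<in>{t0 - e<..<t0 + e}. mc u t 1 = w t)"
  using local_flow[OF w K] by metis
 \<comment> \<open>The local step covers intervals of length at most \<open>e\<close>. An interval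
   is lengthened by \<open>h\<close> through a new piece of length \<open>2 * h\<close>, which is
   \<open>e\<close> and overlaps the old one in length \<open>h\<close>.\<close>
 define h where "h = e / 2"
 have h: "h > 0" using e by (simp add: h_def)
 have short: "flows w {a<..<b}" if "b - a \<le> e" for a b
  unfolding flows_def
 proof (intro ballI)
  fix s x assume s: "s \<in> {a<..<b}" and x: "x \<in> carrier G"
  obtain u where "plot M {s - e<..<s + e} u" "u s = x" "\<forall>t\<in>{s - e<..<s + e}. mc u t 1 = w t" using flow[OF x] by blast
  moreover have "{a<..<b} \<subseteq> {s - e<..<s + e}" using s that by auto
  ultimately show "\<exists>u. plot M {a<..<b} u \<and> u s = x \<and> (\<forall>t\<in>{a<..<b}. mc u t 1 = w t)"
   using plot_sub open_greaterThanLessThan by blast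
 qed
 have long: "flows w {a<..<a + real (Suc n) * h}" for a n
 proof (induction n)
  case 0
  show ?case by (rule short) (use e in \<open>simp add: h_def\<close>)
 next
  case (Suc n)
  define b where "b = a + real n * h"
  have b: "a \<le> b" "a + real (Suc n) * h = b + h" "a + real (Suc (Suc n)) * h = b + 2 * h"
   using h by (simp_all add: b_def algebra_simps)
  have "flows w ({a<..<b + h} \<union> {b<..<b + 2 * h})"
   by (rule flows_Un[where a="b + h / 2"]) (use Suc b h in \<open>auto intro!: short simp: h_def\<close>)
  moreover have "{a<..<b + h} \<union> {b<..<b + 2 * h} = {a<..<b + 2 * h}" using b(1) h by auto
  ultimately show ?case by (simp only: b)
 qed
 \<comment> \<open>The line is exhausted by intervals around \<open>t0\<close>; \<open>Suc n\<close>
   keeps the first of them nonempty, and uniqueness makes the solutions on them agree.\<close>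
 define J where "J n = {t0 - real (Suc n) * h<..<t0 + real (Suc n) * h}" for n
 have J: "convex (J n)" "open (J n)" "t0 \<in> J n" for n using h by (simp_all add: J_def)
 have J_mono: "J m \<subseteq> J n" if "m \<le> n" for m n
 proof -
  have "real (Suc m) * h \<le> real (Suc n) * h" using that h by (intro mult_right_mono) auto
  then show ?thesis by (auto simp: J_def)
 qed
 have "t0 - real (Suc n) * h + real (Suc (2 * n + 1)) * h = t0 + real (Suc n) * h" for n by (simp add: algebra_simps)
 then have "flows w (J n)" for n using long[of "t0 - real (Suc n) * h" "2 * n + 1"] by (simp only: J_def)
 then have "\<exists>u. plot M (J n) u \<and> u t0 = x0 \<and> (\<forall>t\<in>J n. mc u t 1 = w t)" for n
  using J(3) x0 unfolding flows_def by blast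
 then obtain U where U: "\<And>n. plot M (J n) (U n)" "\<And>n. U n t0 = x0" "\<And>n t. t \<in> J n ==> mc (U n) t 1 = w t" by metis
 have consistent: "U m t = U n t" if "t \<in> J m" "m \<le> n" for m n t
 proof (rule same_mc_eq[OF J(1) U(1) plot_sub[OF U(1) J(2) J_mono[OF that(2)]] _ J(3) _ that(1)])
  show "mc (U m) s 1 = mc (U n) s 1" if "s \<in> J m" for s
   using U(3) J_mono[OF \<open>m \<le> n\<close>] that by (metis subsetD)
 qed (simp only: U(2))
 define n where "n t = nat \<lfloor>\<bar>t - t0\<bar> / h\<rfloor>" for t
 have nJ: "t \<in> J (n t)" for t
 proof -
  have "\<bar>t - t0\<bar> / h < real (Suc (n t))" using h by (simp add: n_def, linarith)
  then have "\<bar>t - t0\<bar> < real (Suc (n t)) * h" using h by (simp add: pos_divide_less_eq)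
  then show ?thesis by (auto simp: J_def abs_less_iff)
 qed
 define u where "u t = U (n t) t" for t
 have u_eq: "u t = U m t" if "t \<in> J m" for t m
  unfolding u_def using consistent[OF that, of "n t"] consistent[OF nJ, of t m] by (metis nat_le_linear)
 show ?thesis
 proof (rule that)
  show "plot M UNIV u"
  proof (rule plot_local[OF gM])
   show "\<exists>T q. s \<in> T \<and> T \<subseteq> UNIV \<and> plot M T q \<and> (\<forall>t\<in>T. u t = q t)" for s
    using nJ[of s] U(1)[of "n s"] u_eq by blast
  qed
  show "u t0 = x0" unfolding u_def by (rule U(2))
  show "mc u t 1 = w t" for t
  proof -
   have "mc u t 1 = mc (U (n t)) t 1" by (rule mc_cong[OF J(2) nJ]) (rule u_eq)
   then show ?thesis by (simp only: U(3)[OF nJ])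
  qed
 qed
qed

end

context lie_lattice_lsa begin

text \<open>With a local lift \<open>v\<close> of \<open>c\<close> the element
  \<open>v t \<otimes> inv (u t)\<close> is a constant \<open>g\<close>, and the projections agree
  at \<open>t\<close> exactly if \<open>g\<close> is in \<open>\<Gamma>\<close>. So agreement is
  locally constant in \<open>t\<close>, hence constant on the interval.\<close>

lemma same_mc_quotient:
 fixes I :: "real set"
 assumes I: "open I" "is_interval I" and c: "plot N I c" and u: "plot M UNIV u"
  and w: "\<And>T u' t. [| T \<subseteq> I; plot M T u'; \<And>t. t \<in> T ==> c t = \<pi> (u' t); t \<in> T |] ==> mc u' t 1 = mc u t 1"
  and t0: "t0 \<in> I" "c t0 = \<pi> (u t0)" and t: "t \<in> I"
 shows "\<pi> (u t) = c t"
proof -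
 have uc: "u t \<in> carrier G" for t by (rule plot_carrier[OF u]) simp
 have "connected I" using I(2) is_interval_connected by blast
 have "(\<pi> (u t0) = c t0) = (\<pi> (u t) = c t)"
 proof (rule connected_local_const[OF \<open>connected I\<close> t0(1) t, where f="\<lambda>t. \<pi> (u t) = c t"], intro ballI)
  fix t1 assume t1: "t1 \<in> I"
  obtain T v where T: "open T" "t1 \<in> T" "T \<subseteq> I" "plot M T v" "\<And>t. t \<in> T ==> c t = \<pi> (v t)"
   by (rule plot_lift[OF c t1]) blast
  obtain d where d: "d > 0" "ball t1 d \<subseteq> T" using T(1,2) open_contains_ball by blast
  let ?B = "ball t1 d"
  have v: "plot M ?B v" by (rule plot_sub[OF T(4) open_ball d(2)])
  have uB: "plot M ?B u" by (rule plot_sub[OF u open_ball]) simp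
  have mcv: "mc v t 1 = mc u t 1" if "t \<in> ?B" for t
   by (rule w[OF T(3,4)]) (use T(5) d(2) that in auto)
  define g where "g = v t1 \<otimes> inv (u t1)"
  have vc: "v t \<in> carrier G" if "t \<in> ?B" for t by (rule plot_carrier[OF v that])
  have t1B: "t1 \<in> ?B" using d(1) by simp
  have gc: "g \<in> carrier G" using vc[OF t1B] uc by (simp add: g_def)
  have "(\<pi> (u t) = c t) \<longleftrightarrow> g \<in> \<Gamma>" if t: "t \<in> ?B" for t
  proof -
   have "v t \<otimes> inv (u t) = g" unfolding g_def by (rule same_mc[OF convex_ball v uB mcv t1B t])
   then have vt: "v t = g \<otimes> u t" using vc[OF t] uc inv_solve_right'[of g "v t" "u t"] gc by simp
   have "c t = \<pi> (v t)" using T(5) d(2) t by blast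
   then have "(\<pi> (u t) = c t) \<longleftrightarrow> (\<exists>\<gamma>\<in>\<Gamma>. g \<otimes> u t = \<gamma> \<otimes> u t)"
    using \<pi>_eq_iff[OF uc vc[OF t]] by (simp add: vt)
   also have "\<dots> \<longleftrightarrow> g \<in> \<Gamma>" using gc uc[of t] \<Gamma>_carrier by auto
   finally show ?thesis .
  qed
  then have "\<forall>t\<in>?B. (\<pi> (u t1) = c t1) = (\<pi> (u t) = c t)" using t1B by blast
  then show "eventually (\<lambda>t. (\<pi> (u t1) = c t1) = (\<pi> (u t) = c t)) (at t1 within I)"
   unfolding eventually_at_topological using t1B open_ball by blast
 qed
 then show ?thesis using t0(2) by simp
qed

text \<open>The velocity is extended algebraically, integrated to a curve in \<open>G\<close>
  through a preimage of one point of the geodesic, and projected; equality of the logarithmic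
  derivatives identifies the result with the given geodesic.\<close>

lemma geodesically_complete_nab: "geodesically_complete N nab"
 unfolding geodesically_complete_def
proof (intro allI impI, elim conjE)
 fix I c assume I: "open I" "is_interval I" "I \<noteq> {}" and g: "geodesic_on N nab I c"
 obtain w0 where w0: "plot N I c" "\<And>t. t \<in> I ==> (w0 has_vector_derivative - star (w0 t) (w0 t)) (at t)"
  "\<And>T u t. [| T \<subseteq> I; plot M T u; \<And>t. t \<in> T ==> c t = \<pi> (u t); t \<in> T |] ==> mc u t 1 = w0 t"
  apply (rule geodesic_imp[OF I(1) g])
  subgoal premises prems for w by (rule prems(1)[of w, OF prems(2-4)])
  done
 obtain t0 where t0: "t0 \<in> I" using I(3) by blast
 have "\<exists>w. (\<forall>t::real. (w has_vector_derivative - star (w t) (w t)) (at t)) \<and> bounded (range w) \<and> (\<forall>t\<in>I. w t = w0 t)"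
  using lsa I(1,2) t0 w0(2) unfolding complete_lsa_def by blast
 then obtain w where w: "\<And>t. (w has_vector_derivative - star (w t) (w t)) (at t)" "bounded (range w)"
  "\<And>t. t \<in> I ==> w t = w0 t" by blast
 have ws: "smooth_on UNIV w"
 proof (rule smooth_on_vector_derivI[OF open_UNIV w(1)])
  fix k assume k: "ck_on k UNIV w"
  from ck_on_bilinear[OF open_UNIV bounded_bilinear_star k k] show "ck_on k UNIV (\<lambda>t. - star (w t) (w t))"
   by (rule ck_on_linear[OF open_UNIV bounded_linear_minus[OF bounded_linear_ident]])
 qed
 obtain K where K: "\<And>t. norm (w t) \<le> K" using w(2) by (auto simp: bounded_iff)
 have "c t0 \<in> \<pi> ` carrier G" using plot_in[OF w0(1) t0] by (simp add: topspace_N)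
 then obtain x0 where x0: "x0 \<in> carrier G" "c t0 = \<pi> x0" by blast
 obtain u where u: "plot M UNIV u" "u t0 = x0" "\<And>t. mc u t 1 = w t"
  by (rule global_flow[OF ws K x0(1), of t0]) blast
 have "\<pi> (u t) = c t" if t: "t \<in> I" for t
 proof (rule same_mc_quotient[OF I(1,2) w0(1) u(1) _ t0 _ t])
  show "c t0 = \<pi> (u t0)" using x0 u(2) by simp
  fix T u' t assume *: "T \<subseteq> I" "plot M T u'" "\<And>t. t \<in> T ==> c t = \<pi> (u' t)" "t \<in> T"
  have "mc u' t 1 = w0 t" by (rule w0(3)[OF *])
  then show "mc u' t 1 = mc u t 1" using u(3) w(3) * by auto
 qed
 then show "\<exists>c'. geodesic_on N nab UNIV c' \<and> (\<forall>t\<in>I. c' t = c t)"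
  using geodesicI[OF u(1) u(3) w(1)] by blast
qed

theorem complete_flat_connection:
 "\<exists>nab. affine_connection N nab \<and> flat_connection N nab \<and> torsion_free_connection N nab \<and> geodesically_complete N nab"
 using affine_connection_nab flat_nab torsion_free_nab geodesically_complete_nab by blast

end

section \<open>Invariant structures\<close>

text \<open>Gram-Schmidt for \<open>q\<close>, with the new basis indexed by \<open>Basis\<close>.
  The algebra above works with the standard inner product, so the metric is absorbed into the linear
  change of frame \<open>T\<close>.\<close>

lemma orthonormal_frame:
 fixes q :: "'e::euclidean_space => 'e => real"
 assumes q: "bilinear q" and sym: "\<And>x y. q x y = q y x" and pos: "\<And>x. x \<noteq> 0 ==> q x x > 0"
 shows "\<exists>(T :: 'e => 'e) S. linear T \<and> linear S \<and> (\<forall>x. T (S x) = x) \<and> (\<forall>x. S (T x) = x) \<and> (\<forall>x y. q (T x) (T y) = x \<bullet> y)"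
proof -
 note q_simps = bilinear_ladd[OF q] bilinear_radd[OF q] bilinear_lsub[OF q] bilinear_rsub[OF q]
  bilinear_lmul[OF q] bilinear_rmul[OF q] bilinear_lzero[OF q] bilinear_rzero[OF q]
 have q_sum: "q (\<Sum>i\<in>I. f i) y = (\<Sum>i\<in>I. q (f i) y)" "q y (\<Sum>i\<in>I. f i) = (\<Sum>i\<in>I. q y (f i))" for I and f :: "'e => 'e" and y
  using q linear_sum[of "\<lambda>x. q x y" f I] linear_sum[of "q y" f I] by (auto simp: bilinear_def)
 have "\<exists>e. \<forall>b\<in>B. \<forall>c\<in>B. q (e b) (e c) = (if b = c then 1 else 0)" if "finite B" "B \<subseteq> Basis" for B :: "'e set"
  using that
 proof (induction B rule: finite_induct)
  case (insert b B)
  then obtain e where e: "\<And>c d. c \<in> B ==> d \<in> B ==> q (e c) (e d) = (if c = d then 1 else 0)" by auto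
  have "span (e ` B) \<noteq> UNIV"
  proof
   assume "span (e ` B) = UNIV"
   then have "DIM('e) \<le> card (e ` B)" using dim_le_card'[of "e ` B"] insert(1) by (metis dim_UNIV dim_span finite_imageI)
   also have "\<dots> \<le> card B" by (rule card_image_le[OF insert(1)])
   also have "\<dots> < card (insert b B)" using insert by simp
   also have "\<dots> \<le> DIM('e)" by (rule card_mono) (use insert in auto)
   finally show False by simp
  qed
  then obtain v where v: "v \<notin> span (e ` B)" by blast
  define v' where "v' = v - (\<Sum>c\<in>B. q v (e c) *\<^sub>R e c)"
  have "v' \<noteq> 0"
  proof
   assume "v' = 0"
   then have "v = (\<Sum>c\<in>B. q v (e c) *\<^sub>R e c)" by (simp add: v'_def)
   moreover have "(\<Sum>c\<in>B. q v (e c) *\<^sub>R e c) \<in> span (e ` B)"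
    by (intro span_sum span_scale span_base imageI)
   ultimately show False using v by metis
  qed
  then have p: "q v' v' > 0" by (rule pos)
  have orth: "q v' (e d) = 0" if d: "d \<in> B" for d
  proof -
   have "(\<Sum>c\<in>B. q v (e c) * q (e c) (e d)) = (\<Sum>c\<in>B. if c = d then q v (e c) else 0)"
    by (rule sum.cong) (use e d in auto)
   also have "\<dots> = q v (e d)" using insert(1) d by simp
   finally show ?thesis using q_sum(1)[of "\<lambda>c. q v (e c) *\<^sub>R e c" B "e d"] by (simp add: v'_def q_simps q_sum)
  qed
  define e' where "e' = e(b := (1 / sqrt (q v' v')) *\<^sub>R v')"
  have "q (e' c) (e' d) = (if c = d then 1 else 0)" if "c \<in> insert b B" "d \<in> insert b B" for c d
  proof -
   have 1: "q (e' b) (e' b) = 1" using p by (simp add: e'_def q_simps)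
   have 2: "q (e' b) (e' d) = 0" "q (e' d) (e' b) = 0" if "d \<in> B" for d
    using that insert(2) orth[OF that] sym[of "e d" v'] by (auto simp: e'_def q_simps)
   have 3: "q (e' c) (e' d) = (if c = d then 1 else 0)" if "c \<in> B" "d \<in> B" for c d
    using that insert(2) e[OF that] by (auto simp: e'_def)
   show ?thesis using that insert(2) 1 2 3 by auto
  qed
  then show ?case by blast
 qed simp
 from this[OF finite_Basis subset_refl] obtain e :: "'e => 'e" where
  e: "\<And>b c. b \<in> Basis ==> c \<in> Basis ==> q (e b) (e c) = (if b = c then 1 else 0)" by blast
 define T where "T x = (\<Sum>b\<in>Basis. (x \<bullet> b) *\<^sub>R e b)" for x
 have T: "linear T"
  by (simp add: linear_iff T_def inner_add_left scaleR_add_left sum.distrib scaleR_sum_right)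
 have qT: "q (T x) (T y) = x \<bullet> y" for x y
 proof -
  have "q (T x) (T y) = (\<Sum>b\<in>Basis. \<Sum>c\<in>Basis. (x \<bullet> b) * ((y \<bullet> c) * q (e b) (e c)))"
   unfolding T_def q_sum(1) by (intro sum.cong refl) (simp add: q_sum(2) q_simps sum_distrib_left mult.left_commute)
  also have "\<dots> = (\<Sum>b\<in>Basis. \<Sum>c\<in>Basis. if b = c then (x \<bullet> b) * (y \<bullet> c) else 0)"
   by (intro sum.cong refl) (simp add: e)
  also have "\<dots> = x \<bullet> y" by (simp add: euclidean_inner[of x y])
  finally show ?thesis .
 qed
 have "inj T"
  unfolding linear_injective_0[OF T]
 proof (intro allI impI)
  fix x assume "T x = 0"
  then have "x \<bullet> x = 0" using qT[of x x] by (simp add: q_simps)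
  then show "x = 0" by simp
 qed
 from linear_injective_isomorphism[OF T this] obtain S where "linear S" "\<forall>x. S (T x) = x" "\<forall>x. T (S x) = x" by blast
 then show ?thesis using T qT by blast
qed

lemma lie_chart_exists:
 fixes M :: "('g, 'e::euclidean_space) manifold"
 assumes lie: "lie_group G M"
 obtains r \<psi> \<phi> where "lie_chart G M r \<psi> \<phi>"
proof -
 interpret group G using lie by (simp add: lie_group_def)
 have sM: "smooth_manifold M" and top: "topspace (mtop M) = carrier G" using lie by (auto simp: lie_group_def)
 note gM = smooth_manifold_good_atlas[OF sM]
 obtain U \<phi>0 where U: "(U, \<phi>0) \<in> atlas M" "\<one>\<^bsub>G\<^esub> \<in> U"
  using good_atlas_cover[OF gM, of "\<one>\<^bsub>G\<^esub>"] top by auto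
 note cU = good_atlas_chart[OF gM U(1)]
 define o0 where "o0 = \<phi>0 \<one>\<^bsub>G\<^esub>"
 have "open (\<phi>0 ` U)" by (rule cU(3)[OF cU(1) subset_refl])
 then obtain r where r: "r > 0" "ball o0 r \<subseteq> \<phi>0 ` U" using U(2) open_contains_ball by (metis imageI o0_def)
 define \<psi> where "\<psi> y = inv_into U \<phi>0 (o0 + y)" for y
 define \<phi> where "\<phi> x = \<phi>0 x - o0" for x
 have tr: "o0 + y \<in> ball o0 r" if "y \<in> ball 0 r" for y using that by (simp add: dist_norm)
 have tU: "o0 + y \<in> \<phi>0 ` U" if "y \<in> ball 0 r" for y using tr[OF that] r(2) by blast
 have \<psi>U: "\<psi> y \<in> U" "\<phi>0 (\<psi> y) = o0 + y" if "y \<in> ball 0 r" for y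
  using tU[OF that] by (auto simp: \<psi>_def intro: inv_into_into f_inv_into_f)
 have "lie_chart G M r \<psi> \<phi>"
 proof
  show "lie_group G M" by (rule lie)
  show "r > 0" by (rule r(1))
  show "plot M (ball 0 r) \<psi>"
   unfolding \<psi>_def
   by (rule plot_compose[OF plot_inv_chart[OF sM U(1)] smooth_on_add[OF open_ball smooth_on_const[OF open_ball] smooth_on_ident[OF open_ball]] open_ball _ gM])
    (use tU in blast)
  show "\<psi> 0 = \<one>\<^bsub>G\<^esub>" using inv_into_f_f[OF cU(2) U(2)] by (simp add: \<psi>_def o0_def)
  show "\<phi> (\<psi> y) = y" if "y \<in> ball 0 r" for y using \<psi>U(2)[OF that] by (simp add: \<phi>_def)
  show "openin (mtop M) (\<psi> ` W)" if W: "open W" "W \<subseteq> ball 0 r" for W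
  proof -
   have "homeomorphic_map (subtopology (mtop M) U) (top_of_set (\<phi>0 ` U)) \<phi>0"
    using sM U(1) by (auto simp: smooth_manifold_def)
   then have c: "continuous_map (subtopology (mtop M) U) (top_of_set (\<phi>0 ` U)) \<phi>0"
    by (rule homeomorphic_imp_continuous_map)
   have "open ((\<lambda>y. o0 + y) ` W)" by (rule open_translation[OF W(1)])
   moreover have "(\<lambda>y. o0 + y) ` W \<subseteq> \<phi>0 ` U" using W(2) tU by blast
   ultimately have "openin (top_of_set (\<phi>0 ` U)) ((\<lambda>y. o0 + y) ` W)"
    by (simp add: openin_open_eq[OF \<open>open (\<phi>0 ` U)\<close>])
   from openin_continuous_map_preimage[OF c this]
   have "openin (subtopology (mtop M) U) {x \<in> topspace (subtopology (mtop M) U). \<phi>0 x \<in> (\<lambda>y. o0 + y) ` W}" .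
   moreover have "{x \<in> topspace (subtopology (mtop M) U). \<phi>0 x \<in> (\<lambda>y. o0 + y) ` W} = \<psi> ` W"
   proof (intro subset_antisym subsetI)
    fix x assume "x \<in> {x \<in> topspace (subtopology (mtop M) U). \<phi>0 x \<in> (\<lambda>y. o0 + y) ` W}"
    then obtain y where y: "x \<in> U" "y \<in> W" "\<phi>0 x = o0 + y" by auto
    then have "\<psi> y = x" using inv_into_f_f[OF cU(2) y(1)] by (simp add: \<psi>_def)
    then show "x \<in> \<psi> ` W" using y by blast
   next
    fix x assume "x \<in> \<psi> ` W"
    then obtain y where y: "y \<in> W" "x = \<psi> y" by blast
    then have "\<psi> y \<in> U" "\<phi>0 (\<psi> y) = o0 + y" using \<psi>U W(2) by blast+
    then show "x \<in> {x \<in> topspace (subtopology (mtop M) U). \<phi>0 x \<in> (\<lambda>y. o0 + y) ` W}"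
     using y openin_subset[OF cU(1)] by auto
   qed
   ultimately show ?thesis using openin_trans_full[OF _ cU(1)] by simp
  qed
  show "\<exists>U \<phi>0. (U, \<phi>0) \<in> atlas M \<and> \<psi> ` ball 0 r \<subseteq> U \<and>
    smooth_on (\<phi>0 ` (\<psi> ` ball 0 r)) (\<lambda>z. \<phi> (inv_into U \<phi>0 z))"
  proof (intro exI conjI)
   show "(U, \<phi>0) \<in> atlas M" by (rule U(1))
   show "\<psi> ` ball 0 r \<subseteq> U" using \<psi>U by blast
   have "\<phi>0 ` (\<psi> ` ball 0 r) = (\<lambda>y. o0 + y) ` ball 0 r"
    unfolding image_image by (rule image_cong[OF refl]) (rule \<psi>U(2))
   then have im: "\<phi>0 ` (\<psi> ` ball 0 r) = ball o0 r" using ball_translation[of o0 0 r] by simp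
   show "smooth_on (\<phi>0 ` (\<psi> ` ball 0 r)) (\<lambda>z. \<phi> (inv_into U \<phi>0 z))"
    unfolding im
   proof (rule smooth_on_cong[THEN iffD1, OF open_ball])
    show "smooth_on (ball o0 r) (\<lambda>z. z - o0)"
     by (rule smooth_on_diff[OF open_ball smooth_on_ident[OF open_ball] smooth_on_const[OF open_ball]])
    show "z - o0 = \<phi> (inv_into U \<phi>0 z)" if "z \<in> ball o0 r" for z
     using f_inv_into_f[of z \<phi>0 U] that r(2) by (auto simp: \<phi>_def)
   qed
  qed
 qed
 then show ?thesis by (rule that)
qed

text \<open>Changing the frame of the Lie algebra amounts to reparametrising the chart linearly; the
  radius shrinks by the bound \<open>B\<close> for \<open>T\<close>.\<close>

lemma (in lie_chart) lie_chart_linear: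
 assumes T: "linear T" "linear S" "\<And>x. T (S x) = x" "\<And>x. S (T x) = x"
 obtains r' where "lie_chart G M r' (\<lambda>y. \<psi> (T y)) (\<lambda>x. S (\<phi> x))"
  "\<And>v. lie_chart.E G M (\<lambda>y. \<psi> (T y)) v = E (T v)"
proof -
 have bl: "bounded_linear T" "bounded_linear S" using T by (auto intro: linear_conv_bounded_linear[THEN iffD1])
 obtain B where B: "B > 0" "\<And>x. norm (T x) \<le> norm x * B" using bounded_linear.pos_bounded[OF bl(1)] by blast
 define r' where "r' = r / B"
 have r': "r' > 0" using r_pos B(1) by (simp add: r'_def)
 have Tb: "T y \<in> ball 0 r" if "y \<in> ball 0 r'" for y
 proof -
  have "norm (T y) \<le> norm y * B" by (rule B(2))
  also have "\<dots> < r' * B" using that B(1) by (intro mult_strict_right_mono) auto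
  finally show ?thesis using B(1) by (simp add: r'_def)
 qed
 have openT: "open (T ` W)" if "open W" for W
 proof -
  have "T ` W = S -` W" using T(3,4) by (auto intro: image_eqI[of _ _ "S _"])
  then show ?thesis using that bounded_linear.continuous_on[OF bl(2) continuous_on_id]
   by (simp add: open_vimage linear_continuous_on[OF bl(2)])
 qed
 obtain U \<phi>0 where c: "(U, \<phi>0) \<in> atlas M" "\<psi> ` ball 0 r \<subseteq> U"
  "smooth_on (\<phi>0 ` (\<psi> ` ball 0 r)) (\<lambda>z. \<phi> (inv_into U \<phi>0 z))" using phi_chart by blast
 have C': "lie_chart G M r' (\<lambda>y. \<psi> (T y)) (\<lambda>x. S (\<phi> x))"
 proof
  show "lie_group G M" by (rule lie)
  show "r' > 0" by (rule r')
  show "plot M (ball 0 r') (\<lambda>y. \<psi> (T y))"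
   by (rule plot_comp[OF psi_plot smooth_on_linear[OF open_ball bl(1) smooth_on_ident[OF open_ball]] open_ball])
    (use Tb in blast)
  show "\<psi> (T 0) = \<one>" by (simp add: linear_0[OF T(1)] psi_0)
  show "S (\<phi> (\<psi> (T y))) = y" if "y \<in> ball 0 r'" for y by (simp only: phi_psi[OF Tb[OF that]] T(4))
  show op: "openin (mtop M) ((\<lambda>y. \<psi> (T y)) ` W)" if "open W" "W \<subseteq> ball 0 r'" for W
  proof -
   have "openin (mtop M) (\<psi> ` T ` W)" by (rule psi_open[OF openT[OF that(1)]]) (use that(2) Tb in blast)
   then show ?thesis by (simp only: image_image)
  qed
  have sub: "(\<lambda>y. \<psi> (T y)) ` ball 0 r' \<subseteq> \<psi> ` ball 0 r" using Tb by blast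
  have op': "open (\<phi>0 ` ((\<lambda>y. \<psi> (T y)) ` ball 0 r'))"
   by (rule good_atlas_chart(3)[OF gM c(1) op[OF open_ball subset_refl]]) (use sub c(2) in blast)
  show "\<exists>U \<phi>0. (U, \<phi>0) \<in> atlas M \<and> (\<lambda>y. \<psi> (T y)) ` ball 0 r' \<subseteq> U \<and>
    smooth_on (\<phi>0 ` ((\<lambda>y. \<psi> (T y)) ` ball 0 r')) (\<lambda>z. S (\<phi> (inv_into U \<phi>0 z)))"
  proof (intro exI conjI)
   show "(U, \<phi>0) \<in> atlas M" by (rule c(1))
   show "(\<lambda>y. \<psi> (T y)) ` ball 0 r' \<subseteq> U" using sub c(2) by blast
   show "smooth_on (\<phi>0 ` ((\<lambda>y. \<psi> (T y)) ` ball 0 r')) (\<lambda>z. S (\<phi> (inv_into U \<phi>0 z)))"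
    by (rule smooth_on_linear[OF op' bl(2) smooth_on_subset[OF c(3) image_mono[OF sub]]])
  qed
 qed
 interpret C': lie_chart G M r' "\<lambda>y. \<psi> (T y)" "\<lambda>x. S (\<phi> x)" by (rule C')
 have "C'.E v = E (T v)" for v
 proof (intro ext)
  fix F x
  show "C'.E v F x = E (T v) F x"
  proof (cases "F \<in> SF \<and> x \<in> carrier G")
   case True
   have "(T has_derivative T) (at 0)"
    using T(1) by (intro bounded_linear_imp_has_derivative linear_conv_bounded_linear[THEN iffD1])
   moreover have "((\<lambda>y. F (x \<otimes> \<psi> y)) has_derivative (\<lambda>v. E v F x)) (at (T 0))"
    using E_deriv[of F x] True by (simp add: linear_0[OF T(1)])
   ultimately have "((\<lambda>y. F (x \<otimes> \<psi> (T y))) has_derivative (\<lambda>v. E (T v) F x)) (at 0)"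
    by (rule has_derivative_compose)
   moreover have "((\<lambda>y. F (x \<otimes> \<psi> (T y))) has_derivative (\<lambda>v. C'.E v F x)) (at 0)"
    using C'.E_deriv[of F x] True by simp
   ultimately have "(\<lambda>v. E (T v) F x) = (\<lambda>v. C'.E v F x)" by (rule has_derivative_unique)
   then show ?thesis by metis
  next
   case False
   then show ?thesis unfolding E_def C'.E_def by (simp only: if_False)
  qed
 qed
 with C' show ?thesis by (rule that)
qed

lemma (in lie_chart) linear_E_vfield: "linear E"
 by (auto simp: linear_iff fun_eq_iff E_lin scaleR_fun_apply)

lemma (in lie_chart) inj_E_vfield: "inj E"
 by (rule injI) (simp add: E_eq_iff)

lemma sasakian_transport:
 fixes f :: "'e::euclidean_space => 'v::real_vector"
 assumes f: "linear f" "inj f" and BR: "\<And>x y. BR (f x) (f y) = f (br x y)"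
  and ip: "\<And>x y. ip (f x) (f y) = x \<bullet> y" and S: "sasakian_structure_on (range f) BR ip \<phi> \<xi> \<eta>"
 shows "\<exists>\<phi> \<xi> \<eta>. sasakian_structure_on UNIV br (\<bullet>) \<phi> \<xi> \<eta>"
proof -
 note f_simps = linear_add[OF f(1)] linear_diff[OF f(1)] linear_cmul[OF f(1)] linear_neg[OF f(1)]
 define g where "g = inv_into UNIV f"
 have gf: "g (f x) = x" for x by (simp add: g_def f(2))
 have fg: "f (g y) = y" if "y \<in> range f" for y using that by (simp add: g_def f_inv_into_f)
 have \<phi>L: "\<phi> (f x) \<in> range f" and \<xi>L: "\<xi> \<in> range f" for x
  using S by (auto simp: sasakian_structure_on_def)
 define \<phi>' where "\<phi>' x = g (\<phi> (f x))" for x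
 have f\<phi>: "f (\<phi>' x) = \<phi> (f x)" for x by (simp add: \<phi>'_def fg \<phi>L)
 have f\<xi>: "f (g \<xi>) = \<xi>" by (rule fg[OF \<xi>L])
 have eqI: "x = y" if "f x = f y" for x y using that f(2) by (simp add: inj_eq)
 have lin: "\<phi> (f x + f y) = \<phi> (f x) + \<phi> (f y)" "\<phi> (c *\<^sub>R f x) = c *\<^sub>R \<phi> (f x)"
   "\<eta> (f x + f y) = \<eta> (f x) + \<eta> (f y)" "\<eta> (c *\<^sub>R f x) = c *\<^sub>R \<eta> (f x)" for x y c
  using S by (auto simp: sasakian_structure_on_def linear_on_def)
 have ax: "\<phi> (\<phi> (f x)) = - f x + \<eta> (f x) *\<^sub>R \<xi>" "ip (\<phi> (f x)) (\<phi> (f y)) = ip (f x) (f y) - \<eta> (f x) * \<eta> (f y)"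
  "BR (\<phi> (f x)) (\<phi> (f y)) + \<phi> (\<phi> (BR (f x) (f y))) - \<phi> (BR (\<phi> (f x)) (f y) + BR (f x) (\<phi> (f y)))
   = - (ce_d1 BR \<eta> (f x) (f y) *\<^sub>R \<xi>)"
  "ce_d1 BR \<eta> (f x) (f y) = - ip (\<phi> (f x)) (f y)" "\<eta> \<xi> = 1" for x y
  using S by (auto simp: sasakian_structure_on_def)
 have "sasakian_structure_on UNIV br (\<bullet>) \<phi>' (g \<xi>) (\<lambda>x. \<eta> (f x))"
  unfolding sasakian_structure_on_def
 proof (intro conjI ballI)
  show "inner_product_on UNIV (\<bullet>)"
   by (auto simp: inner_product_on_def bilinear_on_def linear_on_def inner_add_left inner_add_right inner_commute)
  show "linear_on UNIV \<phi>'"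
   by (auto simp: linear_on_def f_simps f\<phi> lin intro!: eqI)
  show "linear_on UNIV (\<lambda>x. \<eta> (f x))" by (auto simp: linear_on_def f_simps lin)
  show "\<eta> (f (g \<xi>)) = 1" by (simp add: f\<xi> ax)
  fix x y
  show "\<phi>' (\<phi>' x) = - x + \<eta> (f x) *\<^sub>R g \<xi>" by (rule eqI) (simp add: f\<phi> f_simps ax f\<xi>)
  show "\<phi>' x \<bullet> \<phi>' y = x \<bullet> y - \<eta> (f x) * \<eta> (f y)" using ax(2)[of x y] by (simp only: ip f\<phi>[symmetric])
  show "br (\<phi>' x) (\<phi>' y) + \<phi>' (\<phi>' (br x y)) - \<phi>' (br (\<phi>' x) y + br x (\<phi>' y)) = - (ce_d1 br (\<lambda>x. \<eta> (f x)) x y *\<^sub>R g \<xi>)"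
  proof (rule eqI)
   show "f (br (\<phi>' x) (\<phi>' y) + \<phi>' (\<phi>' (br x y)) - \<phi>' (br (\<phi>' x) y + br x (\<phi>' y)))
    = f (- (ce_d1 br (\<lambda>x. \<eta> (f x)) x y *\<^sub>R g \<xi>))"
    using ax(3)[of x y] by (simp add: f_simps f\<phi> BR[symmetric] f\<xi> ce_d1_def)
  qed
  show "ce_d1 br (\<lambda>x. \<eta> (f x)) x y = - (\<phi>' x \<bullet> y)"
   using ax(4)[of x y] by (simp add: ip[symmetric] f\<phi> ce_d1_def BR)
 qed auto
 then show ?thesis by blast
qed

text \<open>Unlike in the Sasakian case the metric may be rescaled by \<open>c\<close>: the equation
  tying \<open>\<theta>\<close> to the fundamental form is homogeneous in that form, and the
  Levi-Civita connection does not change. This is used to normalise the Lee vector.\<close>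

lemma vaisman_transport:
 fixes f :: "'e::euclidean_space => 'v::real_vector"
 assumes f: "linear f" "inj f" and BR: "\<And>x y. BR (f x) (f y) = f (br x y)"
  and ip: "\<And>x y. c * ip (f x) (f y) = x \<bullet> y" and S: "vaisman_structure_on (range f) BR J ip \<theta>"
 shows "\<exists>J. vaisman_structure_on UNIV br J (\<bullet>) (\<lambda>x. \<theta> (f x))"
proof -
 note f_simps = linear_add[OF f(1)] linear_diff[OF f(1)] linear_cmul[OF f(1)] linear_neg[OF f(1)] linear_0[OF f(1)]
 define g where "g = inv_into UNIV f"
 have fg: "f (g y) = y" if "y \<in> range f" for y using that by (simp add: g_def f_inv_into_f)
 have JL: "J (f x) \<in> range f" for x
  using S by (auto simp: vaisman_structure_on_def complex_structure_on_def)
 define J' where "J' x = g (J (f x))" for x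
 have fJ: "f (J' x) = J (f x)" for x by (simp add: J'_def fg JL)
 have eqI: "x = y" if "f x = f y" for x y using that f(2) by (simp add: inj_eq)
 have lin: "J (f x + f y) = J (f x) + J (f y)" "J (c *\<^sub>R f x) = c *\<^sub>R J (f x)"
   "\<theta> (f x + f y) = \<theta> (f x) + \<theta> (f y)" "\<theta> (c *\<^sub>R f x) = c *\<^sub>R \<theta> (f x)" for x y c
  using S by (auto simp: vaisman_structure_on_def complex_structure_on_def linear_on_def)
 have ax: "J (J (f x)) = - f x" "ip (J (f x)) (J (f y)) = ip (f x) (f y)"
  "BR (J (f x)) (J (f y)) - BR (f x) (f y) - J (BR (J (f x)) (f y) + BR (f x) (J (f y))) = 0"
  "ce_d1 BR \<theta> (f x) (f y) = 0"
  "ce_d2 BR (\<lambda>x y. ip (J x) y) (f x) (f y) (f z) = wedge12 \<theta> (\<lambda>x y. ip (J x) y) (f x) (f y) (f z)" for x y z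
  using S by (auto simp: vaisman_structure_on_def complex_structure_on_def Let_def)
 obtain x0 where x0: "\<theta> (f x0) \<noteq> 0" using S by (auto simp: vaisman_structure_on_def)
 obtain nab where lc: "levi_civita_on (range f) BR ip nab" and par: "\<And>x y. \<theta> (nab (f x) (f y)) = 0"
  using S by (auto simp: vaisman_structure_on_def)
 define nab' where "nab' x y = g (nab (f x) (f y))" for x y
 have fn: "f (nab' x y) = nab (f x) (f y)" for x y
  using lc by (auto simp: nab'_def levi_civita_on_def intro!: fg)
 have nlin: "nab (f x + f y) (f z) = nab (f x) (f z) + nab (f y) (f z)" "nab (c *\<^sub>R f x) (f z) = c *\<^sub>R nab (f x) (f z)"
   "nab (f z) (f x + f y) = nab (f z) (f x) + nab (f z) (f y)" "nab (f z) (c *\<^sub>R f x) = c *\<^sub>R nab (f z) (f x)" for x y z c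
  using lc by (auto simp: levi_civita_on_def bilinear_on_def linear_on_def)
 have nax: "nab (f x) (f y) - nab (f y) (f x) = BR (f x) (f y)"
  "ip (nab (f x) (f y)) (f z) + ip (f y) (nab (f x) (f z)) = 0" for x y z
  using lc by (auto simp: levi_civita_on_def)
 have "vaisman_structure_on UNIV br J' (\<bullet>) (\<lambda>x. \<theta> (f x))"
  unfolding vaisman_structure_on_def complex_structure_on_def Let_def
 proof (intro conjI ballI)
  show "inner_product_on UNIV (\<bullet>)"
   by (auto simp: inner_product_on_def bilinear_on_def linear_on_def inner_add_left inner_add_right inner_commute)
  show "linear_on UNIV J'" by (auto simp: linear_on_def f_simps fJ lin intro!: eqI)
  show "linear_on UNIV (\<lambda>x. \<theta> (f x))" by (auto simp: linear_on_def f_simps lin)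
  show "\<exists>x\<in>UNIV. \<theta> (f x) \<noteq> 0" using x0 by blast
  fix x y z
  show "J' (J' x) = - x" by (rule eqI) (simp add: fJ f_simps ax)
  show "J' x \<bullet> J' y = x \<bullet> y" by (simp only: ip[symmetric] fJ ax)
  show "br (J' x) (J' y) - br x y - J' (br (J' x) y + br x (J' y)) = 0"
  proof (rule eqI)
   show "f (br (J' x) (J' y) - br x y - J' (br (J' x) y + br x (J' y))) = f 0"
    using ax(3)[of x y] by (simp add: f_simps fJ BR[symmetric])
  qed
  show "ce_d1 br (\<lambda>x. \<theta> (f x)) x y = 0" using ax(4)[of x y] by (simp add: ce_d1_def BR)
  have \<omega>: "J' x \<bullet> y = c * ip (J (f x)) (f y)" for x y by (simp only: ip[symmetric] fJ)
  show "ce_d2 br (\<lambda>x y. J' x \<bullet> y) x y z = wedge12 (\<lambda>x. \<theta> (f x)) (\<lambda>x y. J' x \<bullet> y) x y z"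
   using arg_cong[OF ax(5)[of x y z], of "\<lambda>t. c * t"] by (simp add: ce_d2_def wedge12_def BR \<omega> algebra_simps)
 next
  have "levi_civita_on UNIV br (\<bullet>) nab'"
   unfolding levi_civita_on_def
  proof (intro conjI ballI)
   show "bilinear_on UNIV nab'"
    by (auto simp: bilinear_on_def linear_on_def f_simps fn nlin intro!: eqI)
   fix x y z
   show "nab' x y - nab' y x = br x y" by (rule eqI) (simp add: f_simps fn nax BR)
   show "nab' x y \<bullet> z + y \<bullet> nab' x z = 0" by (simp only: ip[symmetric] fn nax distrib_left[symmetric] mult_zero_right)
  qed simp
  moreover have "\<forall>x\<in>UNIV. \<forall>y\<in>UNIV. - \<theta> (f (nab' x y)) = 0" by (simp add: fn par)
  ultimately show "\<exists>nab. levi_civita_on UNIV br (\<bullet>) nab \<and> (\<forall>x\<in>UNIV. \<forall>y\<in>UNIV. - \<theta> (f (nab x y)) = 0)" by blast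
 qed auto
 then show ?thesis by blast
qed

lemma lee_vector:
 fixes f :: "'e::euclidean_space => 'v::real_vector"
 assumes f: "linear f" and V: "vaisman_structure_on (range f) br J ip \<theta>"
 shows "\<exists>A. \<forall>x. \<theta> (f x) = A \<bullet> x"
proof -
 have "linear (\<lambda>x. \<theta> (f x))"
  using V by (simp add: vaisman_structure_on_def linear_on_def linear_iff linear_add[OF f] linear_cmul[OF f])
 from adjoint_works[OF this, of _ 1] have "\<theta> (f x) = adjoint (\<lambda>x. \<theta> (f x)) 1 \<bullet> x" for x
  by (simp add: inner_commute)
 then show ?thesis by blast
qed

lemma adapted_chart:
 fixes M :: "('g, 'e::euclidean_space) manifold"
 assumes lie: "lie_group G M" and ip: "inner_product_on (lie_algebra G M) ip"
 obtains r \<psi> \<phi> where "lie_chart G M r \<psi> \<phi>" "\<And>x y. ip (lie_chart.E G M \<psi> x) (lie_chart.E G M \<psi> y) = x \<bullet> y"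
proof -
 obtain r \<psi> \<phi> where C: "lie_chart G M r \<psi> \<phi>" by (rule lie_chart_exists[OF lie])
 interpret lie_chart G M r \<psi> \<phi> by (rule C)
 define q where "q x y = ip (E x) (E y)" for x y
 have EL: "E x \<in> lie_algebra G M" for x by (rule E_lie_algebra)
 have Elin: "E (x + y) = E x + E y" "E (c *\<^sub>R x) = c *\<^sub>R E x" for x y c
  using linear_E_vfield by (auto simp: linear_iff)
 have bl: "bilinear q"
  using ip EL by (simp add: bilinear_def linear_iff q_def Elin inner_product_on_def bilinear_on_def linear_on_def)
 have sym: "q x y = q y x" for x y using ip EL by (simp add: q_def inner_product_on_def)
 have pos: "q x x > 0" if "x \<noteq> 0" for x
 proof -
  have "E x \<noteq> E 0" using that by (simp add: E_eq_iff)
  moreover have "E 0 = 0" using Elin(2)[of 0 0] by simp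
  ultimately show ?thesis using ip EL[of x] by (simp add: q_def inner_product_on_def)
 qed
 obtain T S :: "'e => 'e" where T: "linear T" "linear S" "\<And>x. T (S x) = x" "\<And>x. S (T x) = x" "\<And>x y. q (T x) (T y) = x \<bullet> y"
  using orthonormal_frame[OF bl sym pos] by blast
 obtain r' where C': "lie_chart G M r' (\<lambda>y. \<psi> (T y)) (\<lambda>x. S (\<phi> x))"
  "\<And>v. lie_chart.E G M (\<lambda>y. \<psi> (T y)) v = E (T v)"
  by (rule lie_chart_linear[OF T(1-4)]) blast
 show ?thesis by (rule that[OF C'(1)]) (use T(5) in \<open>simp add: C'(2) q_def\<close>)
qed

theorem corollary7p5:
 fixes G :: "('g, 'm) monoid_scheme"
  and M :: "('g, 'e::euclidean_space) manifold"
  and \<Gamma> :: "'g set"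
 assumes "solvmanifold G M \<Gamma>"
  and "admits_invariant_vaisman G M \<or> admits_invariant_sasakian G M"
 shows "\<exists>nab. affine_connection (coset_space G M \<Gamma>) nab \<and>
        flat_connection (coset_space G M \<Gamma>) nab \<and>
        torsion_free_connection (coset_space G M \<Gamma>) nab \<and>
        geodesically_complete (coset_space G M \<Gamma>) nab"
proof -
 have lie: "lie_group G M" and solv: "solvable G" and lat: "lattice_subgroup G M \<Gamma>"
  using assms(1) by (auto simp: solvmanifold_def)
 \<comment> \<open>Stated for an arbitrary chart, since the Vaisman case ends in a rescaled one and
   the product lives on the Lie algebra in the frame of that chart.\<close>
 have main: ?thesis if C: "lie_chart G M r \<psi> \<phi>" and lsa: "\<exists>star. complete_lsa (lie_chart.lbr G \<psi> \<phi>) star" for r \<psi> \<phi>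
 proof -
  interpret lie_chart G M r \<psi> \<phi> by (rule C)
  obtain star where star: "complete_lsa lbr star" using lsa by blast
  interpret lie_lattice_lsa G M r \<psi> \<phi> \<Gamma> star by unfold_locales (rule lat, rule star)
  show ?thesis by (rule complete_flat_connection)
 qed
 from assms(2) show ?thesis
 proof
  assume "admits_invariant_sasakian G M"
  then obtain ip \<Phi> \<xi> \<eta> where S: "sasakian_structure_on (lie_algebra G M) vf_bracket ip \<Phi> \<xi> \<eta>"
   by (auto simp: admits_invariant_sasakian_def)
  then have "inner_product_on (lie_algebra G M) ip" by (simp add: sasakian_structure_on_def)
  from adapted_chart[OF lie this] obtain r \<psi> \<phi> where C: "lie_chart G M r \<psi> \<phi>"
   and ip: "\<And>x y. ip (lie_chart.E G M \<psi> x) (lie_chart.E G M \<psi> y) = x \<bullet> y" by blast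
  interpret lie_chart G M r \<psi> \<phi> by (rule C)
  interpret lie_lattice G M r \<psi> \<phi> \<Gamma> by unfold_locales (rule lat)
  obtain n where n: "lie_algebra_on.der lbr n = {0}" using lbr_solvable[OF solv] by blast
  obtain \<phi>' \<xi>' \<eta>' where "sasakian_structure_on UNIV lbr (\<bullet>) \<phi>' \<xi>' \<eta>'"
   using sasakian_transport[OF linear_E_vfield inj_E_vfield vf_bracket_E ip S[unfolded lie_algebra_eq]] by blast
  from sasakian_imp_complete_lsa[OF lie_algebra_on_lbr tr_lbr n this] show ?thesis by (rule main[OF C])
 next
  assume "admits_invariant_vaisman G M"
  then obtain J ip \<theta> where V: "vaisman_structure_on (lie_algebra G M) vf_bracket J ip \<theta>"
   by (auto simp: admits_invariant_vaisman_def)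
  then have "inner_product_on (lie_algebra G M) ip" by (simp add: vaisman_structure_on_def)
  from adapted_chart[OF lie this] obtain r \<psi> \<phi> where C: "lie_chart G M r \<psi> \<phi>"
   and ip: "\<And>x y. ip (lie_chart.E G M \<psi> x) (lie_chart.E G M \<psi> y) = x \<bullet> y" by blast
  interpret lie_chart G M r \<psi> \<phi> by (rule C)
  obtain A where A: "\<And>x. \<theta> (E x) = A \<bullet> x"
   using lee_vector[OF linear_E_vfield V[unfolded lie_algebra_eq]] by blast
  have "A \<noteq> 0" using V A by (auto simp: vaisman_structure_on_def lie_algebra_eq)
  \<comment> \<open>Dividing the frame by \<open>s\<close> and multiplying the metric by
    \<open>s * s\<close> keeps the frame orthonormal and divides the Lee vector by \<open>s\<close>,
    which makes it a unit vector.\<close>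
  define s where "s = norm A"
  have s: "s > 0" using \<open>A \<noteq> 0\<close> by (simp add: s_def)
  let ?T = "\<lambda>x. (1 / s) *\<^sub>R x"
  obtain r' where C': "lie_chart G M r' (\<lambda>y. \<psi> (?T y)) (\<lambda>x. s *\<^sub>R \<phi> x)"
   and E': "\<And>v. lie_chart.E G M (\<lambda>y. \<psi> (?T y)) v = E (?T v)"
   by (rule lie_chart_linear[of ?T "\<lambda>x. s *\<^sub>R x"]) (use s in \<open>simp_all add: linear_iff algebra_simps\<close>)
  interpret C': lie_lattice G M r' "\<lambda>y. \<psi> (?T y)" "\<lambda>x. s *\<^sub>R \<phi> x" \<Gamma>
   by (intro lie_lattice.intro C') (unfold_locales, rule lat)
  obtain n where n: "lie_algebra_on.der C'.lbr n = {0}" using C'.lbr_solvable[OF solv] by blast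
  have ip': "(s * s) * ip (C'.E x) (C'.E y) = x \<bullet> y" for x y using s by (simp add: E' ip)
  have A': "\<theta> (C'.E x) = ?T A \<bullet> x" for x by (simp add: E' A)
  have "?T A \<bullet> ?T A = 1" using s by (simp add: s_def dot_square_norm power2_eq_square)
  moreover obtain J' where V': "vaisman_structure_on UNIV C'.lbr J' (\<bullet>) (\<lambda>x. \<theta> (C'.E x))"
   using vaisman_transport[OF C'.linear_E_vfield C'.inj_E_vfield C'.vf_bracket_E ip' V[unfolded C'.lie_algebra_eq]] by blast
  ultimately show ?thesis
   by (intro main[OF C'] vaisman_imp_complete_lsa[OF C'.lie_algebra_on_lbr C'.tr_lbr n V' A'])
 qed
qed

end
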